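(* Let $(C,0)$ be a unibranch curve and let $\rho:(Y,E)\to(\mathbb A^2,C)$ be an embedded resolution of the pair $(\mathbb A^2,C)$. Let $N_i$ denote the multiplicity of $E_i$ and let $N=\max_iN_i$. Then $\operatorname{UHilb}^n_{0,1}(C)\neq\emptyset$ for every $n\ge N$.
   Context: $\mathbb K$ is an algebraically closed field of characteristic zero. A unibranch curve $(C,0)$ is a plane curve germ $\{f=0\}$ with $f\in\mathbb K[[x,y]]$ irreducible, $f(0)=0$; $\mathcal O:=\widehat{\mathcal O}_{C,0}=\mathbb K[[x,y]]/(f)$. Embedded resolution: $\rho:Y\to\mathbb A^2$ is proper birational, $Y$ is smooth and $\rho^{-1}(C)$ is a simple normal crossing divisor with irreducible components $E_i$, $i\in I$ (including the strict transform), $E=\bigcup_iE_i$. $N_i$ is the multiplicity along $E_i$ (at any smooth point) of the pullback to $Y$ of the ideal sheaf of $C$. $\operatorname{Hilb}^n_{0,1}(C)$ is the set of principal ideals $I\subseteq\mathcal O$ with $\dim_{\mathbb K}\mathcal O/I=n$. Let $\mathcal X^n$ be the set of arcs $\gamma=(p,q)\in\mathbb K[[t]]^2$ centered at the origin with $\operatorname{val}_t(f(p,q))=n$ (degenerate arcs, i.e. of the form $\gamma'\circ\alpha$ with $\operatorname{val}_t(\alpha)>1$, excluded), and $\pi_{n+1}$ reduction modulo $t^{n+1}$. The map $\Pi:\pi_{n+1}(\mathcal X^n)\to\operatorname{Hilb}^n_{0,1}(C)$ sends $\gamma$ to the scheme-theoretic image of $\gamma$ intersected with $C$, i.e. the ideal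 $(\ker\gamma,f)$. $\operatorname{UHilb}^n_{0,1}(C)=\operatorname{Im}(\Pi)$; equivalently, the principal ideals in $\operatorname{Hilb}^n_{0,1}(C)$ admitting a generator that lifts to an irreducible $g\in\mathbb K[[x,y]]$. *)

theory Defs
  imports "HOL-Algebra.Algebra" "HOL-Algebra.Algebraic_Closure_Type" "HOL-Library.Extended_Nat"
begin

section \<open>Birational models as sets of local rings\<close>

text \<open>
  An integral separated scheme \<open>Y\<close> of finite type and birational over \<open>Spec R\<close>, \<open>R\<close> a domain
  with field of fractions \<open>F\<close>, is determined by the set of its local rings, regarded as subrings
  of \<open>F\<close> (Zariski--Samuel, Commutative Algebra II, Ch. VI, Section 17; EGA I, Section 8).
  Below \<open>F\<close> is a type of sort \<open>field\<close>, subrings of \<open>F\<close> are subsets of it, and a point of \<open>Y\<close> is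
  identified with its local ring \<open>A\<close>. For points \<open>A, B\<close> of \<open>Y\<close>, the inclusion \<open>A \<subseteq> B\<close> means that
  \<open>A\<close> is a specialisation of \<open>B\<close>.
\<close>

definition ring_on :: "'a::comm_ring_1 set \<Rightarrow> 'a ring" where
  "ring_on A = ring_of_type_algebra\<lparr>carrier := A\<rparr>"

text \<open>The maximal ideal, when \<open>A\<close> is local.\<close>

definition nonunits :: "'a::comm_ring_1 set \<Rightarrow> 'a set" where
  "nonunits A = A - Units (ring_on A)"

definition localization :: "'a::Fields.field set \<Rightarrow> 'a set \<Rightarrow> 'a set" where
  "localization A P = {a / s | a s. a \<in> A \<and> s \<in> A - P}"

definition affine_model :: "'a::Fields.field set \<Rightarrow> 'a set set" where
  "affine_model A = {localization A P | P. primeideal P (ring_on A)}"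

definition finitely_generated_over :: "'a::Fields.field set \<Rightarrow> 'a set \<Rightarrow> bool" where
  "finitely_generated_over R A \<longleftrightarrow>
     (\<exists>S. finite S \<and> A = generate_ring ring_of_type_algebra (R \<union> S))"

definition valuation_ring :: "'a::Fields.field set \<Rightarrow> bool" where
  "valuation_ring V \<longleftrightarrow> subring V ring_of_type_algebra \<and> (\<forall>x. x \<in> V \<or> inverse x \<in> V)"

definition dominates :: "'a::comm_ring_1 set \<Rightarrow> 'a set \<Rightarrow> bool" where
  "dominates B A \<longleftrightarrow> A \<subseteq> B \<and> nonunits A = nonunits B \<inter> A"

text \<open>
  \<open>Y\<close> is proper and birational over \<open>Spec R\<close>, where \<open>R\<close> has field of fractions \<open>'a\<close>: it is a
  finite union of affine models of finite type over \<open>R\<close>, and the valuative criterion holds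
  (at most one centre: separated; at least one centre: proper).
\<close>

definition proper_birational_model :: "'a::Fields.field set \<Rightarrow> 'a set set \<Rightarrow> bool" where
  "proper_birational_model R Y \<longleftrightarrow>
     (\<exists>\<A>. finite \<A> \<and> (\<forall>A\<in>\<A>. finitely_generated_over R A) \<and> Y = (\<Union>A\<in>\<A>. affine_model A)) \<and>
     (\<forall>V. valuation_ring V \<and> R \<subseteq> V \<longrightarrow> (\<exists>!A. A \<in> Y \<and> dominates V A))"


section \<open>Regular local rings, simple normal crossings, multiplicities\<close>

definition krull_dim :: "('a, 'b) ring_scheme \<Rightarrow> enat" where
  "krull_dim R =
     (SUP Ps \<in> {Ps. Ps \<noteq> [] \<and> sorted_wrt (\<subset>) Ps \<and> (\<forall>P\<in>set Ps. primeideal P R)}.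
        enat (length Ps - 1))"

definition regular_system_of_parameters :: "'a::comm_ring_1 set \<Rightarrow> 'a list \<Rightarrow> bool" where
  "regular_system_of_parameters A us \<longleftrightarrow>
     set us \<subseteq> A \<and> nonunits A = Idl\<^bsub>ring_on A\<^esub> (set us) \<and>
     enat (length us) = krull_dim (ring_on A)"

definition regular_local_ring :: "'a::comm_ring_1 set \<Rightarrow> bool" where
  "regular_local_ring A \<longleftrightarrow>
     cring (ring_on A) \<and> noetherian_ring (ring_on A) \<and>
     maximalideal (nonunits A) (ring_on A) \<and>
     (\<exists>us. regular_system_of_parameters A us)"

text \<open>
  The divisor of \<open>a\<close> has simple normal crossings at the point \<open>A\<close>. Since \<open>A\<close> is the Zariski local
  ring, and not its henselisation, different parameters belong to different global components.
\<close>

definition snc_at :: "'a::comm_ring_1 set \<Rightarrow> 'a \<Rightarrow> bool" where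
  "snc_at A a \<longleftrightarrow>
     (\<exists>us ks e. regular_system_of_parameters A us \<and> length ks = length us \<and>
        e \<in> Units (ring_on A) \<and> a = e * prod_list (map2 (\<lambda>u k. u ^ k) us ks))"

text \<open>
  The irreducible components of the closed subset \<open>{a = 0}\<close> of \<open>Y\<close>, each represented by its
  generic point.
\<close>

definition components :: "'a::comm_ring_1 set set \<Rightarrow> 'a \<Rightarrow> 'a set set" where
  "components Y a =
     {A \<in> Y. a \<in> nonunits A \<and> (\<forall>B\<in>Y. A \<subseteq> B \<and> a \<in> nonunits B \<longrightarrow> B = A)}"

text \<open>
  Order of vanishing of \<open>a\<close> along a prime divisor with generic point \<open>A\<close> (a discrete valuation
  ring, \<open>u\<close> being a uniformizer).
\<close>

definition order_along :: "'a::comm_ring_1 set \<Rightarrow> 'a \<Rightarrow> nat" where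
  "order_along A a =
     (THE k. \<exists>u\<in>A. \<exists>e\<in>Units (ring_on A). nonunits A = PIdl\<^bsub>ring_on A\<^esub> u \<and> a = e * u ^ k)"


section \<open>Plane curve germs and their embedded resolutions\<close>

text \<open>
  The ring of formal power series in \<open>x, y\<close> over \<open>'k\<close> is \<open>'k fps fps\<close>; the coefficient of
  \<open>x^i y^j\<close> in \<open>f\<close> is \<open>f $ j $ i\<close>. The ambient plane is the formal germ of the affine plane at
  the origin, i.e. the spectrum of this ring: this is where a formal \<open>f\<close> defines an ideal sheaf
  that can be pulled back.
\<close>

definition unibranch :: "'k::Fields.field fps fps \<Rightarrow> bool" where
  "unibranch f \<longleftrightarrow> Factorial_Ring.irreducible f \<and> f $ 0 $ 0 = 0"

definition embedded_resolution :: "'k::Fields.field fps fps \<Rightarrow> 'k fps fps fract set set \<Rightarrow> bool" where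
  "embedded_resolution f Y \<longleftrightarrow>
     proper_birational_model (range to_fract) Y \<and>
     (\<forall>A\<in>Y. regular_local_ring A) \<and>
     (\<forall>A\<in>Y. to_fract f \<in> nonunits A \<longrightarrow> snc_at A (to_fract f))"

text \<open>The set of all \<open>N\<^sub>i\<close>.\<close>

definition multiplicities :: "'k::Fields.field fps fps \<Rightarrow> 'k fps fps fract set set \<Rightarrow> nat set" where
  "multiplicities f Y = (\<lambda>A. order_along A (to_fract f)) ` components Y (to_fract f)"


section \<open>Punctual Hilbert schemes and arcs\<close>

definition curve_ring :: "'k::Fields.field fps fps \<Rightarrow> 'k fps fps set ring" where
  "curve_ring f = ring_of_type_algebra Quot (PIdl\<^bsub>ring_of_type_algebra\<^esub> f)"

definition restrict_to_curve :: "'k::Fields.field fps fps \<Rightarrow> 'k fps fps \<Rightarrow> 'k fps fps set" where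
  "restrict_to_curve f g = (PIdl\<^bsub>ring_of_type_algebra\<^esub> f) +>\<^bsub>ring_of_type_algebra\<^esub> g"

definition colength :: "'k::Fields.field fps fps \<Rightarrow> 'k fps fps set set \<Rightarrow> nat \<Rightarrow> bool" where
  "colength f I n \<longleftrightarrow>
     (let Q = curve_ring f Quot I;
          constants = range (\<lambda>c. I +>\<^bsub>curve_ring f\<^esub> restrict_to_curve f (fps_const (fps_const c)))
      in ring.dimension Q n constants (carrier Q))"

definition Hilb01 :: "'k::Fields.field fps fps \<Rightarrow> nat \<Rightarrow> 'k fps fps set set set" where
  "Hilb01 f n = {I. principalideal I (curve_ring f) \<and> colength f I n}"

text \<open>
  The substitution \<open>g(p, q)\<close>, for \<open>p\<close> and \<open>q\<close> without constant term: then \<open>p^i * q^j\<close> has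
  no coefficient below degree \<open>i + j\<close>, so the sum over \<open>i, j \<le> m\<close> is the full one.
\<close>

definition subst2 :: "'k::Fields.field fps fps \<Rightarrow> 'k fps \<times> 'k fps \<Rightarrow> 'k fps" where
  "subst2 g = (\<lambda>(p, q). Abs_fps (\<lambda>m. \<Sum>i\<le>m. \<Sum>j\<le>m. g $ j $ i * (p ^ i * q ^ j) $ m))"

text \<open>
  Reparametrisation by some \<open>\<alpha>\<close> of valuation at least two; the valuation is infinite for
  \<open>\<alpha> = 0\<close>, whence the use of coefficients instead of \<^const>\<open>subdegree\<close>.
\<close>

definition degenerate :: "'k::Fields.field fps \<times> 'k fps \<Rightarrow> bool" where
  "degenerate = (\<lambda>(p, q). \<exists>p' q' \<alpha>. \<alpha> $ 0 = 0 \<and> \<alpha> $ 1 = 0 \<and>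
     p = fps_compose p' \<alpha> \<and> q = fps_compose q' \<alpha>)"

definition arcs :: "'k::Fields.field fps fps \<Rightarrow> nat \<Rightarrow> ('k fps \<times> 'k fps) set" where
  "arcs f n = {\<gamma>. fst \<gamma> $ 0 = 0 \<and> snd \<gamma> $ 0 = 0 \<and> \<not> degenerate \<gamma> \<and>
     subst2 f \<gamma> \<noteq> 0 \<and> subdegree (subst2 f \<gamma>) = n}"

definition arc_ideal :: "'k::Fields.field fps fps \<Rightarrow> 'k fps \<times> 'k fps \<Rightarrow> 'k fps fps set set" where
  "arc_ideal f \<gamma> =
     restrict_to_curve f ` (Idl\<^bsub>ring_of_type_algebra\<^esub> ({g. subst2 g \<gamma> = 0} \<union> {f}))"

text \<open>
  The image of \<open>\<Pi>\<close>, which sends \<open>\<gamma>\<close> to \<open>(ker \<gamma>, f)\<close>, inside the Hilbert scheme. The value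
  of \<open>\<Pi>\<close> at an \<open>n\<close>-jet is computed from any arc of contact order \<open>n\<close> lifting it, so the image
  may be taken over arcs instead of their truncations modulo \<open>t^(n+1)\<close>.
\<close>

definition UHilb01 :: "'k::Fields.field fps fps \<Rightarrow> nat \<Rightarrow> 'k fps fps set set set" where
  "UHilb01 f n = {I \<in> Hilb01 f n. \<exists>\<gamma>\<in>arcs f n. I = arc_ideal f \<gamma>}"

end

theory Submission
  imports Defs
begin

text \<open>
  Let \<open>m\<close> be the multiplicity of the branch \<open>C\<close>. After exchanging \<open>x\<close> and \<open>y\<close> if necessary, \<open>C\<close> is
  parametrised by \<open>(t\<^sup>m, \<phi>(t))\<close> with \<open>ord \<phi> \<ge> m\<close>, and for \<open>x = t\<^sup>m\<close> its equation is, up to a unit,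
  the product of the \<open>y - \<phi>(\<zeta> t)\<close> over the \<open>m\<close>-th roots of unity \<open>\<zeta>\<close> (Newton--Puiseux, Weierstrass
  preparation; \<open>irreducible_is_puiseux_branch\<close>). Let \<open>\<delta>\<close> be the sum and \<open>\<beta>\<close> the maximum of the orders
  of \<open>\<phi>(t) - \<phi>(\<zeta> t)\<close> for \<open>\<zeta> \<noteq> 1\<close>, with \<open>\<beta> = 0\<close> if \<open>m = 1\<close>. Two facts give the theorem: the points exist for
  \<open>n = \<delta> + j\<close> whenever \<open>j \<ge> max(\<beta>, 1)\<close>, and some multiplicity has this form.

  For the first, the arc \<open>(t\<^sup>m, \<phi> + c t\<^sup>j)\<close> with generic \<open>c\<close> meets \<open>C\<close> with multiplicity \<open>\<delta> + j\<close>
  (\<open>deformed_branch\<close>). The colength of the ideal that an arc cuts out on \<open>C\<close> is its intersection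
  number with \<open>C\<close>. This is read off from the orders in \<open>t\<close> of power series along the arc, all large
  integers being such orders (\<open>dimension_by_orders\<close>, \<open>arc_gives_point\<close>).

  For the second, the strict transform has multiplicity one; this settles \<open>m = 1\<close>, where \<open>\<delta> = 0\<close>.
  Let \<open>m \<ge> 2\<close>. The valuation composed of the order of vanishing along \<open>C\<close> and the order in \<open>t\<close> has a
  centre on the resolution, by properness. Its local ring \<open>A\<close> is regular, and the total transform has
  normal crossings there, so that \<open>f = e u\<^sup>k v\<close> with a unit \<open>e\<close> and parameters \<open>u, v\<close>, where \<open>v\<close> is an
  equation of the strict transform (\<open>local_equation\<close>; it rests on the fact that \<open>A\<close> has dimension at
  most two). The component \<open>u = 0\<close> has multiplicity \<open>k\<close>, and it remains to compute \<open>k\<close>.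

  The ideal generated by \<open>x\<close> and \<open>y\<close> in \<open>A\<close> turns out to be principal, and then \<open>x\<close> is a unit times
  \<open>u\<^sup>m\<close> (\<open>coordinate_monomial\<close>). In the completion of \<open>A\<close> one may therefore change \<open>u\<close> such that
  \<open>x = u\<^sup>m\<close>, and the equation of \<open>C\<close> becomes the product of the \<open>y - \<phi>(\<zeta> u)\<close>, while it is a unit times
  \<open>u\<^sup>k v\<close>. One factor, say the one with \<open>\<zeta> = \<eta>\<close>, contains \<open>v\<close>. So \<open>y\<close> restricts to \<open>\<phi>(\<eta> u)\<close> on
  \<open>v = 0\<close>, the other factors are units times powers of \<open>u\<close> with exponents
  \<open>ord (\<phi>(\<eta> u) - \<phi>(\<zeta> u))\<close>, whose sum is \<open>\<delta>\<close>, and the factor with \<open>\<zeta> = \<eta>\<close> contains \<open>u\<close> at least to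
  the largest of these exponents, as it differs from each other factor by a function of \<open>u\<close>. Hence
  \<open>k = \<delta> + a\<close> with \<open>a \<ge> \<beta>\<close> (\<open>exceptional_multiplicity\<close>).
\<close>


section \<open>Ring homomorphisms between power series rings\<close>

locale unital_ring_hom =
  fixes h :: "'a::comm_ring_1 \<Rightarrow> 'b::comm_ring_1"
  assumes add: "h (a + b) = h a + h b"
    and mult: "h (a * b) = h a * h b"
    and one: "h 1 = 1"
begin

lemma zero: "h 0 = 0"
  using add[of 0 0] by simp

lemma uminus: "h (- a) = - h a"
  using add[of a "- a"] zero by (simp add: eq_neg_iff_add_eq_0 add.commute)

lemma diff: "h (a - b) = h a - h b"
  using add[of a "- b"] uminus by simp

lemma power: "h (a ^ n) = h a ^ n"
  by (induction n) (simp_all add: one mult)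

lemma sum: "h (sum g S) = (\<Sum>i\<in>S. h (g i))"
  by (induction S rule: infinite_finite_induct) (simp_all add: zero add)

lemma prod: "h (prod g S) = (\<Prod>i\<in>S. h (g i))"
  by (induction S rule: infinite_finite_induct) (simp_all add: one mult)

lemma map_poly_hom: "unital_ring_hom (map_poly h)"
proof
  show "map_poly h (p + q) = map_poly h p + map_poly h q" for p q
    by (intro poly_eqI) (simp add: coeff_map_poly zero add)
  show "map_poly h (p * q) = map_poly h p * map_poly h q" for p q
    by (intro poly_eqI) (simp add: coeff_map_poly zero coeff_mult sum mult)
  show "map_poly h 1 = 1"
    by (simp add: one)
qed

end

lemma fps_const_hom: "unital_ring_hom fps_const"
  by unfold_locales (simp_all del: fps_const_add fps_const_mult add: fps_const_add[symmetric] fps_const_mult[symmetric])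

lemma fps_nth_0_hom: "unital_ring_hom (\<lambda>f::'a::comm_ring_1 fps. f $ 0)"
  by unfold_locales simp_all

lemma unital_ring_hom_comp:
  assumes "unital_ring_hom g" "unital_ring_hom h"
  shows "unital_ring_hom (\<lambda>x. g (h x))"
proof -
  interpret g: unital_ring_hom g by fact
  interpret h: unital_ring_hom h by fact
  show ?thesis
    by unfold_locales (simp_all add: g.add h.add g.mult h.mult g.one h.one)
qed

lemma fps_compose_hom:
  assumes "(p :: 'a::idom fps) $ 0 = 0"
  shows "unital_ring_hom (\<lambda>f. fps_compose f p)"
  by unfold_locales
    (simp_all add: assms fps_compose_add_distrib fps_compose_mult_distrib fps_compose_mult_distrib)

definition map_fps :: "('a::comm_ring_1 \<Rightarrow> 'b::comm_ring_1) \<Rightarrow> 'a fps \<Rightarrow> 'b fps" where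
  "map_fps h f = Abs_fps (\<lambda>n. h (f $ n))"

lemma map_fps_nth [simp]: "map_fps h f $ n = h (f $ n)"
  by (simp add: map_fps_def)

lemma map_fps_hom:
  assumes "unital_ring_hom h"
  shows "unital_ring_hom (map_fps h)"
proof -
  interpret h: unital_ring_hom h by fact
  show ?thesis
    by unfold_locales (auto intro!: fps_ext simp: h.add h.mult h.one h.zero h.sum fps_mult_nth)
qed

text \<open>
  Substitution of \<open>q\<close> for the outer variable of \<open>c\<close>. If \<open>q\<close> has no constant term, the
  \<open>m\<close>-th coefficient only sees the terms of index at most \<open>m\<close>.
\<close>

definition eval_fps_at :: "'a::comm_ring_1 fps \<Rightarrow> 'a fps fps \<Rightarrow> 'a fps" where
  "eval_fps_at q c = Abs_fps (\<lambda>m. \<Sum>j\<le>m. (c $ j * q ^ j) $ m)"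

lemma mult_power_nth_below:
  fixes q :: "'a::comm_ring_1 fps"
  assumes "q $ 0 = 0" "m < j"
  shows "(c * q ^ j) $ m = 0"
proof -
  have "q ^ j $ i = 0" if "i < j" for i
    using startsby_zero_power_prefix[OF assms(1), of j] that by auto
  then show ?thesis
    using assms(2) by (auto simp: fps_mult_nth intro!: sum.neutral)
qed

lemma eval_fps_at_nth:
  assumes "q $ 0 = 0" "m \<le> M"
  shows "eval_fps_at q c $ m = (\<Sum>j\<le>M. c $ j * q ^ j) $ m"
proof -
  have "(\<Sum>j\<le>M. c $ j * q ^ j) $ m = (\<Sum>j\<le>M. (c $ j * q ^ j) $ m)"
    by (simp add: fps_sum_nth)
  also have "\<dots> = (\<Sum>j\<le>m. (c $ j * q ^ j) $ m)"
    using assms by (intro sum.mono_neutral_right) (auto intro!: mult_power_nth_below)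
  finally show ?thesis
    by (simp add: eval_fps_at_def)
qed

lemma fps_mult_nth_cong:
  assumes "\<And>i. i \<le> n \<Longrightarrow> a $ i = a' $ i" "\<And>i. i \<le> n \<Longrightarrow> b $ i = b' $ i"
  shows "(a * b) $ n = (a' * b') $ n"
  using assms by (auto simp: fps_mult_nth intro!: sum.cong)

lemma eval_fps_at_hom:
  fixes q :: "'a::comm_ring_1 fps"
  assumes q: "q $ 0 = 0"
  shows "unital_ring_hom (eval_fps_at q)"
proof
  show "eval_fps_at q (a + b) = eval_fps_at q a + eval_fps_at q b" for a b
    by (intro fps_ext) (simp add: eval_fps_at_def sum.distrib algebra_simps)
  show "eval_fps_at q 1 = 1"
    by (intro fps_ext) (auto simp: eval_fps_at_def sum.atMost_shift)
  show "eval_fps_at q (c * d) = eval_fps_at q c * eval_fps_at q d" for c d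
  proof (rule fps_ext)
    fix m
    let ?t = "\<lambda>i j. (c $ i * q ^ i) * (d $ j * q ^ j)"
    have "(eval_fps_at q c * eval_fps_at q d) $ m
        = ((\<Sum>i\<le>m. c $ i * q ^ i) * (\<Sum>j\<le>m. d $ j * q ^ j)) $ m"
      by (rule fps_mult_nth_cong) (simp_all add: eval_fps_at_nth[OF q])
    also have "\<dots> = (\<Sum>(i,j)\<in>{..m} \<times> {..m}. ?t i j) $ m"
      by (simp add: sum_product sum.cartesian_product)
    also have "\<dots> = (\<Sum>(i,j)\<in>{..m} \<times> {..m}. ?t i j $ m)"
      by (simp add: fps_sum_nth case_prod_unfold)
    also have "\<dots> = (\<Sum>(i,j)\<in>{(i,j). i + j \<le> m}. ?t i j $ m)"
    proof (rule sum.mono_neutral_right)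
      show "finite ({..m} \<times> {..m})" by simp
      show "{(i, j). i + j \<le> m} \<subseteq> {..m} \<times> {..m}" by auto
      have "?t i j $ m = 0" if "\<not> i + j \<le> m" for i j
        using mult_power_nth_below[OF q, of m "i + j" "c $ i * d $ j"] that
        by (simp add: power_add mult_ac)
      then show "\<forall>x\<in>{..m} \<times> {..m} - {(i, j). i + j \<le> m}. (case x of (i, j) \<Rightarrow> ?t i j $ m) = 0"
        by auto
    qed
    also have "\<dots> = (\<Sum>k\<le>m. \<Sum>i\<le>k. ?t i (k - i) $ m)"
      by (rule sum.triangle_reindex_eq)
    also have "\<dots> = (\<Sum>k\<le>m. ((\<Sum>i\<le>k. c $ i * d $ (k - i)) * q ^ k) $ m)"
    proof (rule sum.cong[OF refl])
      fix k
      have "(\<Sum>i\<le>k. ?t i (k - i)) = (\<Sum>i\<le>k. c $ i * d $ (k - i)) * q ^ k"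
        unfolding sum_distrib_right
      proof (rule sum.cong[OF refl])
        fix i assume "i \<in> {..k}"
        then have "q ^ k = q ^ i * q ^ (k - i)"
          by (simp add: power_add[symmetric])
        then show "?t i (k - i) = c $ i * d $ (k - i) * q ^ k"
          by (simp add: mult_ac)
      qed
      then show "(\<Sum>i\<le>k. ?t i (k - i) $ m) = ((\<Sum>i\<le>k. c $ i * d $ (k - i)) * q ^ k) $ m"
        by (simp only: fps_sum_nth[symmetric])
    qed
    also have "\<dots> = eval_fps_at q (c * d) $ m"
      by (simp add: eval_fps_at_def fps_mult_nth atLeast0AtMost)
    finally show "eval_fps_at q (c * d) $ m = (eval_fps_at q c * eval_fps_at q d) $ m" ..
  qed
qed

lemma eval_fps_at_const: "eval_fps_at q (fps_const c) = c"
proof (rule fps_ext)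
  fix m
  have "eval_fps_at q (fps_const c) $ m = (\<Sum>j\<le>m. (if j = 0 then c $ m else 0))"
    unfolding eval_fps_at_def fps_nth_Abs_fps by (rule sum.cong) auto
  then show "eval_fps_at q (fps_const c) $ m = c $ m"
    by simp
qed

lemma eval_fps_at_X:
  assumes "q $ 0 = 0"
  shows "eval_fps_at q fps_X = q"
proof (rule fps_ext)
  fix m
  have "eval_fps_at q fps_X $ m = (\<Sum>j\<le>m. (if j = 1 then q $ m else 0))"
    unfolding eval_fps_at_def fps_nth_Abs_fps by (rule sum.cong) auto
  then show "eval_fps_at q fps_X $ m = q $ m"
    using assms by (cases m) auto
qed

lemma fps_compose_nth_upto:
  fixes p :: "'a::idom fps"
  assumes "p $ 0 = 0" "k \<le> m"
  shows "(c oo p) $ k = (\<Sum>i\<le>m. fps_const (c $ i) * p ^ i) $ k"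
proof -
  have "(\<Sum>i\<le>m. fps_const (c $ i) * p ^ i) $ k = (\<Sum>i\<le>m. c $ i * p ^ i $ k)"
    by (simp add: fps_sum_nth)
  also have "\<dots> = (\<Sum>i\<le>k. c $ i * p ^ i $ k)"
    using assms startsby_zero_power_prefix[OF assms(1)]
    by (intro sum.mono_neutral_right) auto
  finally show ?thesis
    by (simp add: fps_compose_nth atLeast0AtMost)
qed

lemma subst2_eq:
  assumes p: "p $ 0 = 0"
  shows "subst2 g (p, q) = eval_fps_at q (map_fps (\<lambda>h. fps_compose h p) g)"
proof (rule fps_ext)
  fix m
  have "((g $ j oo p) * q ^ j) $ m = (\<Sum>i\<le>m. g $ j $ i * (p ^ i * q ^ j) $ m)" for j
  proof -
    have "((g $ j oo p) * q ^ j) $ m = ((\<Sum>i\<le>m. fps_const (g $ j $ i) * p ^ i) * q ^ j) $ m"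
      by (rule fps_mult_nth_cong) (simp_all add: fps_compose_nth_upto[OF p])
    also have "\<dots> = (\<Sum>i\<le>m. g $ j $ i * (p ^ i * q ^ j) $ m)"
      by (simp add: sum_distrib_right fps_sum_nth mult.assoc)
    finally show ?thesis .
  qed
  then show "subst2 g (p, q) $ m = eval_fps_at q (map_fps (\<lambda>h. fps_compose h p) g) $ m"
    unfolding subst2_def eval_fps_at_def by (simp, subst sum.swap) simp
qed

lemma subst2_hom:
  assumes "fst \<gamma> $ 0 = 0" "snd \<gamma> $ 0 = 0"
  shows "unital_ring_hom (\<lambda>g. subst2 g \<gamma>)"
proof -
  have "unital_ring_hom (\<lambda>g. eval_fps_at (snd \<gamma>) (map_fps (\<lambda>h. fps_compose h (fst \<gamma>)) g))"
    by (rule unital_ring_hom_comp[OF eval_fps_at_hom[OF assms(2)]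
          map_fps_hom[OF fps_compose_hom[OF assms(1)]]])
  then show ?thesis
    using subst2_eq[OF assms(1), of _ "snd \<gamma>"] by simp
qed

lemma subst2_fps_const:
  assumes "fst \<gamma> $ 0 = 0"
  shows "subst2 (fps_const h) \<gamma> = h oo fst \<gamma>"
proof -
  have "map_fps (\<lambda>h. fps_compose h (fst \<gamma>)) (fps_const h) = fps_const (h oo fst \<gamma>)"
    by (rule fps_ext) auto
  then show ?thesis
    using subst2_eq[OF assms, of _ "snd \<gamma>"] by (simp add: eval_fps_at_const)
qed

lemma subst2_X:
  assumes "fst \<gamma> $ 0 = 0" "snd \<gamma> $ 0 = 0"
  shows "subst2 fps_X \<gamma> = snd \<gamma>"
proof -
  have "map_fps (\<lambda>h. fps_compose h (fst \<gamma>)) fps_X = fps_X"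
    by (rule fps_ext) auto
  then show ?thesis
    using subst2_eq[OF assms(1), of _ "snd \<gamma>"] by (simp add: eval_fps_at_X assms)
qed

lemma degree_map_poly_le: "h 0 = 0 \<Longrightarrow> degree (map_poly h P) \<le> degree P"
  by (intro degree_le) (simp add: coeff_map_poly coeff_eq_0)

lemma poly_altdef_le:
  fixes P :: "'a::comm_semiring_1 poly"
  assumes "degree P \<le> n"
  shows "poly P x = (\<Sum>i\<le>n. coeff P i * x ^ i)"
  unfolding poly_altdef using assms by (intro sum.mono_neutral_left) (auto simp: coeff_eq_0)

lemma fps_of_poly_sum_powers:
  "fps_of_poly P = (\<Sum>j\<le>degree P. fps_const (coeff P j) * fps_X ^ j)"
  by (rule fps_ext) (auto simp: fps_sum_nth coeff_eq_0 if_distrib cong: if_cong)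

lemma subst2_fps_of_poly:
  assumes "fst \<gamma> $ 0 = 0" "snd \<gamma> $ 0 = 0"
  shows "subst2 (fps_of_poly P) \<gamma> = poly (map_poly (\<lambda>h. h oo fst \<gamma>) P) (snd \<gamma>)"
proof -
  interpret unital_ring_hom "\<lambda>g. subst2 g \<gamma>"
    by (rule subst2_hom[OF assms])
  have "subst2 (fps_of_poly P) \<gamma> = (\<Sum>j\<le>degree P. (coeff P j oo fst \<gamma>) * snd \<gamma> ^ j)"
    by (simp add: fps_of_poly_sum_powers sum mult power subst2_fps_const subst2_X assms)
  also have "\<dots> = poly (map_poly (\<lambda>h. h oo fst \<gamma>) P) (snd \<gamma>)"
    by (simp add: poly_altdef_le[OF degree_map_poly_le] coeff_map_poly)
  finally show ?thesis .
qed

lemma subst2_compose: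
  assumes "\<alpha> $ 0 = 0" "p $ 0 = 0" "q $ 0 = 0"
  shows "subst2 g (p oo \<alpha>, q oo \<alpha>) = subst2 g (p, q) oo \<alpha>"
proof (rule fps_ext)
  fix m
  interpret c: unital_ring_hom "\<lambda>f. f oo \<alpha>"
    by (rule fps_compose_hom[OF assms(1)])
  have *: "subst2 g (a, b) $ l
      = (\<Sum>i\<le>m. \<Sum>j\<le>m. fps_const (g $ j $ i) * (a ^ i * b ^ j)) $ l"
    if "l \<le> m" "a $ 0 = 0" "b $ 0 = 0" for l and a b :: "'a fps"
  proof -
    have z: "(a ^ i * b ^ j) $ l = 0" if "l < i \<or> l < j" for i j
      using mult_power_nth_below[OF \<open>a $ 0 = 0\<close>, of l i "b ^ j"]
        mult_power_nth_below[OF \<open>b $ 0 = 0\<close>, of l j "a ^ i"] that by (auto simp: mult.commute)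
    have "subst2 g (a, b) $ l = (\<Sum>i\<le>l. \<Sum>j\<le>l. g $ j $ i * (a ^ i * b ^ j) $ l)"
      by (simp add: subst2_def)
    also have "\<dots> = (\<Sum>i\<le>l. \<Sum>j\<le>m. g $ j $ i * (a ^ i * b ^ j) $ l)"
      using that z by (intro sum.cong refl sum.mono_neutral_left) auto
    also have "\<dots> = (\<Sum>i\<le>m. \<Sum>j\<le>m. g $ j $ i * (a ^ i * b ^ j) $ l)"
      using that z by (intro sum.mono_neutral_left) auto
    finally show ?thesis
      by (simp add: fps_sum_nth)
  qed
  have "(subst2 g (p, q) oo \<alpha>) $ m
      = ((\<Sum>i\<le>m. \<Sum>j\<le>m. fps_const (g $ j $ i) * (p ^ i * q ^ j)) oo \<alpha>) $ m"
    unfolding fps_compose_nth by (intro sum.cong refl) (subst *, auto simp: assms)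
  also have "\<dots> = (\<Sum>i\<le>m. \<Sum>j\<le>m. fps_const (g $ j $ i) * ((p oo \<alpha>) ^ i * (q oo \<alpha>) ^ j)) $ m"
    by (simp add: c.sum c.mult c.power)
  also have "\<dots> = subst2 g (p oo \<alpha>, q oo \<alpha>) $ m"
    by (subst *) (auto simp: assms)
  finally show "subst2 g (p oo \<alpha>, q oo \<alpha>) $ m = (subst2 g (p, q) oo \<alpha>) $ m" ..
qed

lemma subst2_nth_0:
  "subst2 g \<gamma> $ 0 = g $ 0 $ 0"
  by (cases \<gamma>) (simp add: subst2_def)


section \<open>Exchanging the two variables\<close>

definition swap_xy :: "'a::comm_ring_1 fps fps \<Rightarrow> 'a fps fps" where
  "swap_xy f = Abs_fps (\<lambda>i. Abs_fps (\<lambda>j. f $ j $ i))"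

lemma swap_xy_nth [simp]: "swap_xy f $ i $ j = f $ j $ i"
  by (simp add: swap_xy_def)

lemma swap_xy_swap_xy [simp]: "swap_xy (swap_xy f) = f"
  by (intro fps_ext) simp

lemma swap_xy_hom: "unital_ring_hom swap_xy"
proof
  show "swap_xy (a + b) = swap_xy a + swap_xy b" for a b :: "'a fps fps"
    by (intro fps_ext) simp
  show "swap_xy (a * b) = swap_xy a * swap_xy b" for a b :: "'a fps fps"
    by (intro fps_ext, simp add: fps_mult_nth fps_sum_nth, subst sum.swap, rule refl)
  show "swap_xy (1 :: 'a fps fps) = 1"
    by (intro fps_ext) simp
qed

lemma subst2_swap_xy: "subst2 (swap_xy g) (q, p) = subst2 g (p, q)"
  unfolding subst2_def by (intro fps_ext, simp, subst sum.swap) (simp add: mult.commute)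

lemma swap_xy_fps_X: "swap_xy fps_X = fps_const fps_X"
  by (intro fps_ext) auto


section \<open>Total order of a power series in two variables\<close>

text \<open>
  Under \<open>x \<mapsto> t\<close>, \<open>y \<mapsto> s t\<close> the coefficient of \<open>t\<^sup>n\<close> becomes the dehomogenised form of degree
  \<open>n\<close>. So the order in \<open>t\<close> of the image is the order of \<open>f\<close> with respect to the maximal ideal,
  which makes that order additive on products.
\<close>

definition homogeneous_parts :: "'a::comm_ring_1 fps fps \<Rightarrow> 'a fps fps" where
  "homogeneous_parts f = Abs_fps (\<lambda>n. Abs_fps (\<lambda>b. if b \<le> n then f $ b $ (n - b) else 0))"

lemma homogeneous_parts_nth:
  "homogeneous_parts f $ n $ b = (if b \<le> n then f $ b $ (n - b) else 0)"
  by (simp add: homogeneous_parts_def)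

lemma homogeneous_parts_hom: "unital_ring_hom homogeneous_parts"
proof
  show "homogeneous_parts (a + b) = homogeneous_parts a + homogeneous_parts b" for a b :: "'a fps fps"
    by (intro fps_ext) (simp add: homogeneous_parts_nth)
  show "homogeneous_parts (1 :: 'a fps fps) = 1"
    by (intro fps_ext) (auto simp: homogeneous_parts_nth)
  show "homogeneous_parts (f * g) = homogeneous_parts f * homogeneous_parts g" for f g :: "'a fps fps"
  proof (intro fps_ext)
    fix n b
    let ?t = "\<lambda>b' a'. f $ b' $ a' * g $ (b - b') $ (n - b - a')"
    have "(homogeneous_parts f * homogeneous_parts g) $ n $ b
      = (\<Sum>n'\<le>n. \<Sum>b'\<le>b. if b' \<le> n' \<and> b - b' \<le> n - n'
            then f $ b' $ (n' - b') * g $ (b - b') $ (n - n' - (b - b')) else 0)"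
      by (auto simp: fps_mult_nth fps_sum_nth homogeneous_parts_nth atLeast0AtMost intro!: sum.cong)
    also have "\<dots> = (\<Sum>b'\<le>b. \<Sum>n'\<le>n. if b' \<le> n' \<and> b - b' \<le> n - n'
            then f $ b' $ (n' - b') * g $ (b - b') $ (n - n' - (b - b')) else 0)"
      by (rule sum.swap)
    also have "\<dots> = (\<Sum>b'\<le>b. if b \<le> n then (\<Sum>a'\<le>n - b. ?t b' a') else 0)"
    proof (rule sum.cong[OF refl])
      fix b' assume b': "b' \<in> {..b}"
      show "(\<Sum>n'\<le>n. if b' \<le> n' \<and> b - b' \<le> n - n'
            then f $ b' $ (n' - b') * g $ (b - b') $ (n - n' - (b - b')) else 0)
          = (if b \<le> n then (\<Sum>a'\<le>n - b. ?t b' a') else 0)"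
      proof (cases "b \<le> n")
        case True
        have "(\<Sum>n'\<le>n. if b' \<le> n' \<and> b - b' \<le> n - n'
            then f $ b' $ (n' - b') * g $ (b - b') $ (n - n' - (b - b')) else 0)
          = (\<Sum>n'\<in>{n'. n' \<le> n \<and> b' \<le> n' \<and> b - b' \<le> n - n'}.
               f $ b' $ (n' - b') * g $ (b - b') $ (n - n' - (b - b')))"
          by (subst sum.inter_filter[symmetric]) (auto intro!: sum.cong)
        also have "\<dots> = (\<Sum>a'\<le>n - b. ?t b' a')"
          using b' True
          by (intro sum.reindex_bij_witness[where i = "\<lambda>a. a + b'" and j = "\<lambda>n'. n' - b'"])
             (auto intro!: arg_cong2[of _ _ _ _ "(*)"] arg_cong[of _ _ "fps_nth (g $ (b - b'))"])
        finally show ?thesis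
          using True by simp
      next
        case False
        then show ?thesis
          using b' by (auto intro!: sum.neutral)
      qed
    qed
    also have "\<dots> = homogeneous_parts (f * g) $ n $ b"
      by (auto simp: homogeneous_parts_nth fps_mult_nth fps_sum_nth atLeast0AtMost)
    finally show "homogeneous_parts (f * g) $ n $ b = (homogeneous_parts f * homogeneous_parts g) $ n $ b" ..
  qed
qed

lemma homogeneous_parts_eq_0_iff: "homogeneous_parts f = 0 \<longleftrightarrow> f = 0"
proof
  assume *: "homogeneous_parts f = 0"
  show "f = 0"
  proof (intro fps_ext)
    fix b a
    have "homogeneous_parts f $ (a + b) $ b = f $ b $ a"
      by (simp add: homogeneous_parts_nth)
    then show "f $ b $ a = 0 $ b $ a"
      using * by simp
  qed
qed (auto simp: homogeneous_parts_nth intro!: fps_ext)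

definition xy_order :: "'a::comm_ring_1 fps fps \<Rightarrow> nat" where
  "xy_order f = subdegree (homogeneous_parts f)"

lemma xy_order_mult:
  fixes f g :: "'a::idom fps fps"
  assumes "f \<noteq> 0" "g \<noteq> 0"
  shows "xy_order (f * g) = xy_order f + xy_order g"
  using assms
  by (simp add: xy_order_def unital_ring_hom.mult[OF homogeneous_parts_hom] homogeneous_parts_eq_0_iff)

lemma xy_order_power:
  fixes f :: "'a::idom fps fps"
  shows "xy_order (f ^ n) = n * xy_order f"
  by (simp add: xy_order_def unital_ring_hom.power[OF homogeneous_parts_hom])

text \<open>Membership in the \<open>n\<close>-th power of the maximal ideal.\<close>

definition order_at_least :: "nat \<Rightarrow> 'a::comm_ring_1 fps fps \<Rightarrow> bool" where
  "order_at_least n f \<longleftrightarrow> (\<forall>b a. a + b < n \<longrightarrow> f $ b $ a = 0)"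

lemma order_at_least_iff: "order_at_least n f \<longleftrightarrow> (f = 0 \<or> n \<le> xy_order f)"
proof -
  have "order_at_least n f \<longleftrightarrow> (\<forall>m<n. homogeneous_parts f $ m = 0)"
  proof
    assume *: "\<forall>m<n. homogeneous_parts f $ m = 0"
    show "order_at_least n f"
      unfolding order_at_least_def
    proof (intro allI impI)
      fix b a assume "a + b < n"
      then have "homogeneous_parts f $ (a + b) $ b = 0"
        using * by simp
      then show "f $ b $ a = 0"
        by (simp add: homogeneous_parts_nth)
    qed
  qed (auto simp: order_at_least_def homogeneous_parts_nth intro!: fps_ext)
  also have "\<dots> \<longleftrightarrow> (f = 0 \<or> n \<le> xy_order f)"
    unfolding xy_order_def homogeneous_parts_eq_0_iff[of f, symmetric]
    by (cases "homogeneous_parts f = 0") (simp_all, meson nth_less_subdegree_zero order_less_le_trans subdegree_geI)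
  finally show ?thesis .
qed

lemma order_at_least_0 [simp]: "order_at_least 0 f"
  by (simp add: order_at_least_def)

lemma order_at_least_1: "order_at_least (Suc 0) f \<longleftrightarrow> f $ 0 $ 0 = 0"
  by (auto simp: order_at_least_def)

lemma order_at_least_add: "order_at_least n f \<Longrightarrow> order_at_least n g \<Longrightarrow> order_at_least n (f + g)"
  by (simp add: order_at_least_def)

lemma order_at_least_sum: "(\<And>i. i \<in> S \<Longrightarrow> order_at_least n (f i)) \<Longrightarrow> order_at_least n (sum f S)"
  by (induction S rule: infinite_finite_induct) (auto simp: order_at_least_add order_at_least_def)

lemma order_at_least_mult:
  fixes f g :: "'a::idom fps fps"
  shows "order_at_least m f \<Longrightarrow> order_at_least n g \<Longrightarrow> order_at_least (m + n) (f * g)"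
  by (cases "f = 0"; cases "g = 0") (auto simp: order_at_least_iff xy_order_mult)

lemma order_at_least_power:
  fixes f :: "'a::idom fps fps"
  shows "order_at_least m f \<Longrightarrow> order_at_least (n * m) (f ^ n)"
  by (auto simp: order_at_least_iff xy_order_power)

lemma order_at_least_Suc_decompose:
  assumes "order_at_least (Suc n) f"
  obtains g h where "f = fps_const fps_X * g + fps_X * h" "order_at_least n g" "order_at_least n h"
proof
  show "f = fps_const fps_X * fps_const (fps_shift 1 (f $ 0)) + fps_X * fps_shift 1 f"
  proof (rule fps_ext)
    fix i
    show "f $ i = (fps_const fps_X * fps_const (fps_shift 1 (f $ 0)) + fps_X * fps_shift 1 f) $ i"
    proof (cases i)
      case 0
      have "f $ 0 $ 0 = 0"
        using assms by (simp add: order_at_least_def)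
      then have "fps_X * fps_shift 1 (f $ 0) = f $ 0"
        by (intro fps_ext) (auto simp: fps_X_mult_nth)
      then show ?thesis
        using 0 by (simp add: fps_mult_left_const_nth)
    qed auto
  qed
  show "order_at_least n (fps_const (fps_shift 1 (f $ 0)))"
    using assms by (auto simp: order_at_least_def)
  show "order_at_least n (fps_shift 1 f)"
    using assms by (auto simp: order_at_least_def)
qed

text \<open>
  A homogeneous decomposition with respect to the coordinates \<open>x + l y\<close> and \<open>y\<close>; the parameter \<open>l\<close>
  will be chosen generically.
\<close>

lemma order_at_least_decompose:
  assumes "order_at_least n f"
  shows "\<exists>c. f = (\<Sum>i\<le>n. c i * ((fps_const fps_X + fps_const (fps_const l) * fps_X) ^ i * fps_X ^ (n - i)))"
  using assms
proof (induction n arbitrary: f)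
  case 0
  then show ?case
    by (intro exI[of _ "\<lambda>_. f"]) simp
next
  case (Suc n)
  let ?X = "fps_const fps_X + fps_const (fps_const l) * fps_X :: 'a fps fps"
  obtain g h where gh: "f = fps_const fps_X * g + fps_X * h" "order_at_least n g" "order_at_least n h"
    using order_at_least_Suc_decompose[OF Suc.prems] by blast
  let ?h = "h - fps_const (fps_const l) * g"
  have "order_at_least n ?h"
    using gh by (simp add: order_at_least_def fps_mult_left_const_nth)
  from Suc.IH[OF this] obtain d where d: "?h = (\<Sum>i\<le>n. d i * (?X ^ i * fps_X ^ (n - i)))"
    by blast
  from Suc.IH[OF gh(2)] obtain c where c: "g = (\<Sum>i\<le>n. c i * (?X ^ i * fps_X ^ (n - i)))"
    by blast
  have "f = ?X * g + fps_X * ?h"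
    by (simp add: gh(1) algebra_simps)
  also have "?X * g = (\<Sum>i\<le>n. c i * (?X ^ Suc i * fps_X ^ (Suc n - Suc i)))"
    by (subst c) (simp add: sum_distrib_left mult_ac)
  also have "\<dots> = (\<Sum>i\<le>Suc n. (if i = 0 then 0 else c (i - 1)) * (?X ^ i * fps_X ^ (Suc n - i)))"
    by (subst sum.atMost_Suc_shift) simp
  also have "fps_X * ?h = (\<Sum>i\<le>n. d i * (?X ^ i * fps_X ^ (Suc n - i)))"
    by (subst d) (auto simp: sum_distrib_left Suc_diff_le mult_ac intro!: sum.cong)
  also have "\<dots> = (\<Sum>i\<le>Suc n. (if i \<le> n then d i else 0) * (?X ^ i * fps_X ^ (Suc n - i)))"
    by simp
  finally have "f = (\<Sum>i\<le>Suc n. ((if i = 0 then 0 else c (i - 1)) + (if i \<le> n then d i else 0))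
      * (?X ^ i * fps_X ^ (Suc n - i)))"
    by (simp only: sum.distrib[symmetric] distrib_right)
  then show ?case
    by (rule exI[of _ "\<lambda>i. (if i = 0 then 0 else c (i - 1)) + (if i \<le> n then d i else 0)"])
qed

lemma fps_fps_unitD:
  assumes "(f :: 'k::Fields.field fps fps) $ 0 $ 0 \<noteq> 0"
  obtains g where "f * g = 1"
proof -
  have "f $ 0 * inverse (f $ 0) = 1"
    using assms by (simp add: inverse_mult_eq_1')
  then have "f * fps_right_inverse f (inverse (f $ 0)) = 1"
    by (rule fps_right_inverse)
  then show ?thesis ..
qed

lemma fps_fps_is_unit_iff:
  "(f :: 'k::Fields.field fps fps) dvd 1 \<longleftrightarrow> f $ 0 $ 0 \<noteq> 0"
proof
  assume "f dvd 1"
  then obtain g where "1 = f * g" ..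
  then have "(f * g) $ 0 $ 0 = 1"
    by (metis fps_one_nth)
  then show "f $ 0 $ 0 \<noteq> 0"
    by auto
qed (metis fps_fps_unitD dvdI)


section \<open>Weierstrass division and preparation\<close>

definition y_regular :: "nat \<Rightarrow> 'a::comm_ring_1 fps fps \<Rightarrow> bool" where
  "y_regular m f \<longleftrightarrow> (\<forall>j<m. f $ j $ 0 = 0) \<and> f $ m $ 0 \<noteq> 0"

text \<open>
  The quotient of \<open>h\<close> by \<open>f\<close> is built coefficient by coefficient in \<open>x\<close>: here \<open>H\<close> and \<open>F\<close> are
  \<open>h\<close> and \<open>f\<close> with the variables exchanged, and \<open>F $ 0 = y\<^sup>m / v\<close>. At each step the part of
  order at least \<open>m\<close> in \<open>y\<close> is divided by \<open>F $ 0\<close>, and the part below \<open>m\<close> goes to the remainder.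
\<close>

fun weierstrass_quotient :: "nat \<Rightarrow> 'a::comm_ring_1 fps \<Rightarrow> 'a fps fps \<Rightarrow> 'a fps fps \<Rightarrow> nat \<Rightarrow> 'a fps" where
  "weierstrass_quotient m v F H i =
     fps_shift m (H $ i - (\<Sum>k<i. weierstrass_quotient m v F H k * F $ (i - k))) * v"

declare weierstrass_quotient.simps [simp del]

lemma weierstrass_division:
  fixes f h :: "'k::Fields.field fps fps"
  assumes "y_regular m f"
  obtains q r where "h = q * f + r" "\<And>j. m \<le> j \<Longrightarrow> r $ j = 0"
proof -
  interpret sw: unital_ring_hom swap_xy by (rule swap_xy_hom)
  let ?F = "swap_xy f" and ?H = "swap_xy h"
  define w where "w = fps_shift m (?F $ 0)"
  have F0: "?F $ 0 = fps_X ^ m * w"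
    unfolding w_def using assms
    by (intro fps_ext) (auto simp: fps_X_power_mult_nth y_regular_def)
  have "w $ 0 \<noteq> 0"
    using assms by (simp add: w_def y_regular_def)
  then have winv: "inverse w * w = 1"
    by (simp add: inverse_mult_eq_1)
  define Q where "Q = Abs_fps (weierstrass_quotient m (inverse w) ?F ?H)"
  define T where "T i = ?H $ i - (\<Sum>k<i. Q $ k * ?F $ (i - k))" for i
  have Q: "Q $ i = fps_shift m (T i) * inverse w" for i
    unfolding Q_def T_def by (simp add: weierstrass_quotient.simps[of _ _ _ _ i])
  define R where "R = Abs_fps (\<lambda>i. fps_cutoff m (T i))"
  have "?H = Q * ?F + R"
  proof (rule fps_ext)
    fix i
    have "(Q * ?F) $ i = (\<Sum>k<i. Q $ k * ?F $ (i - k)) + Q $ i * ?F $ 0"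
      by (simp add: fps_mult_nth atLeast0AtMost lessThan_Suc_atMost[symmetric])
    also have "Q $ i * ?F $ 0 = fps_X ^ m * fps_shift m (T i) * (inverse w * w)"
      by (simp only: Q F0 mult_ac)
    also have "\<dots> = fps_X ^ m * fps_shift m (T i)"
      by (simp add: winv)
    also have "\<dots> = T i - R $ i"
      by (intro fps_ext) (auto simp: fps_X_power_mult_nth R_def)
    finally show "?H $ i = (Q * ?F + R) $ i"
      by (simp add: T_def)
  qed
  then have "swap_xy ?H = swap_xy (Q * ?F + R)"
    by (rule arg_cong)
  then have "h = swap_xy Q * f + swap_xy R"
    by (simp add: sw.add sw.mult)
  moreover have "swap_xy R $ j = 0" if "m \<le> j" for j
    using that by (intro fps_ext) (simp add: R_def)
  ultimately show ?thesis
    by (rule that)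
qed

text \<open>
  Division of \<open>y\<^sup>m\<close> by \<open>f\<close>: comparing both sides at \<open>x = 0\<close> shows that the quotient is a unit and that
  the remainder vanishes there.
\<close>

lemma weierstrass_preparation:
  fixes f :: "'k::Fields.field fps fps"
  assumes "y_regular m f"
  obtains u W where "f = u * fps_of_poly W" "u $ 0 $ 0 \<noteq> 0" "degree W = m" "coeff W m = 1"
    "\<And>i. i < m \<Longrightarrow> coeff W i $ 0 = 0"
proof -
  obtain q r where qr: "fps_X ^ m = q * f + r" and r: "\<And>j. m \<le> j \<Longrightarrow> r $ j = 0"
    using weierstrass_division[OF assms] by metis
  let ?red = "map_fps (\<lambda>h::'k fps. h $ 0)"
  interpret red: unital_ring_hom ?red
    by (rule map_fps_hom[OF fps_nth_0_hom])
  have X: "?red (fps_X ^ m) = fps_X ^ m"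
    by (intro fps_ext) (simp add: fps_X_power_nth)
  have qf: "(?red q * ?red f) $ j = (if j = m then q $ 0 $ 0 * f $ m $ 0 else 0)" if "j \<le> m" for j
  proof -
    have "(?red q * ?red f) $ j = (\<Sum>i\<le>j. if i = 0 \<and> j = m then q $ 0 $ 0 * f $ m $ 0 else 0)"
      unfolding fps_mult_nth atLeast0AtMost using assms that
      by (intro sum.cong) (auto simp: y_regular_def)
    then show ?thesis
      by simp
  qed
  have eq: "fps_X ^ m = ?red q * ?red f + ?red r"
    using arg_cong[OF qr, of ?red] by (simp only: X red.add red.mult)
  have r0: "r $ j $ 0 = 0" for j
  proof (cases "j < m")
    case True
    have "(fps_X ^ m :: 'k fps) $ j = (?red q * ?red f + ?red r) $ j"
      using eq by simp
    then show ?thesis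
      using qf[of j] True by (simp add: fps_X_power_nth)
  qed (use r in simp)
  have "(fps_X ^ m :: 'k fps) $ m = (?red q * ?red f + ?red r) $ m"
    using eq by simp
  then have q0: "q $ 0 $ 0 \<noteq> 0"
    using qf[of m] r0[of m] by (auto simp: fps_X_power_nth)
  then obtain u where u: "q * u = 1"
    by (rule fps_fps_unitD)
  have "(q * u) $ 0 $ 0 = 1"
    using u by simp
  then have u0: "u $ 0 $ 0 \<noteq> 0"
    by auto
  define W where "W = (\<Sum>j\<le>m. monom ((fps_X ^ m - r) $ j) j)"
  have cW: "coeff W j = (if j \<le> m then (fps_X ^ m - r) $ j else 0)" for j
    by (simp add: W_def coeff_sum if_distrib cong: if_cong)
  have W: "fps_of_poly W = fps_X ^ m - r"
    by (intro fps_ext) (auto simp: cW r fps_X_power_nth)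
  have cm: "coeff W m = 1"
    by (simp add: cW r fps_X_power_nth)
  show ?thesis
  proof
    have "f = (q * u) * f"
      by (simp add: u)
    also have "\<dots> = u * (q * f)"
      by (simp only: mult_ac)
    also have "q * f = fps_of_poly W"
      by (simp add: W qr)
    finally show "f = u * fps_of_poly W" .
    show "degree W = m"
    proof (rule antisym)
      show "degree W \<le> m"
        by (rule degree_le) (simp add: cW)
      show "m \<le> degree W"
        by (rule le_degree) (simp add: cm)
    qed
    show "coeff W i $ 0 = 0" if "i < m" for i
      using that by (simp add: cW r0 fps_X_power_nth)
  qed fact+
qed


section \<open>The Newton--Puiseux theorem\<close>

lemma (in unital_ring_hom) map_poly_pcompose:
  "map_poly h (pcompose p q) = pcompose (map_poly h p) (map_poly h q)"
proof -
  interpret m: unital_ring_hom "map_poly h" by (rule map_poly_hom)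
  show ?thesis
    by (induction p)
       (simp_all add: pcompose_pCons m.add m.mult map_poly_pCons zero)
qed

lemma (in unital_ring_hom) poly_map_poly: "poly (map_poly h p) (h x) = h (poly p x)"
  by (induction p) (simp_all add: map_poly_pCons zero add mult)

lemma pcompose_sum_powers:
  fixes P :: "'a::comm_ring_1 poly"
  assumes "degree P \<le> n"
  shows "pcompose P q = (\<Sum>i\<le>n. smult (coeff P i) (q ^ i))"
proof -
  have "pcompose P q = poly (map_poly (\<lambda>x. [:x:]) P) q"
    by (rule pcompose_altdef)
  also have "\<dots> = (\<Sum>i\<le>n. [:coeff P i:] * q ^ i)"
    using assms degree_map_poly_le[of "\<lambda>x. [:x:]" P]
    by (subst poly_altdef_le[of _ n]) (auto simp: coeff_map_poly)
  finally show ?thesis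
    by simp
qed

text \<open>
  The Tschirnhaus transformation \<open>Y \<mapsto> Y - b\<close> kills the second coefficient. Afterwards the
  polynomial of the first edge of the Newton polygon is not a power of a linear form, so every
  root of it has a smaller multiplicity: this is what makes the induction terminate.
\<close>

lemma tschirnhaus:
  fixes W :: "'a::comm_ring_1 poly"
  assumes "degree W = m" "coeff W m = 1" "m \<ge> 1" "of_nat m * b = coeff W (m - 1)"
  shows "degree (pcompose W [:- b, 1:]) \<le> m" "coeff (pcompose W [:- b, 1:]) m = 1"
    "coeff (pcompose W [:- b, 1:]) (m - 1) = 0"
proof -
  have c: "coeff (pcompose W [:- b, 1:]) k
      = (\<Sum>i\<le>m. coeff W i * (of_nat (i choose k) * (- b) ^ (i - k)))" for k
  proof -
    have "coeff ([:- b, 1:] ^ i) k = of_nat (i choose k) * (- b) ^ (i - k)" for i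
      by (cases "k \<le> i") (simp_all add: coeff_linear_poly_power coeff_eq_0 degree_linear_power binomial_eq_0)
    then show ?thesis
      by (subst pcompose_sum_powers[of _ m]) (simp_all add: assms coeff_sum)
  qed
  show "degree (pcompose W [:- b, 1:]) \<le> m"
    by (rule degree_le) (auto simp: c binomial_eq_0 intro!: sum.neutral)
  have "coeff (pcompose W [:- b, 1:]) m = (\<Sum>i\<le>m. if i = m then 1 else 0)"
    unfolding c by (rule sum.cong) (auto simp: assms binomial_eq_0)
  then show "coeff (pcompose W [:- b, 1:]) m = 1"
    by simp
  have "coeff (pcompose W [:- b, 1:]) (m - 1)
      = (\<Sum>i\<le>m. (if i = m - 1 then coeff W (m - 1) else 0) + (if i = m then - (of_nat m * b) else 0))"
    unfolding c
  proof (rule sum.cong[OF refl])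
    fix i assume "i \<in> {..m}"
    then consider "i < m - 1" | "i = m - 1" | "i = m" by fastforce
    then show "coeff W i * (of_nat (i choose (m - 1)) * (- b) ^ (i - (m - 1)))
      = (if i = m - 1 then coeff W (m - 1) else 0) + (if i = m then - (of_nat m * b) else 0)"
    proof cases
      case 3
      have "m choose (m - 1) = m" "m - (m - 1) = 1"
        using assms(3) binomial_symmetric[of 1 m] by auto
      then show ?thesis
        using 3 assms by auto
    qed (use assms in \<open>auto simp: binomial_eq_0\<close>)
  qed
  then show "coeff (pcompose W [:- b, 1:]) (m - 1) = 0"
    using assms by (simp add: sum.distrib)
qed

lemma fps_X_power_compose:
  assumes "m \<ge> 1" "n \<ge> 1"
  shows "((f :: 'a::idom fps) oo fps_X ^ m) oo fps_X ^ n = f oo fps_X ^ (m * n)"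
proof -
  have "((f :: 'a::idom fps) oo fps_X ^ m) oo fps_X ^ n = f oo ((fps_X ^ m) oo fps_X ^ n)"
    using assms by (intro fps_compose_assoc[symmetric]) (auto simp: fps_X_power_nth)
  also have "(fps_X ^ m) oo fps_X ^ n = (fps_X ^ (m * n) :: 'a fps)"
    using assms
    by (simp add: unital_ring_hom.power[OF fps_compose_hom] fps_X_power_nth fps_X_fps_compose_startby0
      power_mult[symmetric] mult.commute)
  finally show ?thesis .
qed

lemma subdegree_compose_X_power:
  assumes "n \<ge> 1"
  shows "subdegree ((f :: 'a::idom fps) oo fps_X ^ n) = n * subdegree f"
  using assms by (subst subdegree_fps_compose) (auto simp: fps_X_power_nth)

text \<open>One step of the Newton--Puiseux algorithm: \<open>x = t\<^sup>b, y = t\<^sup>a y'\<close>.\<close>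

lemma newton_edge:
  fixes W :: "'k::{alg_closed_field, field_char_0} fps poly"
  assumes deg: "degree W \<le> m" and lead: "coeff W m = 1" and second: "coeff W (m - 1) = 0"
    and low: "\<And>i. i < m \<Longrightarrow> coeff W i $ 0 = 0" and ex: "\<exists>i<m. coeff W i \<noteq> 0"
  obtains a b V c m' where "a \<ge> 1" "b \<ge> 1" "1 \<le> m'" "m' < m"
    "y_regular m' (fps_of_poly (pcompose V [:fps_const c, 1:]))"
    "\<And>q \<psi>. q \<ge> 1 \<Longrightarrow> poly (map_poly (\<lambda>h. h oo fps_X ^ (b * q)) W) (fps_X ^ (a * q) * \<psi>)
       = fps_X ^ (a * m * q) * poly (map_poly (\<lambda>h. h oo fps_X ^ q) V) \<psi>"
proof -
  let ?S = "{i. i < m \<and> coeff W i \<noteq> 0}"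
  let ?slope = "\<lambda>i. of_nat (subdegree (coeff W i)) / of_nat (m - i) :: rat"
  have "finite ?S" "?S \<noteq> {}"
    using ex by auto
  then obtain i0 where i0: "i0 \<in> ?S" "\<And>i. i \<in> ?S \<Longrightarrow> ?slope i0 \<le> ?slope i"
    using arg_min_if_finite(1)[of ?S ?slope] arg_min_least[of ?S _ ?slope] by blast
  \<comment> \<open>The slope \<open>a/b\<close> of the first edge of the Newton polygon; \<open>w\<close> below is the polynomial of this edge.\<close>
  define a where "a = subdegree (coeff W i0)"
  define b where "b = m - i0"
  have b: "b \<ge> 1"
    using i0(1) by (auto simp: b_def)
  have a: "a \<ge> 1"
    using i0(1) low[of i0] by (auto simp: a_def Suc_le_eq subdegree_eq_0_iff intro!: Nat.gr0I)
  have ab: "a * (m - i) \<le> b * subdegree (coeff W i)" if "i < m" "coeff W i \<noteq> 0" for i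
  proof -
    have "?slope i0 \<le> ?slope i"
      using i0(2)[of i] that by simp
    then have "(of_nat (a * (m - i)) :: rat) \<le> of_nat (b * subdegree (coeff W i))"
      using that b by (simp add: a_def b_def field_simps)
    then show ?thesis
      by (simp only: of_nat_le_iff)
  qed
  define v where "v i = fps_shift (a * (m - i)) (coeff W i oo fps_X ^ b)" for i
  have v: "coeff W i oo fps_X ^ b = fps_X ^ (a * (m - i)) * v i" if "i \<le> m" for i
  proof (cases "i = m \<or> coeff W i = 0")
    case True
    then show ?thesis
      by (auto simp: v_def lead)
  next
    case False
    then have "a * (m - i) \<le> subdegree (coeff W i oo fps_X ^ b)"
      using ab[of i] that b by (simp add: subdegree_compose_X_power mult.commute)
    then show ?thesis
      by (subst mult.commute) (simp add: v_def fps_shift_times_fps_X_power)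
  qed
  define V where "V = (\<Sum>i\<le>m. monom (v i) i)"
  have cV: "coeff V i = (if i \<le> m then v i else 0)" for i
    by (simp add: V_def coeff_sum if_distrib cong: if_cong)
  have dV: "degree V \<le> m"
    by (rule degree_le) (simp add: cV)
  have vm: "v m = 1"
    by (simp add: v_def lead)
  have v1: "v (m - 1) = 0"
    using second by (simp add: v_def)
  have vi0: "v i0 $ 0 \<noteq> 0"
  proof -
    have "subdegree (coeff W i0 oo fps_X ^ b) = a * (m - i0)" "coeff W i0 oo fps_X ^ b \<noteq> 0"
      using b i0(1) by (auto simp: subdegree_compose_X_power a_def b_def fps_compose_eq_0_iff fps_X_power_nth)
    then show ?thesis
      by (metis v_def fps_shift_nth add_0 nth_subdegree_nonzero)
  qed
  interpret z: unital_ring_hom "\<lambda>f::'k fps. f $ 0"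
    by (rule fps_nth_0_hom)
  define w where "w = map_poly (\<lambda>f::'k fps. f $ 0) V"
  have cw: "coeff w i = (if i \<le> m then v i $ 0 else 0)" for i
    by (simp add: w_def coeff_map_poly cV)
  have dw: "degree w = m"
  proof (rule antisym)
    show "degree w \<le> m"
      by (rule degree_le) (simp add: cw)
    show "m \<le> degree w"
      by (rule le_degree) (simp add: cw vm)
  qed
  have m: "m \<ge> 1"
    using i0 by auto
  then obtain c where c: "poly w c = 0"
    using alg_closed_imp_poly_has_root[of w] dw by auto
  have w0: "w \<noteq> 0"
    using dw m by auto
  define m' where "m' = order c w"
  have "m' \<ge> 1"
    using c w0 order_root[of w c] by (auto simp: m'_def)
  have "m' \<le> m"
    using order_degree[OF w0, of c] dw by (simp add: m'_def)
  obtain g where g: "w = [:- c, 1:] ^ m' * g" "poly g c \<noteq> 0"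
    using order_decomp[OF w0, of c] by (auto simp: m'_def poly_eq_0_iff_dvd)
  \<comment> \<open>Otherwise \<open>w\<close> is \<open>(Y - c)\<^sup>m\<close>, whose vanishing second coefficient is \<open>- m c\<close>; but then the edge
    would carry only one nonzero coefficient.\<close>
  have "m' \<noteq> m"
  proof
    assume eq: "m' = m"
    have "g \<noteq> 0"
      using g w0 by auto
    then have "degree w = m' + degree g"
      by (subst g(1)) (simp add: degree_mult_eq degree_linear_power)
    then obtain d where d: "g = [:d:]"
      using dw eq by (auto elim: degree_eq_zeroE)
    have co: "coeff w i = d * (of_nat (m choose i) * (- c) ^ (m - i))" if "i \<le> m" for i
      using that by (simp add: g(1) d eq coeff_linear_poly_power)
    have "d = 1"
      using co[of m] by (simp add: cw vm)
    have "m choose (m - 1) = m" "m - (m - 1) = 1"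
      using m binomial_symmetric[of 1 m] by auto
    then have "of_nat m * c = 0"
      using co[of "m - 1"] v1 \<open>d = 1\<close> by (simp add: cw del: One_nat_def)
    then have "c = 0"
      using m by simp
    then have "coeff w i0 = 0"
      using co[of i0] i0(1) by simp
    then show False
      using vi0 i0(1) by (simp add: cw)
  qed
  then have "m' < m"
    using \<open>m' \<le> m\<close> by simp
  have reg: "y_regular m' (fps_of_poly (pcompose V [:fps_const c, 1:]))"
  proof -
    have "map_poly (\<lambda>f::'k fps. f $ 0) (pcompose V [:fps_const c, 1:]) = pcompose w [:c, 1:]"
      by (simp add: z.map_poly_pcompose w_def map_poly_pCons)
    also have "\<dots> = monom 1 m' * pcompose g [:c, 1:]"
    proof -
      have "pcompose ([:- c, 1:] ^ m') [:c, 1:] = [:0, 1:] ^ m'"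
        by (induction m')
           (simp_all add: pcompose_1 pcompose_mult pcompose_pCons del: mult_pCons_left)
      then show ?thesis
        by (subst g(1)) (simp add: pcompose_mult monom_altdef)
    qed
    finally have eq: "map_poly (\<lambda>f::'k fps. f $ 0) (pcompose V [:fps_const c, 1:])
      = monom 1 m' * pcompose g [:c, 1:]" .
    have "coeff (pcompose V [:fps_const c, 1:]) j $ 0 = coeff (monom 1 m' * pcompose g [:c, 1:]) j" for j
      by (simp add: eq[symmetric] coeff_map_poly)
    then have j: "coeff (pcompose V [:fps_const c, 1:]) j $ 0
        = (if m' \<le> j then coeff (pcompose g [:c, 1:]) (j - m') else 0)" for j
      by (simp add: coeff_monom_mult)
    have "coeff (pcompose g [:c, 1:]) 0 = poly g c"
      by (simp add: poly_0_coeff_0[symmetric] poly_pcompose)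
    then show ?thesis
      using g(2) j by (simp add: y_regular_def)
  qed
  show ?thesis
  proof
    fix q :: nat and \<psi> :: "'k fps"
    assume q: "q \<ge> 1"
    have trm: "(coeff W i oo fps_X ^ (b * q)) * (fps_X ^ (a * q) * \<psi>) ^ i
        = fps_X ^ (a * m * q) * ((coeff V i oo fps_X ^ q) * \<psi> ^ i)" if i: "i \<le> m" for i
    proof -
      have Xq: "fps_X oo fps_X ^ q = (fps_X ^ q :: 'k fps)"
        using q by (simp add: fps_X_fps_compose_startby0 fps_X_power_nth)
      have "coeff W i oo fps_X ^ (b * q) = (coeff W i oo fps_X ^ b) oo fps_X ^ q"
        using q b by (simp add: fps_X_power_compose)
      also have "\<dots> = fps_X ^ (q * (a * (m - i))) * (v i oo fps_X ^ q)"
        using q i by (simp add: v fps_compose_mult_distrib fps_X_power_nth Xq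
            unital_ring_hom.power[OF fps_compose_hom] power_mult)
      finally have "(coeff W i oo fps_X ^ (b * q)) * (fps_X ^ (a * q) * \<psi>) ^ i
         = (fps_X ^ (q * (a * (m - i))) * fps_X ^ (a * q * i)) * ((v i oo fps_X ^ q) * \<psi> ^ i)"
        by (simp add: power_mult_distrib power_mult[symmetric] mult_ac)
      also have "fps_X ^ (q * (a * (m - i))) * fps_X ^ (a * q * i) = (fps_X ^ (a * m * q) :: 'k fps)"
      proof -
        have "q * (a * (m - i)) + a * q * i = a * q * ((m - i) + i)"
          by (simp add: algebra_simps)
        then show ?thesis
          using i by (simp add: power_add[symmetric] mult_ac)
      qed
      finally show ?thesis
        using i by (simp add: cV)
    qed
    have "poly (map_poly (\<lambda>h. h oo fps_X ^ (b * q)) W) (fps_X ^ (a * q) * \<psi>)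
       = (\<Sum>i\<le>m. (coeff W i oo fps_X ^ (b * q)) * (fps_X ^ (a * q) * \<psi>) ^ i)"
      by (subst poly_altdef_le[of _ m])
         (auto simp: coeff_map_poly intro!: order_trans[OF degree_map_poly_le] deg)
    also have "\<dots> = (\<Sum>i\<le>m. fps_X ^ (a * m * q) * ((coeff V i oo fps_X ^ q) * \<psi> ^ i))"
      by (rule sum.cong) (use trm in auto)
    also have "\<dots> = fps_X ^ (a * m * q) * poly (map_poly (\<lambda>h. h oo fps_X ^ q) V) \<psi>"
      by (subst poly_altdef_le[of _ m])
         (auto simp: coeff_map_poly sum_distrib_left intro!: order_trans[OF degree_map_poly_le] dV)
    finally show "poly (map_poly (\<lambda>h. h oo fps_X ^ (b * q)) W) (fps_X ^ (a * q) * \<psi>)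
       = fps_X ^ (a * m * q) * poly (map_poly (\<lambda>h. h oo fps_X ^ q) V) \<psi>" .
  qed fact+
qed

theorem newton_puiseux:
  fixes f :: "'k::{alg_closed_field, field_char_0} fps fps"
  assumes "y_regular m f" "m \<ge> 1"
  shows "\<exists>q \<phi>. q \<ge> 1 \<and> \<phi> $ 0 = 0 \<and> subst2 f (fps_X ^ q, \<phi>) = 0"
  using assms
proof (induction m arbitrary: f rule: less_induct)
  case (less m)
  obtain u W where f: "f = u * fps_of_poly W" and W: "degree W = m" "coeff W m = 1"
      and low: "\<And>i. i < m \<Longrightarrow> coeff W i $ 0 = 0"
    using weierstrass_preparation[OF less.prems(1)] by metis
  define b where "b = fps_const (1 / of_nat m) * coeff W (m - 1)"
  have b0: "b $ 0 = 0"
    using low[of "m - 1"] less.prems by (simp add: b_def)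
  have mb: "of_nat m * b = coeff W (m - 1)"
    using less.prems by (simp add: b_def fps_of_nat[symmetric] mult.assoc[symmetric])
  define W1 where "W1 = pcompose W [:- b, 1:]"
  note W1 = tschirnhaus[OF W less.prems(2) mb, folded W1_def]
  have low1: "coeff W1 i $ 0 = 0" if "i < m" for i
  proof -
    interpret z: unital_ring_hom "\<lambda>f::'k fps. f $ 0"
      by (rule fps_nth_0_hom)
    have "map_poly (\<lambda>f::'k fps. f $ 0) W = monom 1 m"
    proof (rule poly_eqI)
      fix n
      consider "n < m" | "n = m" | "n > m" by linarith
      then show "coeff (map_poly (\<lambda>f::'k fps. f $ 0) W) n = coeff (monom 1 m) n"
        using low[of n] W by cases (simp_all add: coeff_map_poly coeff_eq_0)
    qed
    then have "map_poly (\<lambda>f::'k fps. f $ 0) W1 = monom 1 m"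
      by (simp add: W1_def z.map_poly_pcompose map_poly_pCons b0)
    then have "coeff (map_poly (\<lambda>f::'k fps. f $ 0) W1) i = 0"
      using that by simp
    then show ?thesis
      by (simp add: coeff_map_poly)
  qed
  have "\<exists>q \<phi>. q \<ge> 1 \<and> \<phi> $ 0 = 0 \<and> poly (map_poly (\<lambda>h. h oo fps_X ^ q) W1) \<phi> = 0"
  proof (cases "\<exists>i<m. coeff W1 i \<noteq> 0")
    case True
    obtain a b V c m' where ab: "a \<ge> 1" "b \<ge> 1" "1 \<le> m'" "m' < m"
      and reg: "y_regular m' (fps_of_poly (pcompose V [:fps_const c, 1:]))"
      and eq: "\<And>q \<psi>. q \<ge> 1 \<Longrightarrow> poly (map_poly (\<lambda>h. h oo fps_X ^ (b * q)) W1) (fps_X ^ (a * q) * \<psi>)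
       = fps_X ^ (a * m * q) * poly (map_poly (\<lambda>h. h oo fps_X ^ q) V) \<psi>"
      using newton_edge[OF W1 low1 True] by metis
    obtain q \<phi> where q: "q \<ge> 1" "\<phi> $ 0 = 0"
      "subst2 (fps_of_poly (pcompose V [:fps_const c, 1:])) (fps_X ^ q, \<phi>) = 0"
      using less.IH[OF ab(4) reg ab(3)] by blast
    interpret h: unital_ring_hom "\<lambda>h::'k fps. h oo fps_X ^ q"
      using q by (intro fps_compose_hom) (simp add: fps_X_power_nth)
    have "0 = poly (map_poly (\<lambda>h. h oo fps_X ^ q) (pcompose V [:fps_const c, 1:])) \<phi>"
      using q by (simp add: subst2_fps_of_poly fps_X_power_nth)
    also have "\<dots> = poly (map_poly (\<lambda>h. h oo fps_X ^ q) V) (fps_const c + \<phi>)"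
      by (simp add: h.map_poly_pcompose poly_pcompose map_poly_pCons h.zero h.one)
    finally have "poly (map_poly (\<lambda>h. h oo fps_X ^ (b * q)) W1)
        (fps_X ^ (a * q) * (fps_const c + \<phi>)) = 0"
      using eq[OF q(1), of "fps_const c + \<phi>"] by simp
    moreover have "(fps_X ^ (a * q) * (fps_const c + \<phi>)) $ 0 = 0" "b * q \<ge> 1"
      using ab q by (simp_all add: fps_X_power_nth)
    ultimately show ?thesis
      by blast
  next
    case False
    have "W1 = monom 1 m"
    proof (rule poly_eqI)
      fix n
      consider "n < m" | "n = m" | "n > m" by linarith
      then show "coeff W1 n = coeff (monom 1 m) n"
        using False W1 by cases (auto simp: coeff_eq_0)
    qed
    then show ?thesis
      using less.prems by (intro exI[of _ 1] exI[of _ 0]) (simp add: map_poly_monom poly_monom)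
  qed
  then obtain q \<phi> where q: "q \<ge> 1" "\<phi> $ 0 = 0" "poly (map_poly (\<lambda>h. h oo fps_X ^ q) W1) \<phi> = 0"
    by blast
  interpret h: unital_ring_hom "\<lambda>h::'k fps. h oo fps_X ^ q"
    using q by (intro fps_compose_hom) (simp add: fps_X_power_nth)
  let ?\<phi> = "\<phi> - (b oo fps_X ^ q)"
  have "poly (map_poly (\<lambda>h. h oo fps_X ^ q) W) ?\<phi> = 0"
    using q(3) unfolding W1_def
    by (simp add: h.map_poly_pcompose poly_pcompose map_poly_pCons h.zero h.one h.uminus)
  moreover have "?\<phi> $ 0 = 0"
    using q b0 by simp
  ultimately have "subst2 f (fps_X ^ q, ?\<phi>) = 0"
    using q unital_ring_hom.mult[OF subst2_hom[of "(fps_X ^ q, ?\<phi>)"]]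
    by (simp add: f subst2_fps_of_poly fps_X_power_nth)
  then show ?case
    using q \<open>?\<phi> $ 0 = 0\<close> by blast
qed


section \<open>Parametrised branches\<close>

subsection \<open>Roots of unity and twists\<close>

definition unity_roots :: "nat \<Rightarrow> 'k::Fields.field set" where
  "unity_roots m = {\<zeta>. \<zeta> ^ m = 1}"

lemma unity_roots_card:
  assumes "m \<ge> 1"
  shows "finite (unity_roots m :: 'k::{alg_closed_field, field_char_0} set)"
    and "card (unity_roots m :: 'k set) = m"
proof -
  define P where "P = monom 1 m - (1 :: 'k poly)"
  have coP: "coeff P i = (if i = m then 1 else if i = 0 then -1 else 0)" for i
    using assms by (auto simp: P_def)
  have dP: "degree P = m"
  proof (rule antisym)
    show "degree P \<le> m"
      using assms by (intro degree_le) (simp add: coP)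
    show "m \<le> degree P"
      by (rule le_degree) (simp add: coP)
  qed
  have rP: "poly P x = 0 \<longleftrightarrow> x \<in> unity_roots m" for x
    by (simp add: P_def unity_roots_def poly_monom)
  have "P \<noteq> 0"
    using dP assms by auto
  then obtain A where A: "size A = degree P" "P = smult (lead_coeff P) (\<Prod>x\<in>#A. [:-x, 1:])"
    using alg_closed_imp_factorization by blast
  have P: "P = (\<Prod>x\<in>#A. [:-x, 1:])"
    using A(2) by (simp add: dP coP)
  have setA: "set_mset A = unity_roots m"
  proof -
    have "poly (\<Prod>x\<in>#A. [:-x, 1:]) z = 0 \<longleftrightarrow> z \<in># A" for z
      by (induction A) auto
    then show ?thesis
      using rP P by auto
  qed
  have "count A x \<le> 1" for x
  proof (rule ccontr)
    assume "\<not> count A x \<le> 1"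
    then have "2 \<le> count A x"
      by simp
    then have "{#x, x#} \<subseteq># A"
      by (simp add: subseteq_mset_def)
    then obtain B where "A = {#x, x#} + B"
      by (metis subset_mset.add_diff_inverse)
    then have *: "P = [:-x, 1:] * ([:-x, 1:] * (\<Prod>x\<in>#B. [:-x, 1:]))"
      by (simp add: P)
    have "poly P x = 0"
      unfolding * poly_mult by simp
    have "poly (pderiv P) x = 0"
      unfolding * pderiv_mult poly_add poly_mult by simp
    note roots = \<open>poly P x = 0\<close> this
    have "pderiv P = monom (of_nat m) (m - 1)"
      by (simp add: P_def pderiv_diff pderiv_monom)
    then show False
      using assms roots by (auto simp: poly_monom P_def power_0_left split: if_splits)
  qed
  then have "A = mset_set (set_mset A)"
    by (intro multiset_eqI) (metis count_eq_zero_iff count_mset_set' finite_set_mset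
        le_antisym less_one not_le)
  then have "size A = card (set_mset A)"
    by (metis size_mset_set)
  then show "card (unity_roots m :: 'k set) = m"
    using A(1) dP setA by simp
  show "finite (unity_roots m :: 'k set)"
    by (simp add: setA[symmetric])
qed

lemma unity_roots_detect:
  assumes "m \<ge> 1" "\<And>\<zeta>::'k::{alg_closed_field, field_char_0}. \<zeta> \<in> unity_roots m \<Longrightarrow> \<zeta> ^ i = 1"
  shows "m dvd i"
proof (rule ccontr)
  assume "\<not> m dvd i"
  then have r: "1 \<le> i mod m" "i mod m < m"
    using assms by (auto simp: mod_greater_zero_iff_not_dvd Suc_le_eq)
  have "unity_roots m \<subseteq> (unity_roots (i mod m) :: 'k set)"
  proof
    fix \<zeta> :: 'k assume \<zeta>: "\<zeta> \<in> unity_roots m"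
    have "\<zeta> ^ i = \<zeta> ^ (m * (i div m) + i mod m)"
      by simp
    also have "\<dots> = \<zeta> ^ (i mod m)"
      using \<zeta> unfolding power_add power_mult by (simp add: unity_roots_def)
    finally show "\<zeta> \<in> unity_roots (i mod m)"
      using assms(2)[OF \<zeta>] by (simp add: unity_roots_def)
  qed
  then have "card (unity_roots m :: 'k set) \<le> card (unity_roots (i mod m) :: 'k set)"
    by (intro card_mono unity_roots_card r)
  then show False
    using r assms unity_roots_card(2)[of m, where 'k = 'k] unity_roots_card(2)[of "i mod m", where 'k = 'k]
    by simp
qed

definition twist :: "'k::Fields.field \<Rightarrow> 'k fps \<Rightarrow> 'k fps" where
  "twist \<zeta> h = Abs_fps (\<lambda>n. \<zeta> ^ n * h $ n)"

lemma twist_nth [simp]: "twist \<zeta> h $ n = \<zeta> ^ n * h $ n"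
  by (simp add: twist_def)

lemma twist_hom: "unital_ring_hom (twist \<zeta>)"
proof -
  have "twist \<zeta> = (\<lambda>h. h oo (fps_const \<zeta> * fps_X))"
    by (simp add: fun_eq_iff twist_def fps_compose_linear)
  then show ?thesis
    using fps_compose_hom[of "fps_const \<zeta> * fps_X"] by simp
qed

lemma twist_1 [simp]: "twist 1 h = h"
  by (rule fps_ext) simp

lemma twist_twist: "twist a (twist b h) = twist (a * b) h"
  by (rule fps_ext) (simp add: power_mult_distrib)

lemma compose_X_power_nth:
  assumes "m \<ge> 1"
  shows "((g :: 'a::comm_ring_1 fps) oo fps_X ^ m) $ n = (if m dvd n then g $ (n div m) else 0)"
proof -
  have "(g oo fps_X ^ m) $ n = (\<Sum>i\<in>{0..n}. if n = m * i then g $ i else 0)"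
    by (auto simp: fps_compose_nth power_mult[symmetric] fps_X_power_nth intro!: sum.cong)
  also have "\<dots> = (if m dvd n then g $ (n div m) else 0)"
  proof (cases "m dvd n")
    case True
    then have "(\<Sum>i\<in>{0..n}. if n = m * i then g $ i else 0) = (\<Sum>i\<in>{0..n}. if i = n div m then g $ i else 0)"
      using assms by (intro sum.cong) (auto simp: dvd_def)
    then show ?thesis
      using True by simp
  next
    case False
    then show ?thesis
      by (auto intro!: sum.neutral)
  qed
  finally show ?thesis .
qed

lemma twist_compose_X_power:
  assumes "m \<ge> 1" "\<zeta> \<in> unity_roots m"
  shows "twist \<zeta> (h oo fps_X ^ m) = h oo fps_X ^ m"
  using assms by (intro fps_ext) (auto simp: compose_X_power_nth unity_roots_def power_mult elim!: dvdE)

text \<open>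
  Inverse of the substitution \<open>t \<mapsto> t\<^sup>m\<close> on the series in \<open>t\<^sup>m\<close>, i.e. on those that are fixed by
  the twists with \<open>m\<close>-th roots of unity.
\<close>

definition descend :: "nat \<Rightarrow> 'a::comm_ring_1 fps \<Rightarrow> 'a fps" where
  "descend m h = Abs_fps (\<lambda>i. h $ (m * i))"

lemma descend_compose:
  fixes h :: "'k::{alg_closed_field, field_char_0} fps"
  assumes "m \<ge> 1" "\<And>\<zeta>. \<zeta> \<in> unity_roots m \<Longrightarrow> twist \<zeta> h = h"
  shows "descend m h oo fps_X ^ m = h"
proof (rule fps_ext)
  fix n
  show "(descend m h oo fps_X ^ m) $ n = h $ n"
  proof (cases "m dvd n")
    case False
    then obtain \<zeta> :: 'k where \<zeta>: "\<zeta> \<in> unity_roots m" "\<zeta> ^ n \<noteq> 1"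
      using unity_roots_detect[OF assms(1)] by blast
    have "\<zeta> ^ n * h $ n = h $ n"
      using assms(2)[OF \<zeta>(1)] by (metis twist_nth)
    then have "h $ n = 0"
      using \<zeta>(2) by simp
    then show ?thesis
      using assms(1) False by (simp add: compose_X_power_nth)
  qed (use assms(1) in \<open>auto simp: compose_X_power_nth descend_def\<close>)
qed

lemma descend_compose_poly:
  fixes P :: "'k::{alg_closed_field, field_char_0} fps poly"
  assumes "m \<ge> 1" "\<And>\<zeta>. \<zeta> \<in> unity_roots m \<Longrightarrow> map_poly (twist \<zeta>) P = P"
  shows "map_poly (\<lambda>h. h oo fps_X ^ m) (map_poly (descend m) P) = P"
proof (rule poly_eqI)
  fix i
  have z: "descend m (0 :: 'k fps) = 0" for m
    by (rule fps_ext) (simp add: descend_def)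
  have "twist \<zeta> (coeff P i) = coeff P i" if "\<zeta> \<in> unity_roots m" for \<zeta>
    using arg_cong[OF assms(2)[OF that], of "\<lambda>Q. coeff Q i"]
    by (simp add: coeff_map_poly unital_ring_hom.zero[OF twist_hom])
  then show "coeff (map_poly (\<lambda>h. h oo fps_X ^ m) (map_poly (descend m) P)) i = coeff P i"
    by (simp add: coeff_map_poly z descend_compose[OF assms(1)])
qed

lemma unity_roots_mult_bij:
  assumes "m \<ge> 1" "\<eta> \<in> (unity_roots m :: 'k::Fields.field set)"
  shows "bij_betw (\<lambda>\<zeta>. \<eta> * \<zeta>) (unity_roots m) (unity_roots m)"
proof -
  have "\<eta> \<noteq> 0"
    using assms by (auto simp: unity_roots_def power_0_left)
  then show ?thesis
    using assms
    by (intro bij_betw_byWitness[where f' = "\<lambda>\<zeta>. \<zeta> / \<eta>"])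
       (auto simp: unity_roots_def power_mult_distrib power_divide)
qed


subsection \<open>The branch with a given primitive parametrisation\<close>

text \<open>
  The arc \<open>(t\<^sup>m, \<phi>(t))\<close> is primitive when the \<open>m\<close> conjugates \<open>\<phi>(\<zeta> t)\<close> of \<open>\<phi>\<close> over \<open>K[[t\<^sup>m]]\<close> are
  distinct. Then they are the roots of an irreducible polynomial over \<open>K[[x]]\<close>, \<open>x = t\<^sup>m\<close>, the
  equation of the image of the arc.
\<close>

locale puiseux_branch =
  fixes m :: nat and \<phi> :: "'k::{alg_closed_field, field_char_0} fps"
  assumes m: "m \<ge> 1" and \<phi>_0: "\<phi> $ 0 = 0"
    and primitive: "\<zeta> \<in> unity_roots m \<Longrightarrow> \<zeta> \<noteq> 1 \<Longrightarrow> twist \<zeta> \<phi> \<noteq> \<phi>"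
begin

lemma m_pos [simp]: "0 < m"
  using m by simp

abbreviation \<mu> :: "'k set" where
  "\<mu> \<equiv> unity_roots m"

lemma fin [simp]: "finite \<mu>"
  by (rule unity_roots_card[OF m])

lemma one_in [simp]: "1 \<in> \<mu>"
  by (simp add: unity_roots_def)

definition conjugate_poly :: "'k fps poly" where
  "conjugate_poly = (\<Prod>\<zeta>\<in>\<mu>. [:- twist \<zeta> \<phi>, 1:])"

definition weierstrass_poly :: "'k fps poly" where
  "weierstrass_poly = map_poly (descend m) conjugate_poly"

definition equation :: "'k fps fps" where
  "equation = fps_of_poly weierstrass_poly"

definition arc :: "'k fps \<times> 'k fps" where
  "arc = (fps_X ^ m, \<phi>)"

definition ev :: "'k fps fps \<Rightarrow> 'k fps" where
  "ev h = subst2 h arc"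

text \<open>
  The derivative of the conjugate polynomial at its root \<open>\<phi>\<close>.
\<close>

definition different :: "'k fps" where
  "different = (\<Prod>\<zeta>\<in>\<mu> - {1}. \<phi> - twist \<zeta> \<phi>)"

lemma X_m_0 [simp]: "(fps_X ^ m :: 'k fps) $ 0 = 0"
  using m by (simp add: fps_X_power_nth)

sublocale ev: unital_ring_hom ev
  unfolding ev_def[abs_def] by (rule subst2_hom) (simp_all add: arc_def \<phi>_0)

lemma expand_poly:
  assumes "\<And>\<zeta>. \<zeta> \<in> \<mu> \<Longrightarrow> map_poly (twist \<zeta>) P = P"
  shows "map_poly (\<lambda>h. h oo fps_X ^ m) (map_poly (descend m) P) = P"
  by (rule descend_compose_poly[OF m assms])

lemma expand_weierstrass: "map_poly (\<lambda>h. h oo fps_X ^ m) weierstrass_poly = conjugate_poly"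
  unfolding weierstrass_poly_def
proof (rule expand_poly)
  fix \<eta> assume \<eta>: "\<eta> \<in> \<mu>"
  interpret t: unital_ring_hom "twist \<eta>" by (rule twist_hom)
  interpret tp: unital_ring_hom "map_poly (twist \<eta>)" by (rule t.map_poly_hom)
  have "map_poly (twist \<eta>) conjugate_poly = (\<Prod>\<zeta>\<in>\<mu>. [:- twist (\<eta> * \<zeta>) \<phi>, 1:])"
    by (simp add: conjugate_poly_def tp.prod map_poly_pCons t.zero t.one t.uminus twist_twist)
  also have "\<dots> = conjugate_poly"
    unfolding conjugate_poly_def
    by (rule prod.reindex_bij_betw[OF unity_roots_mult_bij[OF m \<eta>]])
  finally show "map_poly (twist \<eta>) conjugate_poly = conjugate_poly" .
qed

lemma degree_conjugate: "degree conjugate_poly = m" "coeff conjugate_poly m = 1"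
proof -
  show d: "degree conjugate_poly = m"
    unfolding conjugate_poly_def by (subst degree_prod_eq_sum_degree) (simp_all add: unity_roots_card[OF m])
  have "lead_coeff conjugate_poly = 1"
    unfolding conjugate_poly_def by (simp add: lead_coeff_prod)
  then show "coeff conjugate_poly m = 1"
    by (simp add: d)
qed

lemma coeff_weierstrass_compose:
  "coeff weierstrass_poly i oo fps_X ^ m = coeff conjugate_poly i"
  using arg_cong[OF expand_weierstrass, of "\<lambda>P. coeff P i"] by (simp add: coeff_map_poly)

lemma degree_weierstrass: "degree weierstrass_poly = m"
  and coeff_weierstrass_m: "coeff weierstrass_poly m = 1"
proof -
  have 0: "descend m (0 :: 'k fps) = 0"
    by (rule fps_ext) (simp add: descend_def)
  have "descend m (1 :: 'k fps) = 1"
    using m by (intro fps_ext) (simp add: descend_def)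
  then show 1: "coeff weierstrass_poly m = 1"
    unfolding weierstrass_poly_def by (simp add: coeff_map_poly 0 degree_conjugate)
  show "degree weierstrass_poly = m"
  proof (rule antisym)
    show "degree weierstrass_poly \<le> m"
      unfolding weierstrass_poly_def using degree_map_poly_le[of "descend m" conjugate_poly] 0
      by (simp add: degree_conjugate)
    show "m \<le> degree weierstrass_poly"
      by (rule le_degree) (simp add: 1)
  qed
qed

lemma coeff_weierstrass_0: "i < m \<Longrightarrow> coeff weierstrass_poly i $ 0 = 0"
proof -
  assume i: "i < m"
  interpret z: unital_ring_hom "\<lambda>f::'k fps. f $ 0" by (rule fps_nth_0_hom)
  interpret zp: unital_ring_hom "map_poly (\<lambda>f::'k fps. f $ 0)" by (rule z.map_poly_hom)
  have "map_poly (\<lambda>f::'k fps. f $ 0) conjugate_poly = monom 1 m"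
    by (simp add: conjugate_poly_def zp.prod map_poly_pCons \<phi>_0 unity_roots_card[OF m] monom_altdef)
  then have "coeff (map_poly (\<lambda>f::'k fps. f $ 0) conjugate_poly) i = coeff (monom 1 m) i"
    by simp
  then have "coeff conjugate_poly i $ 0 = 0"
    using i by (simp add: coeff_map_poly)
  then show ?thesis
    by (simp add: coeff_weierstrass_compose[symmetric])
qed

lemma y_regular_equation: "y_regular m equation"
  by (simp add: y_regular_def equation_def coeff_weierstrass_0 coeff_weierstrass_m)

lemma equation_subst2:
  assumes "\<psi> $ 0 = 0"
  shows "subst2 equation (fps_X ^ m, \<psi>) = (\<Prod>\<zeta>\<in>\<mu>. \<psi> - twist \<zeta> \<phi>)"
  using assms
  by (simp add: equation_def subst2_fps_of_poly expand_weierstrass conjugate_poly_def poly_prod)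

lemma ev_equation: "ev equation = 0"
proof -
  have "(\<Prod>\<zeta>\<in>\<mu>. \<phi> - twist \<zeta> \<phi>) = 0"
    by (rule prod_zero) (auto intro!: bexI[of _ 1])
  then show ?thesis
    by (simp add: ev_def arc_def equation_subst2 \<phi>_0)
qed

lemma ev_const: "ev (fps_const h) = h oo fps_X ^ m"
  by (simp add: ev_def subst2_fps_const arc_def)

lemma ev_y: "ev fps_X = \<phi>"
  by (simp add: ev_def subst2_X arc_def \<phi>_0)

lemma ev_nth_0: "ev h $ 0 = h $ 0 $ 0"
  by (simp add: ev_def subst2_nth_0)

lemma ev_poly: "ev (fps_of_poly P) = poly (map_poly (\<lambda>h. h oo fps_X ^ m) P) \<phi>"
  by (simp add: ev_def subst2_fps_of_poly arc_def \<phi>_0)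

lemma twist_inj: "inj_on (\<lambda>\<zeta>. twist \<zeta> \<phi>) \<mu>"
proof (rule inj_onI)
  fix a b assume ab: "a \<in> \<mu>" "b \<in> \<mu>" "twist a \<phi> = twist b \<phi>"
  have a: "a \<noteq> 0"
    using ab m by (auto simp: unity_roots_def power_0_left)
  have "twist (inverse a) (twist a \<phi>) = twist (inverse a) (twist b \<phi>)"
    using ab by simp
  then have "twist (inverse a * b) \<phi> = \<phi>"
    using a by (simp add: twist_twist)
  moreover have "inverse a * b \<in> \<mu>"
    using ab by (simp add: unity_roots_def power_mult_distrib power_inverse)
  ultimately have "inverse a * b = 1"
    using primitive by blast
  then show "a = b"
    using a by (simp add: field_simps)
qed

text \<open>
  A remainder of degree below \<open>m\<close> that vanishes on the arc vanishes at the \<open>m\<close> conjugates of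
  \<open>\<phi>\<close>, hence is zero.
\<close>

lemma ev_eq_0_iff: "ev h = 0 \<longleftrightarrow> equation dvd h"
proof
  assume h: "ev h = 0"
  obtain q r where qr: "h = q * equation + r" and r: "\<And>j. m \<le> j \<Longrightarrow> r $ j = 0"
    using weierstrass_division[OF y_regular_equation] by metis
  define P where "P = (\<Sum>j<m. monom (r $ j) j)"
  have cP: "coeff P j = (if j < m then r $ j else 0)" for j
    by (simp add: P_def coeff_sum if_distrib cong: if_cong)
  have rP: "r = fps_of_poly P"
    using r by (intro fps_ext) (simp add: cP)
  define P' where "P' = map_poly (\<lambda>h. h oo fps_X ^ m) P"
  have "ev r = 0"
    using h by (simp add: qr ev.add ev.mult ev_equation)
  then have root: "poly P' \<phi> = 0"
    by (simp add: rP ev_poly P'_def)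
  have "poly P' (twist \<zeta> \<phi>) = 0" if \<zeta>: "\<zeta> \<in> \<mu>" for \<zeta>
  proof -
    interpret t: unital_ring_hom "twist \<zeta>" by (rule twist_hom)
    have "map_poly (twist \<zeta>) P' = P'"
      using twist_compose_X_power[OF m \<zeta>]
      by (intro poly_eqI) (simp add: P'_def coeff_map_poly t.zero)
    then have "poly P' (twist \<zeta> \<phi>) = twist \<zeta> (poly P' \<phi>)"
      by (metis t.poly_map_poly)
    then show ?thesis
      by (simp add: root t.zero)
  qed
  then have sub: "(\<lambda>\<zeta>. twist \<zeta> \<phi>) ` \<mu> \<subseteq> {z. poly P' z = 0}"
    by auto
  have "P' = 0"
  proof (rule ccontr)
    assume "P' \<noteq> 0"
    then have "finite {z. poly P' z = 0}" "card {z. poly P' z = 0} \<le> degree P'"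
      by (simp_all add: poly_roots_finite card_poly_roots_bound)
    then have "m \<le> degree P'"
      using card_mono[OF _ sub] card_image[OF twist_inj] unity_roots_card(2)[OF m, where 'k = 'k] by simp
    moreover have "degree P' \<le> m - 1"
      by (rule degree_le) (auto simp: P'_def coeff_map_poly cP)
    ultimately show False
      using m by simp
  qed
  have "coeff P j = 0" for j
  proof -
    have "coeff P j oo fps_X ^ m = 0"
      using arg_cong[OF \<open>P' = 0\<close>, of "\<lambda>P. coeff P j"] by (simp add: P'_def coeff_map_poly)
    then show ?thesis
      by (subst (asm) fps_compose_eq_0_iff) (simp_all add: fps_X_power_nth)
  qed
  then have "P = 0"
    by (intro poly_eqI) simp
  then show "equation dvd h"
    by (simp add: qr rP)
next
  assume "equation dvd h"
  then show "ev h = 0"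
    by (auto simp: ev.mult ev_equation elim!: dvdE)
qed

lemma different_nonzero: "different \<noteq> 0"
  unfolding different_def using primitive by (force simp: prod_zero_iff)

text \<open>
  Lagrange interpolation at the conjugates of \<open>\<phi>\<close>: the interpolating polynomial of the values
  \<open>twist \<zeta> h\<close>, cleared of denominators, has coefficients in \<open>K[[t\<^sup>m]]\<close>, and its value at \<open>\<phi>\<close>
  is \<open>h\<close> times the different.
\<close>

lemma different_mult_in_range: "\<exists>r. ev r = different * h"
proof -
  define L where "L = (\<Sum>\<zeta>\<in>\<mu>. [:twist \<zeta> h:] * (\<Prod>\<xi>\<in>\<mu> - {\<zeta>}. [:- twist \<xi> \<phi>, 1:]))"
  have "map_poly (twist \<eta>) L = L" if \<eta>: "\<eta> \<in> \<mu>" for \<eta>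
  proof -
    interpret t: unital_ring_hom "twist \<eta>" by (rule twist_hom)
    interpret tp: unital_ring_hom "map_poly (twist \<eta>)" by (rule t.map_poly_hom)
    have bij: "bij_betw (\<lambda>\<zeta>. \<eta> * \<zeta>) \<mu> \<mu>"
      by (rule unity_roots_mult_bij[OF m \<eta>])
    have c: "map_poly (twist \<eta>) [:a:] = [:twist \<eta> a:]" for a
      by (cases "a = 0") (simp_all add: map_poly_pCons t.zero)
    have "map_poly (twist \<eta>) L
      = (\<Sum>\<zeta>\<in>\<mu>. [:twist (\<eta> * \<zeta>) h:] * (\<Prod>\<xi>\<in>\<mu> - {\<zeta>}. [:- twist (\<eta> * \<xi>) \<phi>, 1:]))"
      unfolding L_def tp.sum tp.mult tp.prod c
      by (simp add: map_poly_pCons t.zero t.one t.uminus twist_twist)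
    also have "\<dots> = (\<Sum>\<zeta>\<in>\<mu>. [:twist (\<eta> * \<zeta>) h:] * (\<Prod>\<xi>\<in>\<mu> - {\<eta> * \<zeta>}. [:- twist \<xi> \<phi>, 1:]))"
    proof (rule sum.cong[OF refl])
      fix \<zeta> assume "\<zeta> \<in> \<mu>"
      have "bij_betw (\<lambda>\<xi>. \<eta> * \<xi>) (\<mu> - {\<zeta>}) (\<mu> - {\<eta> * \<zeta>})"
        using bij_betw_DiffI[OF bij, of "{\<zeta>}" "{\<eta> * \<zeta>}"] \<open>\<zeta> \<in> \<mu>\<close>
          bij_betw_apply[OF bij \<open>\<zeta> \<in> \<mu>\<close>] by (simp add: bij_betw_def)
      then have "(\<Prod>\<xi>\<in>\<mu> - {\<zeta>}. [:- twist (\<eta> * \<xi>) \<phi>, 1:]) = (\<Prod>\<xi>\<in>\<mu> - {\<eta> * \<zeta>}. [:- twist \<xi> \<phi>, 1:])"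
        by (rule prod.reindex_bij_betw)
      then show "[:twist (\<eta> * \<zeta>) h:] * (\<Prod>\<xi>\<in>\<mu> - {\<zeta>}. [:- twist (\<eta> * \<xi>) \<phi>, 1:])
        = [:twist (\<eta> * \<zeta>) h:] * (\<Prod>\<xi>\<in>\<mu> - {\<eta> * \<zeta>}. [:- twist \<xi> \<phi>, 1:])"
        by simp
    qed
    also have "\<dots> = L"
      unfolding L_def by (rule sum.reindex_bij_betw[OF bij])
    finally show ?thesis .
  qed
  then have "map_poly (\<lambda>h. h oo fps_X ^ m) (map_poly (descend m) L) = L"
    by (rule expand_poly)
  then have "ev (fps_of_poly (map_poly (descend m) L)) = poly L \<phi>"
    by (simp add: ev_poly)
  also have "\<dots> = (\<Sum>\<zeta>\<in>\<mu>. if \<zeta> = 1 then different * h else 0)"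
    unfolding L_def poly_sum
  proof (rule sum.cong[OF refl])
    fix \<zeta> assume "\<zeta> \<in> \<mu>"
    show "poly ([:twist \<zeta> h:] * (\<Prod>\<xi>\<in>\<mu> - {\<zeta>}. [:- twist \<xi> \<phi>, 1:])) \<phi>
        = (if \<zeta> = 1 then different * h else 0)"
    proof (cases "\<zeta> = 1")
      case False
      then have "(\<Prod>\<xi>\<in>\<mu> - {\<zeta>}. \<phi> - twist \<xi> \<phi>) = 0"
        by (intro prod_zero) (auto intro!: bexI[of _ 1])
      then show ?thesis
        using False by (simp add: poly_prod)
    qed (simp add: poly_prod different_def)
  qed
  also have "\<dots> = different * h"
    by simp
  finally show ?thesis ..
qed

text \<open>
  The order of the different exceeds the exact conductor exponent of the branch by \<open>m - 1\<close>.
\<close>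

lemma conductor:
  assumes "h = 0 \<or> subdegree different \<le> subdegree h"
  shows "\<exists>r. ev r = h"
proof -
  have "different dvd h"
    using assms different_nonzero by (cases "h = 0") (simp_all add: fps_dvd_iff)
  then obtain k where "h = different * k" ..
  then show ?thesis
    using different_mult_in_range by blast
qed

lemma equation_nonzero: "equation \<noteq> 0"
  using y_regular_equation by (auto simp: y_regular_def)

lemma coeff_0_equation: "equation $ 0 oo fps_X ^ m = (\<Prod>\<zeta>\<in>\<mu>. - twist \<zeta> \<phi>)"
proof -
  have "equation $ 0 oo fps_X ^ m = poly conjugate_poly 0"
    by (simp add: equation_def coeff_weierstrass_compose poly_0_coeff_0)
  then show ?thesis
    by (simp add: conjugate_poly_def poly_prod)
qed

text \<open>The order of \<open>\<phi>\<close> is the order of the equation on the axis \<open>y = 0\<close>.\<close>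

lemma subdegree_\<phi>:
  assumes "\<And>i. i < l \<Longrightarrow> equation $ 0 $ i = 0"
  shows "\<phi> = 0 \<or> l \<le> subdegree \<phi>"
proof (rule disjCI)
  assume "\<not> l \<le> subdegree \<phi>"
  then have l: "equation $ 0 $ subdegree \<phi> = 0"
    using assms by simp
  show "\<phi> = 0"
  proof (rule ccontr)
    assume nz: "\<phi> \<noteq> 0"
    have tw: "twist \<zeta> \<phi> \<noteq> 0 \<and> subdegree (twist \<zeta> \<phi>) = subdegree \<phi>" if "\<zeta> \<in> \<mu>" for \<zeta>
    proof -
      have "\<zeta> \<noteq> 0"
        using that m by (auto simp: unity_roots_def power_0_left)
      then have "twist \<zeta> \<phi> $ subdegree \<phi> \<noteq> 0"
        using nz by simp
      moreover have "subdegree (twist \<zeta> \<phi>) = subdegree \<phi>"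
        using \<open>\<zeta> \<noteq> 0\<close> nz by (intro subdegreeI) auto
      ultimately show ?thesis
        by (metis fps_zero_nth)
    qed
    have "subdegree (\<Prod>\<zeta>\<in>\<mu>. - twist \<zeta> \<phi>) = (\<Sum>\<zeta>\<in>\<mu>. subdegree (- twist \<zeta> \<phi>))"
      using tw by (intro subdegree_prod) auto
    also have "\<dots> = m * subdegree \<phi>"
      using tw unity_roots_card(2)[OF m, where 'k = 'k] by simp
    finally have "subdegree (equation $ 0 oo fps_X ^ m) = m * subdegree \<phi>"
      by (simp add: coeff_0_equation)
    then have "subdegree (equation $ 0) = subdegree \<phi>"
      using m by (simp add: subdegree_compose_X_power)
    moreover have "equation $ 0 oo fps_X ^ m \<noteq> 0"
      using tw fin by (simp add: coeff_0_equation prod_zero_iff)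
    then have "equation $ 0 \<noteq> 0"
      by auto
    ultimately show False
      using l by (metis nth_subdegree_nonzero)
  qed
qed

end

text \<open>
  A series fixed by the twist with a root of unity of order \<open>e\<close> only contains powers of \<open>t\<^sup>e\<close>.
\<close>

lemma eq_compose_X_power:
  fixes h :: "'k::{alg_closed_field, field_char_0} fps"
  assumes "\<zeta> ^ q = 1" "\<zeta> \<noteq> 1" "q \<ge> 1" "twist \<zeta> h = h"
  obtains e g where "e > 1" "e dvd q" "h = g oo fps_X ^ e"
proof -
  define e where "e = (LEAST e. e \<ge> 1 \<and> \<zeta> ^ e = 1)"
  have e: "e \<ge> 1" "\<zeta> ^ e = 1"
    unfolding e_def using LeastI[of "\<lambda>e. e \<ge> 1 \<and> \<zeta> ^ e = 1" q] assms by auto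
  have dvd: "e dvd i" if "\<zeta> ^ i = 1" for i
  proof (rule ccontr)
    assume "\<not> e dvd i"
    then have r: "1 \<le> i mod e" "i mod e < e"
      using e by (auto simp: mod_greater_zero_iff_not_dvd Suc_le_eq)
    have "\<zeta> ^ i = \<zeta> ^ (e * (i div e) + i mod e)"
      by simp
    then have "\<zeta> ^ (i mod e) = 1"
      using e that unfolding power_add power_mult by simp
    then show False
      using r not_less_Least[of "i mod e" "\<lambda>e. e \<ge> 1 \<and> \<zeta> ^ e = 1"] by (simp add: e_def)
  qed
  have "h = descend e h oo fps_X ^ e"
  proof (rule fps_ext)
    fix n
    have "\<zeta> ^ n * h $ n = h $ n"
      using assms(4) by (metis twist_nth)
    then have "h $ n = 0" if "\<not> e dvd n"
      using dvd[of n] that by auto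
    then show "h $ n = (descend e h oo fps_X ^ e) $ n"
      using e by (auto simp: compose_X_power_nth descend_def)
  qed
  moreover have "e > 1"
    using e assms(2) by (cases "e = 1") auto
  ultimately show ?thesis
    using dvd[OF assms(1)] that by blast
qed

text \<open>
  A Puiseux root \<open>(t\<^sup>q, \<phi>(t))\<close> with least \<open>q\<close> is primitive, hence its equation divides \<open>f\<close>. That
  \<open>q\<close> is \<open>m\<close> follows by comparing the orders in \<open>y\<close> on the line \<open>x = 0\<close>.
\<close>

theorem irreducible_is_puiseux_branch:
  fixes f :: "'k::{alg_closed_field, field_char_0} fps fps"
  assumes irr: "Factorial_Ring.irreducible f" and reg: "y_regular m f" "m \<ge> 1"
  obtains \<phi> u where "puiseux_branch m \<phi>" "f = u * puiseux_branch.equation m \<phi>" "u dvd 1"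
proof -
  define P where "P = (\<lambda>q. q \<ge> 1 \<and> (\<exists>\<phi>::'k fps. \<phi> $ 0 = 0 \<and> subst2 f (fps_X ^ q, \<phi>) = 0))"
  obtain q0 where "P q0"
    using newton_puiseux[OF reg] unfolding P_def by blast
  define q where "q = (LEAST q. P q)"
  have "P q"
    unfolding q_def by (rule LeastI) fact
  then obtain \<phi> where q: "q \<ge> 1" and \<phi>: "\<phi> $ 0 = 0" "subst2 f (fps_X ^ q, \<phi>) = 0"
    unfolding P_def by blast
  have br: "puiseux_branch q \<phi>"
  proof
    fix \<zeta> :: 'k assume \<zeta>: "\<zeta> \<in> unity_roots q" "\<zeta> \<noteq> 1"
    show "twist \<zeta> \<phi> \<noteq> \<phi>"
    proof
      assume "twist \<zeta> \<phi> = \<phi>"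
      then obtain e g where e: "e > 1" "e dvd q" "\<phi> = g oo fps_X ^ e"
        using eq_compose_X_power[of \<zeta> q \<phi>] \<zeta> q by (auto simp: unity_roots_def)
      from e(2) obtain l where l: "q = e * l" ..
      have lq: "l \<ge> 1" "l < q"
        using l q e by (auto simp: Suc_le_eq intro!: Nat.gr0I)
      have Xe: "(fps_X ^ e :: 'k fps) $ 0 = 0"
        using e by (simp add: fps_X_power_nth)
      have Xl: "(fps_X ^ l :: 'k fps) $ 0 = 0"
        using lq by (simp add: fps_X_power_nth)
      have g0: "g $ 0 = 0"
        using \<phi>(1) e(3) by simp
      have "fps_X ^ q = (fps_X ^ l :: 'k fps) oo fps_X ^ e"
        using Xe by (simp add: unital_ring_hom.power[OF fps_compose_hom] fps_X_fps_compose_startby0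
            power_mult[symmetric] l)
      then have "subst2 f (fps_X ^ q, \<phi>) = subst2 f (fps_X ^ l, g) oo fps_X ^ e"
        using subst2_compose[OF Xe Xl g0] e(3) by simp
      then have "subst2 f (fps_X ^ l, g) = 0"
        using \<phi>(2) e by (auto simp: fps_compose_eq_0_iff fps_X_power_nth)
      then have "P l"
        using lq g0 unfolding P_def by blast
      then show False
        using not_less_Least[of l P] lq by (simp add: q_def)
    qed
  qed (use q \<phi> in auto)
  interpret puiseux_branch q \<phi> by fact
  have "equation dvd f"
    using \<phi>(2) by (simp add: ev_eq_0_iff[symmetric] ev_def arc_def)
  then obtain u where u: "f = u * equation"
    by (metis dvdE mult.commute)
  have "\<not> equation dvd 1"
    using ev_eq_0_iff[of 1] by (simp add: ev.one)
  then have "u dvd 1"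
    using Factorial_Ring.comm_semiring_1_class.irreducibleD[OF irr u] by blast
  moreover have "m = q"
  proof -
    have u0: "u $ 0 $ 0 \<noteq> 0"
      using \<open>u dvd 1\<close> by (simp add: fps_fps_is_unit_iff)
    interpret r: unital_ring_hom "map_fps (\<lambda>h::'k fps. h $ 0)"
      by (rule map_fps_hom[OF fps_nth_0_hom])
    have reg_sub: "subdegree (map_fps (\<lambda>h::'k fps. h $ 0) g) = n \<and> map_fps (\<lambda>h::'k fps. h $ 0) g \<noteq> 0"
      if "y_regular n g" for n g
    proof -
      have "map_fps (\<lambda>h::'k fps. h $ 0) g $ n \<noteq> 0"
        using that by (simp add: y_regular_def)
      moreover from this have "map_fps (\<lambda>h::'k fps. h $ 0) g \<noteq> 0"
        by (metis fps_zero_nth)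
      ultimately show ?thesis
        using that by (auto simp: y_regular_def intro!: subdegreeI)
    qed
    have "subdegree (map_fps (\<lambda>h::'k fps. h $ 0) u) = 0" "map_fps (\<lambda>h::'k fps. h $ 0) u \<noteq> 0"
      using reg_sub[of 0 u] u0 by (simp_all add: y_regular_def)
    then show ?thesis
      using reg_sub[OF reg(1)] reg_sub[OF y_regular_equation] by (simp add: u r.mult)
  qed
  ultimately show ?thesis
    using that br u by blast
qed


section \<open>The point of the Hilbert scheme given by an arc\<close>

lemma ring_of_type_algebra_simps [simp]:
  "carrier ring_of_type_algebra = UNIV"
  "x \<otimes>\<^bsub>ring_of_type_algebra\<^esub> y = x * y"
  "x \<oplus>\<^bsub>ring_of_type_algebra\<^esub> y = x + y"
  "\<one>\<^bsub>ring_of_type_algebra\<^esub> = 1"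
  "\<zero>\<^bsub>ring_of_type_algebra\<^esub> = 0"
  by (simp_all add: ring_of_type_algebra_def)

lemma cring_type: "cring (ring_of_type_algebra :: 'a::comm_ring_1 ring)"
  by (rule cring_from_type_algebra)

lemma ring_of_type_algebra_minus [simp]:
  "x \<ominus>\<^bsub>ring_of_type_algebra\<^esub> y = (x - y :: 'a::comm_ring_1)"
proof -
  interpret cring "ring_of_type_algebra :: 'a ring" by (rule cring_type)
  have "\<ominus>\<^bsub>ring_of_type_algebra\<^esub> y = - y"
    using minus_equality[of "- y" y] by simp
  then show ?thesis
    by (simp add: a_minus_def)
qed

lemma PIdl_type: "PIdl\<^bsub>ring_of_type_algebra\<^esub> f = {x * f | x. True}"
  by (simp add: cgenideal_def)

lemma quotient_carrier:
  assumes "ideal I R"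
  shows "carrier (R Quot I) = (\<lambda>x. I +>\<^bsub>R\<^esub> x) ` carrier R"
  by (auto simp: FactRing_def A_RCOSETS_def')

lemma
  fixes f :: "'k::Fields.field fps fps"
  shows curve_ring_cring: "cring (curve_ring f)"
    and restrict_to_curve_hom: "restrict_to_curve f \<in> ring_hom ring_of_type_algebra (curve_ring f)"
    and curve_ring_carrier: "carrier (curve_ring f) = range (restrict_to_curve f)"
    and restrict_to_curve_eq_iff: "restrict_to_curve f a = restrict_to_curve f b \<longleftrightarrow> f dvd a - b"
proof -
  interpret R: cring "ring_of_type_algebra :: 'k fps fps ring" by (rule cring_type)
  interpret I: ideal "PIdl\<^bsub>ring_of_type_algebra\<^esub> f" ring_of_type_algebra
    by (rule R.cgenideal_ideal) simp
  show "cring (curve_ring f)"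
    unfolding curve_ring_def by (rule I.quotient_is_cring) (rule cring_type)
  show "restrict_to_curve f \<in> ring_hom ring_of_type_algebra (curve_ring f)"
    using I.rcos_ring_hom unfolding curve_ring_def restrict_to_curve_def[abs_def] .
  show "carrier (curve_ring f) = range (restrict_to_curve f)"
    unfolding curve_ring_def restrict_to_curve_def[abs_def]
    by (subst quotient_carrier[OF I.ideal_axioms]) simp
  show "restrict_to_curve f a = restrict_to_curve f b \<longleftrightarrow> f dvd a - b"
    using R.quotient_eq_iff_same_a_r_cos[OF I.ideal_axioms, of a b]
    unfolding restrict_to_curve_def by (auto simp: PIdl_type dvd_def mult.commute)
qed

text \<open>
  The kernel of the arc is generated by the equation \<open>g\<close> of its image, so the point of the Hilbert
  scheme is the principal ideal of \<open>g\<close>, with quotient \<open>K[[x,y]]/(f,g)\<close>.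
\<close>

lemma arc_ideal_eq:
  fixes f g :: "'k::Fields.field fps fps"
  assumes "\<And>h. subst2 h \<gamma> = 0 \<longleftrightarrow> g dvd h"
  shows "arc_ideal f \<gamma> = PIdl\<^bsub>curve_ring f\<^esub> (restrict_to_curve f g)"
    and "restrict_to_curve f h \<in> arc_ideal f \<gamma> \<longleftrightarrow> (\<exists>a b. h = a * g + b * f)"
proof -
  interpret R: cring "ring_of_type_algebra :: 'k fps fps ring" by (rule cring_type)
  let ?S = "{a * g + b * f | a b. True}"
  have S: "Idl\<^bsub>ring_of_type_algebra\<^esub> ({h. subst2 h \<gamma> = 0} \<union> {f}) = ?S"
  proof
    show "Idl\<^bsub>ring_of_type_algebra\<^esub> ({h. subst2 h \<gamma> = 0} \<union> {f}) \<subseteq> ?S"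
    proof (rule R.genideal_minimal)
      show "{h. subst2 h \<gamma> = 0} \<union> {f} \<subseteq> ?S"
      proof
        fix h assume "h \<in> {h. subst2 h \<gamma> = 0} \<union> {f}"
        then consider k where "h = g * k" | "h = f"
          by (auto simp: assms)
        then show "h \<in> ?S"
        proof cases
          case 1
          then have "h = k * g + 0 * f" by simp
          then show ?thesis by blast
        next
          case 2
          then have "h = 0 * g + 1 * f" by simp
          then show ?thesis by blast
        qed
      qed
      show "ideal ?S ring_of_type_algebra"
      proof (rule idealI[OF R.ring_axioms])
        show "subgroup ?S (add_monoid ring_of_type_algebra)"
        proof (rule R.add.subgroupI)
          show "?S \<noteq> {}" by auto
          fix x y assume x: "x \<in> ?S" and y: "y \<in> ?S"
          then obtain a b c d where "x = a * g + b * f" "y = c * g + d * f" by auto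
          then have "x + y = (a + c) * g + (b + d) * f" by (simp add: algebra_simps)
          then show "x \<oplus>\<^bsub>ring_of_type_algebra\<^esub> y \<in> ?S" by auto
        next
          fix x assume "x \<in> ?S"
          then obtain a b where x: "x = a * g + b * f" by auto
          have "\<ominus>\<^bsub>ring_of_type_algebra\<^esub> x = - x"
            using R.minus_equality[of "- x" x] by simp
          also have "- x = (- a) * g + (- b) * f" by (simp add: x)
          finally show "\<ominus>\<^bsub>ring_of_type_algebra\<^esub> x \<in> ?S" by blast
        qed auto
        fix x y assume "x \<in> ?S"
        then obtain a b where x: "x = a * g + b * f" by auto
        have "y * x = (y * a) * g + (y * b) * f" by (simp add: x algebra_simps)
        then have "y * x \<in> ?S" by blast
        then show "y \<otimes>\<^bsub>ring_of_type_algebra\<^esub> x \<in> ?S" "x \<otimes>\<^bsub>ring_of_type_algebra\<^esub> y \<in> ?S"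
          by (simp_all add: mult.commute)
      qed
    qed
    have "ideal (Idl\<^bsub>ring_of_type_algebra\<^esub> ({h. subst2 h \<gamma> = 0} \<union> {f})) ring_of_type_algebra"
      by (rule R.genideal_ideal) simp
    then interpret I: ideal "Idl\<^bsub>ring_of_type_algebra\<^esub> ({h. subst2 h \<gamma> = 0} \<union> {f})" ring_of_type_algebra .
    have "g \<in> Idl\<^bsub>ring_of_type_algebra\<^esub> ({h. subst2 h \<gamma> = 0} \<union> {f})"
      "f \<in> Idl\<^bsub>ring_of_type_algebra\<^esub> ({h. subst2 h \<gamma> = 0} \<union> {f})"
      using R.genideal_self[of "{h. subst2 h \<gamma> = 0} \<union> {f}"] assms[of g] by auto
    then show "?S \<subseteq> Idl\<^bsub>ring_of_type_algebra\<^esub> ({h. subst2 h \<gamma> = 0} \<union> {f})"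
      using I.a_closed I.I_l_closed by fastforce
  qed
  interpret \<rho>: ring_hom_cring ring_of_type_algebra "curve_ring f" "restrict_to_curve f"
    by (intro ring_hom_cring.intro ring_hom_cring_axioms.intro cring_type curve_ring_cring restrict_to_curve_hom)
  have eq: "restrict_to_curve f (a * g + b * f) = restrict_to_curve f (a * g)" for a b
    by (simp add: restrict_to_curve_eq_iff)
  show "arc_ideal f \<gamma> = PIdl\<^bsub>curve_ring f\<^esub> (restrict_to_curve f g)"
  proof -
    have "arc_ideal f \<gamma> = range (\<lambda>a. restrict_to_curve f (a * g))"
    proof
      show "arc_ideal f \<gamma> \<subseteq> range (\<lambda>a. restrict_to_curve f (a * g))"
        unfolding arc_ideal_def S using eq by auto
      have "restrict_to_curve f (a * g) \<in> arc_ideal f \<gamma>" for a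
        unfolding arc_ideal_def S eq[of a 0, symmetric] by blast
      then show "range (\<lambda>a. restrict_to_curve f (a * g)) \<subseteq> arc_ideal f \<gamma>"
        by blast
    qed
    also have "\<dots> = {x \<otimes>\<^bsub>curve_ring f\<^esub> restrict_to_curve f g | x. x \<in> carrier (curve_ring f)}"
      using \<rho>.hom_mult by (auto simp: curve_ring_carrier)
    finally show ?thesis
      by (simp add: cgenideal_def)
  qed
  show "restrict_to_curve f h \<in> arc_ideal f \<gamma> \<longleftrightarrow> (\<exists>a b. h = a * g + b * f)"
  proof
    assume "restrict_to_curve f h \<in> arc_ideal f \<gamma>"
    then obtain a b where "restrict_to_curve f h = restrict_to_curve f (a * g + b * f)"
      unfolding arc_ideal_def S by auto
    then obtain c where "h - (a * g + b * f) = f * c"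
      unfolding restrict_to_curve_eq_iff ..
    then have "h = a * g + (b + c) * f"
      by (simp add: algebra_simps)
    then show "\<exists>a b. h = a * g + b * f" by blast
  next
    assume "\<exists>a b. h = a * g + b * f"
    then show "restrict_to_curve f h \<in> arc_ideal f \<gamma>"
      unfolding arc_ideal_def S by blast
  qed
qed


text \<open>
  Below \<open>D + n\<close> there are \<open>n\<close> more elements of \<open>\<Gamma>\<close> than below \<open>D\<close>, and the latter correspond to the
  elements of \<open>n + \<Gamma>\<close> below \<open>D + n\<close>.
\<close>

lemma semigroup_jumps:
  fixes \<Gamma> :: "nat set"
  assumes "\<And>i. D \<le> i \<Longrightarrow> i \<in> \<Gamma>" "\<And>i. i \<in> \<Gamma> \<Longrightarrow> n + i \<in> \<Gamma>"
  shows "card {i \<in> \<Gamma> - (+) n ` \<Gamma>. i < D + n} = n"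
proof -
  let ?G = "{i \<in> \<Gamma>. i < D}"
  have 1: "{i \<in> \<Gamma>. i < D + n} = ?G \<union> {D..<D + n}"
    using assms(1) by fastforce
  have "card {i \<in> \<Gamma>. i < D + n} = card ?G + n"
    unfolding 1 by (subst card_Un_disjoint) auto
  moreover have "{i \<in> \<Gamma> - (+) n ` \<Gamma>. i < D + n} = {i \<in> \<Gamma>. i < D + n} - (+) n ` ?G"
    by auto
  moreover have "card ((+) n ` ?G) = card ?G"
    by (rule card_image) simp
  moreover have "(+) n ` ?G \<subseteq> {i \<in> \<Gamma>. i < D + n}"
    using assms(2) by auto
  ultimately show ?thesis
    by (simp add: card_Diff_subset)
qed

text \<open>
  The dimension of \<open>K[[x,y]]/(f,g)\<close> is computed along the filtration by the order of the
  restriction to the arc, modulo multiples of \<open>f\<close>. A jump occurs exactly at the orders that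
  belong to the semigroup \<open>\<Gamma>\<close> of the arc but not to \<open>n + \<Gamma>\<close>, and there are \<open>n\<close> of them because
  \<open>\<Gamma>\<close> contains all large integers.
\<close>

lemma dimension_by_orders:
  fixes ev :: "'k::Fields.field fps fps \<Rightarrow> 'k fps" and Q (structure)
  assumes ev: "unital_ring_hom ev" "\<And>c. ev (fps_const (fps_const c)) = fps_const c"
    and ker: "\<And>h. ev h = 0 \<longleftrightarrow> g dvd h"
    and cond: "\<And>h. h = 0 \<or> D \<le> subdegree h \<Longrightarrow> \<exists>r. ev r = h"
    and f: "ev f \<noteq> 0" "subdegree (ev f) = n"
    and Q: "ring Q" and \<tau>: "\<tau> \<in> ring_hom ring_of_type_algebra Q" "carrier Q = range \<tau>"
    and \<tau>_eq: "\<And>h h'. \<tau> h = \<tau> h' \<longleftrightarrow> (\<exists>a b. h - h' = a * g + b * f)"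
  shows "ring.dimension Q n (range (\<lambda>c. \<tau> (fps_const (fps_const c)))) (carrier Q)"
proof -
  interpret ev: unital_ring_hom ev by fact
  interpret Q: ring Q by fact
  have \<tau>_add: "\<tau> (a + b) = \<tau> a \<oplus> \<tau> b" and \<tau>_mult: "\<tau> (a * b) = \<tau> a \<otimes> \<tau> b" for a b
    using ring_hom_add[OF \<tau>(1), of a b] ring_hom_mult[OF \<tau>(1), of a b] by simp_all
  have \<tau>_zero: "\<tau> 0 = \<zero>"
    using ring_hom_zero[OF \<tau>(1)] Q cring_type by (metis cring.axioms(1) ring_of_type_algebra_simps(5))
  define \<kappa> where "\<kappa> c = (fps_const (fps_const c) :: 'k fps fps)" for c
  have ev_\<kappa>: "ev (\<kappa> c * h) $ i = c * ev h $ i" for c h i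
    by (simp add: ev.mult \<kappa>_def ev(2))
  define \<Gamma> where "\<Gamma> = {subdegree (ev h) | h. ev h \<noteq> 0}"
  have \<Gamma>I: "s \<in> \<Gamma>" if "\<And>i. i < s \<Longrightarrow> ev h $ i = 0" "ev h $ s \<noteq> 0" for h s
  proof -
    have "subdegree (ev h) = s" "ev h \<noteq> 0"
      using that by (auto intro: subdegreeI)
    then show ?thesis
      by (auto simp: \<Gamma>_def)
  qed
  have \<Gamma>E: "\<exists>h. (\<forall>i<s. ev h $ i = 0) \<and> ev h $ s \<noteq> 0" if "s \<in> \<Gamma>" for s
    using that nth_less_subdegree_zero nth_subdegree_nonzero unfolding \<Gamma>_def by blast
  \<comment> \<open>The series that have order at least \<open>s\<close> on the arc after subtracting a multiple of \<open>f\<close>.\<close>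
  define L where "L s = {h. \<exists>r. \<forall>i<s. ev (h - r * f) $ i = 0}" for s
  define J where "J = \<Gamma> - (+) n ` \<Gamma>"
  let ?K = "range (\<lambda>c. \<tau> (\<kappa> c))"
  have D: "i \<in> \<Gamma>" if i: "D \<le> i" for i
  proof -
    obtain r where "ev r = fps_X ^ i"
      using cond[of "fps_X ^ i"] i by auto
    then show ?thesis
      by (intro \<Gamma>I[of _ r]) (simp_all add: fps_X_power_nth)
  qed
  have n: "n + i \<in> \<Gamma>" if i: "i \<in> \<Gamma>" for i
  proof -
    obtain h where "ev h \<noteq> 0" "i = subdegree (ev h)"
      using i by (auto simp: \<Gamma>_def)
    then have "ev (f * h) \<noteq> 0" "n + i = subdegree (ev (f * h))"
      using f by (simp_all add: ev.mult)
    then show ?thesis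
      by (auto simp: \<Gamma>_def)
  qed
  have dims: "Q.dimension (card {i\<in>J. s \<le> i \<and> i < D + n}) ?K (\<tau> ` L s)" if "s \<le> D + n" for s
    using that
  proof (induction rule: inc_induct)
    case base
    \<comment> \<open>Beyond \<open>D + n\<close> the conductor makes every series a multiple of \<open>f\<close> on the arc.\<close>
    have "\<tau> ` L (D + n) = {\<zero>}"
    proof -
      have "\<tau> h = \<zero>" if h: "h \<in> L (D + n)" for h
      proof -
        obtain r where r: "\<And>i. i < D + n \<Longrightarrow> ev (h - r * f) $ i = 0"
          using h by (auto simp: L_def)
        have "\<exists>k. ev (h - r * f) = ev f * k \<and> (k = 0 \<or> D \<le> subdegree k)"
        proof (cases "ev (h - r * f) = 0")
          case False
          then have sd: "D + n \<le> subdegree (ev (h - r * f))"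
            using r by (intro subdegree_geI) auto
          then have "ev f dvd ev (h - r * f)"
            using f False by (simp add: fps_dvd_iff)
          then obtain k where k: "ev (h - r * f) = ev f * k" ..
          then have "k \<noteq> 0"
            using False by auto
          then have "subdegree (ev (h - r * f)) = n + subdegree k"
            using k f by simp
          then show ?thesis
            using k sd by (intro exI[of _ k]) simp
        qed (auto intro: exI[of _ 0])
        then obtain k where k: "ev (h - r * f) = ev f * k" "k = 0 \<or> D \<le> subdegree k"
          by blast
        then obtain r' where "ev r' = k"
          using cond by blast
        then have "ev (h - r * f - r' * f) = 0"
          using k by (simp add: ev.diff ev.mult mult.commute)
        then obtain a where "h - r * f - r' * f = g * a"
          by (auto simp: ker)
        then have "h - 0 = a * g + (r + r') * f"
          by (simp add: algebra_simps)
        then have "\<tau> h = \<tau> 0"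
          unfolding \<tau>_eq by blast
        then show ?thesis
          by (simp add: \<tau>_zero)
      qed
      moreover have "0 \<in> L (D + n)"
        by (auto simp: L_def ev.zero intro!: exI[of _ 0])
      ultimately show ?thesis
        using \<tau>_zero by force
    qed
    moreover have "{i\<in>J. D + n \<le> i \<and> i < D + n} = {}"
      by auto
    ultimately show ?case
      by (metis card.empty Q.zero_dim)
  next
    case (step s)
    have sub: "L (Suc s) \<subseteq> L s"
      unfolding L_def using less_SucI by blast
    show ?case
    proof (cases "s \<in> J")
      case True
      then obtain v where v: "\<And>i. i < s \<Longrightarrow> ev v $ i = 0" "ev v $ s \<noteq> 0"
        using \<Gamma>E[of s] by (auto simp: J_def)
      have notin: "\<tau> v \<notin> \<tau> ` L (Suc s)"
      proof
        assume "\<tau> v \<in> \<tau> ` L (Suc s)"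
        then obtain h r where h: "\<tau> v = \<tau> h" "\<And>i. i < Suc s \<Longrightarrow> ev (h - r * f) $ i = 0"
          by (auto simp: L_def)
        then obtain a b where ab: "v - h = a * g + b * f"
          by (auto simp: \<tau>_eq)
        have "v = a * g + (h - r * f) + (b + r) * f"
          using ab by (simp add: algebra_simps)
        then have "ev v = ev (h - r * f) + ev (b + r) * ev f"
          using ker[of "a * g"] by (simp only: ev.add[of "_ + _"] ev.add[of "a * g"] ev.mult) simp
        then have eq: "(ev f * ev (b + r)) $ i = ev v $ i" if "i < Suc s" for i
          using h(2)[OF that] by (simp add: mult.commute)
        have "subdegree (ev f * ev (b + r)) = s" "ev f * ev (b + r) \<noteq> 0"
          using eq v by (auto intro!: subdegreeI dest: arg_cong[of _ _ "\<lambda>f. f $ s"])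
        then have "s = n + subdegree (ev (b + r))" "ev (b + r) \<noteq> 0"
          using f by auto
        then have "s \<in> (+) n ` \<Gamma>"
          by (auto simp: \<Gamma>_def)
        then show False
          using True by (simp add: J_def)
      qed
      have ext: "Q.line_extension ?K (\<tau> v) (\<tau> ` L (Suc s)) = \<tau> ` L s"
      proof
        show "Q.line_extension ?K (\<tau> v) (\<tau> ` L (Suc s)) \<subseteq> \<tau> ` L s"
        proof
          fix z assume "z \<in> Q.line_extension ?K (\<tau> v) (\<tau> ` L (Suc s))"
          then obtain c h where z: "z = (\<tau> (\<kappa> c) \<otimes> \<tau> v) \<oplus> \<tau> h" and h: "h \<in> L (Suc s)"
            by (auto simp: Q.line_extension_def set_add_def' r_coset_def)
          then have "z = \<tau> (\<kappa> c * v + h)"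
            by (simp add: \<tau>_add \<tau>_mult)
          moreover obtain r where r: "\<And>i. i < Suc s \<Longrightarrow> ev (h - r * f) $ i = 0"
            using h by (auto simp: L_def)
          have "\<kappa> c * v + h \<in> L s"
            unfolding L_def
          proof (intro CollectI exI allI impI)
            fix i assume "i < s"
            have "\<kappa> c * v + h - r * f = \<kappa> c * v + (h - r * f)" by simp
            then show "ev (\<kappa> c * v + h - r * f) $ i = 0"
              using r[of i] v(1)[of i] \<open>i < s\<close> by (simp only: ev.add ev_\<kappa> fps_add_nth) simp
          qed
          ultimately show "z \<in> \<tau> ` L s" by blast
        qed
        show "\<tau> ` L s \<subseteq> Q.line_extension ?K (\<tau> v) (\<tau> ` L (Suc s))"
        proof
          fix z assume "z \<in> \<tau> ` L s"
          then obtain h r where z: "z = \<tau> h" and r: "\<And>i. i < s \<Longrightarrow> ev (h - r * f) $ i = 0"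
            by (auto simp: L_def)
          define c where "c = ev (h - r * f) $ s / ev v $ s"
          have "h - \<kappa> c * v \<in> L (Suc s)"
            unfolding L_def
          proof (intro CollectI exI allI impI)
            fix i assume "i < Suc s"
            have "h - \<kappa> c * v - r * f = (h - r * f) - \<kappa> c * v" by simp
            then show "ev (h - \<kappa> c * v - r * f) $ i = 0"
              using r[of i] v \<open>i < Suc s\<close>
              by (cases "i = s") (simp_all only: ev.diff[of _ "\<kappa> c * v"] ev_\<kappa> fps_sub_nth, auto simp: c_def)
          qed
          moreover have "z = (\<tau> (\<kappa> c) \<otimes> \<tau> v) \<oplus> \<tau> (h - \<kappa> c * v)"
            by (simp add: z \<tau>_add[symmetric] \<tau>_mult[symmetric])
          ultimately show "z \<in> Q.line_extension ?K (\<tau> v) (\<tau> ` L (Suc s))"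
            by (auto simp: Q.line_extension_def set_add_def' r_coset_def)
        qed
      qed
      have "{i\<in>J. s \<le> i \<and> i < D + n} = insert s {i\<in>J. Suc s \<le> i \<and> i < D + n}"
        using True step by auto
      then have "card {i\<in>J. s \<le> i \<and> i < D + n} = Suc (card {i\<in>J. Suc s \<le> i \<and> i < D + n})"
        by simp
      then show ?thesis
        using Q.Suc_dim[OF _ notin step.IH] ext \<tau>(2) by simp
    next
      case False
      have "L s \<subseteq> L (Suc s)"
      proof
        fix h assume "h \<in> L s"
        then obtain r where r: "\<And>i. i < s \<Longrightarrow> ev (h - r * f) $ i = 0"
          by (auto simp: L_def)
        show "h \<in> L (Suc s)"
        proof (cases "ev (h - r * f) $ s = 0")
          case True
          then show ?thesis
            using r by (auto simp: L_def less_Suc_eq)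
        next
          case nz: False
          then have "s \<in> \<Gamma>"
            using r \<Gamma>I by blast
          then obtain b where b: "ev b \<noteq> 0" "s = n + subdegree (ev b)"
            using False by (auto simp: J_def \<Gamma>_def)
          then have bf: "ev (b * f) \<noteq> 0" "subdegree (ev (b * f)) = s"
            using f by (simp_all add: ev.mult)
          define c where "c = ev (h - r * f) $ s / ev (b * f) $ s"
          have bfs: "ev (b * f) $ s \<noteq> 0" "\<And>i. i < s \<Longrightarrow> ev (b * f) $ i = 0"
            using bf by (metis nth_subdegree_nonzero, metis nth_less_subdegree_zero)
          have "ev (h - (r + \<kappa> c * b) * f) $ i = 0" if "i < Suc s" for i
          proof -
            have "h - (r + \<kappa> c * b) * f = (h - r * f) - \<kappa> c * (b * f)"
              by (simp add: algebra_simps)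
            then show ?thesis
              using that r[of i] bfs(1) bfs(2)[of i]
              by (cases "i = s") (simp_all only: ev.diff[of _ "\<kappa> c * _"] ev_\<kappa> fps_sub_nth, auto simp: c_def)
          qed
          then show ?thesis
            by (auto simp: L_def)
        qed
      qed
      then have "L s = L (Suc s)"
        using sub by blast
      moreover have "{i\<in>J. s \<le> i \<and> i < D + n} = {i\<in>J. Suc s \<le> i \<and> i < D + n}"
        using False by (auto simp: Suc_le_eq le_less)
      ultimately show ?thesis
        using step.IH by simp
    qed
  qed
  have "L 0 = UNIV"
    by (auto simp: L_def)
  moreover have "card {i\<in>J. 0 \<le> i \<and> i < D + n} = n"
    using semigroup_jumps[of D \<Gamma> n, OF D n] by (simp add: J_def)
  ultimately show ?thesis
    using dims[of 0] \<tau>(2) by (simp add: \<kappa>_def)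
qed

lemma dvd_consecutive: "(a::nat) dvd d \<Longrightarrow> a dvd Suc d \<Longrightarrow> a = 1"
  by (metis Suc_eq_plus1 dvd_add_right_iff nat_dvd_1_iff_1)

text \<open>
  An arc whose coordinate ring contains all series of large order is not degenerate: along a
  reparametrisation of order \<open>a\<close> only multiples of \<open>a\<close> occur as orders.
\<close>

lemma conductor_not_degenerate:
  assumes \<gamma>: "fst \<gamma> $ 0 = 0" "snd \<gamma> $ 0 = 0"
    and cond: "\<And>h :: 'k::Fields.field fps. h = 0 \<or> D \<le> subdegree h \<Longrightarrow> \<exists>r. subst2 r \<gamma> = h"
  shows "\<not> degenerate \<gamma>"
proof
  assume "degenerate \<gamma>"
  then obtain p q \<alpha> where \<alpha>: "\<alpha> $ 0 = 0" "\<alpha> $ 1 = 0" and pq: "\<gamma> = (p oo \<alpha>, q oo \<alpha>)"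
    by (cases \<gamma>) (auto simp: degenerate_def)
  have 0: "p $ 0 = 0" "q $ 0 = 0"
    using \<gamma> pq by simp_all
  obtain r s where r: "subst2 r \<gamma> = fps_X ^ D" and s: "subst2 s \<gamma> = fps_X ^ Suc D"
    using cond[of "fps_X ^ D"] cond[of "fps_X ^ Suc D"] by (auto simp del: power_Suc)
  have comp: "subst2 h \<gamma> = subst2 h (p, q) oo \<alpha>" for h
    unfolding pq by (rule subst2_compose[OF \<alpha>(1) 0])
  have "D = subdegree (subst2 r (p, q)) * subdegree \<alpha>" "Suc D = subdegree (subst2 s (p, q)) * subdegree \<alpha>"
    using arg_cong[OF r, of subdegree] arg_cong[OF s, of subdegree]
    by (simp_all add: comp \<alpha> del: power_Suc)
  then have "subdegree \<alpha> dvd D" "subdegree \<alpha> dvd Suc D"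
    by (metis dvd_triv_right)+
  then have "subdegree \<alpha> = 1"
    by (rule dvd_consecutive)
  moreover from this have "\<alpha> \<noteq> 0"
    by auto
  ultimately show False
    using \<alpha>(2) by (metis nth_subdegree_nonzero)
qed

text \<open>
  The colength is the intersection number of \<open>f\<close> with the arc, for an arc that parametrises its image
  \<open>g = 0\<close> birationally; this is what the conductor condition expresses.
\<close>

theorem arc_gives_point:
  fixes f g :: "'k::Fields.field fps fps"
  assumes \<gamma>: "fst \<gamma> $ 0 = 0" "snd \<gamma> $ 0 = 0"
    and ker: "\<And>h. subst2 h \<gamma> = 0 \<longleftrightarrow> g dvd h"
    and cond: "\<And>h. h = 0 \<or> D \<le> subdegree h \<Longrightarrow> \<exists>r. subst2 r \<gamma> = h"
    and f: "subst2 f \<gamma> \<noteq> 0" "subdegree (subst2 f \<gamma>) = n"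
  shows "UHilb01 f n \<noteq> {}"
proof -
  let ?C = "curve_ring f" and ?J = "arc_ideal f \<gamma>"
  interpret C: cring ?C by (rule curve_ring_cring)
  have gC: "restrict_to_curve f g \<in> carrier ?C"
    by (simp add: curve_ring_carrier)
  have J: "?J = PIdl\<^bsub>?C\<^esub> (restrict_to_curve f g)"
    by (rule arc_ideal_eq(1)[OF ker])
  interpret J: ideal ?J ?C
    unfolding J by (rule C.cgenideal_ideal[OF gC])
  have princ: "principalideal ?J ?C"
    unfolding J by (rule C.cgenideal_is_principalideal[OF gC])
  define \<tau> where "\<tau> h = ?J +>\<^bsub>?C\<^esub> restrict_to_curve f h" for h
  have \<tau>: "\<tau> \<in> ring_hom ring_of_type_algebra (?C Quot ?J)"
    using ring_hom_trans[OF restrict_to_curve_hom J.rcos_ring_hom]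
    by (simp add: \<tau>_def[abs_def] comp_def)
  have \<tau>_carrier: "carrier (?C Quot ?J) = range \<tau>"
    by (simp add: quotient_carrier[OF J.ideal_axioms] curve_ring_carrier image_image \<tau>_def)
  interpret \<rho>: ring_hom_cring ring_of_type_algebra ?C "restrict_to_curve f"
    by (intro ring_hom_cring.intro ring_hom_cring_axioms.intro cring_type curve_ring_cring restrict_to_curve_hom)
  have \<tau>_eq: "\<tau> h = \<tau> h' \<longleftrightarrow> (\<exists>a b. h - h' = a * g + b * f)" for h h'
  proof -
    have "\<tau> h = \<tau> h' \<longleftrightarrow> restrict_to_curve f h \<ominus>\<^bsub>?C\<^esub> restrict_to_curve f h' \<in> ?J"
      unfolding \<tau>_def
      by (rule C.quotient_eq_iff_same_a_r_cos[OF J.ideal_axioms, symmetric]) (auto simp: curve_ring_carrier)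
    also have "restrict_to_curve f h \<ominus>\<^bsub>?C\<^esub> restrict_to_curve f h' = restrict_to_curve f (h - h')"
      using \<rho>.hom_sub[of h h'] by simp
    finally show ?thesis
      by (simp add: arc_ideal_eq(2)[OF ker])
  qed
  have "ring.dimension (?C Quot ?J) n (range (\<lambda>c. \<tau> (fps_const (fps_const c)))) (carrier (?C Quot ?J))"
  proof (rule dimension_by_orders[where ev = "\<lambda>h. subst2 h \<gamma>" and D = D])
    show "unital_ring_hom (\<lambda>h. subst2 h \<gamma>)"
      by (rule subst2_hom[OF \<gamma>])
    show "subst2 (fps_const (fps_const c)) \<gamma> = fps_const c" for c
      by (simp add: subst2_fps_const \<gamma>)
    show "ring (?C Quot ?J)"
      by (rule J.quotient_is_ring)
  qed (use ker cond f \<tau> \<tau>_carrier \<tau>_eq in auto)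
  then have "?J \<in> Hilb01 f n"
    using princ by (simp add: Hilb01_def colength_def \<tau>_def)
  moreover have "\<gamma> \<in> arcs f n"
    using \<gamma> f conductor_not_degenerate[OF \<gamma> cond] by (simp add: arcs_def)
  ultimately show ?thesis
    by (auto simp: UHilb01_def)
qed


section \<open>Branches in arbitrary coordinates\<close>

text \<open>
  The normalisation \<open>K[[x,y]]/(g) \<rightarrow> K[[t]]\<close> of a branch, with \<open>t\<^sup>D K[[t]]\<close> in its image. Unlike the
  Puiseux parametrisation, this is symmetric in \<open>x\<close> and \<open>y\<close>.
\<close>

locale curve_branch =
  ev: unital_ring_hom ev for ev :: "'k::Fields.field fps fps \<Rightarrow> 'k fps" +
  fixes g :: "'k fps fps" and D :: nat
  assumes ev_const: "ev (fps_const (fps_const c)) = fps_const c"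
    and ev_nth_0: "ev h $ 0 = h $ 0 $ 0"
    and ev_eq_0_iff: "ev h = 0 \<longleftrightarrow> g dvd h"
    and conductor: "s = 0 \<or> D \<le> subdegree s \<Longrightarrow> \<exists>r. ev r = s"

lemma (in puiseux_branch) is_curve_branch: "curve_branch ev equation (subdegree different)"
  by unfold_locales (use ev_nth_0 ev_eq_0_iff conductor in \<open>auto simp: ev_const\<close>)

lemma swap_xy_0 [simp]: "swap_xy 0 = 0"
  by (rule unital_ring_hom.zero[OF swap_xy_hom])

lemma swap_xy_1 [simp]: "swap_xy 1 = 1"
  by (rule unital_ring_hom.one[OF swap_xy_hom])

lemma swap_xy_mult: "swap_xy (a * b) = swap_xy a * swap_xy b"
  by (rule unital_ring_hom.mult[OF swap_xy_hom])

lemma swap_xy_eq_0_iff [simp]: "swap_xy h = 0 \<longleftrightarrow> h = 0"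
proof
  assume "swap_xy h = 0"
  then have "swap_xy (swap_xy h) = 0"
    by simp
  then show "h = 0"
    by (simp only: swap_xy_swap_xy)
qed simp

lemma swap_xy_dvd_iff: "swap_xy g dvd h \<longleftrightarrow> g dvd swap_xy h"
proof
  assume "swap_xy g dvd h"
  then obtain k where "h = swap_xy g * k" ..
  then have "swap_xy h = g * swap_xy k"
    by (simp add: swap_xy_mult)
  then show "g dvd swap_xy h" ..
next
  assume "g dvd swap_xy h"
  then obtain k where k: "swap_xy h = g * k" ..
  have "h = swap_xy (swap_xy h)"
    by simp
  also have "\<dots> = swap_xy g * swap_xy k"
    unfolding k by (rule swap_xy_mult)
  finally show "swap_xy g dvd h" ..
qed

lemma (in curve_branch) curve_branch_swap: "curve_branch (\<lambda>h. ev (swap_xy h)) (swap_xy g) D"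
proof -
  interpret h: unital_ring_hom "\<lambda>h. ev (swap_xy h)"
    by (rule unital_ring_hom_comp[OF ev.unital_ring_hom_axioms swap_xy_hom])
  have c: "swap_xy (fps_const (fps_const c)) = fps_const (fps_const c)" for c :: 'k
    by (intro fps_ext) auto
  have "\<exists>r. ev (swap_xy r) = s" if s: "s = 0 \<or> D \<le> subdegree s" for s
  proof -
    obtain r where "ev r = s"
      using conductor[OF s] by blast
    then show ?thesis
      by (intro exI[of _ "swap_xy r"]) simp
  qed
  then show ?thesis
    by unfold_locales (auto simp: c ev_const ev_nth_0 ev_eq_0_iff swap_xy_dvd_iff)
qed

lemma (in curve_branch) curve_branch_unit_mult:
  assumes "u dvd 1"
  shows "curve_branch ev (u * g) D"
proof -
  obtain v where v: "1 = u * v"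
    using assms ..
  have "u * g dvd h" if "g dvd h" for h
  proof -
    have "u * (v * h) = (u * v) * h"
      by (simp only: mult.assoc)
    then have "u * (v * h) = h"
      by (simp add: v[symmetric])
    moreover have "u * g dvd u * (v * h)"
      using that by (intro mult_dvd_mono dvd_mult dvd_refl)
    ultimately show ?thesis
      by (simp only:)
  qed
  then have "u * g dvd h \<longleftrightarrow> g dvd h" for h
    using dvd_mult_right by blast
  then show ?thesis
    by unfold_locales (use conductor in \<open>auto simp: ev_const ev_nth_0 ev_eq_0_iff\<close>)
qed

lemma irreducible_swap_xy:
  assumes "Factorial_Ring.irreducible f"
  shows "Factorial_Ring.irreducible (swap_xy f)"
proof (rule Factorial_Ring.comm_semiring_1_class.irreducibleI)
  have d1: "swap_xy a dvd 1 \<longleftrightarrow> a dvd 1" for a :: "'a fps fps"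
    by (simp add: swap_xy_dvd_iff)
  show "swap_xy f \<noteq> 0"
    using assms by auto
  show "\<not> swap_xy f dvd 1"
    using assms Factorial_Ring.comm_semiring_1_class.irreducible_not_unit by (simp add: d1)
  show "a dvd 1 \<or> b dvd 1" if "swap_xy f = a * b" for a b
  proof -
    have "f = swap_xy a * swap_xy b"
      using arg_cong[OF that, of swap_xy] by (simp add: swap_xy_mult)
    then show ?thesis
      using Factorial_Ring.comm_semiring_1_class.irreducibleD[OF assms, of "swap_xy a" "swap_xy b"]
      by (simp add: d1)
  qed
qed

text \<open>
  The smaller one of the orders of \<open>f(0,y)\<close> and \<open>f(x,0)\<close> is the multiplicity \<open>m\<close> of the branch. If it
  is the first one, both coordinates have order at least \<open>m\<close> on the branch.
\<close>

lemma irreducible_coordinates: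
  fixes f :: "'k::Fields.field fps fps"
  assumes irr: "Factorial_Ring.irreducible f"
  obtains (id) m where "m \<ge> 1" "y_regular m f" "\<And>i. i < m \<Longrightarrow> f $ 0 $ i = 0"
    | (swap) m where "m \<ge> 1" "y_regular m (swap_xy f)" "\<And>i. i < m \<Longrightarrow> swap_xy f $ 0 $ i = 0"
proof -
  have f00: "f $ 0 $ 0 = 0"
    using Factorial_Ring.comm_semiring_1_class.irreducible_not_unit[OF irr]
    by (simp add: fps_fps_is_unit_iff)
  show ?thesis
  proof (cases "\<exists>i. f $ 0 $ i \<noteq> 0")
    case True
    define l where "l = (LEAST i. f $ 0 $ i \<noteq> 0)"
    have l: "f $ 0 $ l \<noteq> 0" "\<And>i. i < l \<Longrightarrow> f $ 0 $ i = 0"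
      unfolding l_def using True LeastI_ex[of "\<lambda>i. f $ 0 $ i \<noteq> 0"] not_less_Least by blast+
    have l1: "l \<ge> 1"
      using l f00 by (cases l) auto
    show ?thesis
    proof (cases "\<exists>j\<le>l. f $ j $ 0 \<noteq> 0")
      case True
      define k where "k = (LEAST j. f $ j $ 0 \<noteq> 0)"
      have k: "f $ k $ 0 \<noteq> 0" "\<And>i. i < k \<Longrightarrow> f $ i $ 0 = 0"
        unfolding k_def using True LeastI_ex[of "\<lambda>i. f $ i $ 0 \<noteq> 0"] not_less_Least by blast+
      have "k \<le> l"
        using True k(2) by (metis leI order_trans)
      moreover have "k \<ge> 1"
        using k f00 by (cases k) auto
      ultimately show ?thesis
        using k l by (intro id[of k]) (auto simp: y_regular_def)
    next
      case False
      then show ?thesis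
        using l l1 by (intro swap[of l]) (auto simp: y_regular_def)
    qed
  next
    case False
    have "f = fps_X * fps_shift 1 f"
      using False by (intro fps_ext) (auto simp: fps_X_mult_nth)
    moreover have "\<not> fps_X dvd (1 :: 'k fps fps)"
      by (simp add: fps_fps_is_unit_iff)
    ultimately have "fps_shift 1 f dvd 1"
      using Factorial_Ring.comm_semiring_1_class.irreducibleD[OF irr] by blast
    then have "f $ 1 $ 0 \<noteq> 0"
      by (simp add: fps_fps_is_unit_iff)
    then show ?thesis
      using False f00 by (intro id[of 1]) (auto simp: y_regular_def)
  qed
qed

lemma irreducible_curve_branch:
  fixes g :: "'k::{alg_closed_field, field_char_0} fps fps"
  assumes "Factorial_Ring.irreducible g"
  obtains ev D where "curve_branch ev g D"
proof -
  have *: "\<exists>ev D. curve_branch ev h D"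
    if irr: "Factorial_Ring.irreducible h" and reg: "m \<ge> 1" "y_regular m h" for h :: "'k fps fps" and m
  proof -
    obtain \<phi> u where br: "puiseux_branch m \<phi>" and h: "h = u * puiseux_branch.equation m \<phi>" "u dvd 1"
      using irreducible_is_puiseux_branch[OF irr reg(2,1)] .
    interpret puiseux_branch m \<phi> by fact
    interpret c: curve_branch ev equation "subdegree different"
      by (rule is_curve_branch)
    show ?thesis
      using c.curve_branch_unit_mult[OF h(2)] h(1) by auto
  qed
  from assms show ?thesis
  proof (cases rule: irreducible_coordinates)
    case (id m)
    then show ?thesis
      using *[OF assms] that by blast
  next
    case (swap m)
    then obtain ev D where "curve_branch ev (swap_xy g) D"
      using *[OF irreducible_swap_xy[OF assms]] by blast
    then show ?thesis
      using curve_branch.curve_branch_swap that by fastforce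
  qed
qed


section \<open>Irreducible curves with prescribed intersection number\<close>

context puiseux_branch
begin

text \<open>
  For a generic constant \<open>c\<close> the arc \<open>(t\<^sup>m, \<phi> + c t\<^sup>j)\<close> separates from every conjugate of the branch
  exactly where the branch itself does, so its intersection number with the branch is the order
  of the different plus \<open>j\<close>. Generic means that no leading coefficients cancel when \<open>j\<close> is one of
  the orders \<open>ord (\<phi> - twist \<zeta> \<phi>)\<close>; these cancellations exclude finitely many \<open>c\<close>.
\<close>

lemma deformed_branch:
  assumes j: "j \<ge> 1" "\<And>\<zeta>. \<zeta> \<in> \<mu> \<Longrightarrow> \<zeta> \<noteq> 1 \<Longrightarrow> subdegree (\<phi> - twist \<zeta> \<phi>) \<le> j"
  obtains \<psi> where "puiseux_branch m \<psi>" "subst2 equation (fps_X ^ m, \<psi>) \<noteq> 0"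
    "subdegree (subst2 equation (fps_X ^ m, \<psi>)) = subdegree different + j"
proof -
  \<comment> \<open>The excluded values of \<open>c\<close>; the value \<open>- \<phi> $ j\<close> could destroy primitivity.\<close>
  define B where "B = {0, - \<phi> $ j} \<union> (\<lambda>\<zeta>. - ((\<phi> - twist \<zeta> \<phi>) $ j)) ` \<mu>"
  have "finite B"
    by (simp add: B_def)
  then obtain c where c: "c \<notin> B"
    using ex_new_if_finite[OF infinite_UNIV_char_0] by blast
  define \<psi> where "\<psi> = \<phi> + fps_const c * fps_X ^ j"
  have \<psi>_0: "\<psi> $ 0 = 0"
    using j by (simp add: \<psi>_def \<phi>_0 fps_X_power_nth)
  have gap: "(\<phi> - twist \<zeta> \<phi>) $ subdegree (\<phi> - twist \<zeta> \<phi>) \<noteq> 0" if "\<zeta> \<in> \<mu>" "\<zeta> \<noteq> 1" for \<zeta>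
    using primitive[OF that] by (intro nth_subdegree_nonzero) auto
  have br: "puiseux_branch m \<psi>"
  proof
    fix \<zeta> assume \<zeta>: "\<zeta> \<in> \<mu>" "\<zeta> \<noteq> 1"
    let ?d = "subdegree (\<phi> - twist \<zeta> \<phi>)"
    have "(\<psi> - twist \<zeta> \<psi>) $ ?d = (\<phi> - twist \<zeta> \<phi>) $ ?d + (if j = ?d then c * (1 - \<zeta> ^ j) else 0)"
      by (simp add: \<psi>_def fps_X_power_nth algebra_simps)
    also have "\<dots> \<noteq> 0"
    proof (cases "j = ?d")
      case True
      then have nz: "\<phi> $ j * (1 - \<zeta> ^ j) \<noteq> 0"
        using gap[OF \<zeta>] by (simp add: algebra_simps)
      have "\<phi> $ j + c \<noteq> 0"
        using c by (auto simp: B_def add_eq_0_iff)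
      then have "(\<phi> $ j + c) * (1 - \<zeta> ^ j) \<noteq> 0"
        using nz by simp
      then show ?thesis
        using True by (simp add: algebra_simps)
    qed (use gap[OF \<zeta>] in simp)
    finally have "\<psi> - twist \<zeta> \<psi> \<noteq> 0"
      by (metis fps_zero_nth)
    then show "twist \<zeta> \<psi> \<noteq> \<psi>"
      by auto
  qed (use m \<psi>_0 in auto)
  have sub: "\<psi> - twist \<zeta> \<phi> \<noteq> 0 \<and> subdegree (\<psi> - twist \<zeta> \<phi>) = (if \<zeta> = 1 then j else subdegree (\<phi> - twist \<zeta> \<phi>))"
    if \<zeta>: "\<zeta> \<in> \<mu>" for \<zeta>
  proof -
    let ?d = "if \<zeta> = 1 then j else subdegree (\<phi> - twist \<zeta> \<phi>)"
    have eq: "(\<psi> - twist \<zeta> \<phi>) $ i = (\<phi> - twist \<zeta> \<phi>) $ i + (if j = i then c else 0)" for i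
      by (simp add: \<psi>_def fps_X_power_nth)
    have "(\<psi> - twist \<zeta> \<phi>) $ ?d \<noteq> 0"
    proof (cases "\<zeta> = 1")
      case True
      then show ?thesis
        using c eq[of j] by (auto simp: B_def)
    next
      case False
      have "(\<phi> - twist \<zeta> \<phi>) $ j + c \<noteq> 0"
        using c \<zeta> by (auto simp: B_def add_eq_0_iff)
      then show ?thesis
        using False gap[OF \<zeta> False] by (simp only: eq) auto
    qed
    moreover have "(\<psi> - twist \<zeta> \<phi>) $ i = 0" if "i < ?d" for i
    proof (cases "\<zeta> = 1")
      case True
      then show ?thesis
        using that eq[of i] by simp
    next
      case False
      then have "i < subdegree (\<phi> - twist \<zeta> \<phi>)" "i \<noteq> j"
        using that j(2)[OF \<zeta> False] by auto
      then show ?thesis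
        using nth_less_subdegree_zero[of i "\<phi> - twist \<zeta> \<phi>"] by (simp only: eq) simp
    qed
    ultimately show ?thesis
      using subdegreeI[of "\<psi> - twist \<zeta> \<phi>" ?d] by (metis (no_types) fps_zero_nth)
  qed
  have eq: "subst2 equation (fps_X ^ m, \<psi>) = (\<Prod>\<zeta>\<in>\<mu>. \<psi> - twist \<zeta> \<phi>)"
    by (rule equation_subst2[OF \<psi>_0])
  have "subdegree (\<Prod>\<zeta>\<in>\<mu>. \<psi> - twist \<zeta> \<phi>) = (\<Sum>\<zeta>\<in>\<mu>. subdegree (\<psi> - twist \<zeta> \<phi>))"
    using sub by (intro subdegree_prod) auto
  also have "\<dots> = subdegree (\<psi> - twist 1 \<phi>) + (\<Sum>\<zeta>\<in>\<mu> - {1}. subdegree (\<psi> - twist \<zeta> \<phi>))"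
    by (rule sum.remove) auto
  also have "\<dots> = j + (\<Sum>\<zeta>\<in>\<mu> - {1}. subdegree (\<phi> - twist \<zeta> \<phi>))"
    using sub[of 1] sub by (intro arg_cong2[of _ _ _ _ "(+)"] sum.cong) auto
  also have "(\<Sum>\<zeta>\<in>\<mu> - {1}. subdegree (\<phi> - twist \<zeta> \<phi>)) = subdegree different"
    unfolding different_def using primitive by (intro subdegree_prod[symmetric]) force
  finally show ?thesis
    using that[OF br] sub by (simp add: eq prod_zero_iff)
qed

text \<open>
  The curve through the deformed arc cuts out a point of the Hilbert scheme of the undeformed one.
\<close>

lemma UHilb01_nonempty:
  assumes "j \<ge> 1" "\<And>\<zeta>. \<zeta> \<in> \<mu> \<Longrightarrow> \<zeta> \<noteq> 1 \<Longrightarrow> subdegree (\<phi> - twist \<zeta> \<phi>) \<le> j"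
    and f: "f = u * equation" "u dvd 1"
  shows "UHilb01 f (subdegree different + j) \<noteq> {}"
    and "UHilb01 (swap_xy f) (subdegree different + j) \<noteq> {}"
proof -
  obtain \<psi> where \<psi>: "puiseux_branch m \<psi>" and ne: "subst2 equation (fps_X ^ m, \<psi>) \<noteq> 0"
    and sd: "subdegree (subst2 equation (fps_X ^ m, \<psi>)) = subdegree different + j"
    using deformed_branch[OF assms(1,2)] by blast
  interpret p: puiseux_branch m \<psi> by fact
  interpret c: curve_branch p.ev p.equation "subdegree p.different"
    by (rule p.is_curve_branch)
  interpret cs: curve_branch "\<lambda>h. p.ev (swap_xy h)" "swap_xy p.equation" "subdegree p.different"
    by (rule c.curve_branch_swap)
  have u: "p.ev u \<noteq> 0" "subdegree (p.ev u) = 0"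
    using f(2) by (auto simp: fps_fps_is_unit_iff p.ev_nth_0[symmetric])
  have "p.ev f = p.ev u * subst2 equation (fps_X ^ m, \<psi>)"
    unfolding f p.ev.mult by (simp add: p.ev_def[of equation] p.arc_def)
  then have evf: "p.ev f \<noteq> 0" "subdegree (p.ev f) = subdegree different + j"
    using ne sd u by auto
  show "UHilb01 f (subdegree different + j) \<noteq> {}"
    by (rule arc_gives_point[of p.arc p.equation "subdegree p.different"])
      (use evf c.ev_eq_0_iff c.conductor p.\<phi>_0 in \<open>auto simp: p.ev_def[symmetric], simp_all add: p.arc_def\<close>)
  have sw: "subst2 h (\<psi>, fps_X ^ m) = p.ev (swap_xy h)" for h
    using subst2_swap_xy[of "swap_xy h" \<psi> "fps_X ^ m"] by (simp add: p.ev_def p.arc_def)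
  show "UHilb01 (swap_xy f) (subdegree different + j) \<noteq> {}"
    by (rule arc_gives_point[of "(\<psi>, fps_X ^ m)" "swap_xy p.equation" "subdegree p.different"])
      (use evf cs.ev_eq_0_iff cs.conductor p.\<phi>_0 in \<open>auto simp: sw\<close>)
qed

end


section \<open>Prime ideals and algebraic relations in the power series ring\<close>

text \<open>
  Two curves without common component meet only at the origin: a high power of \<open>r\<close> has on the branch
  an order that exceeds that of \<open>b\<close> by at least the conductor.
\<close>

lemma (in curve_branch) power_in_ideal:
  assumes "ev b \<noteq> 0" "r $ 0 $ 0 = 0"
  shows "\<exists>a c. r ^ (subdegree (ev b) + D) = a * g + c * b"
proof -
  let ?N = "subdegree (ev b) + D"
  have "\<exists>k. ev (r ^ ?N) = ev b * k \<and> (k = 0 \<or> D \<le> subdegree k)"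
  proof (cases "ev (r ^ ?N) = 0")
    case False
    then have "ev r \<noteq> 0 \<or> ?N = 0"
      by (auto simp: ev.power power_0_left)
    then have "?N \<le> subdegree (ev (r ^ ?N))"
    proof
      assume "ev r \<noteq> 0"
      moreover from this have "subdegree (ev r) \<ge> 1"
        using assms(2) by (simp add: Suc_le_eq subdegree_eq_0_iff ev_nth_0 gr0_conv_Suc[symmetric]
            neq0_conv[symmetric] del: neq0_conv)
      ultimately show ?thesis
        by (simp add: ev.power)
    qed simp
    moreover from this have "ev b dvd ev (r ^ ?N)"
      using assms False by (simp add: fps_dvd_iff)
    then obtain k where k: "ev (r ^ ?N) = ev b * k" ..
    moreover have "k \<noteq> 0"
      using k False by auto
    ultimately show ?thesis
      using assms by auto
  qed (auto intro: exI[of _ 0])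
  then obtain k where k: "ev (r ^ ?N) = ev b * k" "k = 0 \<or> D \<le> subdegree k"
    by blast
  then obtain c where "ev c = k"
    using conductor by blast
  then have "ev (r ^ ?N - c * b) = 0"
    using k by (simp add: ev.diff ev.mult mult.commute)
  then obtain a where "r ^ ?N - c * b = g * a"
    by (auto simp: ev_eq_0_iff)
  then have "r ^ ?N = a * g + c * b"
    by (simp add: algebra_simps)
  then show ?thesis
    by blast
qed

text \<open>
  A prime ideal \<open>P\<close> of the power series ring that contains a nonzero element contains an
  irreducible one, namely any nonzero element of least order. If \<open>P\<close> is larger than the ideal of
  that irreducible curve, it contains a power of each element of the maximal ideal.
\<close>

lemma prime_of_power_series:
  fixes P :: "'k::{alg_closed_field, field_char_0} fps fps set"
  assumes add: "\<And>a b. a \<in> P \<Longrightarrow> b \<in> P \<Longrightarrow> a + b \<in> P"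
    and mult: "\<And>a b. b \<in> P \<Longrightarrow> a * b \<in> P"
    and prime: "\<And>a b. a * b \<in> P \<Longrightarrow> a \<in> P \<or> b \<in> P" and "1 \<notin> P"
    and "r0 \<in> P" "r0 \<noteq> 0"
  obtains (max) "\<And>r. r $ 0 $ 0 = 0 \<Longrightarrow> r \<in> P"
    | (curve) g where "Factorial_Ring.irreducible g" "P = {h. g dvd h}"
proof -
  define g where "g = arg_min xy_order (\<lambda>r. r \<in> P \<and> r \<noteq> 0)"
  have g: "g \<in> P \<and> g \<noteq> 0" and least: "\<And>r. r \<in> P \<Longrightarrow> r \<noteq> 0 \<Longrightarrow> xy_order g \<le> xy_order r"
    unfolding g_def using arg_min_nat_lemma[of "\<lambda>r. r \<in> P \<and> r \<noteq> 0" r0 xy_order] assms(5,6) by blast+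
  have pos: "xy_order a \<ge> 1" if "\<not> a dvd 1" "a \<noteq> 0" for a :: "'k fps fps"
    using that order_at_least_iff[of "Suc 0" a] by (simp add: fps_fps_is_unit_iff order_at_least_1)
  have irr: "Factorial_Ring.irreducible g"
  proof (rule Factorial_Ring.comm_semiring_1_class.irreducibleI)
    show "g \<noteq> 0"
      using g by simp
    show "\<not> g dvd 1"
      using g \<open>1 \<notin> P\<close> mult by (metis dvdE mult.commute)
    fix a b assume ab: "g = a * b"
    show "a dvd 1 \<or> b dvd 1"
    proof (rule ccontr)
      assume "\<not> (a dvd 1 \<or> b dvd 1)"
      moreover have nz: "a \<noteq> 0" "b \<noteq> 0"
        using g ab by auto
      ultimately have "xy_order a \<ge> 1" "xy_order b \<ge> 1" "xy_order g = xy_order a + xy_order b"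
        using pos by (auto simp: ab xy_order_mult)
      moreover have "a \<in> P \<or> b \<in> P"
        using prime g ab by blast
      ultimately show False
        using least[of a] least[of b] nz by auto
    qed
  qed
  obtain ev D where "curve_branch ev g D"
    using irreducible_curve_branch[OF irr] .
  then interpret curve_branch ev g D .
  show ?thesis
  proof (cases "P = {h. g dvd h}")
    case True
    then show ?thesis
      using curve irr by blast
  next
    case False
    have "{h. g dvd h} \<subseteq> P"
      using g mult by (auto simp: mult.commute elim!: dvdE)
    then obtain b where b: "b \<in> P" "\<not> g dvd b"
      using False by auto
    have "r \<in> P" if r: "r $ 0 $ 0 = 0" for r
    proof -
      obtain a c N where "r ^ N = a * g + c * b"
        using power_in_ideal[of b r] r b(2) ev_eq_0_iff by blast
      then have "r ^ N \<in> P"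
        using add mult g b by simp
      moreover have "r ^ N \<in> P \<Longrightarrow> r \<in> P" for N
        by (induction N) (use \<open>1 \<notin> P\<close> prime in auto)
      ultimately show ?thesis
        by blast
    qed
    then show ?thesis
      by (rule max)
  qed
qed

text \<open>
  Gaussian elimination by cross multiplication, as the entries lie in a domain.
\<close>

lemma linear_dependence:
  fixes v :: "'i \<Rightarrow> nat \<Rightarrow> 'd::idom"
  assumes "finite I" "N < card I"
  shows "\<exists>r. (\<exists>i\<in>I. r i \<noteq> 0) \<and> (\<forall>l<N. (\<Sum>i\<in>I. r i * v i l) = 0)"
  using assms
proof (induction N arbitrary: I v)
  case 0
  then show ?case
    by (intro exI[of _ "\<lambda>_. 1"]) (auto simp: card_gt_0_iff)
next
  case (Suc N)
  show ?case
  proof (cases "\<exists>p\<in>I. v p N \<noteq> 0")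
    case False
    obtain r where "\<exists>i\<in>I. r i \<noteq> 0" "\<forall>l<N. (\<Sum>i\<in>I. r i * v i l) = 0"
      using Suc.IH[of I v] Suc.prems by auto
    then show ?thesis
      using False by (intro exI[of _ r]) (auto simp: less_Suc_eq)
  next
    case True
    then obtain p where p: "p \<in> I" "v p N \<noteq> 0" by blast
    let ?w = "\<lambda>i l. v p N * v i l - v i N * v p l"
    obtain r where r: "\<exists>i\<in>I - {p}. r i \<noteq> 0" "\<And>l. l < N \<Longrightarrow> (\<Sum>i\<in>I - {p}. r i * ?w i l) = 0"
    proof -
      have "N < card (I - {p})"
        using Suc.prems p by simp
      then show ?thesis
        using that Suc.IH[of "I - {p}" ?w] Suc.prems(1) by blast
    qed
    define s where "s i = (if i = p then - (\<Sum>i\<in>I - {p}. r i * v i N) else r i * v p N)" for i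
    have "(\<Sum>i\<in>I. s i * v i l) = (\<Sum>i\<in>I - {p}. r i * ?w i l)" for l
    proof -
      have "(\<Sum>i\<in>I. s i * v i l) = s p * v p l + (\<Sum>i\<in>I - {p}. s i * v i l)"
        using Suc.prems p by (simp add: sum.remove)
      also have "(\<Sum>i\<in>I - {p}. s i * v i l) = (\<Sum>i\<in>I - {p}. r i * v p N * v i l)"
        by (rule sum.cong) (auto simp: s_def)
      also have "s p * v p l = - (\<Sum>i\<in>I - {p}. r i * v i N * v p l)"
        by (simp add: s_def sum_distrib_right)
      finally show ?thesis
        by (simp add: algebra_simps sum_subtractf)
    qed
    moreover have "(\<Sum>i\<in>I - {p}. r i * ?w i N) = 0"
      by (simp add: algebra_simps)
    ultimately have "\<forall>l<Suc N. (\<Sum>i\<in>I. s i * v i l) = 0"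
      using r(2) by (auto simp: less_Suc_eq)
    moreover have "\<exists>i\<in>I. s i \<noteq> 0"
      using r(1) p by (auto simp: s_def)
    ultimately show ?thesis
      by blast
  qed
qed

lemma y_regular_mult:
  fixes f g :: "'k::Fields.field fps fps"
  assumes "y_regular m f" "y_regular n g"
  shows "y_regular (m + n) (f * g)"
proof -
  have *: "y_regular k h \<longleftrightarrow> map_fps (\<lambda>h::'k fps. h $ 0) h \<noteq> 0 \<and> subdegree (map_fps (\<lambda>h::'k fps. h $ 0) h) = k"
    for k and h :: "'k fps fps"
  proof
    assume "y_regular k h"
    then have "map_fps (\<lambda>h::'k fps. h $ 0) h $ k \<noteq> 0" "\<And>i. i < k \<Longrightarrow> map_fps (\<lambda>h::'k fps. h $ 0) h $ i = 0"
      by (auto simp: y_regular_def)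
    then show "map_fps (\<lambda>h::'k fps. h $ 0) h \<noteq> 0 \<and> subdegree (map_fps (\<lambda>h::'k fps. h $ 0) h) = k"
      by (metis fps_zero_nth subdegreeI)
  next
    assume "map_fps (\<lambda>h::'k fps. h $ 0) h \<noteq> 0 \<and> subdegree (map_fps (\<lambda>h::'k fps. h $ 0) h) = k"
    then show "y_regular k h"
      unfolding y_regular_def by (metis map_fps_nth nth_less_subdegree_zero nth_subdegree_nonzero)
  qed
  show ?thesis
    using assms unfolding * by (simp add: unital_ring_hom.mult[OF map_fps_hom[OF fps_nth_0_hom]])
qed

lemma y_regular_power:
  fixes f :: "'k::Fields.field fps fps"
  shows "y_regular m f \<Longrightarrow> y_regular (n * m) (f ^ n)"
  by (induction n) (auto intro: y_regular_mult simp: y_regular_def[of 0 1])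

abbreviation x_var :: "'a::comm_ring_1 fps fps" where
  "x_var \<equiv> fps_const fps_X"

lemma x_power_dvd_iff:
  fixes h :: "'k::Fields.field fps fps"
  shows "x_var ^ t dvd h \<longleftrightarrow> h = 0 \<or> t \<le> subdegree (swap_xy h)"
proof -
  have "swap_xy (fps_X ^ t) = (x_var ^ t :: 'k fps fps)"
    by (simp add: unital_ring_hom.power[OF swap_xy_hom] swap_xy_fps_X)
  then have "x_var ^ t dvd h \<longleftrightarrow> fps_X ^ t dvd swap_xy h"
    using swap_xy_dvd_iff[of "fps_X ^ t" h] by simp
  also have "\<dots> \<longleftrightarrow> swap_xy h = 0 \<or> t \<le> subdegree (swap_xy h)"
  proof
    assume "fps_X ^ t dvd swap_xy h"
    then obtain k where "swap_xy h = fps_X ^ t * k" ..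
    then show "swap_xy h = 0 \<or> t \<le> subdegree (swap_xy h)"
      by (cases "k = 0") auto
  next
    assume "swap_xy h = 0 \<or> t \<le> subdegree (swap_xy h)"
    then show "fps_X ^ t dvd swap_xy h"
    proof
      assume "t \<le> subdegree (swap_xy h)"
      then have "swap_xy h = fps_X ^ t * fps_shift t (swap_xy h)"
        by (subst mult.commute) (simp add: fps_shift_times_fps_X_power)
      then show ?thesis ..
    qed simp
  qed
  finally show ?thesis
    by simp
qed

lemma not_x_dvd_y_regular:
  fixes h :: "'k::Fields.field fps fps"
  assumes "h \<noteq> 0" "subdegree (swap_xy h) = 0"
  obtains m where "y_regular m h"
proof -
  have "swap_xy h $ 0 \<noteq> 0"
    using assms nth_subdegree_nonzero[of "swap_xy h"] by simp
  then have "\<exists>j. swap_xy h $ 0 $ j \<noteq> 0"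
    by (auto simp: fps_eq_iff)
  then have "\<exists>j. h $ j $ 0 \<noteq> 0"
    by simp
  then have "y_regular (LEAST j. h $ j $ 0 \<noteq> 0) h"
    unfolding y_regular_def using LeastI_ex[of "\<lambda>j. h $ j $ 0 \<noteq> 0"] not_less_Least by blast
  then show ?thesis
    by (rule that)
qed

lemma y_regular_subdegree_swap:
  assumes "y_regular m h"
  shows "h \<noteq> 0 \<and> subdegree (swap_xy h) = 0"
proof -
  have "swap_xy h $ 0 $ m \<noteq> 0"
    using assms by (simp add: y_regular_def)
  then have "swap_xy h $ 0 \<noteq> 0"
    by (metis fps_zero_nth)
  then show ?thesis
    by (metis fps_zero_nth subdegree_eq_0 swap_xy_0)
qed

text \<open>
  Any three power series \<open>a, b, c\<close> satisfy a homogeneous relation some coefficient of which is a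
  unit: modulo the \<open>n\<close>-th power of a \<open>y\<close>-regular one of them, the ring has rank linear in \<open>n\<close> over
  \<open>K[[x]]\<close>, while there are quadratically many monomials of degree \<open>n\<close>.
\<close>

lemma homogeneous_relation_regular:
  fixes a b c :: "'k::Fields.field fps fps"
  assumes "y_regular m e" "e = a \<or> e = b \<or> e = c"
  shows "\<exists>n S G. finite S \<and> (\<forall>(i,j)\<in>S. i + j \<le> n) \<and> (\<exists>\<alpha>\<in>S. G \<alpha> $ 0 $ 0 \<noteq> 0)
    \<and> (\<Sum>(i,j)\<in>S. G (i,j) * (a ^ i * c ^ j * b ^ (n - i - j))) = 0"
proof -
  define k where "k = Suc (2 * m)"
  define n where "n = 2 * k"
  define \<alpha>0 where "\<alpha>0 = (if e = a then (n, 0) else if e = b then (0, 0) else (0, n))"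
  define h where "h = (\<lambda>(i,j). a ^ i * c ^ j * b ^ (n - i - j))"
  define I where "I = {..k} \<times> {..k} - {\<alpha>0}"
  have h\<alpha>0: "h \<alpha>0 = e ^ n"
    using assms(2) by (auto simp: h_def \<alpha>0_def)
  have "finite I"
    by (simp add: I_def)
  have "card I \<ge> Suc k * Suc k - 1"
    unfolding I_def by (subst card_Diff_singleton_if) auto
  moreover have "n * m < Suc k * Suc k - 1"
    by (simp add: n_def k_def algebra_simps)
  ultimately have "n * m < card I"
    by linarith
  have "\<forall>\<alpha>. \<exists>q r. h \<alpha> = q * e ^ n + r \<and> (\<forall>l\<ge>n * m. r $ l = 0)"
    using weierstrass_division[OF y_regular_power[OF assms(1), of n]] by metis
  then obtain q \<rho> where q: "\<And>\<alpha>. h \<alpha> = q \<alpha> * e ^ n + \<rho> \<alpha>" and \<rho>: "\<And>\<alpha> l. l \<ge> n * m \<Longrightarrow> \<rho> \<alpha> $ l = 0"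
    by metis
  obtain r where r: "\<exists>\<alpha>\<in>I. r \<alpha> \<noteq> 0" and dep: "\<And>l. l < n * m \<Longrightarrow> (\<Sum>\<alpha>\<in>I. r \<alpha> * \<rho> \<alpha> $ l) = 0"
    using linear_dependence[OF \<open>finite I\<close> \<open>n * m < card I\<close>, of "\<lambda>\<alpha> l. \<rho> \<alpha> $ l"] by blast
  have "(\<Sum>\<alpha>\<in>I. fps_const (r \<alpha>) * \<rho> \<alpha>) = 0"
  proof (rule fps_ext)
    fix l
    show "(\<Sum>\<alpha>\<in>I. fps_const (r \<alpha>) * \<rho> \<alpha>) $ l = 0 $ l"
      using dep[of l] \<rho>[of l] by (cases "l < n * m") (simp_all add: fps_sum_nth)
  qed
  then have rel: "(\<Sum>\<alpha>\<in>I. fps_const (r \<alpha>) * h \<alpha>) = (\<Sum>\<alpha>\<in>I. fps_const (r \<alpha>) * q \<alpha>) * e ^ n"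
    by (simp add: q distrib_left sum.distrib sum_distrib_right mult.assoc)
  \<comment> \<open>Dividing by the largest common power of \<open>x\<close> makes one coefficient a unit.\<close>
  define t where "t = Min (subdegree ` r ` {\<alpha> \<in> I. r \<alpha> \<noteq> 0})"
  have fin: "finite (subdegree ` r ` {\<alpha> \<in> I. r \<alpha> \<noteq> 0})" "subdegree ` r ` {\<alpha> \<in> I. r \<alpha> \<noteq> 0} \<noteq> {}"
    using r \<open>finite I\<close> by auto
  obtain \<beta> where \<beta>: "\<beta> \<in> I" "r \<beta> \<noteq> 0" "t = subdegree (r \<beta>)"
    using Min_in[OF fin] by (auto simp: t_def)
  have t: "t \<le> subdegree (r \<alpha>)" if "\<alpha> \<in> I" "r \<alpha> \<noteq> 0" for \<alpha>
    unfolding t_def using that fin by (intro Min_le) auto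
  define r' where "r' \<alpha> = fps_shift t (r \<alpha>)" for \<alpha>
  have r': "r \<alpha> = fps_X ^ t * r' \<alpha>" if "\<alpha> \<in> I" for \<alpha>
  proof (cases "r \<alpha> = 0")
    case False
    then show ?thesis
      using t[OF that False] by (subst mult.commute) (simp add: r'_def fps_shift_times_fps_X_power)
  qed (simp add: r'_def)
  have r'_\<beta>: "r' \<beta> $ 0 \<noteq> 0"
    using \<beta> by (simp add: r'_def)
  define H where "H = (\<Sum>\<alpha>\<in>I. fps_const (r' \<alpha>) * h \<alpha>)"
  define q' where "q' = (\<Sum>\<alpha>\<in>I. fps_const (r \<alpha>) * q \<alpha>)"
  have "(\<Sum>\<alpha>\<in>I. fps_const (r \<alpha>) * h \<alpha>) = x_var ^ t * H"
    unfolding H_def sum_distrib_left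
    by (rule sum.cong) (auto simp: r' fps_const_mult[symmetric] fps_const_power mult.assoc simp del: fps_const_mult)
  then have xH: "x_var ^ t * H = q' * e ^ n"
    using rel by (simp add: q'_def)
  have en: "e ^ n \<noteq> 0" "subdegree (swap_xy (e ^ n)) = 0"
    using y_regular_subdegree_swap[OF y_regular_power[OF assms(1), of n]] by auto
  have "x_var ^ t dvd q'"
  proof (cases "q' = 0")
    case False
    have "x_var ^ t dvd q' * e ^ n"
      unfolding xH[symmetric] by (rule dvd_triv_left)
    from iffD1[OF x_power_dvd_iff this] have "t \<le> subdegree (swap_xy (q' * e ^ n))"
      using False en by auto
    then show ?thesis
      using False en by (intro iffD2[OF x_power_dvd_iff]) (simp add: swap_xy_mult)
  qed simp
  then obtain q'' where "q' = x_var ^ t * q''" ..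
  then have "x_var ^ t * H = x_var ^ t * (q'' * e ^ n)"
    using xH by (simp add: mult.assoc)
  then have H: "H = q'' * e ^ n"
    by simp
  define G where "G \<alpha> = (if \<alpha> = \<alpha>0 then - q'' else fps_const (r' \<alpha>))" for \<alpha>
  have "(\<Sum>\<alpha>\<in>insert \<alpha>0 I. G \<alpha> * h \<alpha>) = - q'' * e ^ n + (\<Sum>\<alpha>\<in>I. G \<alpha> * h \<alpha>)"
    using \<open>finite I\<close> by (subst sum.insert) (auto simp: I_def G_def h\<alpha>0)
  also have "(\<Sum>\<alpha>\<in>I. G \<alpha> * h \<alpha>) = H"
    unfolding H_def by (rule sum.cong) (auto simp: G_def I_def)
  finally have "(\<Sum>\<alpha>\<in>insert \<alpha>0 I. G \<alpha> * h \<alpha>) = 0"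
    by (simp add: H)
  moreover have "G \<beta> $ 0 $ 0 \<noteq> 0"
    using \<beta> r'_\<beta> by (auto simp: G_def I_def)
  moreover have "\<forall>(i,j)\<in>insert \<alpha>0 I. i + j \<le> n"
    by (auto simp: I_def \<alpha>0_def n_def)
  ultimately show ?thesis
    using \<open>finite I\<close> \<beta>(1)
    by (intro exI[of _ n] exI[of _ "insert \<alpha>0 I"] exI[of _ G]) (auto simp: h_def case_prod_unfold)
qed

text \<open>
  The general case reduces to the \<open>y\<close>-regular one by cancelling the largest common power of \<open>x\<close>.
\<close>

lemma homogeneous_relation:
  fixes a b c :: "'k::Fields.field fps fps"
  assumes "b \<noteq> 0"
  shows "\<exists>n S G. finite S \<and> (\<forall>(i,j)\<in>S. i + j \<le> n) \<and> (\<exists>\<alpha>\<in>S. G \<alpha> $ 0 $ 0 \<noteq> 0)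
    \<and> (\<Sum>(i,j)\<in>S. G (i,j) * (a ^ i * c ^ j * b ^ (n - i - j))) = 0"
proof -
  define t where "t = Min ((\<lambda>h. subdegree (swap_xy h)) ` ({a, b, c} - {0}))"
  have fin: "finite ((\<lambda>h. subdegree (swap_xy h)) ` ({a, b, c} - {0}))"
    "(\<lambda>h. subdegree (swap_xy h)) ` ({a, b, c} - {0}) \<noteq> {}"
    using assms by auto
  have "x_var ^ t dvd h" if "h \<in> {a, b, c}" for h
    using that fin Min_le unfolding x_power_dvd_iff t_def by (cases "h = 0") auto
  then obtain a' b' c' where abc: "a = x_var ^ t * a'" "b = x_var ^ t * b'" "c = x_var ^ t * c'"
    by (metis dvdE insertCI)
  have "t \<in> (\<lambda>h. subdegree (swap_xy h)) ` ({a, b, c} - {0})"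
    unfolding t_def by (rule Min_in[OF fin])
  then obtain e where e: "e \<in> {a, b, c}" "e \<noteq> 0" "subdegree (swap_xy e) = t"
    by (elim imageE) (metis DiffE singletonI)
  then obtain e' where e': "e' \<in> {a', b', c'}" "e = x_var ^ t * e'"
    using abc by auto
  have "swap_xy e = fps_X ^ t * swap_xy e'"
    by (simp add: e' unital_ring_hom.mult[OF swap_xy_hom] unital_ring_hom.power[OF swap_xy_hom]
        swap_xy_fps_X[symmetric])
  moreover have "swap_xy e' \<noteq> 0"
    using e e' by auto
  ultimately have "subdegree (swap_xy e') = 0"
    using e(3) by simp
  then obtain m where "y_regular m e'"
    using not_x_dvd_y_regular[of e'] \<open>swap_xy e' \<noteq> 0\<close> by auto
  then obtain n S G where S: "finite S" "\<forall>(i,j)\<in>S. i + j \<le> n" "\<exists>\<alpha>\<in>S. G \<alpha> $ 0 $ 0 \<noteq> 0"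
    and sum: "(\<Sum>(i,j)\<in>S. G (i,j) * (a' ^ i * c' ^ j * b' ^ (n - i - j))) = 0"
    using homogeneous_relation_regular[of m e' a' b' c'] e'(1) by blast
  have "(\<Sum>(i,j)\<in>S. G (i,j) * (a ^ i * c ^ j * b ^ (n - i - j)))
      = x_var ^ (t * n) * (\<Sum>(i,j)\<in>S. G (i,j) * (a' ^ i * c' ^ j * b' ^ (n - i - j)))"
    unfolding sum_distrib_left
  proof (rule sum.cong[OF refl], clarify)
    fix i j assume "(i, j) \<in> S"
    then have "i + (j + (n - i - j)) = n"
      using S(2) by auto
    then have "z ^ n = z ^ i * (z ^ j * z ^ (n - i - j))" for z :: "'k fps fps"
      by (simp only: power_add[symmetric])
    from this[of "x_var ^ t"] show "G (i,j) * (a ^ i * c ^ j * b ^ (n - i - j))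
        = x_var ^ (t * n) * (G (i,j) * (a' ^ i * c' ^ j * b' ^ (n - i - j)))"
      unfolding abc power_mult_distrib power_mult[of x_var t n] by (simp only: mult_ac)
  qed
  then show ?thesis
    using S sum by (intro exI[of _ n] exI[of _ S] exI[of _ G]) simp
qed


section \<open>Subrings of a field\<close>

definition subring_set :: "'f::Fields.field set \<Rightarrow> bool" where
  "subring_set A \<longleftrightarrow> 1 \<in> A \<and> (\<forall>a\<in>A. \<forall>b\<in>A. a + b \<in> A \<and> a * b \<in> A) \<and> (\<forall>a\<in>A. - a \<in> A)"

lemma ring_on_simps [simp]:
  "carrier (ring_on A) = A"
  "x \<otimes>\<^bsub>ring_on A\<^esub> y = x * y"
  "x \<oplus>\<^bsub>ring_on A\<^esub> y = x + y"
  "\<one>\<^bsub>ring_on A\<^esub> = 1"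
  "\<zero>\<^bsub>ring_on A\<^esub> = 0"
  by (simp_all add: ring_on_def ring_of_type_algebra_def)

lemma ring_on_a_inv:
  assumes "cring (ring_on A)" "a \<in> A"
  shows "\<ominus>\<^bsub>ring_on A\<^esub> a = - a" "- a \<in> A"
proof -
  interpret cring "ring_on A" by fact
  have "\<ominus>\<^bsub>ring_on A\<^esub> a \<in> A" "a + \<ominus>\<^bsub>ring_on A\<^esub> a = 0"
    using a_inv_closed[of a] r_neg[of a] assms(2) by simp_all
  moreover from this have "\<ominus>\<^bsub>ring_on A\<^esub> a = - a"
    by (simp add: eq_neg_iff_add_eq_0 add.commute)
  ultimately show "\<ominus>\<^bsub>ring_on A\<^esub> a = - a" "- a \<in> A"
    by simp_all
qed

lemma cring_ring_on:
  "cring (ring_on A) \<longleftrightarrow> subring_set A"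
proof
  assume c: "cring (ring_on A)"
  then interpret cring "ring_on A" .
  show "subring_set A"
    using one_closed a_closed m_closed ring_on_a_inv(2)[OF c] by (simp add: subring_set_def)
next
  assume s: "subring_set A"
  then have "0 \<in> A"
    unfolding subring_set_def by (metis add.right_inverse)
  then show "cring (ring_on A)"
    using s unfolding subring_set_def
    by (unfold_locales)
       (auto simp: algebra_simps Units_def intro!: bexI[of _ "- _"])
qed

lemma Units_ring_on:
  "Units (ring_on A) = {a \<in> A. a \<noteq> 0 \<and> inverse a \<in> (A :: 'f::Fields.field set)}"
proof -
  have "(\<exists>b\<in>A. b * a = 1 \<and> a * b = 1) \<longleftrightarrow> a \<noteq> 0 \<and> inverse a \<in> A" for a :: 'f
  proof
    assume "\<exists>b\<in>A. b * a = 1 \<and> a * b = 1"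
    then obtain b where b: "b \<in> A" "a * b = 1" by blast
    then have "inverse a = b"
      by (simp add: inverse_unique)
    then show "a \<noteq> 0 \<and> inverse a \<in> A"
      using b by auto
  qed (auto intro!: bexI[of _ "inverse a"])
  then show ?thesis
    by (auto simp: Units_def)
qed

lemma nonunits_iff: "a \<in> nonunits A \<longleftrightarrow> a \<in> A \<and> (a = 0 \<or> inverse a \<notin> (A :: 'f::Fields.field set))"
  by (auto simp: nonunits_def Units_ring_on)

definition prime_in :: "'f::Fields.field set \<Rightarrow> 'f set \<Rightarrow> bool" where
  "prime_in A P \<longleftrightarrow> P \<subseteq> A \<and> 0 \<in> P \<and> 1 \<notin> P \<and> (\<forall>a\<in>P. \<forall>b\<in>P. a + b \<in> P) \<and> (\<forall>a\<in>A. \<forall>b\<in>P. a * b \<in> P)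
     \<and> (\<forall>a\<in>A. \<forall>b\<in>A. a * b \<in> P \<longrightarrow> a \<in> P \<or> b \<in> P)"

lemma primeideal_ring_on:
  "primeideal P (ring_on A) \<longleftrightarrow> subring_set A \<and> prime_in A P"
proof
  assume P: "primeideal P (ring_on A)"
  then interpret primeideal P "ring_on A" .
  have "1 \<notin> P"
  proof
    assume "1 \<in> P"
    then have "P = carrier (ring_on A)"
      using I_l_closed[of 1] Icarr by (auto simp: )
    then show False
      using I_notcarr by simp
  qed
  then show "subring_set A \<and> prime_in A P"
    using is_cring cring_ring_on Icarr I_l_closed I_prime
      additive_subgroup.zero_closed[OF is_additive_subgroup]
      additive_subgroup.a_closed[OF is_additive_subgroup]
    by (auto simp: prime_in_def)
next
  assume A: "subring_set A \<and> prime_in A P"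
  then interpret cring "ring_on A"
    by (simp add: cring_ring_on)
  have c: "cring (ring_on A)"
    using A by (simp add: cring_ring_on)
  show "primeideal P (ring_on A)"
  proof (rule primeidealI)
    show "ideal P (ring_on A)"
    proof (rule idealI[OF ring_axioms])
      show "subgroup P (add_monoid (ring_on A))"
      proof (rule add.subgroupI)
        show "P \<subseteq> carrier (ring_on A)" "P \<noteq> {}"
          using A by (auto simp: prime_in_def)
        show "\<ominus>\<^bsub>ring_on A\<^esub> a \<in> P" if a: "a \<in> P" for a
        proof -
          have "a \<in> A" "- 1 \<in> A"
            using A a unfolding prime_in_def subring_set_def by auto
          then have "- 1 * a \<in> P"
            using A a unfolding prime_in_def by blast
          then show ?thesis
            using ring_on_a_inv(1)[OF c \<open>a \<in> A\<close>] by simp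
        qed
        show "a \<oplus>\<^bsub>ring_on A\<^esub> b \<in> P" if "a \<in> P" "b \<in> P" for a b
          using A that by (simp add: prime_in_def)
      qed
      show "x \<otimes>\<^bsub>ring_on A\<^esub> a \<in> P" "a \<otimes>\<^bsub>ring_on A\<^esub> x \<in> P" if "a \<in> P" "x \<in> carrier (ring_on A)" for a x
      proof -
        have "x * a \<in> P"
          using A that by (simp add: prime_in_def)
        then show "x \<otimes>\<^bsub>ring_on A\<^esub> a \<in> P" "a \<otimes>\<^bsub>ring_on A\<^esub> x \<in> P"
          by (simp_all add: mult.commute)
      qed
    qed
    show "cring (ring_on A)" by fact
    show "carrier (ring_on A) \<noteq> P"
      using A by (auto simp: prime_in_def subring_set_def)
    show "a \<in> P \<or> b \<in> P" if "a \<in> carrier (ring_on A)" "b \<in> carrier (ring_on A)" "a \<otimes>\<^bsub>ring_on A\<^esub> b \<in> P" for a b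
      using A that by (simp add: prime_in_def)
  qed
qed

locale field_subring =
  fixes A :: "'f::Fields.field set"
  assumes subring: "subring_set A"
begin

lemma one [simp, intro]: "1 \<in> A"
  and add [simp, intro]: "a \<in> A \<Longrightarrow> b \<in> A \<Longrightarrow> a + b \<in> A"
  and mult [simp, intro]: "a \<in> A \<Longrightarrow> b \<in> A \<Longrightarrow> a * b \<in> A"
  and uminus [simp, intro]: "a \<in> A \<Longrightarrow> - a \<in> A"
  using subring by (simp_all add: subring_set_def)

lemma zero [simp, intro]: "0 \<in> A"
  using add[OF one uminus[OF one]] by simp

lemma diff [simp, intro]: "a \<in> A \<Longrightarrow> b \<in> A \<Longrightarrow> a - b \<in> A"
  using add[of a "- b"] by simp

lemma power [simp, intro]: "a \<in> A \<Longrightarrow> a ^ n \<in> A"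
  by (induction n) auto

lemma sum [intro]: "(\<And>i. i \<in> S \<Longrightarrow> f i \<in> A) \<Longrightarrow> sum f S \<in> A"
  by (induction S rule: infinite_finite_induct) auto

lemma of_nat [simp, intro]: "of_nat n \<in> A"
  by (induction n) auto

definition dvds :: "'f \<Rightarrow> 'f \<Rightarrow> bool" where
  "dvds p c \<longleftrightarrow> (\<exists>a\<in>A. c = p * a)"

lemma dvdsI: "a \<in> A \<Longrightarrow> dvds p (p * a)"
  by (auto simp: dvds_def)

lemma dvds_mult: "dvds p c \<Longrightarrow> a \<in> A \<Longrightarrow> dvds p (a * c)"
  by (auto simp: dvds_def mult.left_commute)

lemma dvds_add: "dvds p c \<Longrightarrow> dvds p d \<Longrightarrow> dvds p (c + d)"
  by (auto simp: dvds_def distrib_left[symmetric])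

lemma dvds_diff: "dvds p c \<Longrightarrow> dvds p d \<Longrightarrow> dvds p (c - d)"
  by (auto simp: dvds_def right_diff_distrib[symmetric])

end

locale local_subring = field_subring +
  assumes nonunits_add: "a \<in> nonunits A \<Longrightarrow> b \<in> nonunits A \<Longrightarrow> a + b \<in> nonunits A"
begin

lemma nonunitsD: "a \<in> nonunits A \<Longrightarrow> a \<in> A"
  by (simp add: nonunits_iff)

lemma zero_nonunit [simp]: "0 \<in> nonunits A"
  by (simp add: nonunits_iff)

lemma one_not_nonunit [simp]: "1 \<notin> nonunits A"
  by (simp add: nonunits_iff)

lemma nonunits_mult: "a \<in> A \<Longrightarrow> b \<in> nonunits A \<Longrightarrow> a * b \<in> nonunits A"
proof -
  assume a: "a \<in> A" and b: "b \<in> nonunits A"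
  have "inverse b \<in> A" if "a * b \<noteq> 0" "inverse (a * b) \<in> A"
  proof -
    have "inverse b = a * inverse (a * b)"
      using that by (simp add: field_simps)
    then show ?thesis
      using mult[OF a that(2)] by (simp only:)
  qed
  then show ?thesis
    using a b unfolding nonunits_iff by auto
qed

lemma nonunits_mult': "a \<in> nonunits A \<Longrightarrow> b \<in> A \<Longrightarrow> a * b \<in> nonunits A"
  using nonunits_mult[of b a] by (simp add: mult.commute)

lemma nonunits_diff: "a \<in> nonunits A \<Longrightarrow> b \<in> nonunits A \<Longrightarrow> a - b \<in> nonunits A"
  using nonunits_add[of a "- b"] nonunits_mult[of "- 1" b] by simp

lemma nonunits_sum: "(\<And>i. i \<in> S \<Longrightarrow> f i \<in> nonunits A) \<Longrightarrow> sum f S \<in> nonunits A"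
  by (induction S rule: infinite_finite_induct) (auto intro: nonunits_add)

lemma unitD: "a \<in> A \<Longrightarrow> a \<notin> nonunits A \<Longrightarrow> a \<noteq> 0 \<and> inverse a \<in> A"
  by (simp add: nonunits_iff)

lemma unit_mult_iff: "e \<in> A \<Longrightarrow> e \<notin> nonunits A \<Longrightarrow> a \<in> A \<Longrightarrow> e * a \<in> nonunits A \<longleftrightarrow> a \<in> nonunits A"
proof -
  assume e: "e \<in> A" "e \<notin> nonunits A" and a: "a \<in> A"
  have "a = inverse e * (e * a)"
    using unitD[OF e] by simp
  then show ?thesis
    using nonunits_mult[of "inverse e" "e * a"] nonunits_mult[of e a] unitD[OF e] e by metis
qed

lemma unit_power: "e \<in> A \<Longrightarrow> e \<notin> nonunits A \<Longrightarrow> e ^ n \<notin> nonunits A"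
  by (induction n) (simp_all add: unit_mult_iff)

lemma nonunit_power: "a \<in> nonunits A \<Longrightarrow> n \<ge> 1 \<Longrightarrow> a ^ n \<in> nonunits A"
  by (cases n) (simp_all add: nonunits_mult' nonunitsD)

lemma one_minus_unit: "a \<in> nonunits A \<Longrightarrow> 1 - a \<noteq> 0 \<and> inverse (1 - a) \<in> A"
proof -
  assume a: "a \<in> nonunits A"
  have "1 - a \<notin> nonunits A"
    using nonunits_add[OF _ a, of "1 - a"] by auto
  then show ?thesis
    using a by (intro unitD) (auto intro: nonunitsD)
qed

lemma prime_in_nonunits:
  assumes "prime_in A P"
  shows "P \<subseteq> nonunits A"
proof
  fix a assume a: "a \<in> P"
  then have "a \<in> A"
    using assms by (auto simp: prime_in_def)
  moreover have "inverse a \<notin> A" if "a \<noteq> 0"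
  proof
    assume "inverse a \<in> A"
    then have "inverse a * a \<in> P"
      using assms a by (simp add: prime_in_def)
    then show False
      using that assms by (simp add: prime_in_def)
  qed
  ultimately show "a \<in> nonunits A"
    by (auto simp: nonunits_iff)
qed

text \<open>
  Induction on the degree \<open>J\<close>: modulo \<open>p\<close>, only the power \<open>q\<^sup>J\<close> remains, and it can be cancelled, so
  its coefficient is divisible by \<open>p\<close>; then \<open>p\<close> can be cancelled from the relation.
\<close>

lemma regular_sequence_independent:
  assumes p: "p \<in> nonunits A" "p \<noteq> 0" and q: "q \<in> nonunits A"
    and reg: "\<And>c. c \<in> A \<Longrightarrow> dvds p (c * q) \<Longrightarrow> dvds p c"
  shows "(\<And>i. i \<le> J \<Longrightarrow> c i \<in> A) \<Longrightarrow> (\<Sum>i\<le>J. c i * (p ^ i * q ^ (J - i))) = 0 \<Longrightarrow> i \<le> J \<Longrightarrow> c i \<in> nonunits A"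
proof (induction J arbitrary: c i)
  case 0
  then show ?case by simp
next
  case (Suc J)
  have pA: "p \<in> A" and qA: "q \<in> A"
    using p q by (auto intro: nonunitsD)
  have reg': "dvds p c" if "c \<in> A" "dvds p (c * q ^ n)" for c n
    using that
  proof (induction n)
    case (Suc n)
    then show ?case
      using reg[of "c * q ^ n"] qA by (simp add: mult_ac)
  qed simp
  define s where "s = (\<Sum>i\<le>J. c (Suc i) * (p ^ i * q ^ (J - i)))"
  have sA: "s \<in> A"
    unfolding s_def using Suc.prems(1) pA qA by (intro sum) auto
  have "(\<Sum>i\<le>Suc J. c i * (p ^ i * q ^ (Suc J - i)))
      = c 0 * q ^ Suc J + (\<Sum>i\<le>J. c (Suc i) * (p ^ Suc i * q ^ (Suc J - Suc i)))"
    by (subst sum.atMost_Suc_shift) simp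
  also have "(\<Sum>i\<le>J. c (Suc i) * (p ^ Suc i * q ^ (Suc J - Suc i))) = p * s"
    by (simp add: s_def sum_distrib_left mult_ac)
  finally have eq: "c 0 * q ^ Suc J = p * (- s)"
    using Suc.prems(2) by (simp add: eq_neg_iff_add_eq_0)
  then have "dvds p (c 0 * q ^ Suc J)"
    using dvdsI[of "- s" p] sA by simp
  then have "dvds p (c 0)"
    using reg'[of "c 0" "Suc J"] Suc.prems(1)[of 0] by simp
  then obtain e where e: "e \<in> A" "c 0 = p * e"
    by (auto simp: dvds_def)
  have "p * (e * q ^ Suc J + s) = 0"
    using eq by (simp add: e algebra_simps)
  then have es: "e * q ^ Suc J + s = 0"
    using p by simp
  define d where "d i = (if i = 0 then c 1 + e * q else c (Suc i))" for i
  have "(\<Sum>i\<le>J. d i * (p ^ i * q ^ (J - i)))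
      = (\<Sum>i\<le>J. (if i = 0 then e * q ^ Suc J else 0) + c (Suc i) * (p ^ i * q ^ (J - i)))"
    by (rule sum.cong) (auto simp: d_def algebra_simps)
  also have "\<dots> = 0"
    using es by (simp add: sum.distrib s_def)
  finally have d: "d i \<in> nonunits A" if "i \<le> J" for i
    using Suc.IH[of d i] that Suc.prems(1) e(1) qA by (auto simp: d_def)
  show ?case
  proof (cases i)
    case 0
    then show ?thesis
      using e p nonunits_mult' by simp
  next
    case (Suc l)
    show ?thesis
    proof (cases l)
      case 0
      have "c 1 = d 0 - e * q"
        by (simp add: d_def)
      then show ?thesis
        using d[of 0] nonunits_mult[OF e(1) q] 0 Suc nonunits_diff by simp
    next
      case (Suc l')
      then show ?thesis
        using d[of l] \<open>i = Suc l\<close> Suc.prems(3) by (simp add: d_def)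
    qed
  qed
qed

end

lemma local_subringI:
  assumes "cring (ring_on A)" "maximalideal (nonunits A) (ring_on A)"
  shows "local_subring A"
proof -
  interpret maximalideal "nonunits A" "ring_on A" by fact
  show ?thesis
    using assms(1) additive_subgroup.a_closed[OF is_additive_subgroup]
    by unfold_locales (auto simp: cring_ring_on)
qed


section \<open>The dimension of a birational local ring\<close>

text \<open>
  The field of fractions of \<open>K[[x,y]]\<close>, with the embedding as a parameter, so that \<open>x\<close> and \<open>y\<close> can be
  exchanged without changing the model.
\<close>

locale fraction_embedding = unital_ring_hom \<iota>
  for \<iota> :: "'k::{alg_closed_field, field_char_0} fps fps \<Rightarrow> 'f::Fields.field" +
  assumes inj: "\<iota> a = 0 \<Longrightarrow> a = 0"
    and fractions: "\<exists>a b. b \<noteq> 0 \<and> z = \<iota> a / \<iota> b"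
begin

lemma eq_0_iff [simp]: "\<iota> a = 0 \<longleftrightarrow> a = 0"
  using inj zero by blast

text \<open>Each cancellation of \<open>g\<close> lowers the order of the denominator.\<close>

lemma reduced_fraction:
  assumes "\<not> g dvd 1"
  obtains a b where "b \<noteq> 0" "z = \<iota> a / \<iota> b" "\<not> (g dvd a \<and> g dvd b)"
proof -
  define S where "S = {b. b \<noteq> 0 \<and> (\<exists>a. z = \<iota> a / \<iota> b)}"
  define b where "b = arg_min xy_order (\<lambda>b. b \<in> S)"
  obtain b0 where "b0 \<in> S"
    using fractions[of z] by (auto simp: S_def)
  then have b: "b \<in> S" and least: "\<And>c. c \<in> S \<Longrightarrow> xy_order b \<le> xy_order c"
    unfolding b_def using arg_min_nat_lemma[of "\<lambda>b. b \<in> S" b0 xy_order] by blast+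
  obtain a where a: "b \<noteq> 0" "z = \<iota> a / \<iota> b"
    using b by (auto simp: S_def)
  have "\<not> (g dvd a \<and> g dvd b)"
  proof
    assume "g dvd a \<and> g dvd b"
    then obtain a' b' where ab: "a = g * a'" "b = g * b'"
      by (auto elim!: dvdE)
    then have nz: "g \<noteq> 0" "b' \<noteq> 0"
      using a by auto
    have "z = \<iota> a' / \<iota> b'"
      using a nz by (simp add: ab mult)
    then have "b' \<in> S"
      using nz by (auto simp: S_def)
    then have "xy_order b \<le> xy_order b'"
      by (rule least)
    moreover have "xy_order b = xy_order g + xy_order b'"
      using nz by (simp add: ab xy_order_mult)
    moreover have "xy_order g \<ge> 1"
      using assms nz order_at_least_iff[of "Suc 0" g]
      by (simp add: fps_fps_is_unit_iff order_at_least_1)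
    ultimately show False
      by simp
  qed
  then show ?thesis
    using a that by blast
qed

end

abbreviation scalar :: "'k::comm_ring_1 \<Rightarrow> 'k fps fps" where
  "scalar c \<equiv> fps_const (fps_const c)"

locale dominating_ring = fraction_embedding \<iota> + A: local_subring A
  for \<iota> :: "'k::{alg_closed_field, field_char_0} fps fps \<Rightarrow> 'f::Fields.field" and A :: "'f set" +
  assumes \<iota>_in: "\<iota> r \<in> A" and dominates: "\<iota> r \<in> nonunits A \<longleftrightarrow> r $ 0 $ 0 = 0"
begin

lemma scalar_unit: "c \<noteq> 0 \<Longrightarrow> \<iota> (scalar c) \<notin> nonunits A"
  by (simp add: dominates)

lemma prime_in_props:
  assumes "prime_in A P"
  shows "P \<subseteq> A" "0 \<in> P" "1 \<notin> P" "a \<in> P \<Longrightarrow> b \<in> P \<Longrightarrow> a + b \<in> P" "a \<in> A \<Longrightarrow> b \<in> P \<Longrightarrow> a * b \<in> P"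
    "a \<in> A \<Longrightarrow> b \<in> A \<Longrightarrow> a * b \<in> P \<Longrightarrow> a \<in> P \<or> b \<in> P"
  using assms by (simp_all add: prime_in_def)

lemma prime_in_sum: "prime_in A P \<Longrightarrow> (\<And>i. i \<in> S \<Longrightarrow> f i \<in> P) \<Longrightarrow> sum f S \<in> P"
  by (induction S rule: infinite_finite_induct) (auto simp: prime_in_props)

lemma prime_in_diff: "prime_in A P \<Longrightarrow> a \<in> P \<Longrightarrow> b \<in> P \<Longrightarrow> a - b \<in> P"
  using prime_in_props(4)[of P a "(- 1) * b"] prime_in_props(5)[of P "- 1" b] by simp

lemma prime_in_power: "prime_in A P \<Longrightarrow> a \<in> A \<Longrightarrow> a ^ n \<in> P \<Longrightarrow> a \<in> P"
  by (induction n) (auto simp: prime_in_props dest: prime_in_props(6))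

text \<open>
  Modulo a prime \<open>P\<close> containing \<open>x\<close> and \<open>y\<close>, the coefficients of a homogeneous relation between
  numerators and denominator become constants, so any two elements \<open>z, w\<close> of \<open>A\<close> are algebraically
  dependent over \<open>K\<close>. For \<open>z \<in> P' - P\<close> and \<open>w \<in> P'' - P'\<close> one can cancel powers of \<open>z\<close> modulo \<open>P\<close> and
  then powers of \<open>w\<close> modulo \<open>P'\<close>, until a nonzero constant is left in the maximal ideal.
\<close>

lemma no_chain_over_origin:
  assumes P: "prime_in A P" "prime_in A P'" "prime_in A P''" "P \<subset> P'" "P' \<subset> P''"
    and origin: "\<And>r. r $ 0 $ 0 = 0 \<Longrightarrow> \<iota> r \<in> P"
  shows False
proof -
  obtain z w where z: "z \<in> P'" "z \<notin> P" and w: "w \<in> P''" "w \<notin> P'"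
    using P(4,5) by blast
  have zA: "z \<in> A" and wA: "w \<in> A" and wm: "w \<in> nonunits A"
    using z w P(2,3) prime_in_props(1) A.prime_in_nonunits by blast+
  obtain a1 b1 c1 b2 where ab: "b1 \<noteq> 0" "z = \<iota> a1 / \<iota> b1" "b2 \<noteq> 0" "w = \<iota> c1 / \<iota> b2"
    using fractions[of z] fractions[of w] by blast
  define a b c where "a = a1 * b2" and "b = b1 * b2" and "c = c1 * b1"
  have b: "b \<noteq> 0" and za: "\<iota> a = z * \<iota> b" and wc: "\<iota> c = w * \<iota> b"
    using ab by (simp_all add: a_def b_def c_def mult)
  obtain n S G where S0: "finite S" "\<forall>(i,j)\<in>S. i + j \<le> n" "\<exists>\<alpha>\<in>S. G \<alpha> $ 0 $ 0 \<noteq> 0"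
    and rel: "(\<Sum>(i,j)\<in>S. G (i,j) * (a ^ i * c ^ j * b ^ (n - i - j))) = 0"
    using homogeneous_relation[OF b, of a c] by (elim exE conjE) (rule that)
  then have S: "finite S" "\<And>i j. (i,j) \<in> S \<Longrightarrow> i + j \<le> n" "\<exists>\<alpha>\<in>S. G \<alpha> $ 0 $ 0 \<noteq> 0"
    by auto
  have "0 = \<iota> (\<Sum>(i,j)\<in>S. G (i,j) * (a ^ i * c ^ j * b ^ (n - i - j)))"
    by (simp only: rel zero)
  also have "\<dots> = (\<Sum>(i,j)\<in>S. \<iota> b ^ n * (\<iota> (G (i,j)) * (z ^ i * w ^ j)))"
    unfolding sum
  proof (rule sum.cong[OF refl], clarify)
    fix i j assume "(i, j) \<in> S"
    then have "i + (j + (n - i - j)) = n"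
      using S(2)[of i j] by simp
    then have "\<iota> b ^ n = \<iota> b ^ i * (\<iota> b ^ j * \<iota> b ^ (n - i - j))"
      by (simp only: power_add[symmetric])
    then show "\<iota> (G (i,j) * (a ^ i * c ^ j * b ^ (n - i - j))) = \<iota> b ^ n * (\<iota> (G (i,j)) * (z ^ i * w ^ j))"
      unfolding mult power za wc power_mult_distrib by (simp only: mult_ac)
  qed
  also have "\<dots> = \<iota> b ^ n * (\<Sum>(i,j)\<in>S. \<iota> (G (i,j)) * (z ^ i * w ^ j))"
    by (simp add: sum_distrib_left case_prod_unfold)
  finally have rel': "(\<Sum>(i,j)\<in>S. \<iota> (G (i,j)) * (z ^ i * w ^ j)) = 0"
    using b by simp
  define \<kappa> where "\<kappa> \<alpha> = \<iota> (scalar (G \<alpha> $ 0 $ 0))" for \<alpha>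
  have \<kappa>A: "\<kappa> \<alpha> \<in> A" for \<alpha>
    by (simp add: \<kappa>_def \<iota>_in)
  define S' where "S' = {\<alpha> \<in> S. G \<alpha> $ 0 $ 0 \<noteq> 0}"
  have fS': "finite S'" "S' \<noteq> {}"
    using S(1,3) by (auto simp: S'_def)
  have "(\<Sum>(i,j)\<in>S. (\<iota> (G (i,j)) - \<kappa> (i,j)) * (z ^ i * w ^ j)) \<in> P"
  proof (rule prime_in_sum[OF P(1)], clarify)
    fix i j
    have "\<iota> (G (i,j)) - \<kappa> (i,j) \<in> P"
      unfolding \<kappa>_def diff[symmetric] by (rule origin) simp
    then have "(z ^ i * w ^ j) * (\<iota> (G (i,j)) - \<kappa> (i,j)) \<in> P"
      by (intro prime_in_props(5)[OF P(1)] A.mult A.power zA wA)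
    then show "(\<iota> (G (i,j)) - \<kappa> (i,j)) * (z ^ i * w ^ j) \<in> P"
      by (simp only: mult.commute)
  qed
  also have "(\<Sum>(i,j)\<in>S. (\<iota> (G (i,j)) - \<kappa> (i,j)) * (z ^ i * w ^ j))
      = - (\<Sum>(i,j)\<in>S. \<kappa> (i,j) * (z ^ i * w ^ j))"
    using rel' by (simp add: left_diff_distrib case_prod_unfold sum_subtractf)
  finally have "(\<Sum>(i,j)\<in>S. \<kappa> (i,j) * (z ^ i * w ^ j)) \<in> P"
    using prime_in_diff[OF P(1) prime_in_props(2)[OF P(1)]] by force
  also have "(\<Sum>(i,j)\<in>S. \<kappa> (i,j) * (z ^ i * w ^ j)) = (\<Sum>(i,j)\<in>S'. \<kappa> (i,j) * (z ^ i * w ^ j))"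
    using S(1) by (intro sum.mono_neutral_right) (auto simp: S'_def \<kappa>_def zero)
  finally have sumP: "(\<Sum>(i,j)\<in>S'. \<kappa> (i,j) * (z ^ i * w ^ j)) \<in> P" .
  \<comment> \<open>The least exponent of \<open>z\<close>; below, \<open>j0\<close> is the least exponent of \<open>w\<close> among the terms with \<open>z\<^sup>i\<^sup>0\<close>.\<close>
  define i0 where "i0 = Min (fst ` S')"
  have i0: "i0 \<in> fst ` S'" "\<And>\<alpha>. \<alpha> \<in> S' \<Longrightarrow> i0 \<le> fst \<alpha>"
    unfolding i0_def using fS' by (auto intro!: Min_in)
  define H where "H = (\<Sum>(i,j)\<in>S'. \<kappa> (i,j) * (z ^ (i - i0) * w ^ j))"
  have HA: "H \<in> A"
    unfolding H_def using zA wA \<kappa>A by (intro A.sum) auto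
  have "(\<Sum>(i,j)\<in>S'. \<kappa> (i,j) * (z ^ i * w ^ j)) = z ^ i0 * H"
    unfolding H_def sum_distrib_left
  proof (rule sum.cong[OF refl], clarify)
    fix i j assume "(i, j) \<in> S'"
    then have "z ^ i = z ^ i0 * z ^ (i - i0)"
      using i0(2)[of "(i, j)"] by (simp add: power_add[symmetric])
    then show "\<kappa> (i, j) * (z ^ i * w ^ j) = z ^ i0 * (\<kappa> (i, j) * (z ^ (i - i0) * w ^ j))"
      by (simp only: mult_ac)
  qed
  then have "z ^ i0 * H \<in> P"
    using sumP by simp
  then have "H \<in> P"
    using prime_in_props(6)[OF P(1), of "z ^ i0" H] prime_in_power[OF P(1) zA, of i0] z zA HA by auto
  then have HP': "H \<in> P'"
    using P(4) by blast
  define S2 where "S2 = {\<alpha> \<in> S'. fst \<alpha> = i0}"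
  have fS2: "finite S2" "S2 \<noteq> {}"
    using fS' i0(1) by (auto simp: S2_def)
  have "(\<Sum>(i,j)\<in>S' - S2. \<kappa> (i,j) * (z ^ (i - i0) * w ^ j)) \<in> P'"
  proof (rule prime_in_sum[OF P(2)], clarify)
    fix i j assume ij: "(i, j) \<in> S'" "(i, j) \<notin> S2"
    then have "i - i0 \<noteq> 0"
      using i0(2)[of "(i, j)"] by (auto simp: S2_def)
    then obtain l where "i - i0 = Suc l"
      by (cases "i - i0") auto
    then have eq: "\<kappa> (i, j) * (z ^ (i - i0) * w ^ j) = (\<kappa> (i, j) * z ^ l * w ^ j) * z"
      by simp
    show "\<kappa> (i, j) * (z ^ (i - i0) * w ^ j) \<in> P'"
      unfolding eq by (intro prime_in_props(5)[OF P(2)] A.mult A.power zA wA \<kappa>A z(1))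
  qed
  moreover have "(\<Sum>(i,j)\<in>S2. \<kappa> (i,j) * (z ^ (i - i0) * w ^ j))
      = H - (\<Sum>(i,j)\<in>S' - S2. \<kappa> (i,j) * (z ^ (i - i0) * w ^ j))"
    unfolding H_def using fS' by (subst sum.subset_diff[of S2 S']) (auto simp: S2_def)
  ultimately have "(\<Sum>(i,j)\<in>S2. \<kappa> (i,j) * (z ^ (i - i0) * w ^ j)) \<in> P'"
    using prime_in_diff[OF P(2) HP'] by simp
  also have "(\<Sum>(i,j)\<in>S2. \<kappa> (i,j) * (z ^ (i - i0) * w ^ j)) = (\<Sum>(i,j)\<in>S2. \<kappa> (i,j) * w ^ j)"
    by (rule sum.cong) (auto simp: S2_def)
  finally have sumP': "(\<Sum>(i,j)\<in>S2. \<kappa> (i,j) * w ^ j) \<in> P'" .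
  define j0 where "j0 = Min (snd ` S2)"
  have j0: "j0 \<in> snd ` S2" "\<And>\<alpha>. \<alpha> \<in> S2 \<Longrightarrow> j0 \<le> snd \<alpha>"
    unfolding j0_def using fS2 by (auto intro!: Min_in)
  define H2 where "H2 = (\<Sum>(i,j)\<in>S2. \<kappa> (i,j) * w ^ (j - j0))"
  have H2A: "H2 \<in> A"
    unfolding H2_def using wA \<kappa>A by (intro A.sum) auto
  have "(\<Sum>(i,j)\<in>S2. \<kappa> (i,j) * w ^ j) = w ^ j0 * H2"
    unfolding H2_def sum_distrib_left
  proof (rule sum.cong[OF refl], clarify)
    fix i j assume "(i, j) \<in> S2"
    then have "w ^ j = w ^ j0 * w ^ (j - j0)"
      using j0(2)[of "(i, j)"] by (simp add: power_add[symmetric])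
    then show "\<kappa> (i, j) * w ^ j = w ^ j0 * (\<kappa> (i, j) * w ^ (j - j0))"
      by (simp only: mult_ac)
  qed
  then have "w ^ j0 * H2 \<in> P'"
    using sumP' by simp
  then have "H2 \<in> P'"
    using prime_in_props(6)[OF P(2), of "w ^ j0" H2] prime_in_power[OF P(2) wA, of j0] w wA H2A by auto
  then have H2m: "H2 \<in> nonunits A"
    using A.prime_in_nonunits[OF P(2)] by blast
  have ij0: "(i0, j0) \<in> S2"
    using j0(1) by (auto simp: S2_def)
  have rest: "(\<Sum>(i,j)\<in>S2 - {(i0, j0)}. \<kappa> (i,j) * w ^ (j - j0)) \<in> nonunits A"
  proof (rule A.nonunits_sum)
    fix \<alpha> assume \<alpha>: "\<alpha> \<in> S2 - {(i0, j0)}"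
    obtain i j where ij: "\<alpha> = (i, j)"
      by (cases \<alpha>)
    have "j - j0 \<ge> 1"
      using j0(2)[of "(i, j)"] \<alpha> by (auto simp: S2_def ij)
    then show "(case \<alpha> of (i, j) \<Rightarrow> \<kappa> (i, j) * w ^ (j - j0)) \<in> nonunits A"
      using A.nonunits_mult[OF \<kappa>A] A.nonunit_power[OF wm] by (simp add: ij)
  qed
  have "H2 = \<kappa> (i0, j0) + (\<Sum>(i,j)\<in>S2 - {(i0, j0)}. \<kappa> (i,j) * w ^ (j - j0))"
    unfolding H2_def using fS2 ij0 by (subst sum.remove) auto
  then have "\<kappa> (i0, j0) = H2 - (\<Sum>(i,j)\<in>S2 - {(i0, j0)}. \<kappa> (i,j) * w ^ (j - j0))"
    by simp
  then have "\<kappa> (i0, j0) \<in> nonunits A"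
    using A.nonunits_diff[OF H2m rest] by (simp only:)
  then show False
    using ij0 scalar_unit[of "G (i0, j0) $ 0 $ 0"] by (auto simp: \<kappa>_def S2_def S'_def)
qed

text \<open>
  The ring \<open>A/P\<close> lies between \<open>K[[x,y]]/(g)\<close> and its field of fractions, which is contained in
  \<open>K((t))\<close>. A larger prime \<open>P'\<close> contains a curve other than \<open>g\<close>, hence \<open>x\<close> and \<open>y\<close>. Let
  \<open>w \<in> P'' - P'\<close>, regarded as an element of \<open>K((t))\<close>. If \<open>w\<close> is a power series with constant term \<open>c\<close>,
  a power of \<open>w - c\<close> comes from \<open>K[[x,y]]\<close> by the conductor, so \<open>w - c \<in> P'\<close>, which is absurd.
  Otherwise a power of \<open>1/w\<close> comes from \<open>K[[x,y]]\<close>, and \<open>w\<close> is not in the maximal ideal.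
\<close>

lemma no_chain_over_curve:
  assumes P: "prime_in A P" "prime_in A P'" "prime_in A P''" "P \<subset> P'" "P' \<subset> P''"
    and br: "curve_branch ev g D" and over: "\<And>r. \<iota> r \<in> P \<longleftrightarrow> g dvd r"
  shows False
proof -
  interpret curve_branch ev g D by fact
  have "\<not> g dvd 1"
    using over[of 1] P(1) by (simp add: prime_in_def one)
  have frac: "\<exists>a b. z * \<iota> b = \<iota> a \<and> ev b \<noteq> 0 \<and> \<iota> b \<notin> P" if z: "z \<in> A" for z
  proof -
    obtain a b where ab: "b \<noteq> 0" "z = \<iota> a / \<iota> b" "\<not> (g dvd a \<and> g dvd b)"
      using reduced_fraction[OF \<open>\<not> g dvd 1\<close>] .
    have eq: "z * \<iota> b = \<iota> a"
      using ab by simp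
    have "\<not> g dvd b"
    proof
      assume "g dvd b"
      then have "z * \<iota> b \<in> P"
        using over prime_in_props(5)[OF P(1) z] by blast
      then show False
        using eq over ab(3) \<open>g dvd b\<close> by simp
    qed
    then show ?thesis
      using eq over[of b] ev_eq_0_iff[of b] by blast
  qed
  obtain y where y: "y \<in> P'" "y \<notin> P"
    using P(4) by blast
  then have yA: "y \<in> A"
    using prime_in_props(1)[OF P(2)] by blast
  obtain a b where ab: "y * \<iota> b = \<iota> a" "ev b \<noteq> 0" "\<iota> b \<notin> P"
    using frac[OF yA] by blast
  have "\<iota> a \<in> P'"
    using prime_in_props(5)[OF P(2) \<iota>_in y(1), of b] ab(1) by (simp add: mult.commute)
  have "\<iota> a \<notin> P"
    using prime_in_props(6)[OF P(1) yA \<iota>_in[of b]] ab y by auto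
  then have eva: "ev a \<noteq> 0"
    using over[of a] ev_eq_0_iff[of a] by simp
  have "\<iota> g \<in> P'"
    using over[of g] P(4) by auto
  have origin: "\<iota> r \<in> P'" if r: "r $ 0 $ 0 = 0" for r
  proof -
    obtain \<alpha> \<gamma> where "r ^ (subdegree (ev a) + D) = \<alpha> * g + \<gamma> * a"
      using power_in_ideal[OF eva r] by blast
    then have "\<iota> r ^ (subdegree (ev a) + D) = \<iota> \<alpha> * \<iota> g + \<iota> \<gamma> * \<iota> a"
      by (metis add mult power)
    also have "\<dots> \<in> P'"
      using prime_in_props(4,5)[OF P(2)] \<iota>_in \<open>\<iota> a \<in> P'\<close> \<open>\<iota> g \<in> P'\<close> by blast
    finally show ?thesis
      using prime_in_power[OF P(2) \<iota>_in] by blast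
  qed
  obtain w where w: "w \<in> P''" "w \<notin> P'"
    using P(5) by blast
  then have wA: "w \<in> A" and wm: "w \<in> nonunits A"
    using prime_in_props(1)[OF P(3)] A.prime_in_nonunits[OF P(3)] by auto
  obtain a b where ab: "w * \<iota> b = \<iota> a" "ev b \<noteq> 0" "\<iota> b \<notin> P"
    using frac[OF wA] by blast
  have cancel: "z \<in> P" if "z \<in> A" "z * \<iota> b ^ n \<in> P" for z n
    using prime_in_props(6)[OF P(1) that(1), of "\<iota> b ^ n"] that(2) prime_in_power[OF P(1) \<iota>_in] ab(3) \<iota>_in
    by blast
  have small: "\<exists>r. ev r = k ^ Suc D \<and> r $ 0 $ 0 = 0" if k: "k $ 0 = 0" for k
  proof -
    have "k ^ Suc D = 0 \<or> D \<le> subdegree (k ^ Suc D)"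
    proof (cases "k = 0")
      case False
      then have "subdegree k \<ge> 1"
        using k by (simp add: Suc_le_eq subdegree_eq_0_iff neq0_conv[symmetric] del: neq0_conv)
      then have "Suc D * 1 \<le> Suc D * subdegree k"
        by (rule mult_le_mono2)
      then show ?thesis
        by (simp del: power_Suc)
    qed simp
    then obtain r where r: "ev r = k ^ Suc D"
      using conductor by blast
    then have "r $ 0 $ 0 = 0"
      using k by (simp add: ev_nth_0[symmetric])
    then show ?thesis
      using r by blast
  qed
  show False
  proof (cases "ev a = 0 \<or> subdegree (ev b) \<le> subdegree (ev a)")
    case True
    then have "ev b dvd ev a"
      using ab(2) by (cases "ev a = 0") (simp_all add: fps_dvd_iff)
    then obtain k where k: "ev a = ev b * k" ..
    define c where "c = k $ 0"
    obtain r where r: "ev r = (k - fps_const c) ^ Suc D" "r $ 0 $ 0 = 0"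
      using small[of "k - fps_const c"] by (auto simp: c_def)
    have eq: "ev (a - scalar c * b) = ev b * (k - fps_const c)"
      by (simp add: ev.diff ev.mult ev_const k algebra_simps)
    have "ev ((a - scalar c * b) ^ Suc D - r * b ^ Suc D)
        = ev ((a - scalar c * b) ^ Suc D) - ev (r * b ^ Suc D)"
      by (rule ev.diff)
    also have "ev (r * b ^ Suc D) = ev ((a - scalar c * b) ^ Suc D)"
      unfolding ev.power ev.mult eq r power_mult_distrib by (rule mult.commute)
    finally have "ev ((a - scalar c * b) ^ Suc D - r * b ^ Suc D) = 0"
      by (simp only: diff_self)
    then have "\<iota> ((a - scalar c * b) ^ Suc D - r * b ^ Suc D) \<in> P"
      unfolding ev_eq_0_iff over .
    also have "\<iota> ((a - scalar c * b) ^ Suc D - r * b ^ Suc D)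
        = ((w - \<iota> (scalar c)) ^ Suc D - \<iota> r) * \<iota> b ^ Suc D"
      unfolding diff mult power ab(1)[symmetric] left_diff_distrib[symmetric] power_mult_distrib ..
    finally have "(w - \<iota> (scalar c)) ^ Suc D - \<iota> r \<in> P"
      by (rule cancel[rotated]) (intro A.diff A.power wA \<iota>_in)
    then have "(w - \<iota> (scalar c)) ^ Suc D - \<iota> r \<in> P'"
      using P(4) by blast
    from prime_in_props(4)[OF P(2) this origin[OF r(2)]]
    have "(w - \<iota> (scalar c)) ^ Suc D \<in> P'"
      by (simp only: diff_add_cancel)
    then have wc: "w - \<iota> (scalar c) \<in> P'"
      by (rule prime_in_power[OF P(2), rotated]) (intro A.diff wA \<iota>_in)
    show False
    proof (cases "c = 0")
      case True
      then show False
        using wc w by (simp add: zero)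
    next
      case False
      have "w - (w - \<iota> (scalar c)) \<in> nonunits A"
        by (rule A.nonunits_diff[OF wm]) (use A.prime_in_nonunits[OF P(2)] wc in blast)
      then show False
        using scalar_unit[OF False] by simp
    qed
  next
    case False
    then have "ev a dvd ev b"
      using ab(2) by (simp add: fps_dvd_iff)
    then obtain k where k: "ev b = ev a * k" ..
    then have "k \<noteq> 0"
      using ab by auto
    then have "subdegree k > 0"
      using k False by auto
    then have "k $ 0 = 0"
      by (rule nth_less_subdegree_zero)
    then obtain r where r: "ev r = k ^ Suc D" "r $ 0 $ 0 = 0"
      using small by blast
    have "ev (b ^ Suc D - r * a ^ Suc D) = ev (b ^ Suc D) - ev (r * a ^ Suc D)"
      by (rule ev.diff)
    also have "ev (r * a ^ Suc D) = ev (b ^ Suc D)"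
      unfolding ev.power ev.mult k r power_mult_distrib by (rule mult.commute)
    finally have "ev (b ^ Suc D - r * a ^ Suc D) = 0"
      by (simp only: diff_self)
    then have "\<iota> (b ^ Suc D - r * a ^ Suc D) \<in> P"
      unfolding ev_eq_0_iff over .
    also have "\<iota> (b ^ Suc D - r * a ^ Suc D) = (1 - \<iota> r * w ^ Suc D) * \<iota> b ^ Suc D"
      unfolding diff mult power ab(1)[symmetric] power_mult_distrib by (simp only: left_diff_distrib mult_1 mult.assoc)
    finally have "1 - \<iota> r * w ^ Suc D \<in> P"
      by (rule cancel[rotated]) (intro A.diff A.mult A.one A.power wA \<iota>_in)
    then have "1 - \<iota> r * w ^ Suc D \<in> nonunits A"
      using A.prime_in_nonunits[OF P(1)] by blast
    moreover have "\<iota> r * w ^ Suc D \<in> nonunits A"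
      by (intro A.nonunits_mult[OF \<iota>_in A.nonunit_power[OF wm]]) simp
    ultimately have "(1 - \<iota> r * w ^ Suc D) + \<iota> r * w ^ Suc D \<in> nonunits A"
      by (rule A.nonunits_add)
    then show False
      by simp
  qed
qed

text \<open>
  The second member of a chain of primes contracts to a nonzero prime of \<open>K[[x,y]]\<close>, which belongs to
  the origin or to a curve.
\<close>

lemma no_prime_chain:
  assumes P: "prime_in A P0" "prime_in A P1" "prime_in A P2" "prime_in A P3" "P0 \<subset> P1" "P1 \<subset> P2" "P2 \<subset> P3"
  shows False
proof -
  obtain y where "y \<in> P1" "y \<notin> P0"
    using P(5) by blast
  then have y: "y \<in> P1" "y \<noteq> 0"
    using prime_in_props(2)[OF P(1)] by auto
  obtain a b where ab: "b \<noteq> 0" "y = \<iota> a / \<iota> b"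
    using fractions by blast
  then have "\<iota> a = \<iota> b * y"
    by simp
  then have "\<iota> a \<in> P1"
    using prime_in_props(5)[OF P(2) \<iota>_in y(1)] by simp
  moreover have "a \<noteq> 0"
    using ab y by (auto simp: zero)
  ultimately have a: "a \<in> {r. \<iota> r \<in> P1}" "a \<noteq> 0"
    by simp_all
  have "(\<forall>r. r $ 0 $ 0 = 0 \<longrightarrow> \<iota> r \<in> P1)
      \<or> (\<exists>g. Factorial_Ring.irreducible g \<and> {r. \<iota> r \<in> P1} = {h. g dvd h})"
  proof (rule prime_of_power_series[OF _ _ _ _ a])
    show "a \<in> {r. \<iota> r \<in> P1} \<or> b \<in> {r. \<iota> r \<in> P1}" if "a * b \<in> {r. \<iota> r \<in> P1}" for a b
      using prime_in_props(6)[OF P(2) \<iota>_in \<iota>_in, of a b] that by (simp add: mult)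
  qed (use prime_in_props(3-5)[OF P(2)] \<iota>_in in \<open>auto simp: add mult one\<close>)
  then show False
  proof (elim disjE exE conjE)
    assume "\<forall>r. r $ 0 $ 0 = 0 \<longrightarrow> \<iota> r \<in> P1"
    then show False
      using no_chain_over_origin[OF P(2-4,6,7)] by blast
  next
    fix g assume g: "Factorial_Ring.irreducible g" "{r. \<iota> r \<in> P1} = {h. g dvd h}"
    obtain ev D where "curve_branch ev g D"
      using irreducible_curve_branch[OF g(1)] .
    then show False
      by (rule no_chain_over_curve[OF P(2-4,6,7)]) (use g(2) in blast)
  qed
qed

lemma krull_dim_le_2:
  assumes "krull_dim (ring_on A) = enat d"
  shows "d \<le> 2"
proof (rule ccontr)
  assume "\<not> d \<le> 2"
  have "\<exists>Ps\<in>{Ps. Ps \<noteq> [] \<and> sorted_wrt (\<subset>) Ps \<and> (\<forall>P\<in>set Ps. primeideal P (ring_on A))}. \<not> enat (length Ps - 1) \<le> 2"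
  proof (rule ccontr)
    assume "\<not> ?thesis"
    then have "krull_dim (ring_on A) \<le> 2"
      unfolding krull_dim_def by (intro SUP_least) blast
    then show False
      using assms \<open>\<not> d \<le> 2\<close> by (simp add: numeral_eq_enat)
  qed
  then obtain Ps where Ps: "sorted_wrt (\<subset>) Ps" "\<And>P. P \<in> set Ps \<Longrightarrow> primeideal P (ring_on A)"
    and "\<not> enat (length Ps - 1) \<le> 2"
    by blast
  then have len: "length Ps > 3"
    by (simp add: numeral_eq_enat)
  have pr: "prime_in A (Ps ! i)" if "i \<le> 3" for i
    using Ps(2)[of "Ps ! i"] that len by (simp add: primeideal_ring_on)
  have lt: "Ps ! i \<subset> Ps ! Suc i" if "i < 3" for i
    using sorted_wrt_nth_less[OF Ps(1), of i "Suc i"] that len by simp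
  show False
    using no_prime_chain[OF pr[of 0] pr[of 1] pr[of 2] pr[of 3]] lt[of 0] lt[of 1] lt[of 2]
    by (simp add: numeral_2_eq_2 numeral_3_eq_3)
qed

end


section \<open>Noetherian local domains with two parameters\<close>

lemma two_generators_commute:
  fixes u v :: "'a::comm_ring_1"
  shows "{a * u + b * v | a b. a \<in> A \<and> b \<in> A} = {a * v + b * u | a b. a \<in> A \<and> b \<in> A}"
proof -
  have "{a * u + b * v | a b. a \<in> A \<and> b \<in> A} \<subseteq> {a * v + b * u | a b. a \<in> A \<and> b \<in> A}" for u v :: 'a
  proof clarify
    fix a b assume "a \<in> A" "b \<in> A"
    then show "\<exists>a' b'. a * u + b * v = a' * v + b' * u \<and> a' \<in> A \<and> b' \<in> A"
      by (intro exI[of _ b] exI[of _ a]) (simp add: add.commute)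
  qed
  then show ?thesis
    by (intro equalityI)
qed

context field_subring
begin

lemma cring_ring: "cring (ring_on A)"
  using subring by (simp add: cring_ring_on)

lemma Idl_two:
  assumes "u \<in> A" "v \<in> A"
  shows "Idl\<^bsub>ring_on A\<^esub> {u, v} = {a * u + b * v | a b. a \<in> A \<and> b \<in> A}"
proof -
  interpret R: cring "ring_on A" by (rule cring_ring)
  let ?S = "{a * u + b * v | a b. a \<in> A \<and> b \<in> A}"
  have SI: "a * u + b * v \<in> ?S" if "a \<in> A" "b \<in> A" for a b
    using that by blast
  have "ideal ?S (ring_on A)"
  proof (rule idealI[OF R.ring_axioms])
    show "subgroup ?S (add_monoid (ring_on A))"
    proof (rule R.add.subgroupI)
      show "?S \<subseteq> carrier (ring_on A)"
        using assms by auto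
      show "?S \<noteq> {}"
        using zero by blast
      fix x y assume x: "x \<in> ?S" and y: "y \<in> ?S"
      obtain a b c d where "a \<in> A" "b \<in> A" "c \<in> A" "d \<in> A" "x = a * u + b * v" "y = c * u + d * v"
        using x y by blast
      then show "x \<oplus>\<^bsub>ring_on A\<^esub> y \<in> ?S"
        using SI[of "a + c" "b + d"] by (simp add: algebra_simps)
    next
      fix x assume "x \<in> ?S"
      then obtain a b where ab: "a \<in> A" "b \<in> A" "x = a * u + b * v" by blast
      then have "x \<in> A"
        using assms by auto
      then have "\<ominus>\<^bsub>ring_on A\<^esub> x = - x"
        by (rule ring_on_a_inv(1)[OF cring_ring])
      moreover have "- x = (- a) * u + (- b) * v"
        by (simp add: ab)
      ultimately show "\<ominus>\<^bsub>ring_on A\<^esub> x \<in> ?S"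
        using SI[OF uminus[OF ab(1)] uminus[OF ab(2)]] by (simp only:)
    qed
    fix x z assume "x \<in> ?S" and z: "z \<in> carrier (ring_on A)"
    then obtain a b where ab: "a \<in> A" "b \<in> A" "x = a * u + b * v" by blast
    then have "z * x \<in> ?S"
      using SI[of "z * a" "z * b"] z by (simp add: algebra_simps)
    then show "z \<otimes>\<^bsub>ring_on A\<^esub> x \<in> ?S" "x \<otimes>\<^bsub>ring_on A\<^esub> z \<in> ?S"
      by (simp_all add: mult.commute)
  qed
  moreover have "{u, v} \<subseteq> ?S"
    using SI[of 1 0] SI[of 0 1] by auto
  ultimately have "Idl\<^bsub>ring_on A\<^esub> {u, v} \<subseteq> ?S"
    by (rule R.genideal_minimal)
  moreover have "?S \<subseteq> Idl\<^bsub>ring_on A\<^esub> {u, v}"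
  proof
    fix x assume "x \<in> ?S"
    then obtain a b where ab: "a \<in> A" "b \<in> A" "x = a * u + b * v" by blast
    have id: "ideal (Idl\<^bsub>ring_on A\<^esub> {u, v}) (ring_on A)"
      by (rule R.genideal_ideal) (use assms in simp)
    have "u \<in> Idl\<^bsub>ring_on A\<^esub> {u, v}" "v \<in> Idl\<^bsub>ring_on A\<^esub> {u, v}"
      using R.genideal_self[of "{u, v}"] assms by auto
    then have "a * u \<in> Idl\<^bsub>ring_on A\<^esub> {u, v}" "b * v \<in> Idl\<^bsub>ring_on A\<^esub> {u, v}"
      using ideal.I_l_closed[OF id] ab by fastforce+
    then show "x \<in> Idl\<^bsub>ring_on A\<^esub> {u, v}"
      using additive_subgroup.a_closed[OF ideal.axioms(1)[OF id]] ab by fastforce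
  qed
  ultimately show ?thesis
    by blast
qed

end

locale noetherian_local = local_subring +
  assumes noetherian: "noetherian_ring (ring_on A)"
begin

text \<open>
  Krull's intersection theorem for the principal ideal \<open>uA\<close> in \<open>A/vA\<close>. The elements \<open>\<alpha> j\<close> are
  successive quotients by \<open>u\<close> modulo \<open>v\<close>; the ascending chain of the ideals \<open>(\<alpha> j, v)\<close> stops.
\<close>

lemma infinite_descent:
  assumes u: "u \<in> nonunits A" and v: "v \<in> A" and \<alpha>: "\<And>j::nat. \<alpha> j \<in> A"
    and step: "\<And>j. dvds v (\<alpha> j - u * \<alpha> (Suc j))"
  shows "dvds v (\<alpha> 0)"
proof -
  interpret N: noetherian_ring "ring_on A" by (rule noetherian)
  have uA: "u \<in> A"
    using u by (rule nonunitsD)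
  define I where "I j = {a * \<alpha> j + b * v | a b. a \<in> A \<and> b \<in> A}" for j
  have I: "ideal (I j) (ring_on A)" for j
    unfolding I_def Idl_two[OF \<alpha> v, symmetric] by (rule N.genideal_ideal) (use \<alpha> v in simp)
  have mono: "I j \<subseteq> I (Suc j)" for j
  proof
    fix x assume "x \<in> I j"
    then obtain a b where ab: "a \<in> A" "b \<in> A" "x = a * \<alpha> j + b * v"
      by (auto simp: I_def)
    obtain c where c: "c \<in> A" "\<alpha> j - u * \<alpha> (Suc j) = v * c"
      using step[of j] by (auto simp: dvds_def)
    have "x = a * (\<alpha> j - u * \<alpha> (Suc j)) + a * u * \<alpha> (Suc j) + b * v"
      by (simp add: ab algebra_simps)
    then have "x = (a * u) * \<alpha> (Suc j) + (a * c + b) * v"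
      unfolding c(2) by (simp add: algebra_simps)
    moreover have "a * u \<in> A" "a * c + b \<in> A"
      using ab c uA by auto
    ultimately show "x \<in> I (Suc j)"
      unfolding I_def by blast
  qed
  have "\<Union>(range I) \<in> range I"
  proof (rule N.ideal_chain_is_trivial)
    show "subset.chain {I. ideal I (ring_on A)} (range I)"
      unfolding pred_on.chain_def
    proof (intro conjI ballI)
      show "range I \<subseteq> {I. ideal I (ring_on A)}"
        using I by auto
      have "I i \<subseteq> I j \<or> I j \<subseteq> I i" for i j
        using lift_Suc_mono_le[of I, OF mono] linear[of i j] by blast
      then show "(\<subset>)\<^sup>=\<^sup>= x y \<or> (\<subset>)\<^sup>=\<^sup>= y x" if "x \<in> range I" "y \<in> range I" for x y
        using that by auto
    qed
  qed auto
  then obtain j where j: "\<Union>(range I) = I j"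
    by auto
  have "1 * \<alpha> (Suc j) + 0 * v \<in> I (Suc j)"
    unfolding I_def by blast
  then have "\<alpha> (Suc j) \<in> I j"
    using j by auto
  then obtain a b where ab: "a \<in> A" "b \<in> A" "\<alpha> (Suc j) = a * \<alpha> j + b * v"
    by (auto simp: I_def)
  obtain c where c: "c \<in> A" "\<alpha> j - u * \<alpha> (Suc j) = v * c"
    using step[of j] by (auto simp: dvds_def)
  have "\<alpha> (Suc j) = a * (\<alpha> j - u * \<alpha> (Suc j)) + a * u * \<alpha> (Suc j) + b * v"
    using ab(3) by (simp add: algebra_simps)
  then have "(1 - a * u) * \<alpha> (Suc j) = v * (a * c + b)"
    unfolding c(2) by (simp add: algebra_simps)
  moreover have inv: "1 - a * u \<noteq> 0" "inverse (1 - a * u) \<in> A"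
    using one_minus_unit[OF nonunits_mult[OF ab(1) u]] by auto
  ultimately have "\<alpha> (Suc j) = v * ((a * c + b) * inverse (1 - a * u))"
    by (simp add: field_simps)
  then have last: "dvds v (\<alpha> (Suc j))"
    using dvdsI[of "(a * c + b) * inverse (1 - a * u)" v] ab c inv by auto
  have "dvds v (\<alpha> i)" if "i \<le> Suc j" for i
    using that
  proof (induction rule: inc_induct)
    case base
    show ?case by (rule last)
  next
    case (step i)
    have "dvds v (u * \<alpha> (Suc i) + (\<alpha> i - u * \<alpha> (Suc i)))"
      using dvds_add dvds_mult step assms(4) uA by blast
    then show ?case by simp
  qed
  then show ?thesis by simp
qed

text \<open>
  The quotients by the powers of \<open>u\<close> cannot all lie in \<open>A\<close>: apply the descent with \<open>v = 0\<close>.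
\<close>

lemma finite_divisibility:
  assumes u: "u \<in> nonunits A" "u \<noteq> 0" and a: "a \<in> A" "a \<noteq> 0"
  obtains i b where "b \<in> A" "a = u ^ i * b" "\<not> dvds u b"
proof -
  have "\<exists>i. \<not> dvds (u ^ i) a"
  proof (rule ccontr)
    assume "\<not> ?thesis"
    then have all: "dvds (u ^ i) a" for i
      by blast
    have q: "a / u ^ j \<in> A" for j
      using all[of j] u(2) by (auto simp: dvds_def)
    have "dvds 0 (a / u ^ 0)"
    proof (rule infinite_descent[OF u(1) zero])
      show "dvds 0 (a / u ^ j - u * (a / u ^ Suc j))" for j
        using u(2) by (auto simp: dvds_def)
    qed (rule q)
    then show False
      using a(2) by (auto simp: dvds_def)
  qed
  define i where "i = (LEAST i. \<not> dvds (u ^ i) a)"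
  have i: "\<not> dvds (u ^ i) a" "\<And>j. j < i \<Longrightarrow> dvds (u ^ j) a"
    unfolding i_def using LeastI_ex[OF \<open>\<exists>i. \<not> dvds (u ^ i) a\<close>] not_less_Least by blast+
  have "i \<noteq> 0"
    using i(1) a(1) dvdsI[OF a(1), of 1] by (intro notI) simp
  then obtain l where l: "i = Suc l"
    by (cases i) auto
  obtain b where b: "b \<in> A" "a = u ^ l * b"
    using i(2)[of l] l by (auto simp: dvds_def)
  have "\<not> dvds u b"
  proof
    assume "dvds u b"
    then obtain c where "c \<in> A" "b = u * c"
      by (auto simp: dvds_def)
    then have "a = u ^ i * c"
      using b l by simp
    then show False
      using i(1) \<open>c \<in> A\<close> dvdsI by blast
  qed
  then show ?thesis
    using b that by blast
qed

text \<open>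
  If \<open>p, q\<close> generate the maximal ideal and \<open>q\<close> is regular modulo \<open>p\<close>, then \<open>A/pA\<close> is a discrete
  valuation ring with uniformizer \<open>q\<close>; in particular \<open>p\<close> is prime.
\<close>

lemma unit_times_power_mod:
  assumes gen: "nonunits A = {a * p + b * q | a b. a \<in> A \<and> b \<in> A}" and q: "q \<in> nonunits A" and p: "p \<in> A"
    and a: "a \<in> A" "\<not> dvds p a"
  obtains i e where "e \<in> A" "e \<notin> nonunits A" "dvds p (a - e * q ^ i)"
proof (rule ccontr)
  assume "\<not> thesis"
  then have no: "\<not> dvds p (a - e * q ^ i)" if "e \<in> A" "e \<notin> nonunits A" for e i
    using that \<open>\<And>e i. \<lbrakk>e \<in> A; e \<notin> nonunits A; dvds p (a - e * q ^ i)\<rbrakk> \<Longrightarrow> thesis\<close> by blast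
  have qA: "q \<in> A"
    using q by (rule nonunitsD)
  have "\<exists>\<alpha>::nat \<Rightarrow> 'a. \<forall>j. (\<alpha> j \<in> A \<and> dvds p (a - \<alpha> j * q ^ j)) \<and> dvds p (\<alpha> j - q * \<alpha> (Suc j))"
  proof (rule dependent_nat_choice)
    show "\<exists>x. x \<in> A \<and> dvds p (a - x * q ^ 0)"
      using a(1) dvdsI[OF zero, of p] by (intro exI[of _ a]) simp
    fix x j assume x: "x \<in> A \<and> dvds p (a - x * q ^ j)"
    then have "x \<in> nonunits A"
      using no by blast
    then obtain c d where cd: "c \<in> A" "d \<in> A" "x = c * p + d * q"
      using gen by blast
    have "dvds p (x - q * d)"
      using dvdsI[OF cd(1), of p] by (simp add: cd mult.commute)
    moreover have "dvds p (a - d * q ^ Suc j)"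
    proof -
      have "dvds p ((a - x * q ^ j) + q ^ j * (x - q * d))"
        using x \<open>dvds p (x - q * d)\<close> qA by (intro dvds_add dvds_mult) auto
      then show ?thesis
        by (simp add: algebra_simps)
    qed
    ultimately show "\<exists>y. (y \<in> A \<and> dvds p (a - y * q ^ Suc j)) \<and> dvds p (x - q * y)"
      using cd by blast
  qed
  then obtain \<alpha> where \<alpha>: "\<And>j::nat. \<alpha> j \<in> A" "\<And>j. dvds p (a - \<alpha> j * q ^ j)" "\<And>j. dvds p (\<alpha> j - q * \<alpha> (Suc j))"
    by blast
  have "dvds p (\<alpha> 0)"
    by (rule infinite_descent[where \<alpha> = \<alpha>]) (use q p \<alpha> in auto)
  then have "dvds p ((a - \<alpha> 0 * q ^ 0) + \<alpha> 0)"
    using \<alpha>(2)[of 0] dvds_add by blast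
  then show False
    using a(2) by simp
qed

lemma parameter_is_prime:
  assumes gen: "nonunits A = {a * p + b * q | a b. a \<in> A \<and> b \<in> A}"
    and p: "p \<in> nonunits A" and q: "q \<in> nonunits A"
    and reg: "\<And>c. c \<in> A \<Longrightarrow> dvds p (c * q) \<Longrightarrow> dvds p c"
  shows "prime_in A {c. dvds p c}"
proof -
  have pA: "p \<in> A" and qA: "q \<in> A"
    using p q by (auto intro: nonunitsD)
  have inA: "dvds p c \<Longrightarrow> c \<in> A" for c
    using pA by (auto simp: dvds_def)
  have nu: "dvds p c \<Longrightarrow> c \<in> nonunits A" for c
    using p nonunits_mult' by (auto simp: dvds_def)
  have reg': "dvds p c" if "c \<in> A" "dvds p (c * q ^ n)" for c n
    using that
  proof (induction n)
    case (Suc n)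
    then show ?case
      using reg[of "c * q ^ n"] qA by (simp add: mult_ac)
  qed simp
  have "dvds p a \<or> dvds p b" if a: "a \<in> A" and b: "b \<in> A" and ab: "dvds p (a * b)" for a b
  proof (rule ccontr)
    assume no: "\<not> (dvds p a \<or> dvds p b)"
    obtain i e where e: "e \<in> A" "e \<notin> nonunits A" "dvds p (a - e * q ^ i)"
      using unit_times_power_mod[OF gen q pA a] no by blast
    obtain j d where d: "d \<in> A" "d \<notin> nonunits A" "dvds p (b - d * q ^ j)"
      using unit_times_power_mod[OF gen q pA b] no by blast
    have "dvds p (a * b - (b * (a - e * q ^ i) + (e * q ^ i) * (b - d * q ^ j)))"
      by (rule dvds_diff[OF ab dvds_add[OF dvds_mult[OF e(3) b] dvds_mult[OF d(3)]]])
         (use e(1) qA in auto)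
    then have "dvds p ((e * d) * q ^ (i + j))"
      by (simp add: algebra_simps power_add)
    then have "dvds p (e * d)"
      by (rule reg'[OF mult[OF e(1) d(1)]])
    then have "e * d \<in> nonunits A"
      by (rule nu)
    then show False
      using unit_mult_iff[OF e(1,2) d(1)] d(2) by simp
  qed
  moreover have "\<not> dvds p 1"
    using nu[of 1] by auto
  ultimately show ?thesis
    using inA dvds_add dvds_mult dvdsI[OF zero, of p] unfolding prime_in_def by auto
qed

end


section \<open>The valuation of a branch and its centre\<close>

locale branch_valuation = fraction_embedding \<iota> + b: curve_branch ev f D
  for \<iota> :: "'k::{alg_closed_field, field_char_0} fps fps \<Rightarrow> 'f::Fields.field"
    and ev :: "'k fps fps \<Rightarrow> 'k fps" and f D +
  assumes f_nonzero: "f \<noteq> 0"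
begin

text \<open>
  The value along the branch. It is the composite of the \<open>f\<close>-adic valuation with the order in
  \<open>t\<close>; keeping the power series instead of its order makes it a ring homomorphism.
\<close>

definition restricts_to :: "'f \<Rightarrow> 'k fps \<Rightarrow> bool" where
  "restricts_to z h \<longleftrightarrow> (\<exists>a b. ev b \<noteq> 0 \<and> z * \<iota> b = \<iota> a \<and> ev a = h * ev b)"

definition V :: "'f set" where
  "V = {z. \<exists>h. restricts_to z h}"

definition \<pi> :: "'f \<Rightarrow> 'k fps" where
  "\<pi> z = (THE h. restricts_to z h)"

lemma \<iota>_eq_iff: "\<iota> a = \<iota> b \<longleftrightarrow> a = b"
  using inj[of "a - b"] diff[of a b] by auto

lemma restricts_to_unique:
  assumes "restricts_to z h" "restricts_to z h'"
  shows "h = h'"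
proof -
  obtain a b where ab: "ev b \<noteq> 0" "z * \<iota> b = \<iota> a" "ev a = h * ev b"
    using assms(1) by (auto simp: restricts_to_def)
  obtain c d where cd: "ev d \<noteq> 0" "z * \<iota> d = \<iota> c" "ev c = h' * ev d"
    using assms(2) by (auto simp: restricts_to_def)
  have "\<iota> (a * d) = \<iota> (c * b)"
    unfolding mult ab(2)[symmetric] cd(2)[symmetric] by (simp only: mult_ac)
  then have "a * d = c * b"
    by (simp only: \<iota>_eq_iff)
  then have "ev a * ev d = ev c * ev b"
    using b.ev.mult by metis
  then have "(h - h') * (ev b * ev d) = 0"
    by (simp add: ab cd algebra_simps)
  then show ?thesis
    using ab cd by simp
qed

lemma \<pi>_eq: "restricts_to z h \<Longrightarrow> \<pi> z = h"
  unfolding \<pi>_def using restricts_to_unique by blast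

lemma restricts_to_\<pi>: "z \<in> V \<Longrightarrow> restricts_to z (\<pi> z)"
  using \<pi>_eq by (auto simp: V_def)

lemma VI: "restricts_to z h \<Longrightarrow> z \<in> V"
  by (auto simp: V_def)

lemma restricts_to_\<iota>: "restricts_to (\<iota> r) (ev r)"
  unfolding restricts_to_def by (intro exI[of _ r] exI[of _ 1]) (simp add: one b.ev.one)

lemma restricts_to_add:
  assumes "restricts_to z h" "restricts_to z' h'"
  shows "restricts_to (z + z') (h + h')"
proof -
  obtain a b where ab: "ev b \<noteq> 0" "z * \<iota> b = \<iota> a" "ev a = h * ev b"
    using assms(1) by (auto simp: restricts_to_def)
  obtain c d where cd: "ev d \<noteq> 0" "z' * \<iota> d = \<iota> c" "ev c = h' * ev d"
    using assms(2) by (auto simp: restricts_to_def)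
  have "(z + z') * \<iota> (b * d) = \<iota> (a * d + c * b)"
    unfolding add mult ab(2)[symmetric] cd(2)[symmetric] by (simp add: algebra_simps)
  moreover have "ev (a * d + c * b) = (h + h') * ev (b * d)"
    by (simp add: b.ev.add b.ev.mult ab cd algebra_simps)
  moreover have "ev (b * d) \<noteq> 0"
    using ab cd by (simp add: b.ev.mult)
  ultimately show ?thesis
    unfolding restricts_to_def by blast
qed

lemma restricts_to_mult:
  assumes "restricts_to z h" "restricts_to z' h'"
  shows "restricts_to (z * z') (h * h')"
proof -
  obtain a b where ab: "ev b \<noteq> 0" "z * \<iota> b = \<iota> a" "ev a = h * ev b"
    using assms(1) by (auto simp: restricts_to_def)
  obtain c d where cd: "ev d \<noteq> 0" "z' * \<iota> d = \<iota> c" "ev c = h' * ev d"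
    using assms(2) by (auto simp: restricts_to_def)
  have "(z * z') * \<iota> (b * d) = \<iota> (a * c)"
    unfolding mult ab(2)[symmetric] cd(2)[symmetric] by (simp add: algebra_simps)
  moreover have "ev (a * c) = (h * h') * ev (b * d)"
    by (simp add: b.ev.mult ab cd algebra_simps)
  moreover have "ev (b * d) \<noteq> 0"
    using ab cd by (simp add: b.ev.mult)
  ultimately show ?thesis
    unfolding restricts_to_def by blast
qed

lemma V_\<iota>: "\<iota> r \<in> V" and \<pi>_\<iota>: "\<pi> (\<iota> r) = ev r"
  using restricts_to_\<iota> VI \<pi>_eq by blast+

lemma V_add: "z \<in> V \<Longrightarrow> z' \<in> V \<Longrightarrow> z + z' \<in> V" and
  \<pi>_add: "z \<in> V \<Longrightarrow> z' \<in> V \<Longrightarrow> \<pi> (z + z') = \<pi> z + \<pi> z'"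
  using restricts_to_add[OF restricts_to_\<pi> restricts_to_\<pi>] VI \<pi>_eq by blast+

lemma V_mult: "z \<in> V \<Longrightarrow> z' \<in> V \<Longrightarrow> z * z' \<in> V" and
  \<pi>_mult: "z \<in> V \<Longrightarrow> z' \<in> V \<Longrightarrow> \<pi> (z * z') = \<pi> z * \<pi> z'"
  using restricts_to_mult[OF restricts_to_\<pi> restricts_to_\<pi>] VI \<pi>_eq by blast+

lemma \<pi>_1: "\<pi> 1 = 1"
  using \<pi>_\<iota>[of 1] by (simp add: one b.ev.one)

lemma \<pi>_0: "\<pi> 0 = 0"
  using \<pi>_\<iota>[of 0] by (simp add: zero b.ev.zero)

lemma subring_set_V: "subring_set V"
proof -
  have "1 \<in> V" "- 1 \<in> V"
    using V_\<iota>[of 1] V_\<iota>[of "- 1"] by (simp_all add: one uminus)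
  then show ?thesis
    using V_add V_mult[of "- 1"] V_mult by (simp add: subring_set_def)
qed

text \<open>
  After cancelling \<open>f\<close>, numerator and denominator are not both zero on the branch, and one of them
  divides the other there.
\<close>

lemma valuation_ring_V: "valuation_ring V"
proof -
  interpret R: ring "ring_of_type_algebra :: 'f ring"
    by (rule ring_from_type_algebra)
  have neg: "\<ominus>\<^bsub>ring_of_type_algebra\<^esub> y = - y" for y :: 'f
    using R.minus_equality[of "- y" y] by simp
  have "subring V ring_of_type_algebra"
    by (rule R.subringI) (use subring_set_V in \<open>auto simp: neg subring_set_def\<close>)
  moreover have "z \<in> V \<or> inverse z \<in> V" for z
  proof -
    have "\<not> f dvd 1"
      using b.ev_eq_0_iff[of 1] by (simp add: b.ev.one)
    then obtain a c where ac: "c \<noteq> 0" "z = \<iota> a / \<iota> c" "\<not> (f dvd a \<and> f dvd c)"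
      using reduced_fraction by metis
    have rel: "z' \<in> V" if "ev c' dvd ev a'" "ev c' \<noteq> 0" "z' = \<iota> a' / \<iota> c'" for z' a' c'
    proof -
      have "c' \<noteq> 0"
        using that b.ev.zero by auto
      from that(1) obtain h where "ev a' = ev c' * h" ..
      then have "restricts_to z' h"
        unfolding restricts_to_def using that \<open>c' \<noteq> 0\<close>
        by (intro exI[of _ a'] exI[of _ c']) (simp add: mult.commute)
      then show ?thesis
        by (rule VI)
    qed
    have "ev a \<noteq> 0 \<or> ev c \<noteq> 0"
      using ac(3) by (simp add: b.ev_eq_0_iff)
    then consider "ev c \<noteq> 0" "ev c dvd ev a" | "ev a \<noteq> 0" "ev a dvd ev c"
      using nat_le_linear[of "subdegree (ev a)" "subdegree (ev c)"]
      by (cases "ev a = 0"; cases "ev c = 0") (auto simp: fps_dvd_iff)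
    then show ?thesis
    proof cases
      case 2
      then have "inverse z \<in> V"
        using ac by (intro rel[of a c]) simp_all
      then show ?thesis ..
    qed (use rel ac in blast)
  qed
  ultimately show ?thesis
    by (simp add: valuation_ring_def)
qed

lemma nonunits_V: "nonunits V = {z \<in> V. \<pi> z $ 0 = 0}"
proof -
  have "z = 0 \<or> inverse z \<notin> V \<longleftrightarrow> \<pi> z $ 0 = 0" if z: "z \<in> V" for z
  proof
    assume *: "z = 0 \<or> inverse z \<notin> V"
    show "\<pi> z $ 0 = 0"
    proof (rule ccontr)
      assume nz: "\<pi> z $ 0 \<noteq> 0"
      then have "z \<noteq> 0"
        by (auto simp: \<pi>_0)
      obtain a b where ab: "ev b \<noteq> 0" "z * \<iota> b = \<iota> a" "ev a = \<pi> z * ev b"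
        using restricts_to_\<pi>[OF z] by (auto simp: restricts_to_def)
      have "\<pi> z \<noteq> 0"
        using nz by auto
      then have "ev a \<noteq> 0"
        using ab by simp
      moreover have "inverse z * \<iota> a = \<iota> b"
        using \<open>z \<noteq> 0\<close> ab(2)[symmetric] by simp
      moreover have "ev b = inverse (\<pi> z) * ev a"
        using nz by (simp add: ab mult.assoc[symmetric] inverse_mult_eq_1)
      ultimately have "restricts_to (inverse z) (inverse (\<pi> z))"
        unfolding restricts_to_def by blast
      then show False
        using * \<open>z \<noteq> 0\<close> VI by blast
    qed
  next
    assume 0: "\<pi> z $ 0 = 0"
    show "z = 0 \<or> inverse z \<notin> V"
    proof (rule ccontr)
      assume "\<not> (z = 0 \<or> inverse z \<notin> V)"
      then have "z \<noteq> 0" "inverse z \<in> V" by auto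
      then have "\<pi> z * \<pi> (inverse z) = 1"
        using \<pi>_mult[OF z, of "inverse z"] by (simp add: \<pi>_1)
      then have "(\<pi> z * \<pi> (inverse z)) $ 0 = 1"
        by simp
      then show False
        using 0 by simp
    qed
  qed
  then show ?thesis
    unfolding nonunits_iff set_eq_iff mem_Collect_eq by blast
qed

end

lemma Idl_ring_on_empty:
  assumes "cring (ring_on A)"
  shows "Idl\<^bsub>ring_on A\<^esub> {} \<subseteq> {0}"
proof -
  interpret cring "ring_on A" by fact
  show ?thesis
    using genideal_minimal[OF zeroideal, of "{}"] by simp
qed

text \<open>
  A point \<open>A\<close> of a resolution at which the valuation of the branch is centred. This is the closed
  point of the strict transform.
\<close>

locale branch_centre = branch_valuation \<iota> ev f D + A: noetherian_local A
  for \<iota> :: "'k::{alg_closed_field, field_char_0} fps fps \<Rightarrow> 'f::Fields.field"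
    and ev :: "'k fps fps \<Rightarrow> 'k fps" and f D and A :: "'f set" +
  assumes A_\<iota>: "\<iota> r \<in> A" and A_V: "A \<subseteq> V" and A_nonunits: "nonunits A = nonunits V \<inter> A"
begin

sublocale dominating_ring \<iota> A
proof
  show "\<iota> r \<in> A" for r
    by (rule A_\<iota>)
  show "\<iota> r \<in> nonunits A \<longleftrightarrow> r $ 0 $ 0 = 0" for r
    using A_\<iota> V_\<iota> by (simp add: A_nonunits nonunits_V \<pi>_\<iota> b.ev_nth_0)
qed

lemma \<pi>_A: "a \<in> A \<Longrightarrow> a \<in> nonunits A \<longleftrightarrow> \<pi> a $ 0 = 0"
  using A_V by (auto simp: A_nonunits nonunits_V)

lemma \<pi>_A_add: "a \<in> A \<Longrightarrow> b \<in> A \<Longrightarrow> \<pi> (a + b) = \<pi> a + \<pi> b"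
  and \<pi>_A_mult: "a \<in> A \<Longrightarrow> b \<in> A \<Longrightarrow> \<pi> (a * b) = \<pi> a * \<pi> b"
  using A_V \<pi>_add \<pi>_mult by blast+

lemma \<pi>_A_power: "a \<in> A \<Longrightarrow> \<pi> (a ^ n) = \<pi> a ^ n"
  by (induction n) (simp_all add: \<pi>_1 \<pi>_A_mult)

lemma \<pi>_unit: "a \<in> A \<Longrightarrow> a \<notin> nonunits A \<Longrightarrow> \<pi> a \<noteq> 0"
  using \<pi>_A by force

lemma \<pi>_f: "\<pi> (\<iota> f) = 0"
  by (simp add: \<pi>_\<iota> b.ev_eq_0_iff)

lemma nonunit_off_branch: "\<exists>z\<in>nonunits A. \<pi> z \<noteq> 0"
proof -
  obtain r where r: "ev r = fps_X ^ Suc D"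
    using b.conductor[of "fps_X ^ Suc D"] by (auto simp del: power_Suc)
  then have "r $ 0 $ 0 = 0"
    by (simp add: b.ev_nth_0[symmetric])
  then have "\<iota> r \<in> nonunits A"
    by (simp add: dominates)
  moreover have "\<pi> (\<iota> r) \<noteq> 0"
    using r by (simp add: \<pi>_\<iota>)
  ultimately show ?thesis
    by blast
qed

text \<open>
  There are exactly two parameters: at least one vanishes on the branch, since \<open>f\<close> does, and not
  all of them, since by the conductor \<open>A\<close> has nonunits that do not vanish on the branch. The parameter
  \<open>v\<close> that vanishes on the branch has exponent one because its numerator is a multiple of \<open>f\<close>, and
  \<open>f\<close> generates the prime ideal of the branch.
\<close>

lemma local_equation:
  assumes snc: "snc_at A (\<iota> f)"
  obtains e u v k where "e \<in> A" "e \<notin> nonunits A" "\<iota> f = e * u ^ k * v"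
    "u \<in> nonunits A" "v \<in> nonunits A" "nonunits A = {a * u + b * v | a b. a \<in> A \<and> b \<in> A}"
    "\<pi> v = 0" "\<pi> u \<noteq> 0"
proof -
  note conclude = that
  obtain us ks e where us: "regular_system_of_parameters A us" and len: "length ks = length us"
    and e: "e \<in> Units (ring_on A)" and f: "\<iota> f = e * prod_list (map2 (\<lambda>u k. u ^ k) us ks)"
    using snc by (auto simp: snc_at_def)
  have eA: "e \<in> A" "e \<notin> nonunits A"
    using e by (simp_all add: Units_ring_on nonunits_iff)
  have usA: "set us \<subseteq> A" and m: "nonunits A = Idl\<^bsub>ring_on A\<^esub> (set us)"
    and dim: "krull_dim (ring_on A) = enat (length us)"
    using us by (auto simp: regular_system_of_parameters_def)
  have fm: "\<iota> f \<in> nonunits A"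
    using \<pi>_A[OF A_\<iota>] \<pi>_f by simp
  have f0: "\<iota> f \<noteq> 0"
    using f_nonzero by simp
  consider "us = []" | w where "us = [w]" | u1 u2 where "us = [u1, u2]"
    using krull_dim_le_2[OF dim] by (cases us; cases "tl us"; cases "tl (tl us)") auto
  then show ?thesis
  proof cases
    case 1
    then have "nonunits A \<subseteq> {0}"
      using Idl_ring_on_empty[OF A.cring_ring] m by simp
    then show ?thesis
      using fm f0 by auto
  next
    case (2 w)
    then obtain k where "ks = [k]"
      using len by (cases ks) auto
    then have fw: "\<iota> f = e * w ^ k"
      using f 2 by simp
    have wA: "w \<in> A"
      using usA 2 by simp
    have "0 = \<pi> e * \<pi> w ^ k"
      using \<pi>_f wA eA by (simp add: fw \<pi>_A_mult \<pi>_A_power)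
    then have "\<pi> w = 0"
      using \<pi>_unit[OF eA] by auto
    moreover have "nonunits A = {a * w + b * w | a b. a \<in> A \<and> b \<in> A}"
      using m A.Idl_two[OF wA wA] 2 by simp
    ultimately have "\<pi> z = 0" if "z \<in> nonunits A" for z
      using that wA by (auto simp: \<pi>_A_add \<pi>_A_mult)
    then show ?thesis
      using nonunit_off_branch by blast
  next
    case (3 u1 u2)
    then obtain k1 k2 where "ks = [k1, k2]"
      using len by (cases ks; cases "tl ks") auto
    then have f12: "\<iota> f = e * u1 ^ k1 * u2 ^ k2"
      using f 3 by (simp add: mult.assoc)
    have u12A: "u1 \<in> A" "u2 \<in> A"
      using usA 3 by auto
    have gen: "nonunits A = {a * u1 + b * u2 | a b. a \<in> A \<and> b \<in> A}"
      using m A.Idl_two[OF u12A] 3 by simp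
    have u12m: "u1 \<in> nonunits A" "u2 \<in> nonunits A"
    proof -
      have "1 * u1 + 0 * u2 \<in> nonunits A" "0 * u1 + 1 * u2 \<in> nonunits A"
        unfolding gen by blast+
      then show "u1 \<in> nonunits A" "u2 \<in> nonunits A" by simp_all
    qed
    have notboth: "\<not> (\<pi> u1 = 0 \<and> \<pi> u2 = 0)"
    proof
      assume "\<pi> u1 = 0 \<and> \<pi> u2 = 0"
      then have "\<pi> z = 0" if "z \<in> nonunits A" for z
        using that u12A unfolding gen by (auto simp: \<pi>_A_add \<pi>_A_mult)
      then show False
        using nonunit_off_branch by blast
    qed
    have main: thesis if f: "\<iota> f = e * u ^ k * v ^ l" and uvA: "u \<in> A" "v \<in> A" and uvm: "u \<in> nonunits A" "v \<in> nonunits A"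
      and gen: "nonunits A = {a * u + b * v | a b. a \<in> A \<and> b \<in> A}" and pv: "\<pi> v = 0" "\<pi> u \<noteq> 0" for u v k l
    proof -
      have "0 = \<pi> e * \<pi> u ^ k * \<pi> v ^ l"
        using \<pi>_f uvA eA by (simp add: f \<pi>_A_mult \<pi>_A_power)
      then have "l \<noteq> 0"
        using \<pi>_unit[OF eA] pv by (intro notI) simp
      obtain p q where pq: "ev q \<noteq> 0" "e * \<iota> q = \<iota> p" "ev p = \<pi> e * ev q"
        using restricts_to_\<pi>[of e] A_V eA by (auto simp: restricts_to_def)
      obtain c d where cd: "ev d \<noteq> 0" "u * \<iota> d = \<iota> c" "ev c = \<pi> u * ev d"
        using restricts_to_\<pi>[of u] A_V uvA by (auto simp: restricts_to_def)
      obtain a b where ab: "ev b \<noteq> 0" "v * \<iota> b = \<iota> a" "ev a = \<pi> v * ev b"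
        using restricts_to_\<pi>[of v] A_V uvA by (auto simp: restricts_to_def)
      then have "ev a = 0"
        by (simp add: pv)
      then obtain a' where a': "a = f * a'"
        by (auto simp: b.ev_eq_0_iff)
      have "\<iota> (f * (q * (d ^ k * b ^ l))) = (e * \<iota> q) * ((u * \<iota> d) ^ k * (v * \<iota> b) ^ l)"
        unfolding mult power f power_mult_distrib by (simp only: mult_ac)
      also have "\<dots> = \<iota> (p * (c ^ k * a ^ l))"
        unfolding pq(2) cd(2) ab(2) mult power ..
      finally have eq: "f * (q * (d ^ k * b ^ l)) = p * (c ^ k * a ^ l)"
        by (simp only: \<iota>_eq_iff)
      have "l = 1"
      proof (rule ccontr)
        assume "l \<noteq> 1"
        then obtain l' where l': "l = Suc (Suc l')"
          using \<open>l \<noteq> 0\<close> by (metis One_nat_def not0_implies_Suc)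
        have "a ^ l = f * (f * (a' * a' * a ^ l'))"
          by (simp add: l' a')
        then have "f * (q * (d ^ k * b ^ l)) = f * (f * (p * c ^ k * (a' * a' * a ^ l')))"
          using eq by (simp only: mult_ac)
        then have "q * (d ^ k * b ^ l) = f * (p * c ^ k * (a' * a' * a ^ l'))"
          using f0 by simp
        then have "ev (q * (d ^ k * b ^ l)) = 0"
          by (simp add: b.ev_eq_0_iff)
        then show False
          using pq cd ab by (simp add: b.ev.mult b.ev.power)
      qed
      then show thesis
        using conclude[OF eA _ uvm gen pv, of k] f by simp
    qed
    have "0 = \<pi> e * \<pi> u1 ^ k1 * \<pi> u2 ^ k2"
      using \<pi>_f u12A eA by (simp add: f12 \<pi>_A_mult \<pi>_A_power)
    then have "\<pi> u1 = 0 \<or> \<pi> u2 = 0"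
      using \<pi>_unit[OF eA] by auto
    then show ?thesis
    proof
      assume "\<pi> u2 = 0"
      then show ?thesis
        using main[OF f12 u12A u12m gen] notboth by blast
    next
      assume "\<pi> u1 = 0"
      moreover have "{a * u1 + b * u2 | a b. a \<in> A \<and> b \<in> A} = {a * u2 + b * u1 | a b. a \<in> A \<and> b \<in> A}"
        by (rule two_generators_commute)
      moreover have "\<iota> f = e * u2 ^ k2 * u1 ^ k1"
        by (simp add: f12 mult_ac)
      ultimately show ?thesis
        using main[of u2 k2 u1 k1] u12A u12m gen notboth by simp
    qed
  qed
qed

end


section \<open>Components of the total transform\<close>

context noetherian_local
begin

text \<open>
  A prime parameter \<open>p\<close> at a point of \<open>Y\<close> defines a prime divisor, whose local ring is the
  localisation of \<open>A\<close> at \<open>pA\<close>. It is a discrete valuation ring, hence a maximal subring of the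
  field; this gives both the maximality required of a component and the multiplicity.
\<close>

lemma component_of_parameter:
  fixes p F c :: 'a and l :: nat
  assumes Y: "Y = (\<Union>B\<in>\<B>. affine_model B)" "A \<in> Y" "\<And>B. B \<in> Y \<Longrightarrow> subring_set B"
    and fractions: "\<And>z. \<exists>a\<in>A. \<exists>b\<in>A. b \<noteq> 0 \<and> z = a / b"
    and p: "p \<in> nonunits A" "p \<noteq> 0" "prime_in A {c. dvds p c}"
    and F: "F = c * p ^ l" "c \<in> A" "\<not> dvds p c" "l \<ge> 1"
  shows "\<exists>C\<in>components Y F. order_along C F = l"
proof -
  let ?P = "{c. dvds p c}"
  define C where "C = localization A ?P"
  have pA: "p \<in> A"
    using p(1) by (rule nonunitsD)
  have p1: "\<not> dvds p 1"
    using p(3) by (simp add: prime_in_def)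
  have pm: "dvds p a \<or> dvds p b" if "dvds p (a * b)" "a \<in> A" "b \<in> A" for a b
    using p(3) that by (auto simp: prime_in_def)
  have p0: "dvds p 0"
    using p(3) by (simp add: prime_in_def)
  have CI: "a / s \<in> C" if "a \<in> A" "s \<in> A" "\<not> dvds p s" for a s
    using that by (auto simp: C_def localization_def)
  have CE: "\<exists>a s. z = a / s \<and> a \<in> A \<and> s \<in> A \<and> \<not> dvds p s" if "z \<in> C" for z
    using that by (auto simp: C_def localization_def)
  have AC: "a \<in> C" if "a \<in> A" for a
    using CI[OF that one p1] by simp
  have "C \<in> Y"
  proof -
    obtain B P where B: "B \<in> \<B>" "A = localization B P" "primeideal P (ring_on B)"
      using Y(1,2) by (auto simp: affine_model_def)
    have Bs: "subring_set B" and P: "prime_in B P"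
      using B(3) by (simp_all add: primeideal_ring_on)
    interpret B: field_subring B
      using Bs by unfold_locales
    have PB: "P \<subseteq> B" "1 \<notin> P"
      using P by (simp_all add: prime_in_def)
    have BA: "b \<in> A" if "b \<in> B" for b
    proof -
      have "b / 1 \<in> localization B P"
        unfolding localization_def using that PB by blast
      then show ?thesis
        using B(2) by simp
    qed
    define P' where "P' = {b \<in> B. dvds p b}"
    have "prime_in B P'"
      unfolding prime_in_def P'_def
      using p1 p0 pm BA dvds_add dvds_mult by auto
    moreover have "localization B P' = C"
    proof
      show "localization B P' \<subseteq> C"
        using BA CI by (auto simp: localization_def P'_def)
      show "C \<subseteq> localization B P'"
      proof
        fix z assume "z \<in> C"
        then obtain a s where z: "z = a / s" "a \<in> A" "s \<in> A" "\<not> dvds p s"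
          using CE by blast
        obtain a' ta where a: "a = a' / ta" "a' \<in> B" "ta \<in> B" "ta \<notin> P"
          using z(2) unfolding B(2) localization_def by blast
        obtain s' ts where s: "s = s' / ts" "s' \<in> B" "ts \<in> B" "ts \<notin> P"
          using z(3) unfolding B(2) localization_def by blast
        have nz: "ta \<noteq> 0" "ts \<noteq> 0"
          using a(4) s(4) P by (auto simp: prime_in_def)
        have unit: "inverse ta \<in> A"
        proof -
          have "1 / ta \<in> localization B P"
            unfolding localization_def using a(3,4) B.one by blast
          then show ?thesis
            using B(2) by (simp add: inverse_eq_divide)
        qed
        have "\<not> dvds p ta"
        proof
          assume "dvds p ta"
          then have "dvds p (inverse ta * ta)"
            using unit by (rule dvds_mult)
          then show False
            using p1 nz by simp
        qed
        moreover have "\<not> dvds p s'"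
        proof
          assume "dvds p s'"
          have "inverse ts \<in> A"
          proof -
            have "1 / ts \<in> localization B P"
              unfolding localization_def using s(3,4) B.one by blast
            then show ?thesis
              using B(2) by (simp add: inverse_eq_divide)
          qed
          then have "dvds p (inverse ts * s')"
            using \<open>dvds p s'\<close> by (intro dvds_mult)
          then show False
            using z(4) s(1) by (simp add: field_simps)
        qed
        ultimately have "ta * s' \<in> B - P'"
          using a s pm BA by (auto simp: P'_def)
        moreover have "z = (a' * ts) / (ta * s')"
          using z(1) a(1) s(1) nz by (simp add: field_simps)
        moreover have "a' * ts \<in> B"
          using a s by simp
        ultimately show "z \<in> localization B P'"
          unfolding localization_def by blast
      qed
    qed
    ultimately show ?thesis
      using Y(1) B(1) Bs by (auto simp: affine_model_def primeideal_ring_on)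
  qed
  have unitC: "z \<noteq> 0 \<and> inverse z \<in> C \<longleftrightarrow> \<not> dvds p a"
    if z: "z = a / s" "a \<in> A" "s \<in> A" "\<not> dvds p s" for z a s
  proof
    assume *: "z \<noteq> 0 \<and> inverse z \<in> C"
    then obtain b t where bt: "inverse z = b / t" "b \<in> A" "t \<in> A" "\<not> dvds p t"
      using CE by blast
    have "s \<noteq> 0" "t \<noteq> 0"
      using z bt p0 by auto
    then have "a = z * s" "b = inverse z * t"
      using z bt by simp_all
    then have "s * t = b * a"
      using * by simp
    show "\<not> dvds p a"
    proof
      assume "dvds p a"
      then have "dvds p (s * t)"
        unfolding \<open>s * t = b * a\<close> by (rule dvds_mult[OF _ bt(2)])
      then show False
        using pm z bt by blast
    qed
  next
    assume na: "\<not> dvds p a"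
    then have "a \<noteq> 0" "s \<noteq> 0"
      using z p0 by auto
    then show "z \<noteq> 0 \<and> inverse z \<in> C"
      using CI[of s a] z na by simp
  qed
  have nonunitsC: "nonunits C = {x * p | x. x \<in> C}"
  proof
    show "nonunits C \<subseteq> {x * p | x. x \<in> C}"
    proof
      fix z assume z: "z \<in> nonunits C"
      then have "z \<in> C"
        by (simp add: nonunits_iff)
      then obtain a s where as: "z = a / s" "a \<in> A" "s \<in> A" "\<not> dvds p s"
        using CE by blast
      then have "dvds p a"
        using unitC[OF as] z by (auto simp: nonunits_iff)
      then obtain a' where "a' \<in> A" "a = p * a'"
        by (auto simp: dvds_def)
      then show "z \<in> {x * p | x. x \<in> C}"
        using as CI[of a' s] by (intro CollectI exI[of _ "a' / s"]) simp
    qed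
    show "{x * p | x. x \<in> C} \<subseteq> nonunits C"
    proof clarify
      fix x assume "x \<in> C"
      then obtain a s where as: "x = a / s" "a \<in> A" "s \<in> A" "\<not> dvds p s"
        using CE by blast
      have eq: "x * p = (p * a) / s"
        using as by simp
      have "x * p \<in> C"
        unfolding eq using CI as pA by blast
      then show "x * p \<in> nonunits C"
        using unitC[OF eq _ as(3,4)] dvdsI[OF as(2), of p] as(2) pA by (auto simp: nonunits_iff)
    qed
  qed
  have C_mult: "z * z' \<in> C" if zz: "z \<in> C" "z' \<in> C" for z z'
  proof -
    obtain a s where as: "z = a / s" "a \<in> A" "s \<in> A" "\<not> dvds p s"
      using CE[OF zz(1)] by blast
    obtain b t where bt: "z' = b / t" "b \<in> A" "t \<in> A" "\<not> dvds p t"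
      using CE[OF zz(2)] by blast
    have "z * z' = (a * b) / (s * t)"
      using as bt by simp
    then show ?thesis
      using CI[of "a * b" "s * t"] as bt pm by auto
  qed
  have outside: "\<exists>x\<in>C. z * (p * x) = 1" if "z \<notin> C" for z
  proof -
    obtain a b where ab: "a \<in> A" "b \<in> A" "b \<noteq> 0" "z = a / b"
      using fractions by blast
    have "a \<noteq> 0"
      using that AC[OF zero] ab by auto
    obtain i a' where a': "a' \<in> A" "a = p ^ i * a'" "\<not> dvds p a'"
      using finite_divisibility[OF p(1,2) ab(1) \<open>a \<noteq> 0\<close>] by blast
    obtain j b' where b': "b' \<in> A" "b = p ^ j * b'" "\<not> dvds p b'"
      using finite_divisibility[OF p(1,2) ab(2,3)] by blast
    have nz: "a' \<noteq> 0" "b' \<noteq> 0"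
      using a' b' p0 by auto
    have "i < j"
    proof (rule ccontr)
      assume "\<not> i < j"
      then have "p ^ i = p ^ j * p ^ (i - j)"
        by (simp add: power_add[symmetric])
      then have "z = (p ^ (i - j) * a') / b'"
        using ab a' b' p(2) by simp
      then show False
        using that CI[of "p ^ (i - j) * a'" b'] a' b' pA by simp
    qed
    then obtain d where "j = Suc (i + d)"
      using less_imp_Suc_add by blast
    then have "z * (p * ((p ^ d * b') / a')) = 1"
      using ab a' b' p(2) nz by (simp add: power_add field_simps)
    moreover have "(p ^ d * b') / a' \<in> C"
      using CI a' b' pA by simp
    ultimately show ?thesis by blast
  qed
  have cC: "c \<in> C" "c \<noteq> 0" "inverse c \<in> C"
    using unitC[of c c 1] AC F p1 by auto
  have F0: "F \<noteq> 0"
    using cC p F by simp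
  obtain l' where l': "l = Suc l'"
    using F(4) by (cases l) auto
  have FC: "F \<in> nonunits C"
  proof -
    have "F = (c * p ^ l') * p"
      by (simp add: F l')
    then show ?thesis
      unfolding nonunitsC using AC[of "c * p ^ l'"] F(2) pA by blast
  qed
  have "C \<in> components Y F"
    unfolding components_def
  proof (intro CollectI conjI ballI impI)
    fix B assume B: "B \<in> Y" "C \<subseteq> B \<and> F \<in> nonunits B"
    interpret B: field_subring B
      using Y(3)[OF B(1)] by unfold_locales
    show "B = C"
    proof (rule ccontr)
      assume "B \<noteq> C"
      then obtain z where z: "z \<in> B" "z \<notin> C"
        using B(2) by blast
      then obtain x where x: "x \<in> C" "z * (p * x) = 1"
        using outside by blast
      then have "inverse p = z * x"
        by (metis mult.left_commute inverse_unique)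
      then have "inverse p \<in> B"
        using z x B(2) by auto
      moreover have "inverse F = inverse c * inverse p ^ l"
        by (simp add: F power_inverse)
      ultimately have "inverse F \<in> B"
        using cC B(2) by auto
      then show False
        using B(2) F0 by (simp add: nonunits_iff)
    qed
  qed (use \<open>C \<in> Y\<close> FC in auto)
  moreover have "order_along C F = l"
    unfolding order_along_def
  proof (rule the_equality)
    have PI: "PIdl\<^bsub>ring_on C\<^esub> u = {x * u | x. x \<in> C}" for u
      by (simp add: cgenideal_def)
    show "\<exists>u\<in>C. \<exists>e\<in>Units (ring_on C). nonunits C = PIdl\<^bsub>ring_on C\<^esub> u \<and> F = e * u ^ l"
      using AC[OF pA] cC by (intro bexI[of _ p] bexI[of _ c]) (auto simp: PI nonunitsC F(1) Units_ring_on)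
    fix k assume "\<exists>u\<in>C. \<exists>e\<in>Units (ring_on C). nonunits C = PIdl\<^bsub>ring_on C\<^esub> u \<and> F = e * u ^ k"
    then obtain u e where u: "u \<in> C" "nonunits C = {x * u | x. x \<in> C}" and e: "e \<in> C" "e \<noteq> 0" "inverse e \<in> C"
      and Fu: "F = e * u ^ k"
      by (auto simp: PI Units_ring_on)
    have "1 \<in> C"
      using AC by simp
    then have "1 * u \<in> nonunits C" "1 * p \<in> nonunits C"
      using u(2) nonunitsC by blast+
    moreover obtain x where x: "x \<in> C" "u = x * p"
      using \<open>1 * u \<in> nonunits C\<close> unfolding nonunitsC by auto
    moreover obtain y where y: "y \<in> C" "p = y * u"
      using \<open>1 * p \<in> nonunits C\<close> unfolding u(2) by auto
    have "(x * y) * p = y * u"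
      unfolding x(2) by (simp only: mult_ac)
    then have "p = (x * y) * p"
      using y(2) by (simp only:)
    then have xy: "x * y = 1"
      using p(2) by simp
    have Cpow: "z ^ n \<in> C" if "z \<in> C" for z n
      using that AC[OF one] C_mult by (induction n) auto
    have unit_no: False if "z \<in> C" "inverse z \<in> C" "z \<noteq> 0" "z = w * p" "w \<in> C" for z w
    proof -
      have "z \<in> nonunits C"
        using that nonunitsC by blast
      then show False
        using that by (simp add: nonunits_iff)
    qed
    have eq: "e * x ^ k * p ^ k = c * p ^ l"
      using Fu F(1) x by (simp add: power_mult_distrib mult.assoc)
    define z where "z = e * x ^ k"
    have z: "z \<in> C" "z \<noteq> 0" "inverse z \<in> C"
    proof -
      have "inverse x = y"
        using xy by (rule inverse_unique)
      moreover have "inverse z = inverse e * inverse x ^ k"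
        by (simp add: z_def power_inverse)
      ultimately have "inverse z = inverse e * y ^ k"
        by simp
      then show "z \<in> C" "z \<noteq> 0" "inverse z \<in> C"
        using xy e C_mult Cpow x(1) y(1) by (auto simp: z_def)
    qed
    show "k = l"
    proof (rule linorder_cases[of k l])
      assume "k < l"
      then obtain d where d: "l = Suc (k + d)"
        using less_imp_Suc_add by blast
      then have "z * p ^ k = ((c * p ^ d) * p) * p ^ k"
        using eq by (simp add: z_def power_add mult_ac)
      then have "z = (c * p ^ d) * p"
        using p(2) by simp
      then show ?thesis
        using unit_no[OF z(1,3,2)] AC[of "c * p ^ d"] F(2) pA by blast
    next
      assume "l < k"
      then obtain d where d: "k = Suc (l + d)"
        using less_imp_Suc_add by blast
      have "c * p ^ l = z * p ^ k"
        using eq by (simp add: z_def)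
      also have "\<dots> = ((z * p ^ d) * p) * p ^ l"
        by (simp add: d power_add)
      finally have "c * p ^ l = ((z * p ^ d) * p) * p ^ l" .
      then have "c = (z * p ^ d) * p"
        using p(2) by simp
      then show ?thesis
        using unit_no[OF cC(1,3,2)] C_mult[OF z(1) Cpow[OF AC[OF pA]]] by blast
    qed
  qed
  ultimately show ?thesis
    by blast
qed

end


section \<open>Local coordinates at the strict transform\<close>

locale branch_chart = branch_centre \<iota> ev f D A
  for \<iota> :: "'k::{alg_closed_field, field_char_0} fps fps \<Rightarrow> 'f::Fields.field"
    and ev :: "'k fps fps \<Rightarrow> 'k fps" and f D and A :: "'f set" +
  fixes e u v :: 'f and k :: nat
  assumes e: "e \<in> A" "e \<notin> nonunits A" and f_eq: "\<iota> f = e * u ^ k * v"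
    and u: "u \<in> nonunits A" and v: "v \<in> nonunits A"
    and generators: "nonunits A = {a * u + b * v | a b. a \<in> A \<and> b \<in> A}"
    and \<pi>_v: "\<pi> v = 0" and \<pi>_u: "\<pi> u \<noteq> 0"
begin

lemma uA: "u \<in> A" and vA: "v \<in> A"
  using u v by (auto intro: A.nonunitsD)

lemma u_nonzero: "u \<noteq> 0"
  using \<pi>_u \<pi>_0 by auto

lemma v_nonzero: "v \<noteq> 0"
  using f_eq f_nonzero by auto

text \<open>
  An element that vanishes on the branch is modulo \<open>v\<close> a multiple of \<open>u\<close> by another such element;
  iterating this, it is zero modulo \<open>v\<close> by descent. So \<open>A/vA\<close> embeds into \<open>K[[t]]\<close>.
\<close>

lemma dvds_v_iff:
  assumes "z \<in> A"
  shows "A.dvds v z \<longleftrightarrow> \<pi> z = 0"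
proof
  assume "A.dvds v z"
  then show "\<pi> z = 0"
    using vA \<pi>_v by (auto simp: A.dvds_def \<pi>_A_mult)
next
  assume z: "\<pi> z = 0"
  define next_quotient where "next_quotient x = (SOME y. (y \<in> A \<and> \<pi> y = 0) \<and> A.dvds v (x - u * y))" for x
  have step: "(next_quotient x \<in> A \<and> \<pi> (next_quotient x) = 0) \<and> A.dvds v (x - u * next_quotient x)"
    if x: "x \<in> A" "\<pi> x = 0" for x
  proof -
    have "x \<in> nonunits A"
      using x \<pi>_A by simp
    then obtain a b where ab: "a \<in> A" "b \<in> A" "x = a * u + b * v"
      using generators by blast
    then have "\<pi> a = 0"
      using x uA vA \<pi>_u \<pi>_v by (simp add: \<pi>_A_add \<pi>_A_mult)
    moreover have "A.dvds v (x - u * a)"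
      using A.dvdsI[OF ab(2), of v] by (simp add: ab mult.commute)
    ultimately have "(a \<in> A \<and> \<pi> a = 0) \<and> A.dvds v (x - u * a)"
      using ab(1) by simp
    then show ?thesis
      unfolding next_quotient_def by (rule someI)
  qed
  define \<alpha> where "\<alpha> j = (next_quotient ^^ j) z" for j
  have \<alpha>0: "\<alpha> j \<in> A \<and> \<pi> (\<alpha> j) = 0" for j
    by (induction j) (use assms z step in \<open>auto simp: \<alpha>_def\<close>)
  have \<alpha>: "\<alpha> 0 = z" "\<And>j. \<alpha> j \<in> A" "\<And>j. A.dvds v (\<alpha> j - u * \<alpha> (Suc j))"
    using \<alpha>0 step by (auto simp: \<alpha>_def)
  have "A.dvds v (\<alpha> 0)"
    by (rule A.infinite_descent[where \<alpha> = \<alpha>]) (use u vA \<alpha> in auto)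
  then show "A.dvds v z"
    by (simp add: \<alpha>)
qed

lemma regular_uv:
  assumes c: "c \<in> A" and "A.dvds u (c * v)"
  shows "A.dvds u c"
proof -
  obtain a where a: "a \<in> A" "c * v = u * a"
    using assms(2) by (auto simp: A.dvds_def)
  have "\<pi> u * \<pi> a = \<pi> (c * v)"
    using a uA by (simp add: \<pi>_A_mult)
  also have "\<dots> = 0"
    using c vA \<pi>_v by (simp add: \<pi>_A_mult)
  finally have "A.dvds v a"
    using \<pi>_u a by (simp add: dvds_v_iff)
  then obtain b where b: "b \<in> A" "a = v * b"
    by (auto simp: A.dvds_def)
  have "c * v = (u * b) * v"
    using a b by (simp add: mult_ac)
  then have "c = u * b"
    using v_nonzero by simp
  then show ?thesis
    using b by (simp add: A.dvdsI)
qed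

lemma regular_vu:
  assumes c: "c \<in> A" and "A.dvds v (c * u)"
  shows "A.dvds v c"
proof -
  have "\<pi> c * \<pi> u = 0"
    using assms uA by (simp add: dvds_v_iff \<pi>_A_mult)
  then show ?thesis
    using \<pi>_u c by (simp add: dvds_v_iff)
qed

lemma generators': "nonunits A = {a * v + b * u | a b. a \<in> A \<and> b \<in> A}"
  unfolding generators by (rule two_generators_commute)

lemma prime_u: "prime_in A {c. A.dvds u c}"
  by (rule A.parameter_is_prime[OF generators u v regular_uv])

lemma prime_v: "prime_in A {c. A.dvds v c}"
  by (rule A.parameter_is_prime[OF generators' v u regular_vu])

lemma dvds_u_cancel:
  assumes "a \<in> A" "b \<in> A" "A.dvds u (a * b)" "\<not> A.dvds u b"
  shows "A.dvds u a"
  using prime_u assms by (auto simp: prime_in_def)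

lemma not_dvds_u_unit: "z \<in> A \<Longrightarrow> z \<notin> nonunits A \<Longrightarrow> \<not> A.dvds u z"
  using u A.nonunits_mult' by (auto simp: A.dvds_def)

text \<open>
  Every order on the branch of an element of \<open>A\<close> is a multiple of the order of \<open>u\<close>, and all large
  orders occur.
\<close>

lemma subdegree_\<pi>_u: "subdegree (\<pi> u) = 1"
proof -
  have "subdegree (\<pi> u) dvd subdegree (\<pi> a)" if "a \<in> A" "\<pi> a \<noteq> 0" for a
    using that
  proof (induction "subdegree (\<pi> a)" arbitrary: a rule: less_induct)
    case less
    show ?case
    proof (cases "a \<in> nonunits A")
      case True
      then obtain b c where bc: "b \<in> A" "c \<in> A" "a = b * u + c * v"
        using generators by blast
      then have eq: "\<pi> a = \<pi> b * \<pi> u"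
        using uA vA \<pi>_v by (simp add: \<pi>_A_add \<pi>_A_mult)
      then have nz: "\<pi> b \<noteq> 0"
        using less.prems by auto
      have "subdegree (\<pi> u) > 0"
        using u uA \<pi>_u \<pi>_A by (auto simp: subdegree_eq_0_iff intro!: gr0I)
      moreover have sd: "subdegree (\<pi> a) = subdegree (\<pi> b) + subdegree (\<pi> u)"
        using nz \<pi>_u by (simp add: eq)
      ultimately have "subdegree (\<pi> u) dvd subdegree (\<pi> b)"
        using less.hyps[of b] bc nz by simp
      then show ?thesis
        by (simp add: sd)
    next
      case False
      then show ?thesis
        using less.prems \<pi>_A by simp
    qed
  qed
  note multiple = this
  have "subdegree (\<pi> u) dvd i" if i: "D \<le> i" for i
  proof -
    obtain r where "ev r = fps_X ^ i"
      using b.conductor[of "fps_X ^ i"] i by auto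
    then show ?thesis
      using multiple[OF A_\<iota>[of r]] by (simp add: \<pi>_\<iota>)
  qed
  then show ?thesis
    using dvd_consecutive[of "subdegree (\<pi> u)" D] by simp
qed

lemma components_of_chart:
  assumes Y: "Y = (\<Union>B\<in>\<B>. affine_model B)" "A \<in> Y" "\<And>B. B \<in> Y \<Longrightarrow> subring_set B"
  shows "\<exists>C\<in>components Y (\<iota> f). order_along C (\<iota> f) = 1"
    and "k \<ge> 1 \<Longrightarrow> \<exists>C\<in>components Y (\<iota> f). order_along C (\<iota> f) = k"
proof -
  have fr: "\<exists>a\<in>A. \<exists>b\<in>A. b \<noteq> 0 \<and> z = a / b" for z
  proof -
    obtain a b where "b \<noteq> 0" "z = \<iota> a / \<iota> b"
      using fractions by blast
    then show ?thesis
      using A_\<iota> by (intro bexI[of _ "\<iota> a"] bexI[of _ "\<iota> b"]) auto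
  qed
  show "\<exists>C\<in>components Y (\<iota> f). order_along C (\<iota> f) = 1"
  proof (rule A.component_of_parameter[OF Y fr v v_nonzero prime_v])
    show "\<iota> f = (e * u ^ k) * v ^ 1"
      by (simp add: f_eq)
    show "e * u ^ k \<in> A"
      using e uA by auto
    have "\<pi> (e * u ^ k) \<noteq> 0"
      using e uA \<pi>_u \<pi>_unit[OF e] by (simp add: \<pi>_A_mult \<pi>_A_power)
    then show "\<not> A.dvds v (e * u ^ k)"
      using e uA by (simp add: dvds_v_iff)
  qed auto
  assume "k \<ge> 1"
  then show "\<exists>C\<in>components Y (\<iota> f). order_along C (\<iota> f) = k"
  proof (rule A.component_of_parameter[OF Y fr u u_nonzero prime_u, rotated -1])
    show "\<iota> f = (e * v) * u ^ k"
      by (simp add: f_eq mult_ac)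
    show "e * v \<in> A"
      using e vA by auto
    show "\<not> A.dvds u (e * v)"
      using regular_uv[OF e(1)] not_dvds_u_unit[OF e] by blast
  qed
qed

end


section \<open>Monomiality of the pulled back coordinate\<close>

context fraction_embedding
begin

text \<open>Fractions of order at least \<open>j\<close> for the order valuation of the maximal ideal of \<open>K[[x,y]]\<close>.\<close>

definition fraction_order_at_least :: "nat \<Rightarrow> 'f \<Rightarrow> bool" where
  "fraction_order_at_least j z \<longleftrightarrow> (\<exists>r s. s \<noteq> 0 \<and> z * \<iota> s = \<iota> r \<and> order_at_least (xy_order s + j) r)"

lemma order_at_least_xy_order: "order_at_least (xy_order s) s"
  by (simp add: order_at_least_iff)

lemma fraction_order_at_least_add:
  assumes "fraction_order_at_least j z" "fraction_order_at_least j z'"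
  shows "fraction_order_at_least j (z + z')"
proof -
  obtain r s where rs: "s \<noteq> 0" "z * \<iota> s = \<iota> r" "order_at_least (xy_order s + j) r"
    using assms(1) by (auto simp: fraction_order_at_least_def)
  obtain r' s' where rs': "s' \<noteq> 0" "z' * \<iota> s' = \<iota> r'" "order_at_least (xy_order s' + j) r'"
    using assms(2) by (auto simp: fraction_order_at_least_def)
  have "(z + z') * \<iota> (s * s') = \<iota> (r * s' + r' * s)"
    unfolding add mult rs(2)[symmetric] rs'(2)[symmetric] by (simp add: algebra_simps)
  moreover have "order_at_least (xy_order (s * s') + j) (r * s' + r' * s)"
    using order_at_least_mult[OF rs(3) order_at_least_xy_order[of s']]
      order_at_least_mult[OF rs'(3) order_at_least_xy_order[of s]] rs(1) rs'(1)
    by (intro order_at_least_add) (simp_all add: xy_order_mult ac_simps)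
  ultimately show ?thesis
    unfolding fraction_order_at_least_def using rs(1) rs'(1) by (metis no_zero_divisors)
qed

lemma fraction_order_at_least_mult:
  assumes "fraction_order_at_least i z" "fraction_order_at_least j z'"
  shows "fraction_order_at_least (i + j) (z * z')"
proof -
  obtain r s where rs: "s \<noteq> 0" "z * \<iota> s = \<iota> r" "order_at_least (xy_order s + i) r"
    using assms(1) by (auto simp: fraction_order_at_least_def)
  obtain r' s' where rs': "s' \<noteq> 0" "z' * \<iota> s' = \<iota> r'" "order_at_least (xy_order s' + j) r'"
    using assms(2) by (auto simp: fraction_order_at_least_def)
  have "(z * z') * \<iota> (s * s') = \<iota> (r * r')"
    unfolding mult rs(2)[symmetric] rs'(2)[symmetric] by (simp add: algebra_simps)
  moreover have "order_at_least (xy_order (s * s') + (i + j)) (r * r')"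
    using order_at_least_mult[OF rs(3) rs'(3)] rs(1) rs'(1) by (simp add: xy_order_mult ac_simps)
  ultimately show ?thesis
    unfolding fraction_order_at_least_def using rs(1) rs'(1) by (metis no_zero_divisors)
qed

lemma fraction_order_at_least_\<iota>:
  assumes "fraction_order_at_least j (\<iota> r)"
  shows "order_at_least j r"
proof -
  obtain r' s where rs: "s \<noteq> 0" "\<iota> r * \<iota> s = \<iota> r'" "order_at_least (xy_order s + j) r'"
    using assms by (auto simp: fraction_order_at_least_def)
  have "\<iota> (r * s - r') = 0"
    by (simp only: diff mult rs(2) diff_self)
  then have "r' = r * s"
    using inj by fastforce
  then show ?thesis
    using rs by (cases "r = 0") (auto simp: order_at_least_iff xy_order_mult)
qed

end

context branch_chart
begin

abbreviation \<kappa> :: "'k \<Rightarrow> 'f" where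
  "\<kappa> c \<equiv> \<iota> (scalar c)"

lemma \<pi>_\<kappa>: "\<pi> (\<kappa> c) = fps_const c"
  by (simp add: \<pi>_\<iota> b.ev_const)

lemma residue: "a \<in> A \<Longrightarrow> a - \<kappa> (\<pi> a $ 0) \<in> nonunits A"
proof -
  assume a: "a \<in> A"
  have "\<pi> (a + \<kappa> (- (\<pi> a $ 0))) $ 0 = 0"
    using a A_\<iota> by (simp add: \<pi>_A_add \<pi>_\<kappa>)
  moreover have "\<kappa> (- (\<pi> a $ 0)) = - \<kappa> (\<pi> a $ 0)"
    by (simp add: uminus[symmetric])
  ultimately show ?thesis
    using a A_\<iota> \<pi>_A[of "a - \<kappa> (\<pi> a $ 0)"] by simp
qed

end

text \<open>
  The coordinates are chosen such that the branch has order \<open>m\<close> in \<open>x\<close> and at least \<open>m\<close> in \<open>y\<close>,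
  i.e. \<open>m\<close> is the multiplicity of the curve.
\<close>

locale singular_chart = branch_chart \<iota> ev f D A e u v k
  for \<iota> :: "'k::{alg_closed_field, field_char_0} fps fps \<Rightarrow> 'f::Fields.field"
    and ev :: "'k fps fps \<Rightarrow> 'k fps" and f D and A :: "'f set" and e u v :: 'f and k :: nat +
  fixes m :: nat
  assumes m2: "m \<ge> 2" and ev_x: "ev x_var \<noteq> 0" "subdegree (ev x_var) = m"
    and ev_y: "ev fps_X = 0 \<or> m \<le> subdegree (ev fps_X)"
begin

text \<open>
  The coordinates of the plane have order at least \<open>m > 1\<close> on the branch, while \<open>u\<close> has order one.
\<close>

lemma singular_coordinate:
  assumes "h = x_var \<or> h = fps_X"
  obtains a b where "a \<in> nonunits A" "b \<in> A" "\<iota> h = a * u + b * v"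
proof -
  have "\<iota> h \<in> nonunits A"
    using assms by (auto simp: dominates)
  then obtain a b where ab: "a \<in> A" "b \<in> A" "\<iota> h = a * u + b * v"
    using generators by blast
  have "ev h = \<pi> (a * u + b * v)"
    by (simp only: ab(3)[symmetric] \<pi>_\<iota>)
  then have \<pi>h: "ev h = \<pi> a * \<pi> u"
    using ab(1,2) uA vA \<pi>_v by (simp add: \<pi>_A_add \<pi>_A_mult)
  have "\<pi> a $ 0 = 0"
  proof (rule ccontr)
    assume *: "\<pi> a $ 0 \<noteq> 0"
    then have "\<pi> a \<noteq> 0" "subdegree (\<pi> a) = 0"
      by auto
    then have "ev h \<noteq> 0" "subdegree (ev h) = 1"
      using \<pi>_u subdegree_\<pi>_u by (simp_all add: \<pi>h)
    then show False
      using assms ev_x ev_y m2 by auto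
  qed
  then show ?thesis
    using that ab \<pi>_A by blast
qed

text \<open>
  The order valuation of \<open>K[[x,y]]\<close> is not centred at \<open>A\<close>: otherwise \<open>x\<close> and \<open>y\<close> would be
  independent in the cotangent space of \<open>A\<close>, while the branch is smooth on \<open>A\<close> and singular on the
  plane.
\<close>

lemma order_not_centred: "\<exists>a\<in>nonunits A. \<not> fraction_order_at_least 1 a"
proof (rule ccontr)
  assume "\<not> ?thesis"
  then have cent: "\<And>a. a \<in> nonunits A \<Longrightarrow> fraction_order_at_least 1 a"
    by blast
  have sq: "fraction_order_at_least 2 (a * u + b * v)" if "a \<in> nonunits A" "b \<in> nonunits A" for a b
    using fraction_order_at_least_mult[OF cent[OF that(1)] cent[OF u]]
      fraction_order_at_least_mult[OF cent[OF that(2)] cent[OF v]]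
    by (intro fraction_order_at_least_add) (simp_all add: numeral_2_eq_2)
  obtain a b where ab: "a \<in> nonunits A" "b \<in> A" "\<iota> x_var = a * u + b * v"
    using singular_coordinate[of x_var] by blast
  obtain a' b' where ab': "a' \<in> nonunits A" "b' \<in> A" "\<iota> fps_X = a' * u + b' * v"
    using singular_coordinate[of fps_X] by blast
  define \<beta> \<beta>' where "\<beta> = \<pi> b $ 0" and "\<beta>' = \<pi> b' $ 0"
  have "\<iota> (scalar \<beta>' * x_var - scalar \<beta> * fps_X)
      = (\<kappa> \<beta>' * a - \<kappa> \<beta> * a') * u + (\<kappa> \<beta>' * b - \<kappa> \<beta> * b') * v"
    unfolding diff mult ab(3) ab'(3) by (simp add: algebra_simps)
  moreover have "\<kappa> \<beta>' * a - \<kappa> \<beta> * a' \<in> nonunits A"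
    using ab ab' A_\<iota> by (intro A.nonunits_diff A.nonunits_mult)
  moreover have "\<kappa> \<beta>' * b - \<kappa> \<beta> * b' \<in> nonunits A"
  proof -
    have "\<kappa> \<beta>' * b - \<kappa> \<beta> * b' = \<kappa> \<beta>' * (b - \<kappa> \<beta>) - \<kappa> \<beta> * (b' - \<kappa> \<beta>')"
      by (simp add: algebra_simps)
    then show ?thesis
      unfolding \<beta>_def \<beta>'_def
      by (simp only:) (intro A.nonunits_diff A.nonunits_mult[OF A_\<iota> residue] ab(2) ab'(2))
  qed
  ultimately have "order_at_least 2 (scalar \<beta>' * x_var - scalar \<beta> * fps_X)"
    using sq fraction_order_at_least_\<iota> by metis
  then have "(scalar \<beta>' * x_var - scalar \<beta> * fps_X) $ 1 $ 0 = 0"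
    unfolding order_at_least_def by (elim allE[of _ 1] allE[of _ 0]) simp
  then have "\<beta> = 0"
    by simp
  then have "b \<in> nonunits A"
    using \<pi>_A[OF ab(2)] by (simp add: \<beta>_def)
  then have "order_at_least 2 (x_var :: 'k fps fps)"
    using sq[OF ab(1)] fraction_order_at_least_\<iota> ab(3) by metis
  then have "(x_var :: 'k fps fps) $ 0 $ 1 = 0"
    unfolding order_at_least_def by (metis add.right_neutral one_less_numeral_iff semiring_norm(76))
  then show False
    by simp
qed

text \<open>
  Hence the ideal \<open>(x,y)A\<close> is principal (a step in the factorisation of \<open>A\<close> into quadratic
  transforms). Otherwise \<open>x\<close> and \<open>y\<close>, divided by their common factor \<open>u\<^sup>c\<close>, would form a regular
  sequence: a common prime factor would divide \<open>f\<close>, hence be \<open>u\<close> or \<open>v\<close>. By the independence of the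
  monomials in a regular sequence, the leading form of the numerator of each nonunit \<open>r/s\<close> whose
  order is at most that of \<open>s\<close> would vanish.
\<close>

lemma coordinate_monomial:
  obtains \<epsilon> where "\<epsilon> \<in> A" "\<epsilon> \<notin> nonunits A" "\<iota> x_var = \<epsilon> * u ^ m"
proof -
  have xm: "\<iota> x_var \<in> A" "\<iota> x_var \<noteq> 0" and ym: "\<iota> fps_X \<in> A" "\<iota> fps_X \<noteq> 0"
    using A_\<iota> by simp_all
  obtain i X1 where X1: "X1 \<in> A" "\<iota> x_var = u ^ i * X1" "\<not> A.dvds u X1"
    using A.finite_divisibility[OF u u_nonzero xm] .
  obtain j Y1 where Y1: "Y1 \<in> A" "\<iota> fps_X = u ^ j * Y1" "\<not> A.dvds u Y1"
    using A.finite_divisibility[OF u u_nonzero ym] .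
  define c where "c = min i j"
  define x' y' where "x' = u ^ (i - c) * X1" and "y' = u ^ (j - c) * Y1"
  have x'A: "x' \<in> A" and y'A: "y' \<in> A"
    using X1 Y1 uA by (auto simp: x'_def y'_def)
  have x'_eq: "\<iota> x_var = u ^ c * x'"
  proof -
    have "u ^ i = u ^ c * u ^ (i - c)"
      by (simp add: c_def power_add[symmetric])
    then show ?thesis
      by (simp add: X1(2) x'_def mult.assoc)
  qed
  have y'_eq: "\<iota> fps_X = u ^ c * y'"
  proof -
    have "u ^ j = u ^ c * u ^ (j - c)"
      by (simp add: c_def power_add[symmetric])
    then show ?thesis
      by (simp add: Y1(2) y'_def mult.assoc)
  qed
  have notboth: "\<not> (A.dvds u x' \<and> A.dvds u y')"
    using X1(3) Y1(3) by (cases "i \<le> j") (auto simp: x'_def y'_def c_def)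
  have \<pi>x: "ev x_var = \<pi> u ^ c * \<pi> x'"
  proof -
    have "ev x_var = \<pi> (u ^ c * x')"
      by (simp only: x'_eq[symmetric] \<pi>_\<iota>)
    then show ?thesis
      using uA x'A by (simp add: \<pi>_A_mult \<pi>_A_power)
  qed
  have \<pi>y: "ev fps_X = \<pi> u ^ c * \<pi> y'"
  proof -
    have "ev fps_X = \<pi> (u ^ c * y')"
      by (simp only: y'_eq[symmetric] \<pi>_\<iota>)
    then show ?thesis
      using uA y'A by (simp add: \<pi>_A_mult \<pi>_A_power)
  qed
  have \<pi>x': "\<pi> x' \<noteq> 0"
    using ev_x \<pi>x by auto
  then have m_eq: "m = c + subdegree (\<pi> x')"
    using ev_x(2) \<pi>_u subdegree_\<pi>_u by (simp add: \<pi>x)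
  have "x' \<notin> nonunits A \<or> y' \<notin> nonunits A"
  proof (rule ccontr)
    assume "\<not> ?thesis"
    then have x'm: "x' \<in> nonunits A" and y'm: "y' \<in> nonunits A"
      by simp_all
    \<comment> \<open>For all but two \<open>l\<close>, the combination \<open>x' + l y'\<close> is prime to both \<open>u\<close> and \<open>v\<close>.\<close>
    have "\<exists>l0. \<forall>l. A.dvds u (x' + \<kappa> l * y') \<longrightarrow> l = l0"
    proof (cases "\<exists>l0. A.dvds u (x' + \<kappa> l0 * y')")
      case True
      then obtain l0 where l0: "A.dvds u (x' + \<kappa> l0 * y')" ..
      have "l = l0" if l: "A.dvds u (x' + \<kappa> l * y')" for l
      proof (rule ccontr)
        assume "l \<noteq> l0"
        have "A.dvds u ((x' + \<kappa> l * y') - (x' + \<kappa> l0 * y'))"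
          using l l0 by (rule A.dvds_diff)
        also have "(x' + \<kappa> l * y') - (x' + \<kappa> l0 * y') = \<kappa> (l - l0) * y'"
          by (simp add: fps_const_sub[symmetric] diff algebra_simps del: fps_const_sub)
        finally have "A.dvds u (\<kappa> (1 / (l - l0)) * (\<kappa> (l - l0) * y'))"
          using A_\<iota> by (rule A.dvds_mult)
        also have "\<kappa> (1 / (l - l0)) * (\<kappa> (l - l0) * y') = y'"
          using \<open>l \<noteq> l0\<close> by (simp add: mult.assoc[symmetric] mult[symmetric] one)
        finally have "A.dvds u y'" .
        moreover from this have "A.dvds u ((x' + \<kappa> l * y') - \<kappa> l * y')"
          using l A_\<iota> by (intro A.dvds_diff A.dvds_mult)
        ultimately show False
          using notboth by simp
      qed
      then show ?thesis by blast
    qed blast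
    then obtain l0 where l0: "\<And>l. A.dvds u (x' + \<kappa> l * y') \<Longrightarrow> l = l0"
      by blast
    have \<pi>l: "\<pi> (x' + \<kappa> l * y') = \<pi> x' + fps_const l * \<pi> y'" for l
      using x'A y'A A_\<iota> by (simp add: \<pi>_A_add \<pi>_A_mult \<pi>_\<kappa>)
    have "\<exists>l1. \<forall>l. \<pi> (x' + \<kappa> l * y') = 0 \<longrightarrow> l = l1"
    proof (cases "\<exists>l1. \<pi> (x' + \<kappa> l1 * y') = 0")
      case True
      then obtain l1 where l1: "\<pi> x' + fps_const l1 * \<pi> y' = 0"
        by (auto simp: \<pi>l)
      have "l = l1" if "\<pi> (x' + \<kappa> l * y') = 0" for l
      proof -
        have "(fps_const l - fps_const l1) * \<pi> y' = 0"
          using that l1 unfolding \<pi>l by (metis add_left_cancel diff_self left_diff_distrib)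
        moreover have "\<pi> y' \<noteq> 0"
          using l1 \<pi>x' by auto
        ultimately have "fps_const (l - l1) = 0"
          by simp
        then show ?thesis
          by simp
      qed
      then show ?thesis by blast
    qed blast
    then obtain l1 where l1: "\<And>l. \<pi> (x' + \<kappa> l * y') = 0 \<Longrightarrow> l = l1"
      by blast
    obtain l :: 'k where "l \<notin> {l0, l1}"
      using ex_new_if_finite[OF infinite_UNIV_char_0, of "{l0, l1}"] by auto
    then have uX: "\<not> A.dvds u (x' + \<kappa> l * y')" and \<pi>X: "\<pi> (x' + \<kappa> l * y') \<noteq> 0"
      using l0 l1 by auto
    define X' where "X' = x' + \<kappa> l * y'"
    have X'm: "X' \<in> nonunits A"
      unfolding X'_def by (intro A.nonunits_add x'm A.nonunits_mult[OF A_\<iota> y'm])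
    then have X'A: "X' \<in> A"
      by (rule A.nonunitsD)
    have X'0: "X' \<noteq> 0"
      using \<pi>X \<pi>_0 by (auto simp: X'_def)
    have vX: "\<not> A.dvds v X'"
      using \<pi>X X'A by (simp add: dvds_v_iff X'_def)
    have "f $ 0 $ 0 = 0"
      using dominates[of f] \<pi>_A[OF A_\<iota>[of f]] \<pi>_f by simp
    then obtain \<alpha> \<beta> where f\<alpha>: "f = x_var * \<alpha> + fps_X * \<beta>"
      using order_at_least_Suc_decompose[of 0 f] by (auto simp: order_at_least_1)
    define w where "w = \<iota> \<alpha> * x' + \<iota> \<beta> * y'"
    have wA: "w \<in> A"
      using A_\<iota> x'A y'A by (auto simp: w_def)
    have fw: "e * u ^ k * v = u ^ c * w"
    proof -
      have "\<iota> f = (u ^ c * x') * \<iota> \<alpha> + (u ^ c * y') * \<iota> \<beta>"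
        by (subst f\<alpha>) (simp only: add mult x'_eq y'_eq)
      then show ?thesis
        by (simp add: f_eq w_def algebra_simps)
    qed
    have uev: "\<not> A.dvds u (e * v)"
      using regular_uv[OF e(1)] not_dvds_u_unit[OF e] by blast
    have "c \<le> k"
    proof (rule ccontr)
      assume "\<not> c \<le> k"
      then obtain d where d: "c = Suc (k + d)"
        using less_imp_Suc_add[of k c] by auto
      have "u ^ k * (e * v) = u ^ k * (u * (u ^ d * w))"
        using fw by (simp add: d power_add mult_ac)
      then have "e * v = u * (u ^ d * w)"
        using u_nonzero by simp
      then show False
        using uev A.dvdsI[of "u ^ d * w" u] uA wA by simp
    qed
    then have "u ^ k = u ^ c * u ^ (k - c)"
      by (simp add: power_add[symmetric])
    then have "u ^ c * (e * u ^ (k - c) * v) = u ^ c * w"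
      using fw by (simp add: mult_ac)
    then have w_eq: "w = e * u ^ (k - c) * v"
      using u_nonzero by simp
    \<comment> \<open>As \<open>f\<close> is a combination of \<open>x\<close> and \<open>y\<close>, modulo \<open>X'\<close> the element \<open>w\<close> is a multiple of \<open>y'\<close>, and
      it is a product of a unit and powers of \<open>u\<close> and \<open>v\<close>.\<close>
    have reg: "A.dvds X' d" if d: "d \<in> A" and "A.dvds X' (d * y')" for d
    proof -
      have w_comb: "w = \<iota> \<alpha> * X' + (\<iota> \<beta> - \<kappa> l * \<iota> \<alpha>) * y'"
        by (simp add: w_def X'_def algebra_simps)
      have "d * w = (d * \<iota> \<alpha>) * X' + (\<iota> \<beta> - \<kappa> l * \<iota> \<alpha>) * (d * y')"
        unfolding w_comb by (simp add: algebra_simps)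
      moreover have "A.dvds X' ((d * \<iota> \<alpha>) * X')"
        using A.dvdsI[of "d * \<iota> \<alpha>" X'] d A_\<iota> by (simp add: mult.commute)
      moreover have "A.dvds X' ((\<iota> \<beta> - \<kappa> l * \<iota> \<alpha>) * (d * y'))"
        by (intro A.dvds_mult[OF that(2)] A.diff A.mult A_\<iota>)
      ultimately have "A.dvds X' (d * w)"
        using A.dvds_add by simp
      then obtain g where g: "g \<in> A" "(d * e * u ^ (k - c)) * v = X' * g"
        unfolding w_eq by (auto simp: A.dvds_def mult_ac)
      have "A.dvds v (X' * g)"
        using A.dvdsI[of "d * e * u ^ (k - c)" v] d e uA g(2) by (simp add: mult.commute)
      then have "A.dvds v g"
        using prime_v vX X'A g(1) by (auto simp: prime_in_def)
      then obtain g' where g': "g' \<in> A" "g = v * g'"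
        by (auto simp: A.dvds_def)
      have "d * e * u ^ (k - c) = X' * g'"
        using g(2) v_nonzero by (simp add: g' mult_ac)
      moreover have "A.dvds X' (d * e)" if "d * e * u ^ n = X' * h" "h \<in> A" for n h
        using that
      proof (induction n arbitrary: h)
        case 0
        then show ?case
          using A.dvdsI by simp
      next
        case (Suc n)
        have "u * (d * e * u ^ n) = h * X'"
          using Suc.prems(1) by (simp add: mult_ac)
        then have "A.dvds u (h * X')"
          using A.dvdsI[of "d * e * u ^ n" u] d e uA by auto
        then have "A.dvds u h"
          using dvds_u_cancel[OF Suc.prems(2) X'A] uX by (simp add: X'_def)
        then obtain h' where h': "h' \<in> A" "h = u * h'"
          by (auto simp: A.dvds_def)
        then have "u * (d * e * u ^ n) = u * (X' * h')"
          using Suc.prems(1) by (simp add: mult_ac)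
        then have "d * e * u ^ n = X' * h'"
          using u_nonzero by simp
        then show ?case
          using Suc.IH h'(1) by blast
      qed
      ultimately have "A.dvds X' (d * e)"
        using g'(1) by blast
      then have "A.dvds X' (inverse e * (d * e))"
        by (rule A.dvds_mult) (use A.unitD[OF e] in blast)
      then show ?thesis
        using A.unitD[OF e] by (simp add: mult.left_commute)
    qed
    obtain a where a: "a \<in> nonunits A" "\<not> fraction_order_at_least 1 a"
      using order_not_centred by blast
    have aA: "a \<in> A"
      using a by (intro A.nonunitsD)
    obtain r s where rs: "s \<noteq> 0" "a = \<iota> r / \<iota> s"
      using fractions by blast
    then have r_eq: "\<iota> r = a * \<iota> s"
      by simp
    have nr: "\<not> order_at_least (xy_order s + 1) r"
      using a(2) rs r_eq unfolding fraction_order_at_least_def by metis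
    define \<rho> where "\<rho> = xy_order r"
    have \<rho>: "order_at_least \<rho> r" "order_at_least \<rho> s" "\<not> order_at_least (Suc \<rho>) r"
      using nr rs(1) by (auto simp: \<rho>_def order_at_least_iff)
    obtain rc where rc: "r = (\<Sum>i\<le>\<rho>. rc i * ((x_var + scalar l * fps_X) ^ i * fps_X ^ (\<rho> - i)))"
      using order_at_least_decompose[OF \<rho>(1), of l] by blast
    obtain sc where sc: "s = (\<Sum>i\<le>\<rho>. sc i * ((x_var + scalar l * fps_X) ^ i * fps_X ^ (\<rho> - i)))"
      using order_at_least_decompose[OF \<rho>(2), of l] by blast
    have X_eq: "\<iota> (x_var + scalar l * fps_X) = u ^ c * X'"
      unfolding add mult x'_eq y'_eq X'_def by (simp add: algebra_simps)
    have expand: "\<iota> (\<Sum>i\<le>\<rho>. q i * ((x_var + scalar l * fps_X) ^ i * fps_X ^ (\<rho> - i)))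
        = (u ^ c) ^ \<rho> * (\<Sum>i\<le>\<rho>. \<iota> (q i) * (X' ^ i * y' ^ (\<rho> - i)))" for q
      unfolding sum sum_distrib_left
    proof (rule sum.cong[OF refl])
      fix i assume "i \<in> {..\<rho>}"
      then have "(u ^ c) ^ \<rho> = (u ^ c) ^ i * (u ^ c) ^ (\<rho> - i)"
        by (simp add: power_add[symmetric])
      then show "\<iota> (q i * ((x_var + scalar l * fps_X) ^ i * fps_X ^ (\<rho> - i)))
          = (u ^ c) ^ \<rho> * (\<iota> (q i) * (X' ^ i * y' ^ (\<rho> - i)))"
        unfolding mult power X_eq y'_eq power_mult_distrib by (simp only: mult_ac)
    qed
    have "(u ^ c) ^ \<rho> * (\<Sum>i\<le>\<rho>. (\<iota> (rc i) - a * \<iota> (sc i)) * (X' ^ i * y' ^ (\<rho> - i)))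
        = (u ^ c) ^ \<rho> * (\<Sum>i\<le>\<rho>. \<iota> (rc i) * (X' ^ i * y' ^ (\<rho> - i)))
          - a * ((u ^ c) ^ \<rho> * (\<Sum>i\<le>\<rho>. \<iota> (sc i) * (X' ^ i * y' ^ (\<rho> - i))))"
      by (simp add: left_diff_distrib right_diff_distrib sum_subtractf sum_distrib_left mult_ac)
    also have "\<dots> = \<iota> r - a * \<iota> s"
      unfolding expand[symmetric] rc[symmetric] sc[symmetric] ..
    finally have "(\<Sum>i\<le>\<rho>. (\<iota> (rc i) - a * \<iota> (sc i)) * (X' ^ i * y' ^ (\<rho> - i))) = 0"
      using u_nonzero r_eq by simp
    then have "\<iota> (rc i) - a * \<iota> (sc i) \<in> nonunits A" if "i \<le> \<rho>" for i
      using A.regular_sequence_independent[OF X'm X'0 y'm reg, of \<rho> "\<lambda>i. \<iota> (rc i) - a * \<iota> (sc i)" i]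
        that A_\<iota> aA by auto
    then have rcm: "\<iota> (rc i) \<in> nonunits A" if "i \<le> \<rho>" for i
    proof -
      have "(\<iota> (rc i) - a * \<iota> (sc i)) + a * \<iota> (sc i) \<in> nonunits A"
        using that \<open>\<And>i. i \<le> \<rho> \<Longrightarrow> \<iota> (rc i) - a * \<iota> (sc i) \<in> nonunits A\<close> a(1) A_\<iota>
        by (intro A.nonunits_add A.nonunits_mult')
      then show ?thesis by simp
    qed
    have "order_at_least (Suc \<rho>) r"
      unfolding rc
    proof (rule order_at_least_sum)
      fix i assume i: "i \<in> {..\<rho>}"
      have 1: "order_at_least (Suc 0) (rc i)"
        using rcm[of i] i by (simp add: dominates order_at_least_1)
      have 2: "order_at_least (Suc 0) (x_var + scalar l * fps_X)" "order_at_least (Suc 0) (fps_X :: 'k fps fps)"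
        by (simp_all add: order_at_least_1)
      have "order_at_least (Suc 0 + (i * Suc 0 + (\<rho> - i) * Suc 0))
          (rc i * ((x_var + scalar l * fps_X) ^ i * fps_X ^ (\<rho> - i)))"
        by (intro order_at_least_mult order_at_least_power 1 2)
      then show "order_at_least (Suc \<rho>) (rc i * ((x_var + scalar l * fps_X) ^ i * fps_X ^ (\<rho> - i)))"
        using i by simp
    qed
    then show False
      using \<rho>(3) by blast
  qed
  \<comment> \<open>The case \<open>y'\<close> a unit and \<open>x'\<close> not would make the order of \<open>y\<close> on the branch less than that of \<open>x\<close>.\<close>
  then have "x' \<notin> nonunits A"
  proof
    assume y': "y' \<notin> nonunits A"
    show ?thesis
    proof
      assume "x' \<in> nonunits A"
      then have "\<pi> x' $ 0 = 0"
        using \<pi>_A[OF x'A] by simp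
      then have "subdegree (\<pi> x') > 0"
        using \<pi>x' by (auto simp: subdegree_eq_0_iff intro!: gr0I)
      moreover have "\<pi> y' $ 0 \<noteq> 0"
        using \<pi>_A[OF y'A] y' by simp
      then have "\<pi> y' \<noteq> 0" "subdegree (\<pi> y') = 0"
        by auto
      then have "ev fps_X \<noteq> 0" "subdegree (ev fps_X) = c"
        using \<pi>_u subdegree_\<pi>_u by (simp_all add: \<pi>y)
      ultimately show False
        using ev_y m_eq by simp
    qed
  qed
  moreover from this have "\<pi> x' $ 0 \<noteq> 0"
    using \<pi>_A[OF x'A] by simp
  then have "m = c"
    using m_eq by simp
  ultimately show ?thesis
    using that[of x'] x'A x'_eq by (simp add: mult.commute)
qed

end


section \<open>The completion of the local ring\<close>

lemma poly_hom: "unital_ring_hom (\<lambda>p. poly p (t :: 'a::comm_ring_1))"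
  by unfold_locales simp_all

lemma fps_of_poly_hom: "unital_ring_hom (fps_of_poly :: 'a::comm_ring_1 poly \<Rightarrow> 'a fps)"
  by unfold_locales (simp_all add: fps_of_poly_add fps_of_poly_mult)

definition poly_poly_to_fps :: "'a::comm_ring_1 poly poly \<Rightarrow> 'a fps fps" where
  "poly_poly_to_fps P = map_fps fps_of_poly (fps_of_poly P)"

lemma poly_poly_to_fps_nth [simp]: "poly_poly_to_fps P $ j $ i = coeff (coeff P j) i"
  by (simp add: poly_poly_to_fps_def)

lemma poly_poly_to_fps_hom: "unital_ring_hom poly_poly_to_fps"
  unfolding poly_poly_to_fps_def[abs_def]
  by (rule unital_ring_hom_comp[OF map_fps_hom[OF fps_of_poly_hom] fps_of_poly_hom])

lemma poly_poly_approximation: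
  "\<exists>P. order_at_least (Suc N) (poly_poly_to_fps P - s)"
proof -
  define P where "P = (\<Sum>j\<le>N. monom (\<Sum>i\<le>N. monom (s $ j $ i) i) j)"
  have "coeff (coeff P j) i = (if j \<le> N \<and> i \<le> N then s $ j $ i else 0)" for i j
    by (simp add: P_def coeff_sum if_distrib cong: if_cong)
  then have "order_at_least (Suc N) (poly_poly_to_fps P - s)"
    by (simp add: order_at_least_def)
  then show ?thesis ..
qed

lemma order_at_least_diff:
  "order_at_least n f \<Longrightarrow> order_at_least n g \<Longrightarrow> order_at_least n (f - g)"
  by (simp add: order_at_least_def)

locale monomial_chart = branch_chart \<iota> ev f D A e u v k
  for \<iota> :: "'k::{alg_closed_field, field_char_0} fps fps \<Rightarrow> 'f::Fields.field"
    and ev :: "'k fps fps \<Rightarrow> 'k fps" and f D and A :: "'f set" and e u v :: 'f and k :: nat +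
  fixes m :: nat and \<epsilon> :: 'f
  assumes m1: "m \<ge> 1" and \<epsilon>: "\<epsilon> \<in> A" "\<epsilon> \<notin> nonunits A" and x_eq: "\<iota> x_var = \<epsilon> * u ^ m"
begin

subsection \<open>Powers of the maximal ideal\<close>

primrec maximal_power :: "nat \<Rightarrow> 'f set" where
  "maximal_power 0 = A"
| "maximal_power (Suc J) = {a * u + b * v | a b. a \<in> maximal_power J \<and> b \<in> maximal_power J}"

lemma maximal_power_SucI:
  "a \<in> maximal_power J \<Longrightarrow> b \<in> maximal_power J \<Longrightarrow> a * u + b * v \<in> maximal_power (Suc J)"
  by auto

lemma maximal_power_1: "maximal_power (Suc 0) = nonunits A"
  by (simp add: generators)

lemma maximal_power_add: "a \<in> maximal_power J \<Longrightarrow> b \<in> maximal_power J \<Longrightarrow> a + b \<in> maximal_power J"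
proof (induction J arbitrary: a b)
  case (Suc J)
  obtain a1 a2 where a: "a1 \<in> maximal_power J" "a2 \<in> maximal_power J" "a = a1 * u + a2 * v"
    using Suc.prems(1) by auto
  obtain b1 b2 where b: "b1 \<in> maximal_power J" "b2 \<in> maximal_power J" "b = b1 * u + b2 * v"
    using Suc.prems(2) by auto
  have "a + b = (a1 + b1) * u + (a2 + b2) * v"
    by (simp add: a b algebra_simps)
  then show ?case
    using maximal_power_SucI[OF Suc.IH[OF a(1) b(1)] Suc.IH[OF a(2) b(2)]] by (simp only:)
qed auto

lemma maximal_power_mult: "c \<in> A \<Longrightarrow> a \<in> maximal_power J \<Longrightarrow> c * a \<in> maximal_power J"
proof (induction J arbitrary: a)
  case (Suc J)
  obtain a1 a2 where a: "a1 \<in> maximal_power J" "a2 \<in> maximal_power J" "a = a1 * u + a2 * v"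
    using Suc.prems(2) by auto
  have "c * a = (c * a1) * u + (c * a2) * v"
    by (simp add: a algebra_simps)
  then show ?case
    using maximal_power_SucI[OF Suc.IH[OF Suc.prems(1) a(1)] Suc.IH[OF Suc.prems(1) a(2)]] by (simp only:)
qed auto

lemma maximal_power_A: "a \<in> maximal_power J \<Longrightarrow> a \<in> A"
  by (induction J arbitrary: a) (auto intro!: A.add A.mult uA vA)

lemma maximal_power_0 [simp]: "0 \<in> maximal_power J"
proof (induction J)
  case (Suc J)
  then show ?case
    using maximal_power_SucI[of 0 J 0] by simp
qed simp

lemma maximal_power_Suc_subset: "a \<in> maximal_power (Suc J) \<Longrightarrow> a \<in> maximal_power J"
  by (auto intro!: maximal_power_add simp: mult.commute[of _ u] mult.commute[of _ v]
      intro: maximal_power_mult uA vA)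

lemma maximal_power_mono: "i \<le> j \<Longrightarrow> a \<in> maximal_power j \<Longrightarrow> a \<in> maximal_power i"
  by (induction rule: inc_induct) (auto dest: maximal_power_Suc_subset simp del: maximal_power.simps)

lemma maximal_power_times: "a \<in> maximal_power i \<Longrightarrow> b \<in> maximal_power j \<Longrightarrow> a * b \<in> maximal_power (i + j)"
proof (induction i arbitrary: a)
  case 0
  then show ?case
    by (simp add: maximal_power_mult)
next
  case (Suc i)
  obtain a1 a2 where a: "a1 \<in> maximal_power i" "a2 \<in> maximal_power i" "a = a1 * u + a2 * v"
    using Suc.prems(1) by auto
  have "a * b = (a1 * b) * u + (a2 * b) * v"
    by (simp add: a algebra_simps)
  moreover have "(a1 * b) * u + (a2 * b) * v \<in> maximal_power (Suc (i + j))"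
    by (rule maximal_power_SucI[OF Suc.IH[OF a(1) Suc.prems(2)] Suc.IH[OF a(2) Suc.prems(2)]])
  ultimately show ?case
    by (simp only: add_Suc)
qed

lemma maximal_power_minus: "a \<in> maximal_power J \<Longrightarrow> - a \<in> maximal_power J"
  using maximal_power_mult[of "- 1" a J] by simp

lemma maximal_power_diff: "a \<in> maximal_power J \<Longrightarrow> b \<in> maximal_power J \<Longrightarrow> a - b \<in> maximal_power J"
  using maximal_power_add[of a J "- b"] maximal_power_minus by simp

lemma maximal_power_sum: "(\<And>i. i \<in> S \<Longrightarrow> g i \<in> maximal_power J) \<Longrightarrow> sum g S \<in> maximal_power J"
  by (induction S rule: infinite_finite_induct) (auto intro: maximal_power_add)

lemma nonunit_power_maximal: "a \<in> nonunits A \<Longrightarrow> a ^ n \<in> maximal_power n"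
proof (induction n)
  case (Suc n)
  then have "a * a ^ n \<in> maximal_power (Suc 0 + n)"
    by (intro maximal_power_times) (auto simp: maximal_power_1 simp del: maximal_power.simps)
  then show ?case
    by simp
qed simp

lemma monomial_maximal: "a \<in> nonunits A \<Longrightarrow> b \<in> nonunits A \<Longrightarrow> a ^ i * b ^ j \<in> maximal_power (i + j)"
  by (intro maximal_power_times nonunit_power_maximal)

lemma maximal_power_decompose:
  "z \<in> maximal_power J \<Longrightarrow> \<exists>a. (\<forall>i\<le>J. a i \<in> A) \<and> z = (\<Sum>i\<le>J. a i * (u ^ i * v ^ (J - i)))"
proof (induction J arbitrary: z)
  case 0
  then show ?case
    by (intro exI[of _ "\<lambda>_. z"]) simp
next
  case (Suc J)
  obtain g h where gh: "g \<in> maximal_power J" "h \<in> maximal_power J" "z = g * u + h * v"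
    using Suc.prems by auto
  obtain c where c: "\<forall>i\<le>J. c i \<in> A" "g = (\<Sum>i\<le>J. c i * (u ^ i * v ^ (J - i)))"
    using Suc.IH[OF gh(1)] by blast
  obtain d where d: "\<forall>i\<le>J. d i \<in> A" "h = (\<Sum>i\<le>J. d i * (u ^ i * v ^ (J - i)))"
    using Suc.IH[OF gh(2)] by blast
  have 1: "g * u = (\<Sum>i\<le>Suc J. (if i = 0 then 0 else c (i - 1)) * (u ^ i * v ^ (Suc J - i)))"
    by (subst sum.atMost_Suc_shift) (simp add: c(2) sum_distrib_left mult_ac)
  have "h * v = (\<Sum>i\<le>J. d i * (u ^ i * v ^ (Suc J - i)))"
    unfolding d(2) sum_distrib_right
  proof (rule sum.cong[OF refl])
    fix i assume "i \<in> {..J}"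
    then have "v ^ (Suc J - i) = v ^ (J - i) * v"
      by (simp add: Suc_diff_le mult.commute)
    then show "d i * (u ^ i * v ^ (J - i)) * v = d i * (u ^ i * v ^ (Suc J - i))"
      by (simp add: mult_ac)
  qed
  then have 2: "h * v = (\<Sum>i\<le>Suc J. (if i \<le> J then d i else 0) * (u ^ i * v ^ (Suc J - i)))"
    by simp
  have "z = (\<Sum>i\<le>Suc J. ((if i = 0 then 0 else c (i - 1)) + (if i \<le> J then d i else 0))
      * (u ^ i * v ^ (Suc J - i)))"
    unfolding gh(3) 1 2 by (simp only: sum.distrib[symmetric] distrib_right)
  moreover have "\<forall>i\<le>Suc J. (if i = 0 then 0 else c (i - 1)) + (if i \<le> J then d i else 0) \<in> A"
    using c(1) d(1) by auto
  ultimately show ?case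
    by (intro exI[of _ "\<lambda>i. (if i = 0 then 0 else c (i - 1)) + (if i \<le> J then d i else 0)"] conjI)
qed

text \<open>
  The graded ring of \<open>A\<close> is a polynomial ring in the classes of \<open>u\<close> and \<open>v\<close>.
\<close>

lemma monomials_independent:
  assumes c: "\<And>i. i \<le> J \<Longrightarrow> c i \<in> A" and sum: "(\<Sum>i\<le>J. c i * (u ^ i * v ^ (J - i))) \<in> maximal_power (Suc J)"
    and "i \<le> J"
  shows "c i \<in> nonunits A"
proof -
  obtain g h where gh: "g \<in> maximal_power J" "h \<in> maximal_power J"
      "(\<Sum>i\<le>J. c i * (u ^ i * v ^ (J - i))) = g * u + h * v"
    using sum by auto
  obtain a where a: "\<forall>i\<le>J. a i \<in> A" "g = (\<Sum>i\<le>J. a i * (u ^ i * v ^ (J - i)))"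
    using maximal_power_decompose[OF gh(1)] by blast
  obtain b where b: "\<forall>i\<le>J. b i \<in> A" "h = (\<Sum>i\<le>J. b i * (u ^ i * v ^ (J - i)))"
    using maximal_power_decompose[OF gh(2)] by blast
  have nu: "a i * u + b i * v \<in> nonunits A" if "i \<le> J" for i
    using a(1) b(1) that by (intro A.nonunits_add A.nonunits_mult u v) auto
  have "(\<Sum>i\<le>J. (c i - (a i * u + b i * v)) * (u ^ i * v ^ (J - i)))
      = (\<Sum>i\<le>J. c i * (u ^ i * v ^ (J - i))) - (g * u + h * v)"
    unfolding a(2) b(2) sum_distrib_right sum.distrib[symmetric] sum_subtractf[symmetric]
    by (rule sum.cong) (simp_all add: algebra_simps)
  then have "(\<Sum>i\<le>J. (c i - (a i * u + b i * v)) * (u ^ i * v ^ (J - i))) = 0"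
    by (simp add: gh(3))
  then have "c i - (a i * u + b i * v) \<in> nonunits A"
    using A.regular_sequence_independent[OF u u_nonzero v regular_uv, of J "\<lambda>i. c i - (a i * u + b i * v)" i]
      c nu assms(3) A.nonunitsD by auto
  then have "(c i - (a i * u + b i * v)) + (a i * u + b i * v) \<in> nonunits A"
    using nu[OF assms(3)] by (rule A.nonunits_add)
  then show ?thesis
    by simp
qed


subsection \<open>An \<open>m\<close>-th root of \<open>x\<close>\<close>

text \<open>
  By Newton iteration \<open>\<epsilon>\<close> has an \<open>m\<close>-th root modulo each power of the maximal ideal, so \<open>x\<close> has an
  \<open>m\<close>-th root in the completion, which may be taken as a coordinate instead of \<open>u\<close>.
\<close>

lemma power_diff_square:
  assumes "a \<in> A" "h \<in> A"
  shows "\<exists>w\<in>A. (a - h) ^ n = a ^ n - of_nat n * a ^ (n - 1) * h + h\<^sup>2 * w"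
proof (induction n)
  case 0
  then show ?case
    by (intro bexI[of _ 0]) auto
next
  case (Suc n)
  then obtain w where w: "w \<in> A" "(a - h) ^ n = a ^ n - of_nat n * a ^ (n - 1) * h + h\<^sup>2 * w"
    by blast
  have "of_nat n * a ^ (n - 1) * a = of_nat n * a ^ n"
    by (cases n) simp_all
  then have eq: "of_nat n * a ^ (n - 1) * h * a = of_nat n * a ^ n * h"
    by (metis mult.commute mult.left_commute)
  have "(a - h) ^ Suc n = (a ^ n - of_nat n * a ^ (n - 1) * h + h\<^sup>2 * w) * (a - h)"
    unfolding w(2)[symmetric] by (rule power_Suc2)
  also have "\<dots> = a ^ Suc n - (of_nat n * a ^ (n - 1) * h * a + a ^ n * h) + h\<^sup>2 * (of_nat n * a ^ (n - 1) + w * (a - h))"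
    by (simp add: algebra_simps power2_eq_square)
  also have "of_nat n * a ^ (n - 1) * h * a + a ^ n * h = of_nat (Suc n) * a ^ (Suc n - 1) * h"
    unfolding eq by (simp add: algebra_simps)
  finally have "(a - h) ^ Suc n = a ^ Suc n - of_nat (Suc n) * a ^ (Suc n - 1) * h
      + h\<^sup>2 * (of_nat n * a ^ (n - 1) + w * (a - h))" .
  moreover have "of_nat n * a ^ (n - 1) + w * (a - h) \<in> A"
    using assms w(1) by auto
  ultimately show ?case
    by blast
qed

lemma of_nat_eq: "of_nat n = \<kappa> (of_nat n)"
  by (induction n) (simp_all add: zero one add fps_const_add[symmetric] del: fps_const_add)

lemma of_nat_m_unit: "of_nat m \<notin> nonunits A"
  using m1 by (simp add: of_nat_eq dominates)

lemma root_exists: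
  "\<exists>E::nat \<Rightarrow> 'f. \<forall>M. (E M \<in> A \<and> E M \<notin> nonunits A \<and> E M ^ m - \<epsilon> \<in> maximal_power (Suc M))
     \<and> E (Suc M) - E M \<in> maximal_power (Suc M)"
proof (rule dependent_nat_choice)
  obtain r where r: "r ^ m = \<pi> \<epsilon> $ 0"
    using nth_root_exists[of m "\<pi> \<epsilon> $ 0"] m1 by auto
  have "r \<noteq> 0"
    using r m1 \<pi>_A[OF \<epsilon>(1)] \<epsilon>(2) by (auto simp: power_0_left)
  moreover have "\<kappa> r ^ m - \<epsilon> \<in> maximal_power (Suc 0)"
  proof -
    have "\<kappa> r ^ m = \<kappa> (\<pi> \<epsilon> $ 0)"
      by (simp add: power[symmetric] fps_const_power r)
    then have "\<kappa> r ^ m - \<epsilon> = - (\<epsilon> - \<kappa> (\<pi> \<epsilon> $ 0))"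
      by simp
    then show ?thesis
      using maximal_power_minus[of "\<epsilon> - \<kappa> (\<pi> \<epsilon> $ 0)" "Suc 0"] residue[OF \<epsilon>(1)]
      by (simp only: maximal_power_1)
  qed
  ultimately show "\<exists>E. E \<in> A \<and> E \<notin> nonunits A \<and> E ^ m - \<epsilon> \<in> maximal_power (Suc 0)"
    using A_\<iota> scalar_unit by blast
next
  fix E :: 'f and M :: nat
  assume E: "E \<in> A \<and> E \<notin> nonunits A \<and> E ^ m - \<epsilon> \<in> maximal_power (Suc M)"
  define q where "q = of_nat m * E ^ (m - 1)"
  have q: "q \<in> A" "q \<notin> nonunits A"
    using E A.unit_power[of E "m - 1"] of_nat_m_unit A.unit_mult_iff[of "of_nat m" "E ^ (m - 1)"]
    by (auto simp: q_def)
  define h where "h = inverse q * (E ^ m - \<epsilon>)"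
  have h: "h \<in> maximal_power (Suc M)"
    unfolding h_def using A.unitD[OF q] E by (intro maximal_power_mult) auto
  have hA: "h \<in> A"
    using h by (rule maximal_power_A)
  have hm: "h \<in> nonunits A"
  proof -
    have "h \<in> maximal_power (Suc 0)"
      by (rule maximal_power_mono[OF _ h]) simp
    then show ?thesis
      by (simp only: maximal_power_1)
  qed
  obtain w where w: "w \<in> A" "(E - h) ^ m = E ^ m - of_nat m * E ^ (m - 1) * h + h\<^sup>2 * w"
    using power_diff_square[of E h m] E hA by blast
  have "q * h = E ^ m - \<epsilon>"
    using A.unitD[OF q] by (simp add: h_def mult.assoc[symmetric])
  then have "(E - h) ^ m - \<epsilon> = w * (h * h)"
    using w(2) by (simp add: q_def power2_eq_square mult_ac)
  moreover have "h * h \<in> maximal_power (Suc (Suc M))"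
    using maximal_power_times[OF h, of h "Suc 0"] hm
    by (simp only: maximal_power_1 add_Suc_right add_0_right)
  ultimately have "(E - h) ^ m - \<epsilon> \<in> maximal_power (Suc (Suc M))"
    using maximal_power_mult[OF w(1)] by (simp only:)
  moreover have "E - h \<notin> nonunits A"
    using A.nonunits_add[OF _ hm, of "E - h"] E by auto
  moreover have "(E - h) - E \<in> maximal_power (Suc M)"
    using maximal_power_minus[OF h] by (simp del: maximal_power.simps)
  moreover have "E - h \<in> A"
    using E hA by auto
  ultimately show "\<exists>E'. (E' \<in> A \<and> E' \<notin> nonunits A \<and> E' ^ m - \<epsilon> \<in> maximal_power (Suc (Suc M)))
      \<and> E' - E \<in> maximal_power (Suc M)"
    by blast
qed

definition root :: "nat \<Rightarrow> 'f" where
  "root = (SOME E. \<forall>M. (E M \<in> A \<and> E M \<notin> nonunits A \<and> E M ^ m - \<epsilon> \<in> maximal_power (Suc M))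
     \<and> E (Suc M) - E M \<in> maximal_power (Suc M))"

lemma root: "root M \<in> A" "root M \<notin> nonunits A" "root M ^ m - \<epsilon> \<in> maximal_power (Suc M)"
  "root (Suc M) - root M \<in> maximal_power (Suc M)"
  using someI_ex[OF root_exists] unfolding root_def[symmetric] by blast+

text \<open>
  Approximations to the coordinate \<open>z\<close> of the completion with \<open>z\<^sup>m = x\<close>.
\<close>

definition z :: "nat \<Rightarrow> 'f" where
  "z M = root M * u"

lemma z_nonunit: "z M \<in> nonunits A"
  unfolding z_def by (rule A.nonunits_mult[OF root(1) u])

lemma zA: "z M \<in> A"
  by (rule A.nonunitsD[OF z_nonunit])

lemma z_step: "z (Suc M) - z M \<in> maximal_power (Suc M)"
proof -
  have "z (Suc M) - z M = u * (root (Suc M) - root M)"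
    by (simp add: z_def algebra_simps)
  then show ?thesis
    using maximal_power_mult[OF uA root(4)] by (simp only:)
qed

lemma z_power: "\<iota> x_var - z M ^ m \<in> maximal_power (Suc M)"
proof -
  have "\<iota> x_var - z M ^ m = (- (u ^ m)) * (root M ^ m - \<epsilon>)"
    by (simp add: z_def x_eq power_mult_distrib algebra_simps)
  then show ?thesis
    using maximal_power_mult[OF A.uminus[OF A.power[OF uA]] root(3)] by (simp only:)
qed


subsection \<open>Expansion of the elements of the local ring\<close>

definition poly_value :: "'f \<Rightarrow> 'k poly poly \<Rightarrow> 'f" where
  "poly_value t P = poly (map_poly (\<lambda>p. poly (map_poly \<kappa> p) t) P) v"

lemma \<kappa>_hom: "unital_ring_hom \<kappa>"
  by (rule unital_ring_hom_comp[OF unital_ring_hom_axioms unital_ring_hom_comp[OF fps_const_hom fps_const_hom]])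

lemma coeff_value_hom: "unital_ring_hom (\<lambda>p. poly (map_poly \<kappa> p) t)"
  by (rule unital_ring_hom_comp[OF poly_hom unital_ring_hom.map_poly_hom[OF \<kappa>_hom]])

lemma poly_value_hom: "unital_ring_hom (poly_value t)"
  unfolding poly_value_def[abs_def]
  by (rule unital_ring_hom_comp[OF poly_hom unital_ring_hom.map_poly_hom[OF coeff_value_hom]])

lemma poly_value_monom: "poly_value t (monom (monom c i) j) = \<kappa> c * (t ^ i * v ^ j)"
  by (simp add: poly_value_def map_poly_monom unital_ring_hom.zero[OF \<kappa>_hom] poly_monom mult.assoc zero)

lemma poly_value_sum:
  "poly_value t P = (\<Sum>j\<le>degree P. \<Sum>i\<le>degree (coeff P j). \<kappa> (coeff (coeff P j) i) * (t ^ i * v ^ j))"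
proof -
  have inner: "poly (map_poly \<kappa> p) t = (\<Sum>i\<le>degree p. \<kappa> (coeff p i) * t ^ i)" for p
    by (subst poly_altdef_le[of _ "degree p"])
       (simp_all add: coeff_map_poly zero degree_map_poly_le)
  have "poly_value t P = (\<Sum>j\<le>degree P. poly (map_poly \<kappa> (coeff P j)) t * v ^ j)"
    unfolding poly_value_def
    by (subst poly_altdef_le[of _ "degree P"])
       (simp_all add: coeff_map_poly degree_map_poly_le)
  then show ?thesis
    by (simp add: inner sum_distrib_right mult.assoc)
qed

lemma poly_value_high_order:
  assumes t: "t \<in> nonunits A" and P: "order_at_least (Suc N) (poly_poly_to_fps P)"
  shows "poly_value t P \<in> maximal_power (Suc N)"
  unfolding poly_value_sum
proof (intro maximal_power_sum)
  fix i j
  show "\<kappa> (coeff (coeff P j) i) * (t ^ i * v ^ j) \<in> maximal_power (Suc N)"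
  proof (cases "i + j < Suc N")
    case True
    then have "coeff (coeff P j) i = 0"
      using P by (simp add: order_at_least_def)
    then show ?thesis
      by (simp add: zero del: maximal_power.simps)
  next
    case False
    then have "t ^ i * v ^ j \<in> maximal_power (Suc N)"
      using maximal_power_mono[OF _ monomial_maximal[OF t v, of i j], of "Suc N"] by simp
    then show ?thesis
      by (rule maximal_power_mult[OF A_\<iota>])
  qed
qed

lemma poly_value_change:
  assumes "t \<in> A" "t' \<in> A" "t - t' \<in> maximal_power J"
  shows "poly_value t P - poly_value t' P \<in> maximal_power J"
proof -
  have pw: "t ^ i - t' ^ i \<in> maximal_power J" for i
  proof (induction i)
    case (Suc i)
    have "t ^ Suc i - t' ^ Suc i = t * (t ^ i - t' ^ i) + t' ^ i * (t - t')"
      by (simp add: algebra_simps)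
    then show ?case
      using maximal_power_add[OF maximal_power_mult[OF assms(1) Suc]
          maximal_power_mult[OF A.power[OF assms(2)] assms(3)], of i] by (simp only:)
  qed simp
  have "poly_value t P - poly_value t' P
    = (\<Sum>j\<le>degree P. \<Sum>i\<le>degree (coeff P j). (\<kappa> (coeff (coeff P j) i) * v ^ j) * (t ^ i - t' ^ i))"
    unfolding poly_value_sum sum_subtractf[symmetric]
    by (intro sum.cong refl) (simp add: algebra_simps)
  also have "\<dots> \<in> maximal_power J"
    by (intro maximal_power_sum maximal_power_mult pw A.mult A.power A_\<iota> vA)
  finally show ?thesis .
qed

text \<open>\<open>s\<close> is the expansion of \<open>a\<close> in the coordinates \<open>z = lim z\<^sub>N\<close> and \<open>v\<close> of the completion.\<close>

definition expands_to :: "'f \<Rightarrow> 'k fps fps \<Rightarrow> bool" where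
  "expands_to a s \<longleftrightarrow> (\<forall>N P. order_at_least (Suc N) (poly_poly_to_fps P - s) \<longrightarrow>
     a - poly_value (z N) P \<in> maximal_power (Suc N))"

lemma expands_toI:
  assumes "\<And>N. \<exists>P. order_at_least (Suc N) (poly_poly_to_fps P - s) \<and> a - poly_value (z N) P \<in> maximal_power (Suc N)"
  shows "expands_to a s"
  unfolding expands_to_def
proof (intro allI impI)
  fix N P assume P: "order_at_least (Suc N) (poly_poly_to_fps P - s)"
  obtain P' where P': "order_at_least (Suc N) (poly_poly_to_fps P' - s)"
      "a - poly_value (z N) P' \<in> maximal_power (Suc N)"
    using assms by blast
  interpret F: unital_ring_hom "poly_poly_to_fps :: 'k poly poly \<Rightarrow> _" by (rule poly_poly_to_fps_hom)
  interpret V: unital_ring_hom "poly_value (z N)" by (rule poly_value_hom)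
  have "order_at_least (Suc N) (poly_poly_to_fps (P' - P))"
    using order_at_least_diff[OF P'(1) P] by (simp add: F.diff)
  then have "poly_value (z N) (P' - P) \<in> maximal_power (Suc N)"
    by (rule poly_value_high_order[OF z_nonunit])
  then have "(a - poly_value (z N) P') + poly_value (z N) (P' - P) \<in> maximal_power (Suc N)"
    using P'(2) maximal_power_add by blast
  then show "a - poly_value (z N) P \<in> maximal_power (Suc N)"
    by (simp add: V.diff del: maximal_power.simps)
qed

text \<open>
  If two expansions differed, the lowest homogeneous form of the difference would be a relation
  between the monomials in \<open>z\<close> and \<open>v\<close>.
\<close>

lemma expands_to_unique:
  assumes "expands_to a s" "expands_to a s'"
  shows "s = s'"
proof (rule ccontr)
  assume "s \<noteq> s'"
  define d where "d = s - s'"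
  define N where "N = xy_order d"
  have d0: "d \<noteq> 0"
    using \<open>s \<noteq> s'\<close> by (simp add: d_def)
  then have d: "order_at_least N d" "\<not> order_at_least (Suc N) d"
    by (simp_all add: order_at_least_iff N_def)
  interpret F: unital_ring_hom "poly_poly_to_fps :: 'k poly poly \<Rightarrow> _" by (rule poly_poly_to_fps_hom)
  interpret V: unital_ring_hom "poly_value (z N)" by (rule poly_value_hom)
  obtain P where P: "order_at_least (Suc N) (poly_poly_to_fps P - s)"
    using poly_poly_approximation by blast
  obtain P' where P': "order_at_least (Suc N) (poly_poly_to_fps P' - s')"
    using poly_poly_approximation by blast
  define Q where "Q = (\<Sum>i\<le>N. monom (monom (d $ (N - i) $ i) i) (N - i))"
  have cQ: "coeff (coeff Q b) a = (if a + b = N then d $ b $ a else 0)" for a b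
  proof -
    have "coeff (coeff Q b) a = (\<Sum>i\<le>N. if i = a then (if a + b = N then d $ b $ a else 0) else 0)"
      unfolding Q_def coeff_sum by (rule sum.cong) auto
    then show ?thesis
      by auto
  qed
  have "order_at_least (Suc N) (poly_poly_to_fps Q - d)"
    using d(1) by (auto simp: order_at_least_def cQ)
  moreover have "order_at_least (Suc N) ((poly_poly_to_fps P - s) - (poly_poly_to_fps P' - s'))"
    by (rule order_at_least_diff[OF P P'])
  ultimately have "order_at_least (Suc N) ((poly_poly_to_fps Q - d) - ((poly_poly_to_fps P - s) - (poly_poly_to_fps P' - s')))"
    by (rule order_at_least_diff)
  then have "order_at_least (Suc N) (poly_poly_to_fps (Q - (P - P')))"
    by (simp add: F.diff F.add d_def algebra_simps)
  then have 1: "poly_value (z N) (Q - (P - P')) \<in> maximal_power (Suc N)"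
    by (rule poly_value_high_order[OF z_nonunit])
  have "(a - poly_value (z N) P') - (a - poly_value (z N) P) \<in> maximal_power (Suc N)"
    using assms P P' unfolding expands_to_def by (blast intro: maximal_power_diff)
  then have "poly_value (z N) (Q - (P - P')) + ((a - poly_value (z N) P') - (a - poly_value (z N) P)) \<in> maximal_power (Suc N)"
    by (rule maximal_power_add[OF 1])
  then have "poly_value (z N) Q \<in> maximal_power (Suc N)"
    by (simp add: V.diff del: maximal_power.simps)
  also have "poly_value (z N) Q = (\<Sum>i\<le>N. (\<kappa> (d $ (N - i) $ i) * root N ^ i) * (u ^ i * v ^ (N - i)))"
    unfolding Q_def V.sum poly_value_monom
    by (rule sum.cong) (simp_all only: z_def power_mult_distrib mult_ac)
  finally have in_max: "(\<Sum>i\<le>N. (\<kappa> (d $ (N - i) $ i) * root N ^ i) * (u ^ i * v ^ (N - i))) \<in> maximal_power (Suc N)" .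
  have "d $ (N - i) $ i = 0" if i: "i \<le> N" for i
  proof -
    have "\<kappa> (d $ (N - i) $ i) * root N ^ i \<in> nonunits A"
      by (rule monomials_independent[OF _ in_max i]) (intro A.mult A.power A_\<iota> root)
    then have "\<kappa> (d $ (N - i) $ i) \<in> nonunits A"
      using A.unit_mult_iff[OF A.power[OF root(1)] A.unit_power[OF root(1,2)] A_\<iota>]
      by (simp add: mult.commute)
    then show ?thesis
      by (simp add: dominates)
  qed
  then have "d $ b $ a = 0" if "a + b = N" for a b
    using that by (metis add_diff_cancel_left' le_add1)
  then have "order_at_least (Suc N) d"
    using d(1) unfolding order_at_least_def by (metis less_SucE)
  then show False
    using d(2) by blast
qed

text \<open>
  The polynomial approximations are refined degree by degree: the error in degree \<open>M + 1\<close> is a form in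
  \<open>u\<close> and \<open>v\<close>, whose coefficients are replaced by their residues, after passing from \<open>u\<close> to
  \<open>root (M + 1) * u\<close>.
\<close>

lemma expands_to_exists:
  assumes a: "a \<in> A"
  shows "\<exists>s. expands_to a s"
proof -
  interpret F: unital_ring_hom "poly_poly_to_fps :: 'k poly poly \<Rightarrow> _" by (rule poly_poly_to_fps_hom)
  have "\<exists>P::nat \<Rightarrow> 'k poly poly. \<forall>M. (a - poly_value (z M) (P M) \<in> maximal_power (Suc M))
     \<and> order_at_least (Suc M) (poly_poly_to_fps (P (Suc M)) - poly_poly_to_fps (P M))"
  proof (rule dependent_nat_choice)
    have "poly_value (z 0) (monom (monom (\<pi> a $ 0) 0) 0) = \<kappa> (\<pi> a $ 0)"
      unfolding poly_value_monom by simp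
    then have "a - poly_value (z 0) (monom (monom (\<pi> a $ 0) 0) 0) \<in> maximal_power (Suc 0)"
      using residue[OF a] by (simp only: maximal_power_1)
    then show "\<exists>P. a - poly_value (z 0) P \<in> maximal_power (Suc 0)" ..
  next
    fix P :: "'k poly poly" and M
    assume P: "a - poly_value (z M) P \<in> maximal_power (Suc M)"
    interpret V: unital_ring_hom "poly_value (z (Suc M))" by (rule poly_value_hom)
    have "a - poly_value (z (Suc M)) P
        = (a - poly_value (z M) P) - (poly_value (z (Suc M)) P - poly_value (z M) P)"
      by simp
    then have "a - poly_value (z (Suc M)) P \<in> maximal_power (Suc M)"
      using maximal_power_diff[OF P poly_value_change[OF zA zA z_step]] by (simp only:)
    then obtain c where c: "\<forall>i\<le>Suc M. c i \<in> A"
      and eq: "a - poly_value (z (Suc M)) P = (\<Sum>i\<le>Suc M. c i * (u ^ i * v ^ (Suc M - i)))"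
      using maximal_power_decompose by blast
    let ?E = "root (Suc M)"
    have E: "inverse ?E \<in> A" "?E \<noteq> 0"
      using A.unitD[OF root(1,2)] by auto
    define \<alpha> where "\<alpha> i = c i * inverse ?E ^ i" for i
    define Q where "Q = (\<Sum>i\<le>Suc M. monom (monom (\<pi> (\<alpha> i) $ 0) i) (Suc M - i))"
    have cQ: "coeff (coeff Q b) l = 0" if "l + b < Suc M" for l b
      unfolding Q_def coeff_sum using that by (intro sum.neutral) auto
    have "a - poly_value (z (Suc M)) (P + Q)
        = (\<Sum>i\<le>Suc M. c i * (u ^ i * v ^ (Suc M - i))) - poly_value (z (Suc M)) Q"
      by (simp only: V.add eq[symmetric]) simp
    also have "poly_value (z (Suc M)) Q
        = (\<Sum>i\<le>Suc M. (\<kappa> (\<pi> (\<alpha> i) $ 0) * ?E ^ i) * (u ^ i * v ^ (Suc M - i)))"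
      unfolding Q_def V.sum poly_value_monom
      by (rule sum.cong) (simp_all only: z_def power_mult_distrib mult_ac)
    also have "(\<Sum>i\<le>Suc M. c i * (u ^ i * v ^ (Suc M - i)))
         - (\<Sum>i\<le>Suc M. (\<kappa> (\<pi> (\<alpha> i) $ 0) * ?E ^ i) * (u ^ i * v ^ (Suc M - i)))
       = (\<Sum>i\<le>Suc M. (?E ^ i * (\<alpha> i - \<kappa> (\<pi> (\<alpha> i) $ 0))) * (u ^ i * v ^ (Suc M - i)))"
      unfolding sum_subtractf[symmetric]
    proof (rule sum.cong[OF refl])
      fix i
      have "c i = ?E ^ i * \<alpha> i"
        using E by (simp add: \<alpha>_def power_inverse)
      then show "c i * (u ^ i * v ^ (Suc M - i)) - \<kappa> (\<pi> (\<alpha> i) $ 0) * ?E ^ i * (u ^ i * v ^ (Suc M - i))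
          = (?E ^ i * (\<alpha> i - \<kappa> (\<pi> (\<alpha> i) $ 0))) * (u ^ i * v ^ (Suc M - i))"
        by (simp only: left_diff_distrib right_diff_distrib mult_ac)
    qed
    also have "\<dots> \<in> maximal_power (Suc (Suc M))"
    proof (rule maximal_power_sum)
      fix i assume i: "i \<in> {..Suc M}"
      have "\<alpha> i \<in> A"
        using c i E by (auto simp: \<alpha>_def)
      then have 1: "?E ^ i * (\<alpha> i - \<kappa> (\<pi> (\<alpha> i) $ 0)) \<in> maximal_power (Suc 0)"
        unfolding maximal_power_1 by (intro A.nonunits_mult residue A.power root)
      have 2: "u ^ i * v ^ (Suc M - i) \<in> maximal_power (Suc M)"
        using monomial_maximal[OF u v, of i "Suc M - i"] i by (simp del: maximal_power.simps)
      show "(?E ^ i * (\<alpha> i - \<kappa> (\<pi> (\<alpha> i) $ 0))) * (u ^ i * v ^ (Suc M - i)) \<in> maximal_power (Suc (Suc M))"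
        using maximal_power_times[OF 1 2] by (simp only: add_Suc add_0)
    qed
    finally have "a - poly_value (z (Suc M)) (P + Q) \<in> maximal_power (Suc (Suc M))" .
    moreover have "order_at_least (Suc M) (poly_poly_to_fps (P + Q) - poly_poly_to_fps P)"
      using cQ by (simp add: order_at_least_def)
    ultimately show "\<exists>P'. a - poly_value (z (Suc M)) P' \<in> maximal_power (Suc (Suc M))
        \<and> order_at_least (Suc M) (poly_poly_to_fps P' - poly_poly_to_fps P)"
      by blast
  qed
  then obtain P :: "nat \<Rightarrow> 'k poly poly" where P: "\<And>M. a - poly_value (z M) (P M) \<in> maximal_power (Suc M)"
    and stable: "\<And>M. order_at_least (Suc M) (poly_poly_to_fps (P (Suc M)) - poly_poly_to_fps (P M))"
    by blast
  define s where "s = Abs_fps (\<lambda>j. Abs_fps (\<lambda>i. coeff (coeff (P (i + j)) j) i))"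
  have "coeff (coeff (P M) j) i = s $ j $ i" if "i + j \<le> M" for i j M
    using that
  proof (induction rule: dec_induct)
    case base
    then show ?case by (simp add: s_def)
  next
    case (step n)
    have "(poly_poly_to_fps (P (Suc n)) - poly_poly_to_fps (P n)) $ j $ i = 0"
      using stable[of n] step(1) unfolding order_at_least_def by simp
    then show ?case
      using step.IH by simp
  qed
  then have "order_at_least (Suc M) (poly_poly_to_fps (P M) - s)" for M
    by (simp add: order_at_least_def)
  then have "expands_to a s"
    using P by (intro expands_toI) blast
  then show ?thesis ..
qed

lemma expands_to_add:
  assumes "expands_to a s" "expands_to b r"
  shows "expands_to (a + b) (s + r)"
proof (rule expands_toI)
  fix N
  interpret F: unital_ring_hom "poly_poly_to_fps :: 'k poly poly \<Rightarrow> _" by (rule poly_poly_to_fps_hom)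
  interpret V: unital_ring_hom "poly_value (z N)" by (rule poly_value_hom)
  obtain P where P: "order_at_least (Suc N) (poly_poly_to_fps P - s)"
    using poly_poly_approximation by blast
  obtain Q where Q: "order_at_least (Suc N) (poly_poly_to_fps Q - r)"
    using poly_poly_approximation by blast
  have "order_at_least (Suc N) (poly_poly_to_fps (P + Q) - (s + r))"
    using order_at_least_add[OF P Q] by (simp add: F.add algebra_simps)
  moreover have "(a - poly_value (z N) P) + (b - poly_value (z N) Q) \<in> maximal_power (Suc N)"
    using assms P Q unfolding expands_to_def by (intro maximal_power_add) blast+
  then have "(a + b) - poly_value (z N) (P + Q) \<in> maximal_power (Suc N)"
    by (simp add: V.add algebra_simps del: maximal_power.simps)
  ultimately show "\<exists>P. order_at_least (Suc N) (poly_poly_to_fps P - (s + r))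
      \<and> a + b - poly_value (z N) P \<in> maximal_power (Suc N)"
    by blast
qed

lemma poly_value_A: "poly_value (z N) P \<in> A"
  unfolding poly_value_sum by (intro A.sum A.mult A.power A_\<iota> zA vA)

lemma expands_to_mult:
  assumes "expands_to a s" "expands_to b r" "a \<in> A"
  shows "expands_to (a * b) (s * r)"
proof (rule expands_toI)
  fix N
  interpret F: unital_ring_hom "poly_poly_to_fps :: 'k poly poly \<Rightarrow> _" by (rule poly_poly_to_fps_hom)
  interpret V: unital_ring_hom "poly_value (z N)" by (rule poly_value_hom)
  obtain P where P: "order_at_least (Suc N) (poly_poly_to_fps P - s)"
    using poly_poly_approximation by blast
  obtain Q where Q: "order_at_least (Suc N) (poly_poly_to_fps Q - r)"
    using poly_poly_approximation by blast
  have "poly_poly_to_fps (P * Q) - s * r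
      = (poly_poly_to_fps P - s) * poly_poly_to_fps Q + s * (poly_poly_to_fps Q - r)"
    by (simp add: F.mult algebra_simps)
  moreover have "order_at_least (Suc N) ((poly_poly_to_fps P - s) * poly_poly_to_fps Q)"
    using order_at_least_mult[OF P order_at_least_0[of "poly_poly_to_fps Q"]] by simp
  moreover have "order_at_least (Suc N) (s * (poly_poly_to_fps Q - r))"
    using order_at_least_mult[OF order_at_least_0[of s] Q] by simp
  ultimately have "order_at_least (Suc N) (poly_poly_to_fps (P * Q) - s * r)"
    by (simp add: order_at_least_add)
  moreover have "a * b - poly_value (z N) (P * Q)
      = poly_value (z N) Q * (a - poly_value (z N) P) + a * (b - poly_value (z N) Q)"
    by (simp add: V.mult algebra_simps)
  moreover have "poly_value (z N) Q * (a - poly_value (z N) P) + a * (b - poly_value (z N) Q) \<in> maximal_power (Suc N)"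
    using assms(1,2) P Q unfolding expands_to_def
    by (intro maximal_power_add maximal_power_mult poly_value_A assms(3)) blast+
  ultimately show "\<exists>P. order_at_least (Suc N) (poly_poly_to_fps P - s * r)
      \<and> a * b - poly_value (z N) P \<in> maximal_power (Suc N)"
    by metis
qed

lemma expands_to_poly:
  assumes "\<And>N. a - poly_value (z N) P \<in> maximal_power (Suc N)"
  shows "expands_to a (poly_poly_to_fps P)"
  by (rule expands_toI) (use assms in \<open>auto intro!: exI[of _ P] simp: order_at_least_def simp del: maximal_power.simps\<close>)

lemma expands_to_\<kappa>: "expands_to (\<kappa> c) (scalar c)"
proof -
  have "expands_to (\<kappa> c) (poly_poly_to_fps (monom (monom c 0) 0))"
    by (rule expands_to_poly) (simp only: poly_value_monom, simp del: maximal_power.simps)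
  moreover have "poly_poly_to_fps (monom (monom c 0) 0) = scalar c"
    by (intro fps_ext) auto
  ultimately show ?thesis by simp
qed

lemma expands_to_v: "expands_to v fps_X"
proof -
  have "expands_to v (poly_poly_to_fps (monom (monom 1 0) 1))"
    by (rule expands_to_poly) (simp only: poly_value_monom, simp add: one del: maximal_power.simps)
  moreover have "poly_poly_to_fps (monom (monom 1 0) 1) = (fps_X :: 'k fps fps)"
    by (intro fps_ext) auto
  ultimately show ?thesis by simp
qed

lemma expands_to_x: "expands_to (\<iota> x_var) (fps_const (fps_X ^ m))"
proof -
  have "expands_to (\<iota> x_var) (poly_poly_to_fps (monom (monom 1 m) 0))"
    by (rule expands_to_poly) (use z_power in \<open>simp only: poly_value_monom, simp add: one del: maximal_power.simps\<close>)
  moreover have "poly_poly_to_fps (monom (monom 1 m) 0) = (fps_const (fps_X ^ m) :: 'k fps fps)"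
    by (intro fps_ext) (auto simp: fps_X_power_nth)
  ultimately show ?thesis by simp
qed

text \<open>
  The embedding of \<open>A\<close> into its completion \<open>K[[z,v]]\<close>.
\<close>

definition \<Psi> :: "'f \<Rightarrow> 'k fps fps" where
  "\<Psi> a = (THE s. expands_to a s)"

lemma \<Psi>_eq: "expands_to a s \<Longrightarrow> \<Psi> a = s"
  unfolding \<Psi>_def using expands_to_unique by blast

lemma expands_to_\<Psi>: "a \<in> A \<Longrightarrow> expands_to a (\<Psi> a)"
  using expands_to_exists \<Psi>_eq by metis

lemma \<Psi>_add: "a \<in> A \<Longrightarrow> b \<in> A \<Longrightarrow> \<Psi> (a + b) = \<Psi> a + \<Psi> b"
  by (intro \<Psi>_eq expands_to_add expands_to_\<Psi>)

lemma \<Psi>_mult: "a \<in> A \<Longrightarrow> b \<in> A \<Longrightarrow> \<Psi> (a * b) = \<Psi> a * \<Psi> b"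
  by (intro \<Psi>_eq expands_to_mult expands_to_\<Psi>)

lemma \<Psi>_1: "\<Psi> 1 = 1"
  using \<Psi>_eq[OF expands_to_\<kappa>[of 1]] by (simp add: one)

lemma \<Psi>_power: "a \<in> A \<Longrightarrow> \<Psi> (a ^ n) = \<Psi> a ^ n"
  by (induction n) (simp_all add: \<Psi>_1 \<Psi>_mult)

lemma \<Psi>_\<iota>_hom: "unital_ring_hom (\<lambda>r. \<Psi> (\<iota> r))"
  by unfold_locales (simp_all add: add mult one \<Psi>_add \<Psi>_mult \<Psi>_1 A_\<iota>)

lemma \<Psi>_unit:
  assumes "a \<in> A" "a \<notin> nonunits A"
  shows "\<Psi> a dvd 1"
proof -
  have "a * inverse a = 1" "inverse a \<in> A"
    using A.unitD[OF assms] by auto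
  then have "1 = \<Psi> a * \<Psi> (inverse a)"
    using \<Psi>_mult[OF assms(1), of "inverse a"] \<Psi>_1 by simp
  then show ?thesis ..
qed

end


section \<open>The multiplicity of the component met by the strict transform\<close>

text \<open>
  A divisor of \<open>x\<^sup>k\<close> is, up to a unit, a power of \<open>x\<close>; its exponent can therefore be read off on
  the line \<open>y = 0\<close>.
\<close>

lemma dvd_x_power:
  fixes h :: "'k::Fields.field fps fps"
  assumes dvd: "h dvd E * x_var ^ k" and E: "E dvd 1"
  shows "h $ 0 \<noteq> 0" "subdegree (swap_xy h) = subdegree (h $ 0)"
proof -
  interpret s: unital_ring_hom "swap_xy :: 'k fps fps \<Rightarrow> _" by (rule swap_xy_hom)
  obtain r where r: "E * x_var ^ k = h * r"
    using dvd ..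
  define a b where "a = swap_xy h" and "b = swap_xy r"
  have "swap_xy (x_var :: 'k fps fps) = fps_X"
    using arg_cong[OF swap_xy_fps_X, of "swap_xy :: 'k fps fps \<Rightarrow> _"] by simp
  then have ab: "a * b = swap_xy E * fps_X ^ k"
    using arg_cong[OF r, of swap_xy] by (simp only: a_def b_def s.mult s.power)
  have E0: "E $ 0 $ 0 \<noteq> 0"
    using E by (simp add: fps_fps_is_unit_iff)
  have "swap_xy E \<noteq> 0"
    using E0 by auto
  then have ne: "a \<noteq> 0" "b \<noteq> 0"
    using ab by auto
  have sE: "subdegree (swap_xy E) = 0"
  proof (rule subdegree_eq_0)
    have "swap_xy E $ 0 $ 0 \<noteq> 0"
      using E0 by simp
    then show "swap_xy E $ 0 \<noteq> 0"
      by (metis fps_zero_nth)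
  qed
  have "subdegree a + subdegree b = subdegree (swap_xy E * fps_X ^ k)"
    unfolding ab[symmetric] using ne by simp
  also have "\<dots> = k"
    using \<open>swap_xy E \<noteq> 0\<close> sE by simp
  finally have k: "subdegree a + subdegree b = k" .
  have "a $ subdegree a * b $ subdegree b = (a * b) $ (subdegree a + subdegree b)"
    by simp
  also have "\<dots> = swap_xy E $ 0"
    unfolding ab k by (simp add: fps_X_power_mult_right_nth)
  finally have "(a $ subdegree a * b $ subdegree b) $ 0 \<noteq> 0"
    using E0 by simp
  then have "a $ subdegree a $ 0 \<noteq> 0"
    by auto
  then have top: "h $ 0 $ subdegree a \<noteq> 0"
    by (simp add: a_def)
  then show "h $ 0 \<noteq> 0"
    by auto
  have "h $ 0 $ i = 0" if i: "i < subdegree a" for i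
  proof -
    have "a $ i = 0"
      using i by (rule nth_less_subdegree_zero)
    then show ?thesis
      unfolding a_def by (metis swap_xy_nth fps_zero_nth)
  qed
  then have "subdegree (h $ 0) = subdegree a"
    using top by (intro subdegreeI) auto
  then show "subdegree (swap_xy h) = subdegree (h $ 0)"
    by (simp add: a_def)
qed

text \<open>
  A homomorphism on \<open>K[[x]]\<close> that sends \<open>x\<close> to a power of \<open>x\<close> is automatically continuous, hence
  is the substitution.
\<close>

lemma hom_is_substitution:
  fixes H :: "'k::Fields.field fps \<Rightarrow> 'k fps fps"
  assumes H: "unital_ring_hom H" and scalars: "\<And>c. H (fps_const c) = scalar c"
    and x: "H fps_X = x_var ^ m" and m: "m \<ge> 1"
  shows "H h = fps_const (h oo fps_X ^ m)"
proof -
  interpret H: unital_ring_hom H by (rule H)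
  have Xm: "(fps_X ^ m :: 'k fps) $ 0 = 0"
    using m by (simp add: fps_X_power_nth)
  define G :: "'k fps \<Rightarrow> 'k fps fps" where "G h = fps_const (h oo fps_X ^ m)" for h
  interpret G: unital_ring_hom G
    unfolding G_def[abs_def] by (rule unital_ring_hom_comp[OF fps_const_hom fps_compose_hom[OF Xm]])
  have G: "G (fps_const c) = scalar c" "G fps_X = x_var ^ m" for c
    using fps_X_fps_compose_startby0[OF Xm] by (simp_all add: G_def)
  have "x_var ^ M dvd H h - G h" for M h
  proof (induction M arbitrary: h)
    case (Suc M)
    have h: "h = fps_const (h $ 0) + fps_X * fps_shift 1 h"
      by (rule fps_ext) (simp add: fps_X_mult_nth)
    have "H h = scalar (h $ 0) + x_var ^ m * H (fps_shift 1 h)"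
      by (subst h) (simp only: H.add H.mult scalars x)
    moreover have "G h = scalar (h $ 0) + x_var ^ m * G (fps_shift 1 h)"
      by (subst h) (simp only: G.add G.mult G)
    ultimately have "H h - G h = x_var ^ m * (H (fps_shift 1 h) - G (fps_shift 1 h))"
      by (simp add: algebra_simps)
    moreover have "x_var dvd (x_var :: 'k fps fps) ^ m"
      using m by (intro dvd_power) simp
    ultimately show ?case
      using Suc.IH[of "fps_shift 1 h"] by (simp only: power_Suc mult_dvd_mono)
  qed simp
  then have "x_var ^ Suc (subdegree (swap_xy (H h - G h))) dvd H h - G h" .
  then have "H h - G h = 0"
    unfolding x_power_dvd_iff by simp
  then show ?thesis
    by (simp add: G_def)
qed

lemma subdegree_twist: "\<zeta> \<noteq> 0 \<Longrightarrow> subdegree (twist \<zeta> h) = subdegree h"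
  by (cases "h = 0") (auto intro!: subdegreeI simp: unital_ring_hom.zero[OF twist_hom])

context monomial_chart
begin

text \<open>
  From \<open>x\<^sup>m = \<epsilon> u\<^sup>m\<close> in the completion, where \<open>x\<close> now denotes the coordinate \<open>z\<close>.
\<close>

lemma \<Psi>_u:
  obtains w where "w dvd 1" "\<Psi> u = w * x_var"
proof -
  have "\<Psi> (\<iota> x_var) = \<Psi> \<epsilon> * \<Psi> u ^ m"
    unfolding x_eq using uA \<epsilon> by (simp add: \<Psi>_mult \<Psi>_power)
  then have eq: "x_var ^ m = \<Psi> \<epsilon> * \<Psi> u ^ m"
    using \<Psi>_eq[OF expands_to_x] by (simp only: fps_const_power)
  have \<epsilon>1: "\<Psi> \<epsilon> dvd 1"
    by (rule \<Psi>_unit[OF \<epsilon>])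
  have "\<Psi> u dvd \<Psi> u ^ m"
    using m1 by (intro dvd_power) simp
  then have "\<Psi> u dvd 1 * x_var ^ m"
    unfolding eq by (simp add: dvd_mult)
  note d = dvd_x_power[OF this one_dvd]
  have "m = subdegree ((x_var ^ m) $ 0 :: 'k fps)"
    by (simp add: unital_ring_hom.power[OF fps_nth_0_hom])
  also have "\<dots> = subdegree (\<Psi> \<epsilon> $ 0) + m * subdegree (\<Psi> u $ 0)"
  proof -
    have "\<Psi> \<epsilon> $ 0 $ 0 \<noteq> 0"
      using \<epsilon>1 by (simp add: fps_fps_is_unit_iff)
    then have "\<Psi> \<epsilon> $ 0 \<noteq> 0"
      by auto
    then show ?thesis
      unfolding eq using d(1) by (simp add: unital_ring_hom.power[OF fps_nth_0_hom])
  qed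
  finally have "m = subdegree (\<Psi> \<epsilon> $ 0) + m * subdegree (\<Psi> u $ 0)" .
  moreover have "subdegree (\<Psi> \<epsilon> $ 0) = 0"
    using \<epsilon>1 unfolding fps_fps_is_unit_iff by (rule subdegree_eq_0)
  ultimately have "subdegree (\<Psi> u $ 0) = 1"
    using m1 by simp
  then have "x_var ^ 1 dvd \<Psi> u"
    unfolding x_power_dvd_iff using d(2) by simp
  then obtain w where w: "\<Psi> u = w * x_var"
    by (auto simp: mult.commute)
  have "x_var ^ m * 1 = x_var ^ m * (\<Psi> \<epsilon> * w ^ m)"
    unfolding mult_1_right by (subst eq) (simp only: w power_mult_distrib mult_ac)
  then have "1 = \<Psi> \<epsilon> * w ^ m"
    by (simp add: mult_cancel_left)
  then have "w ^ m dvd 1"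
    by (metis dvd_triv_right)
  moreover have "w dvd w ^ m"
    using m1 by (intro dvd_power) simp
  ultimately show ?thesis
    using w that dvd_trans by blast
qed

lemma \<Psi>_f:
  obtains E where "E dvd 1" "\<Psi> (\<iota> f) = fps_X * (E * x_var ^ k)"
proof -
  obtain w where w: "w dvd 1" "\<Psi> u = w * x_var"
    by (rule \<Psi>_u)
  have "\<Psi> (\<iota> f) = \<Psi> e * \<Psi> u ^ k * \<Psi> v"
    unfolding f_eq using e uA vA by (simp add: \<Psi>_mult \<Psi>_power)
  also have "\<dots> = fps_X * ((\<Psi> e * w ^ k) * x_var ^ k)"
    by (simp only: w(2) \<Psi>_eq[OF expands_to_v] power_mult_distrib mult_ac)
  finally have "\<Psi> (\<iota> f) = fps_X * ((\<Psi> e * w ^ k) * x_var ^ k)" .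
  moreover have "\<Psi> e * w ^ k dvd 1"
    using mult_dvd_mono[OF \<Psi>_unit[OF e] dvd_power_same[OF w(1), of k]] by simp
  ultimately show ?thesis
    using that by blast
qed

lemma \<Psi>_const: "\<Psi> (\<iota> (fps_const h)) = fps_const (h oo fps_X ^ m)"
proof (rule hom_is_substitution[OF _ _ _ m1])
  show "unital_ring_hom (\<lambda>h. \<Psi> (\<iota> (fps_const h)))"
    by (rule unital_ring_hom_comp[OF \<Psi>_\<iota>_hom fps_const_hom])
  show "\<Psi> (\<iota> (scalar c)) = scalar c" for c
    by (rule \<Psi>_eq[OF expands_to_\<kappa>])
  show "\<Psi> (\<iota> x_var) = x_var ^ m"
    using \<Psi>_eq[OF expands_to_x] by (simp only: fps_const_power)
qed

lemma \<Psi>_equation: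
  assumes "puiseux_branch m \<phi>"
  shows "\<Psi> (\<iota> (puiseux_branch.equation m \<phi>))
    = (\<Prod>\<zeta>\<in>unity_roots m. \<Psi> (\<iota> fps_X) - fps_const (twist \<zeta> \<phi>))"
proof -
  interpret p: puiseux_branch m \<phi> by (rule assms)
  interpret H: unital_ring_hom "\<lambda>r. \<Psi> (\<iota> r)" by (rule \<Psi>_\<iota>_hom)
  interpret cst: unital_ring_hom "fps_const :: 'k fps \<Rightarrow> _" by (rule fps_const_hom)
  interpret cp: unital_ring_hom "map_poly (fps_const :: 'k fps \<Rightarrow> _)" by (rule cst.map_poly_hom)
  have "\<Psi> (\<iota> p.equation)
      = (\<Sum>j\<le>degree p.weierstrass_poly. fps_const (coeff p.weierstrass_poly j oo fps_X ^ m) * \<Psi> (\<iota> fps_X) ^ j)"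
    by (simp add: p.equation_def fps_of_poly_sum_powers H.sum H.mult H.power \<Psi>_const)
  also have "\<dots> = (\<Sum>j\<le>m. fps_const (coeff p.conjugate_poly j) * \<Psi> (\<iota> fps_X) ^ j)"
    by (simp only: p.degree_weierstrass p.coeff_weierstrass_compose)
  also have "\<dots> = poly (map_poly fps_const p.conjugate_poly) (\<Psi> (\<iota> fps_X))"
    using degree_map_poly_le[of fps_const p.conjugate_poly]
    by (simp add: poly_altdef_le[of _ m] p.degree_conjugate coeff_map_poly)
  also have "\<dots> = (\<Prod>\<zeta>\<in>unity_roots m. \<Psi> (\<iota> fps_X) - fps_const (twist \<zeta> \<phi>))"
    unfolding p.conjugate_poly_def cp.prod poly_prod
    by (rule prod.cong) (simp_all add: map_poly_pCons cst.uminus del: fps_const_neg)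
  finally show ?thesis .
qed

text \<open>
  In the coordinates of the completed local ring, the equation splits into the factors
  \<open>y' - \<phi>(\<zeta> x)\<close>, and exactly one of them, say at \<open>\<zeta> = \<eta>\<close>, contains the branch \<open>y = 0\<close>.
  Hence \<open>y'\<close> restricts to \<open>\<phi>(\<eta> x)\<close> on \<open>y = 0\<close>, the factor at \<open>\<zeta> \<noteq> \<eta>\<close> is a power of \<open>x\<close> whose
  exponent is the order of \<open>\<phi>(\<eta> x) - \<phi>(\<zeta> x)\<close>, and the remaining factor is divisible by all
  these powers, as the factors differ by functions of \<open>x\<close> only.
\<close>

lemma exceptional_multiplicity:
  assumes "puiseux_branch m \<phi>" and f: "f = U * puiseux_branch.equation m \<phi>" "U dvd 1"
  obtains a where "k = subdegree (puiseux_branch.different m \<phi>) + a"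
    "\<And>\<zeta>. \<zeta> \<in> unity_roots m \<Longrightarrow> \<zeta> \<noteq> 1 \<Longrightarrow> subdegree (\<phi> - twist \<zeta> \<phi>) \<le> a"
proof -
  interpret p: puiseux_branch m \<phi> by (rule assms)
  interpret H: unital_ring_hom "\<lambda>r. \<Psi> (\<iota> r)" by (rule \<Psi>_\<iota>_hom)
  define \<theta> where "\<theta> \<zeta> = \<Psi> (\<iota> fps_X) - fps_const (twist \<zeta> \<phi>)" for \<zeta>
  obtain E where E: "E dvd 1" "\<Psi> (\<iota> f) = fps_X * (E * x_var ^ k)"
    by (rule \<Psi>_f)
  obtain U' where "1 = U * U'"
    using f(2) ..
  then have U': "\<Psi> (\<iota> U) * \<Psi> (\<iota> U') = 1"
    by (metis H.mult H.one)
  have "(\<Prod>\<zeta>\<in>p.\<mu>. \<theta> \<zeta>) = (\<Psi> (\<iota> U) * \<Psi> (\<iota> U')) * (\<Prod>\<zeta>\<in>p.\<mu>. \<theta> \<zeta>)"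
    by (simp add: U')
  also have "\<dots> = \<Psi> (\<iota> U') * (\<Psi> (\<iota> U) * \<Psi> (\<iota> p.equation))"
    unfolding \<Psi>_equation[OF assms(1)] \<theta>_def by (simp only: mult_ac)
  also have "\<Psi> (\<iota> U) * \<Psi> (\<iota> p.equation) = fps_X * (E * x_var ^ k)"
    using E(2) by (simp only: f(1) H.mult)
  finally have prod_\<theta>: "(\<Prod>\<zeta>\<in>p.\<mu>. \<theta> \<zeta>) = fps_X * ((\<Psi> (\<iota> U') * E) * x_var ^ k)"
    by (simp only: mult_ac)
  define E' where "E' = \<Psi> (\<iota> U') * E"
  have E': "E' dvd 1"
    unfolding E'_def using U' E(1) by (metis dvd_triv_right mult_1 mult_dvd_mono)
  have "(\<Prod>\<zeta>\<in>p.\<mu>. \<theta> \<zeta> $ 0) = (\<Prod>\<zeta>\<in>p.\<mu>. \<theta> \<zeta>) $ 0"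
    by (simp add: unital_ring_hom.prod[OF fps_nth_0_hom])
  also have "\<dots> = 0"
    unfolding prod_\<theta> by simp
  finally obtain \<eta> where \<eta>: "\<eta> \<in> p.\<mu>" "\<theta> \<eta> $ 0 = 0"
    by auto
  then have y_on_branch: "\<Psi> (\<iota> fps_X) $ 0 = twist \<eta> \<phi>"
    by (simp add: \<theta>_def)
  define \<theta>' where "\<theta>' = fps_shift 1 (\<theta> \<eta>)"
  have \<theta>': "\<theta> \<eta> = fps_X * \<theta>'"
    unfolding \<theta>'_def using \<eta>(2) by (intro fps_ext) (simp add: fps_X_mult_nth)
  have "fps_X * (\<theta>' * (\<Prod>\<zeta>\<in>p.\<mu> - {\<eta>}. \<theta> \<zeta>)) = fps_X * (E' * x_var ^ k)"
    using prod_\<theta> unfolding prod.remove[OF p.fin \<eta>(1)] \<theta>' E'_def by (simp only: mult_ac)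
  then have factors: "\<theta>' * (\<Prod>\<zeta>\<in>p.\<mu> - {\<eta>}. \<theta> \<zeta>) = E' * x_var ^ k"
    by (simp only: mult_cancel_left) simp
  have \<theta>_branch: "\<theta> \<zeta> $ 0 = twist \<eta> \<phi> - twist \<zeta> \<phi>" for \<zeta>
    by (simp add: \<theta>_def y_on_branch)
  have x_power: "x_var ^ subdegree (\<theta> \<zeta> $ 0) dvd \<theta> \<zeta>" if z: "\<zeta> \<in> p.\<mu> - {\<eta>}" for \<zeta>
  proof -
    have "\<theta> \<zeta> dvd (\<Prod>\<zeta>\<in>p.\<mu> - {\<eta>}. \<theta> \<zeta>)"
      using z by (intro dvd_prodI) auto
    then have "\<theta> \<zeta> dvd E' * x_var ^ k"
      unfolding factors[symmetric] by (rule dvd_mult)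
    then show ?thesis
      unfolding x_power_dvd_iff using dvd_x_power(2)[OF _ E'] by simp
  qed
  have \<theta>'0: "\<theta>' $ 0 \<noteq> 0"
    by (rule dvd_x_power(1)[OF _ E', of _ k]) (unfold factors[symmetric], rule dvd_triv_left)
  \<comment> \<open>Both \<open>\<theta> \<zeta>\<close> and \<open>\<theta> \<eta> - \<theta> \<zeta>\<close>, a function of \<open>x\<close>, are divisible by the same power of \<open>x\<close>.\<close>
  have bound: "subdegree (\<theta> \<zeta> $ 0) \<le> subdegree (\<theta>' $ 0)" if z: "\<zeta> \<in> p.\<mu> - {\<eta>}" for \<zeta>
  proof -
    let ?a = "subdegree (\<theta> \<zeta> $ 0)"
    have "x_var ^ ?a dvd (fps_const (\<theta> \<zeta> $ 0) :: 'k fps fps)"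
    proof -
      have "fps_X ^ ?a dvd \<theta> \<zeta> $ 0"
        by (cases "\<theta> \<zeta> $ 0 = 0") (simp_all add: fps_dvd_iff)
      then obtain r where "\<theta> \<zeta> $ 0 = fps_X ^ ?a * r" ..
      then have "fps_const (\<theta> \<zeta> $ 0) = x_var ^ ?a * fps_const r"
        by (metis fps_const_mult fps_const_power)
      then show ?thesis ..
    qed
    moreover have "\<theta> \<eta> = \<theta> \<zeta> - fps_const (\<theta> \<zeta> $ 0)"
      unfolding \<theta>_branch by (simp add: \<theta>_def flip: fps_const_sub)
    ultimately have "x_var ^ ?a dvd \<theta> \<eta>"
      using x_power[OF z] by (simp only: dvd_diff)
    then obtain r where "\<theta> \<eta> = x_var ^ ?a * r" ..
    then have "\<theta> \<eta> $ 1 = fps_X ^ ?a * r $ 1"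
      by (simp only: unital_ring_hom.power[OF fps_const_hom, symmetric] fps_mult_left_const_nth)
    then have "\<theta>' $ 0 = fps_X ^ ?a * r $ 1"
      by (simp add: \<theta>'_def)
    then show ?thesis
      using \<theta>'0 by auto
  qed
  have \<eta>0: "\<eta> \<noteq> 0"
    using \<eta>(1) p.m by (auto simp: unity_roots_def power_0_left)
  have inj\<eta>: "inj_on ((*) \<eta>) (p.\<mu> - {1})"
    using \<eta>0 by (auto simp: inj_on_def)
  have image\<eta>: "(*) \<eta> ` (p.\<mu> - {1}) = p.\<mu> - {\<eta>}"
    using unity_roots_mult_bij[OF p.m \<eta>(1)] \<eta>0 by (auto simp: bij_betw_def) force+
  have tw: "\<theta> (\<eta> * \<zeta>) $ 0 = twist \<eta> (\<phi> - twist \<zeta> \<phi>)" for \<zeta>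
    unfolding \<theta>_branch by (simp add: unital_ring_hom.diff[OF twist_hom] twist_twist)
  have "(E' * x_var ^ k) $ 0 = E' $ 0 * fps_X ^ k"
    by (simp add: unital_ring_hom.power[OF fps_nth_0_hom])
  then have "\<theta>' $ 0 * (\<Prod>\<zeta>\<in>p.\<mu> - {\<eta>}. \<theta> \<zeta> $ 0) = E' $ 0 * fps_X ^ k"
    unfolding factors[symmetric] by (simp add: unital_ring_hom.prod[OF fps_nth_0_hom])
  also have "(\<Prod>\<zeta>\<in>p.\<mu> - {\<eta>}. \<theta> \<zeta> $ 0) = (\<Prod>\<zeta>\<in>p.\<mu> - {1}. \<theta> (\<eta> * \<zeta>) $ 0)"
    unfolding image\<eta>[symmetric] by (simp add: prod.reindex[OF inj\<eta>])
  also have "\<dots> = twist \<eta> p.different"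
    unfolding tw p.different_def by (simp add: unital_ring_hom.prod[OF twist_hom])
  finally have eq: "\<theta>' $ 0 * twist \<eta> p.different = E' $ 0 * fps_X ^ k" .
  have E'0: "E' $ 0 $ 0 \<noteq> 0"
    using E' by (simp add: fps_fps_is_unit_iff)
  have sE': "subdegree (E' $ 0) = 0" and E'1: "E' $ 0 \<noteq> 0"
    using E'0 by (auto simp: subdegree_eq_0_iff)
  have "k = subdegree (E' $ 0 * fps_X ^ k)"
    using sE' E'1 by simp
  also have "\<dots> = subdegree (\<theta>' $ 0 * twist \<eta> p.different)"
    by (simp only: eq)
  also have "\<dots> = subdegree (\<theta>' $ 0) + subdegree (twist \<eta> p.different)"
    using \<theta>'0 eq E'1 by (intro subdegree_mult) auto
  finally have "k = subdegree p.different + subdegree (\<theta>' $ 0)"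
    by (simp add: subdegree_twist[OF \<eta>0])
  moreover have "subdegree (\<phi> - twist \<zeta> \<phi>) \<le> subdegree (\<theta>' $ 0)" if "\<zeta> \<in> p.\<mu>" "\<zeta> \<noteq> 1" for \<zeta>
  proof -
    have "\<eta> * \<zeta> \<in> p.\<mu> - {\<eta>}"
      unfolding image\<eta>[symmetric] using that by blast
    from bound[OF this] show ?thesis
      unfolding tw subdegree_twist[OF \<eta>0] .
  qed
  ultimately show ?thesis
    by (rule that)
qed

end


section \<open>Multiplicities of an embedded resolution\<close>

text \<open>
  The component found here is the strict transform if the curve is smooth, and otherwise the
  exceptional component through the closed point of the strict transform.
\<close>

lemma (in fraction_embedding) large_multiplicity:
  assumes model: "proper_birational_model (range \<iota>) Y"
    and regular: "\<And>A. A \<in> Y \<Longrightarrow> regular_local_ring A"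
    and snc: "\<And>A. A \<in> Y \<Longrightarrow> \<iota> f \<in> nonunits A \<Longrightarrow> snc_at A (\<iota> f)"
    and branch: "puiseux_branch m \<phi>"
    and f: "f = U * puiseux_branch.equation m \<phi>" "U dvd 1"
    and tangent: "\<And>i. i < m \<Longrightarrow> f $ 0 $ i = 0"
  obtains C a where "C \<in> components Y (\<iota> f)" "a \<ge> 1"
    "order_along C (\<iota> f) = subdegree (puiseux_branch.different m \<phi>) + a"
    "\<And>\<zeta>. \<zeta> \<in> unity_roots m \<Longrightarrow> \<zeta> \<noteq> 1 \<Longrightarrow> subdegree (\<phi> - twist \<zeta> \<phi>) \<le> a"
proof -
  note conclude = that
  interpret p: puiseux_branch m \<phi> by (rule branch)
  let ?D = "subdegree p.different"
  have cb: "curve_branch p.ev f ?D"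
    unfolding f(1) by (rule curve_branch.curve_branch_unit_mult[OF p.is_curve_branch f(2)])
  have f0: "f \<noteq> 0"
    using f p.equation_nonzero by auto
  interpret bv: branch_valuation \<iota> p.ev f ?D
    by (intro branch_valuation.intro branch_valuation_axioms.intro fraction_embedding_axioms cb f0)
  obtain \<A> where \<A>: "\<And>B. B \<in> \<A> \<Longrightarrow> finitely_generated_over (range \<iota>) B"
      "Y = (\<Union>B\<in>\<A>. affine_model B)"
    and centre: "\<And>V. valuation_ring V \<Longrightarrow> range \<iota> \<subseteq> V \<Longrightarrow> \<exists>A\<in>Y. dominates V A"
  proof -
    from model obtain \<A> where "\<forall>B\<in>\<A>. finitely_generated_over (range \<iota>) B" "Y = (\<Union>B\<in>\<A>. affine_model B)"
      and "\<forall>V. valuation_ring V \<and> range \<iota> \<subseteq> V \<longrightarrow> (\<exists>!A. A \<in> Y \<and> dominates V A)"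
      unfolding proper_birational_model_def by (elim conjE exE)
    then show ?thesis
      by (intro that[of \<A>]) (simp, simp, meson)
  qed
  obtain A where A: "A \<in> Y" "dominates bv.V A"
    using centre[OF bv.valuation_ring_V image_subsetI[OF bv.V_\<iota>]] by (elim bexE) (rule that)
  have A_\<iota>: "\<iota> r \<in> A" for r
  proof -
    obtain B P where B: "B \<in> \<A>" "A = localization B P" "primeideal P (ring_on B)"
      using A(1) \<A>(2) by (auto simp: affine_model_def)
    have \<iota>B: "\<iota> s \<in> B" for s
      using \<A>(1)[OF B(1)] by (auto simp: finitely_generated_over_def intro: generate_ring.incl)
    have "1 \<notin> P"
      using B(3) by (simp add: primeideal_ring_on prime_in_def)
    moreover have "1 \<in> B"
      using \<iota>B[of 1] by (simp add: one)
    ultimately have "\<iota> r / 1 \<in> localization B P"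
      unfolding localization_def using \<iota>B by blast
    then show ?thesis
      using B(2) by simp
  qed
  have reg: "cring (ring_on B)" "noetherian_ring (ring_on B)" "maximalideal (nonunits B) (ring_on B)"
    if "B \<in> Y" for B
    using regular[OF that] by (simp_all add: regular_local_ring_def)
  interpret A: local_subring A
    by (rule local_subringI[OF reg(1,3)[OF A(1)]])
  interpret bc: branch_centre \<iota> p.ev f ?D A
  proof (intro branch_centre.intro noetherian_local.intro noetherian_local_axioms.intro
      branch_centre_axioms.intro bv.branch_valuation_axioms A.local_subring_axioms)
    show "noetherian_ring (ring_on A)"
      by (rule reg(2)[OF A(1)])
    show "A \<subseteq> bv.V" "nonunits A = nonunits bv.V \<inter> A"
      using A(2) by (simp_all only: dominates_def)
  qed (rule A_\<iota>)
  have "\<iota> f \<in> nonunits A"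
    using tangent[of 0] by (simp add: bc.dominates)
  obtain e u v k where "e \<in> A" "e \<notin> nonunits A" "\<iota> f = e * u ^ k * v"
    "u \<in> nonunits A" "v \<in> nonunits A" "nonunits A = {a * u + b * v | a b. a \<in> A \<and> b \<in> A}"
    "bv.\<pi> v = 0" "bv.\<pi> u \<noteq> 0"
    by (rule bc.local_equation[OF snc[OF A(1) \<open>\<iota> f \<in> nonunits A\<close>]])
  then interpret ch: branch_chart \<iota> p.ev f ?D A e u v k
    by unfold_locales
  have subrings: "subring_set B" if "B \<in> Y" for B
    using reg(1)[OF that] by (simp add: cring_ring_on)
  note components = ch.components_of_chart[OF \<A>(2) A(1) subrings]
  show ?thesis
  proof (cases "m \<ge> 2")
    case False
    then have "m = 1"
      using p.m by simp
    then have "p.\<mu> = {1}"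
      by (auto simp: unity_roots_def)
    then have "p.different = 1"
      by (simp add: p.different_def)
    moreover obtain C where "C \<in> components Y (\<iota> f)" "order_along C (\<iota> f) = 1"
      using components(1) by blast
    ultimately show ?thesis
      using \<open>p.\<mu> = {1}\<close> by (intro conclude[of C 1]) auto
  next
    case True
    obtain U' where "1 = U * U'"
      using f(2) ..
    then have equation: "p.equation = U' * f"
      unfolding f(1) by (metis mult.assoc mult.commute mult_1)
    have "p.equation $ 0 $ i = 0" if "i < m" for i
      unfolding equation using that tangent by (simp add: fps_mult_nth)
    then have \<phi>: "\<phi> = 0 \<or> m \<le> subdegree \<phi>"
      by (rule p.subdegree_\<phi>)
    have ev_x: "p.ev x_var = fps_X ^ m"
      by (simp add: p.ev_const fps_X_fps_compose_startby0)
    interpret sc: singular_chart \<iota> p.ev f ?D A e u v k m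
      by unfold_locales (use True \<phi> in \<open>simp_all add: ev_x p.ev_y\<close>)
    obtain \<epsilon> where "\<epsilon> \<in> A" "\<epsilon> \<notin> nonunits A" "\<iota> x_var = \<epsilon> * u ^ m"
      by (rule sc.coordinate_monomial)
    then interpret mc: monomial_chart \<iota> p.ev f ?D A e u v k m \<epsilon>
      using p.m by unfold_locales
    obtain a where a: "k = ?D + a" "\<And>\<zeta>. \<zeta> \<in> p.\<mu> \<Longrightarrow> \<zeta> \<noteq> 1 \<Longrightarrow> subdegree (\<phi> - twist \<zeta> \<phi>) \<le> a"
      using mc.exceptional_multiplicity[OF branch f] by blast
    have "card (p.\<mu> - {1}) \<noteq> 0"
      using True unity_roots_card[OF p.m, where 'k = 'k] by simp
    then obtain \<zeta> where \<zeta>: "\<zeta> \<in> p.\<mu>" "\<zeta> \<noteq> 1"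
      by (metis DiffE card.empty ex_in_conv insertI1)
    have "(\<phi> - twist \<zeta> \<phi>) $ 0 = 0" "\<phi> - twist \<zeta> \<phi> \<noteq> 0"
      using p.\<phi>_0 p.primitive[OF \<zeta>] by auto
    then have "subdegree (\<phi> - twist \<zeta> \<phi>) \<noteq> 0"
      by (simp add: subdegree_eq_0_iff)
    then have a1: "a \<ge> 1"
      using a(2)[OF \<zeta>] by simp
    then have "k \<ge> 1"
      using a(1) by simp
    then obtain C where "C \<in> components Y (\<iota> f)" "order_along C (\<iota> f) = k"
      using components(2) by blast
    then show ?thesis
      using a a1 by (intro conclude[of C a]) auto
  qed
qed

lemma fraction_embedding_to_fract:
  "fraction_embedding (to_fract :: 'k::{alg_closed_field, field_char_0} fps fps \<Rightarrow> _)"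
proof unfold_locales
  show "\<exists>a b. b \<noteq> 0 \<and> z = to_fract a / to_fract b" for z :: "'k fps fps fract"
    by (cases z rule: Fract_cases) (auto simp: Fract_conv_to_fract)
qed simp_all

lemma fraction_embedding_swap:
  "fraction_embedding (\<lambda>r :: 'k::{alg_closed_field, field_char_0} fps fps. to_fract (swap_xy r))"
proof -
  interpret t: fraction_embedding "to_fract :: 'k fps fps \<Rightarrow> _"
    by (rule fraction_embedding_to_fract)
  interpret h: unital_ring_hom "\<lambda>r :: 'k fps fps. to_fract (swap_xy r)"
    by (rule unital_ring_hom_comp[OF t.unital_ring_hom_axioms swap_xy_hom])
  show ?thesis
  proof unfold_locales
    fix z :: "'k fps fps fract"
    obtain a b where "b \<noteq> 0" "z = to_fract a / to_fract b"
      using t.fractions by blast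
    then show "\<exists>a b. b \<noteq> 0 \<and> z = to_fract (swap_xy a) / to_fract (swap_xy b)"
      by (intro exI[of _ "swap_xy a"] exI[of _ "swap_xy b"]) simp
  qed simp
qed

theorem theorem1p9:
  fixes f :: "'k::{alg_closed_field, field_char_0} fps fps"
    and Y :: "'k fps fps fract set set"
    and N n :: nat
  assumes "unibranch f"
    and "embedded_resolution f Y"
    and "N \<in> multiplicities f Y" and "\<forall>m\<in>multiplicities f Y. m \<le> N"
    and "n \<ge> N"
  shows "UHilb01 f n \<noteq> {}"
proof -
  have irr: "Factorial_Ring.irreducible f"
    using assms(1) by (simp add: unibranch_def)
  have model: "proper_birational_model (range to_fract) Y"
    and regular: "\<And>A. A \<in> Y \<Longrightarrow> regular_local_ring A"
    and snc: "\<And>A. A \<in> Y \<Longrightarrow> to_fract f \<in> nonunits A \<Longrightarrow> snc_at A (to_fract f)"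
    using assms(2) by (auto simp: embedded_resolution_def)
  have large: "n \<ge> order_along C (to_fract f)" if "C \<in> components Y (to_fract f)" for C
    using assms(4,5) that by (force simp: multiplicities_def)
  show ?thesis
    using irr
  proof (cases rule: irreducible_coordinates)
    case (id m)
    obtain \<phi> U where branch: "puiseux_branch m \<phi>"
      and f: "f = U * puiseux_branch.equation m \<phi>" "U dvd 1"
      using irreducible_is_puiseux_branch[OF irr id(2,1)] .
    interpret p: puiseux_branch m \<phi> by (rule branch)
    obtain C a where C: "C \<in> components Y (to_fract f)" and a: "a \<ge> 1"
      "order_along C (to_fract f) = subdegree p.different + a"
      "\<And>\<zeta>. \<zeta> \<in> p.\<mu> \<Longrightarrow> \<zeta> \<noteq> 1 \<Longrightarrow> subdegree (\<phi> - twist \<zeta> \<phi>) \<le> a"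
      using fraction_embedding.large_multiplicity[OF fraction_embedding_to_fract model regular snc branch f id(3)]
      by blast
    have n: "n = subdegree p.different + (n - subdegree p.different)" "a \<le> n - subdegree p.different"
      using large[OF C] a(2) by auto
    show ?thesis
      using a(1,3) n(2) by (subst n(1), intro p.UHilb01_nonempty(1)[OF _ _ f]) (auto intro: order_trans)
  next
    case (swap m)
    have irr': "Factorial_Ring.irreducible (swap_xy f)"
      by (rule irreducible_swap_xy[OF irr])
    obtain \<phi> U where branch: "puiseux_branch m \<phi>"
      and f: "swap_xy f = U * puiseux_branch.equation m \<phi>" "U dvd 1"
      using irreducible_is_puiseux_branch[OF irr' swap(2,1)] .
    interpret p: puiseux_branch m \<phi> by (rule branch)
    have "range (\<lambda>r :: 'k fps fps. to_fract (swap_xy r)) = range to_fract"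
    proof -
      have "to_fract s \<in> range (\<lambda>r :: 'k fps fps. to_fract (swap_xy r))" for s :: "'k fps fps"
        by (rule range_eqI[of _ _ "swap_xy s"]) simp
      then show ?thesis
        by blast
    qed
    with model have model': "proper_birational_model (range (\<lambda>r :: 'k fps fps. to_fract (swap_xy r))) Y"
      by simp
    have snc': "snc_at A (to_fract (swap_xy (swap_xy f)))"
      if "A \<in> Y" "to_fract (swap_xy (swap_xy f)) \<in> nonunits A" for A
      using snc that by simp
    obtain C a where C: "C \<in> components Y (to_fract f)" and a: "a \<ge> 1"
      "order_along C (to_fract f) = subdegree p.different + a"
      "\<And>\<zeta>. \<zeta> \<in> p.\<mu> \<Longrightarrow> \<zeta> \<noteq> 1 \<Longrightarrow> subdegree (\<phi> - twist \<zeta> \<phi>) \<le> a"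
      using fraction_embedding.large_multiplicity[OF fraction_embedding_swap model' regular snc' branch f swap(3)]
      by (auto simp only: swap_xy_swap_xy)
    have n: "n = subdegree p.different + (n - subdegree p.different)" "a \<le> n - subdegree p.different"
      using large[OF C] a(2) by auto
    have "UHilb01 (swap_xy (swap_xy f)) (subdegree p.different + (n - subdegree p.different)) \<noteq> {}"
      using a(1,3) n(2) by (intro p.UHilb01_nonempty(2)[OF _ _ f]) (auto intro: order_trans)
    then show ?thesis
      using n(1) by simp
  qed
qed

end
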